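(* Let $\mathcal{D}=\mathcal{D}(\Gamma,(g_i)_{i\in\mathbb{I}},(\chi_i)_{i\in\mathbb{I}})$ be a YD-datum with linking parameter $\lambda$, let $L$ be a subset of the set of vertices of $\mathbb{I}$ that are not linked, put $\mathbb{I}'=\mathbb{I}\setminus L$, and let $\mathcal{D}'$, $\lambda'$ be the YD-datum and linking parameter on $\mathbb{I}'$ obtained by omitting $L$ (see context). Let $X=\bigoplus_{i\in\mathbb{I}}\Bbbk x_i$, $X'=\bigoplus_{i\in\mathbb{I}'}\Bbbk x_i$, let $\iota:X'\to X$ be the inclusion and $\pi:X\to X'$ the projection with $\pi(x_i)=x_i$ for $i\in\mathbb{I}'$ and $\pi(x_h)=0$ for $h\in L$. Then $\pi$ and $\iota$ induce Hopf algebra morphisms $\Phi:\mathcal{U}(\mathcal{D},\lambda)\to\mathcal{U}(\mathcal{D}',\lambda')$ and $\Psi:\mathcal{U}(\mathcal{D}',\lambda')\to\mathcal{U}(\mathcal{D},\lambda)$ (given on the generators $x_i$ by $\pi$ and $\iota$ respectively, and by the identity on $\Gamma$) with $\Phi\Psi=\mathrm{id}$. Moreover $$K=\mathcal{U}(\mathcal{D},\lambda)^{\mathrm{co}\,\Phi}=\{a\in \mathcal{U}(\mathcal{D},\lambda)\mid(\mathrm{id}\otimes\Phi)\Delta(a)=a\otimes1\}$$ is a braided Hopf algebra in the category of Yetter-Drinfeld modules over $\mathcal{U}(\mathcal{D}',\lambda')$, and multiplication ($r\#u\mapsto r\Psi(u)$) gives an isomorphism of Hopf algebras $$K\#\mathcal{U}(\mathcal{D}',\lambda')\cong\mathcal{U}(\mathcal{D},\lambda).$$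 Furthermore, the algebra $K$ is generated by the set $$S=\{\mathrm{ad}(x_{i_1}\cdots x_{i_n})(x_h)\mid h\in L,\ n\ge0,\ i_\nu\in\mathbb{I}',\ i_\nu\sim h\ \text{for all }1\le\nu\le n\}.$$
   Context: $\Bbbk$ is an algebraically closed field of characteristic zero, $\mathbb{N}=\{0,1,\dots\}$, $\widehat{\Gamma}=\mathrm{Hom}(\Gamma,\Bbbk^\times)$. For a Hopf algebra, $\mathrm{ad}(x)(y)=x_{(1)}y\mathcal{S}(x_{(2)})$ is the left adjoint action. Yetter-Drinfeld modules and Nichols algebras. A Yetter-Drinfeld module over $\Bbbk\Gamma$ ($\Gamma$ abelian) is a $\Gamma$-graded vector space $V=\bigoplus_g V_g$ with a $\Gamma$-action stabilizing each $V_g$; the braiding is $c(v\otimes w)=g\cdot w\otimes v$ for $v\in V_g$. $T(V)$ is a Hopf algebra in the braided category of Yetter-Drinfeld modules with the elements of $V$ primitive; $I(V)$ is the largest $\mathbb{N}$-graded ideal and coideal $I\subset T(V)$ with $I\cap V=0$, and $\mathfrak{B}(V)=T(V)/I(V)$ is the Nichols algebra. For a Hopf algebra $R$ in Yetter-Drinfeld modules over $H$, $R\#H$ is the bosonization (smash product and smash coproduct). The Yetter-Drinfeld structure of $K$ over $\mathcal{U}(\mathcal{D}',\lambda')$ is the standard one for a Hopf algebra projection: action by $\mathrm{ad}$ through $\Psi$, coaction $(\Phi\otimes\mathrm{id})\Delta$. YD-data. A YD-datum $\mathcal{D}(\Gamma,(g_i)_{i\in\mathbb{I}},(\chi_i)_{i\in\mathbb{I}})$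 consists of an abelian group $\Gamma$, a finite index set $\mathbb{I}=\{1,\dots,\theta\}$, elements $g_i\in\Gamma$ and characters $\chi_i\in\widehat\Gamma$; $q_{ij}=\chi_j(g_i)$. The equivalence relation $\sim$ on $\mathbb{I}$: for $i\ne j$, $i\sim j$ iff there are $i=i_1,\dots,i_t=j$ in $\mathbb{I}$, $t\ge2$, with $q_{i_li_{l+1}}q_{i_{l+1}i_l}\ne1$ for all $1\le l<t$; $\mathcal{X}$ is the set of equivalence classes. $X$ has basis $(x_i)_{i\in\mathbb I}$ and is a Yetter-Drinfeld module over $\Bbbk\Gamma$ with $x_i$ of degree $g_i$ and $g\cdot x_i=\chi_i(g)x_i$; for $J\subset\mathbb{I}$, $X_J=\bigoplus_{j\in J}\Bbbk x_j$. Linking. $i,j\in\mathbb{I}$ are linkable if $i\not\sim j$, $g_ig_j\ne1$ and $\chi_i\chi_j=1$. A linking parameter is a family $\lambda=(\lambda_{ij})_{i\not\sim j}$ in $\Bbbk$ with $\lambda_{ij}=0$ if $i,j$ are not linkable and $\lambda_{ij}=-q_{ij}\lambda_{ji}$. Vertices $i\not\sim j$ are linked if $\lambda_{ij}\neq0$; a vertex is not linked if it is linked to no vertex. $\mathcal{U}(\mathcal{D},\lambda)$ is the quotient of $T(X)\#\Bbbk\Gamma$ by the ideal generated by $I(X_J)$, $J\in\mathcal{X}$, and $x_ix_j-q_{ij}x_jx_i-\lambda_{ij}(1-g_ig_j)$ for all $i\not\sim j$; it is a Hopf algebra with $\Delta(x_i)=g_i\otimes x_i+x_i\otimes1$ and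 $\Delta(g)=g\otimes g$. Omitting vertices. $\mathcal{D}'=\mathcal{D}(\Gamma,(g_i)_{i\in\mathbb{I}'},(\chi_i)_{i\in\mathbb{I}'})$, $\approx$ is the equivalence relation on $\mathbb{I}'$ defined by $\mathcal{D}'$, and for $i,j\in\mathbb{I}'$ with $i\not\approx j$: $\lambda'_{ij}=\lambda_{ij}$ if $i\not\sim j$ and $\lambda'_{ij}=0$ if $i\sim j$. (If $\mathbb{I}'=\emptyset$, $\mathcal{U}(\mathcal{D}',\lambda')$ means $\Bbbk\Gamma$.) *)

theory Defs
  imports
    "HOL-Algebra.Algebraic_Closure_Type"
    "HOL-Algebra.QuotRing"
    "HOL-Algebra.Subrings"
    "HOL-Library.Poly_Mapping"
begin

text \<open>
  The base field is a type \<open>'k\<close>; vector spaces and algebras over it are records of HOL-Algebra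
  (type \<^typ>\<open>('k, 'a) module\<close>), with scalar ring \<^const>\<open>ring_of_type_algebra\<close>.
  The abelian group \<open>\<Gamma>\<close> is a type \<open>'g\<close> of class \<^class>\<open>ab_group_add\<close>, so it is written additively:
  \<open>g\<^sub>i g\<^sub>j \<noteq> 1\<close> becomes \<open>g\<^sub>i + g\<^sub>j \<noteq> 0\<close>, and its group algebra is \<^typ>\<open>('g, 'k) poly_mapping\<close>
  with the convolution product of the library.
\<close>

section \<open>Vector spaces and tensor products\<close>

abbreviation vspace :: "('k::field, 'a, 'm) module_scheme \<Rightarrow> bool" where
  "vspace V \<equiv> Module.module (ring_of_type_algebra :: 'k ring) V"

definition base_alg :: "('k::field, 'k) module" where
  "base_alg = ring.extend ring_of_type_algebra (module.fields (*))"

definition lin_map ::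
    "('k::field, 'a, 'm) module_scheme \<Rightarrow> ('k, 'b, 'n) module_scheme \<Rightarrow> ('a \<Rightarrow> 'b) \<Rightarrow> bool" where
  "lin_map V W f \<longleftrightarrow> f \<in> carrier V \<rightarrow> carrier W \<and>
     (\<forall>x\<in>carrier V. \<forall>y\<in>carrier V. f (x \<oplus>\<^bsub>V\<^esub> y) = f x \<oplus>\<^bsub>W\<^esub> f y) \<and>
     (\<forall>c. \<forall>x\<in>carrier V. f (c \<odot>\<^bsub>V\<^esub> x) = c \<odot>\<^bsub>W\<^esub> f x)"

text \<open>Linear extension to formal linear combinations of a map given on basis elements.\<close>

definition lin_ext ::
    "('k::field, 'z, 'm) module_scheme \<Rightarrow> ('a \<Rightarrow> 'z) \<Rightarrow> ('a, 'k) poly_mapping \<Rightarrow> 'z" where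
  "lin_ext Z b f =
     (\<Oplus>\<^bsub>Z\<^esub>x\<in>Poly_Mapping.keys f. Poly_Mapping.lookup f x \<odot>\<^bsub>Z\<^esub> b x)"

definition lin_span :: "('k::field, 'z, 'm) module_scheme \<Rightarrow> 'z set \<Rightarrow> 'z set" where
  "lin_span Z S = {lin_ext Z (\<lambda>x. x) f | f. Poly_Mapping.keys f \<subseteq> S}"

definition scale :: "'k::field \<Rightarrow> ('a, 'k) poly_mapping \<Rightarrow> ('a, 'k) poly_mapping" where
  "scale c f = Poly_Mapping.map ((*) c) f"

text \<open>
  \<open>V \<otimes> W\<close> is the quotient of the vector space with basis \<open>V \<times> W\<close> by the subspace \<open>tensor_null V W\<close>
  spanned by the bilinearity relations; its elements are the cosets.  The rules below carry
  an arbitrary coefficient \<open>c\<close>, so closure under addition already yields a subspace.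
\<close>

inductive_set tensor_null ::
    "('k::field, 'a, 'm) module_scheme \<Rightarrow> ('k, 'b, 'n) module_scheme \<Rightarrow> ('a \<times> 'b, 'k) poly_mapping set"
  for V :: "('k::field, 'a, 'm) module_scheme" and W :: "('k, 'b, 'n) module_scheme"
where
  null_zero: "0 \<in> tensor_null V W"
| null_plus: "m \<in> tensor_null V W \<Longrightarrow> n \<in> tensor_null V W \<Longrightarrow> m + n \<in> tensor_null V W"
| null_add_left: "v \<in> carrier V \<Longrightarrow> v' \<in> carrier V \<Longrightarrow> w \<in> carrier W \<Longrightarrow>
    Poly_Mapping.single (v \<oplus>\<^bsub>V\<^esub> v', w) c - Poly_Mapping.single (v, w) c
      - Poly_Mapping.single (v', w) c \<in> tensor_null V W"
| null_add_right: "v \<in> carrier V \<Longrightarrow> w \<in> carrier W \<Longrightarrow> w' \<in> carrier W \<Longrightarrow>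
    Poly_Mapping.single (v, w \<oplus>\<^bsub>W\<^esub> w') c - Poly_Mapping.single (v, w) c
      - Poly_Mapping.single (v, w') c \<in> tensor_null V W"
| null_smult_left: "v \<in> carrier V \<Longrightarrow> w \<in> carrier W \<Longrightarrow>
    Poly_Mapping.single (a \<odot>\<^bsub>V\<^esub> v, w) c - Poly_Mapping.single (v, w) (c * a) \<in> tensor_null V W"
| null_smult_right: "v \<in> carrier V \<Longrightarrow> w \<in> carrier W \<Longrightarrow>
    Poly_Mapping.single (v, a \<odot>\<^bsub>W\<^esub> w) c - Poly_Mapping.single (v, w) (c * a) \<in> tensor_null V W"

type_synonym ('k, 'a, 'b) tensor = "('a \<times> 'b, 'k) poly_mapping set"

definition tensor_class ::
    "('k::field, 'a, 'm) module_scheme \<Rightarrow> ('k, 'b, 'n) module_scheme \<Rightarrow>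
     ('a \<times> 'b, 'k) poly_mapping \<Rightarrow> ('k, 'a, 'b) tensor" where
  "tensor_class V W f = (\<lambda>n. f + n) ` tensor_null V W"

definition tns ::
    "('k::field, 'a, 'm) module_scheme \<Rightarrow> ('k, 'b, 'n) module_scheme \<Rightarrow>
     'a \<Rightarrow> 'b \<Rightarrow> ('k, 'a, 'b) tensor" where
  "tns V W v w = tensor_class V W (Poly_Mapping.single (v, w) 1)"

definition tensor_rep :: "('k::field, 'a, 'b) tensor \<Rightarrow> ('a \<times> 'b, 'k) poly_mapping" where
  "tensor_rep t = (SOME f. f \<in> t)"

text \<open>
  The linear map \<open>V \<otimes> W \<rightarrow> Z\<close> induced by a bilinear map \<open>B\<close>.  It plays the role of Sweedler
  notation: \<open>tensor_lift Z (\<lambda>a b. \<dots>a\<dots>b\<dots>) (comult H x)\<close> is the sum of the terms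
  \<open>\<dots>x\<^sub>(\<^sub>1\<^sub>)\<dots>x\<^sub>(\<^sub>2\<^sub>)\<dots>\<close>.  The value is independent of the representative whenever \<open>B\<close> is bilinear on the
  carriers, which is the case at every use below.
\<close>

definition tensor_lift ::
    "('k::field, 'z, 'm) module_scheme \<Rightarrow> ('a \<Rightarrow> 'b \<Rightarrow> 'z) \<Rightarrow> ('k, 'a, 'b) tensor \<Rightarrow> 'z" where
  "tensor_lift Z B t = lin_ext Z (\<lambda>(v, w). B v w) (tensor_rep t)"

text \<open>
  The ring components \<open>mult\<close> and \<open>one\<close> of the record \<open>tensor V W\<close> are not used; the algebra
  structures on tensor products are \<open>tensor_alg\<close>, \<open>braided_tensor_alg\<close> and \<open>boson\<close> below.
\<close>

definition tensor ::
    "('k::field, 'a, 'm) module_scheme \<Rightarrow> ('k, 'b, 'n) module_scheme \<Rightarrow>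
     ('k, ('k, 'a, 'b) tensor) module" where
  "tensor V W =
     \<lparr>carrier = tensor_class V W ` {f. Poly_Mapping.keys f \<subseteq> carrier V \<times> carrier W},
      monoid.mult = undefined, one = undefined,
      ring.zero = tensor_class V W 0,
      add = (\<lambda>s t. tensor_class V W (tensor_rep s + tensor_rep t)),
      module.smult = (\<lambda>c t. tensor_class V W (scale c (tensor_rep t)))\<rparr>"


section \<open>Hopf algebras\<close>

definition kalgebra :: "('k::field, 'a, 'm) module_scheme \<Rightarrow> bool" where
  "kalgebra A \<longleftrightarrow> vspace A \<and> ring A \<and>
     (\<forall>c. \<forall>x\<in>carrier A. \<forall>y\<in>carrier A.
        (c \<odot>\<^bsub>A\<^esub> x) \<otimes>\<^bsub>A\<^esub> y = c \<odot>\<^bsub>A\<^esub> (x \<otimes>\<^bsub>A\<^esub> y) \<and> x \<otimes>\<^bsub>A\<^esub> (c \<odot>\<^bsub>A\<^esub> y) = c \<odot>\<^bsub>A\<^esub> (x \<otimes>\<^bsub>A\<^esub> y))"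

definition alg_hom ::
    "('k::field, 'a, 'm) module_scheme \<Rightarrow> ('k, 'b, 'n) module_scheme \<Rightarrow> ('a \<Rightarrow> 'b) \<Rightarrow> bool" where
  "alg_hom A B f \<longleftrightarrow> f \<in> ring_hom A B \<and> lin_map A B f"

definition alg_generate :: "('k::field, 'a, 'm) module_scheme \<Rightarrow> 'a set \<Rightarrow> 'a set" where
  "alg_generate A S =
     \<Inter>{B. subring B A \<and> (\<forall>c. \<forall>x\<in>B. c \<odot>\<^bsub>A\<^esub> x \<in> B) \<and> S \<subseteq> B}"

definition tensor_alg ::
    "('k::field, 'a, 'm) module_scheme \<Rightarrow> ('k, 'b, 'n) module_scheme \<Rightarrow>
     ('k, ('k, 'a, 'b) tensor) module" where
  "tensor_alg A B = (let Z = tensor A B in Z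
     \<lparr>monoid.mult := (\<lambda>s t. tensor_lift Z (\<lambda>a b. tensor_lift Z (\<lambda>c d.
         tns A B (a \<otimes>\<^bsub>A\<^esub> c) (b \<otimes>\<^bsub>B\<^esub> d)) t) s),
      one := tns A B \<one>\<^bsub>A\<^esub> \<one>\<^bsub>B\<^esub>\<rparr>)"

definition coalgebra ::
    "('k::field, 'a, 'm) module_scheme \<Rightarrow> ('a \<Rightarrow> ('k, 'a, 'a) tensor) \<Rightarrow> ('a \<Rightarrow> 'k) \<Rightarrow> bool" where
  "coalgebra C \<Delta> \<epsilon> \<longleftrightarrow> vspace C \<and> lin_map C (tensor C C) \<Delta> \<and> lin_map C base_alg \<epsilon> \<and>
     (\<forall>x\<in>carrier C.
        (let Z = tensor C (tensor C C) in
         tensor_lift Z (\<lambda>a b. tensor_lift Z (\<lambda>a1 a2.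
             tns C (tensor C C) a1 (tns C C a2 b)) (\<Delta> a)) (\<Delta> x)
         = tensor_lift Z (\<lambda>a b. tns C (tensor C C) a (\<Delta> b)) (\<Delta> x)) \<and>
        tensor_lift C (\<lambda>a b. \<epsilon> a \<odot>\<^bsub>C\<^esub> b) (\<Delta> x) = x \<and>
        tensor_lift C (\<lambda>a b. \<epsilon> b \<odot>\<^bsub>C\<^esub> a) (\<Delta> x) = x)"

record (overloaded) ('k, 'a) bialg = "('k, 'a) module" +
  comult :: "'a \<Rightarrow> ('k, 'a, 'a) tensor"
  counit :: "'a \<Rightarrow> 'k"

definition bialgebra :: "('k::field, 'a, 'm) bialg_scheme \<Rightarrow> bool" where
  "bialgebra H \<longleftrightarrow> kalgebra H \<and> coalgebra H (comult H) (counit H) \<and>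
     alg_hom H (tensor_alg H H) (comult H) \<and> alg_hom H base_alg (counit H)"

definition is_antipode :: "('k::field, 'a, 'm) bialg_scheme \<Rightarrow> ('a \<Rightarrow> 'a) \<Rightarrow> bool" where
  "is_antipode H S \<longleftrightarrow> lin_map H H S \<and>
     (\<forall>x\<in>carrier H.
        tensor_lift H (\<lambda>a b. S a \<otimes>\<^bsub>H\<^esub> b) (comult H x) = counit H x \<odot>\<^bsub>H\<^esub> \<one>\<^bsub>H\<^esub> \<and>
        tensor_lift H (\<lambda>a b. a \<otimes>\<^bsub>H\<^esub> S b) (comult H x) = counit H x \<odot>\<^bsub>H\<^esub> \<one>\<^bsub>H\<^esub>)"

definition hopf_algebra :: "('k::field, 'a, 'm) bialg_scheme \<Rightarrow> bool" where
  "hopf_algebra H \<longleftrightarrow> bialgebra H \<and> (\<exists>S. is_antipode H S)"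

text \<open>The antipode is unique on the carrier.\<close>

definition antipode :: "('k::field, 'a, 'm) bialg_scheme \<Rightarrow> 'a \<Rightarrow> 'a" where
  "antipode H = (SOME S. is_antipode H S)"

definition hopf_hom ::
    "('k::field, 'a, 'm) bialg_scheme \<Rightarrow> ('k, 'b, 'n) bialg_scheme \<Rightarrow> ('a \<Rightarrow> 'b) \<Rightarrow> bool" where
  "hopf_hom A B f \<longleftrightarrow> hopf_algebra A \<and> hopf_algebra B \<and> alg_hom A B f \<and>
     (\<forall>x\<in>carrier A.
        comult B (f x) = tensor_lift (tensor B B) (\<lambda>a b. tns B B (f a) (f b)) (comult A x) \<and>
        counit B (f x) = counit A x)"

definition hopf_iso ::
    "('k::field, 'a, 'm) bialg_scheme \<Rightarrow> ('k, 'b, 'n) bialg_scheme \<Rightarrow> ('a \<Rightarrow> 'b) \<Rightarrow> bool" where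
  "hopf_iso A B f \<longleftrightarrow> hopf_hom A B f \<and> bij_betw f (carrier A) (carrier B)"

definition ad :: "('k::field, 'a, 'm) bialg_scheme \<Rightarrow> 'a \<Rightarrow> 'a \<Rightarrow> 'a" where
  "ad H x y = tensor_lift H (\<lambda>a b. a \<otimes>\<^bsub>H\<^esub> y \<otimes>\<^bsub>H\<^esub> antipode H b) (comult H x)"

text \<open>
  Quotient of a bialgebra by an ideal.  Apart from the ring structure \<open>H Quot I\<close>, the operations are
  induced through representatives; this is meaningful when \<open>I\<close> is also a coideal.
\<close>

definition bialg_quot :: "('k::field, 'a, 'm) bialg_scheme \<Rightarrow> 'a set \<Rightarrow> ('k, 'a set) bialg" where
  "bialg_quot H I = (let
       rep = (\<lambda>A. SOME a. a \<in> A);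
       p = (\<lambda>a. I +>\<^bsub>H\<^esub> a);
       Q = ring.extend (H Quot I) (module.fields (\<lambda>c A. p (c \<odot>\<^bsub>H\<^esub> rep A)))
     in module.extend Q (bialg.fields
          (\<lambda>A. tensor_lift (tensor Q Q) (\<lambda>a b. tns Q Q (p a) (p b)) (comult H (rep A)))
          (\<lambda>A. counit H (rep A))))"


section \<open>Yetter-Drinfeld modules\<close>

record (overloaded) ('k, 'h, 'a) yd = "('k, 'a) module" +
  act :: "'h \<Rightarrow> 'a \<Rightarrow> 'a"
  coact :: "'a \<Rightarrow> ('k, 'h, 'a) tensor"

definition yd_module :: "('k::field, 'h, 'm) bialg_scheme \<Rightarrow> ('k, 'h, 'a, 'n) yd_scheme \<Rightarrow> bool" where
  "yd_module H V \<longleftrightarrow> vspace V \<and>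
     (\<forall>h\<in>carrier H. lin_map V V (act V h)) \<and>
     (\<forall>v\<in>carrier V. lin_map H V (\<lambda>h. act V h v)) \<and>
     (\<forall>v\<in>carrier V. act V \<one>\<^bsub>H\<^esub> v = v) \<and>
     (\<forall>h\<in>carrier H. \<forall>h'\<in>carrier H. \<forall>v\<in>carrier V.
        act V (h \<otimes>\<^bsub>H\<^esub> h') v = act V h (act V h' v)) \<and>
     lin_map V (tensor H V) (coact V) \<and>
     (\<forall>v\<in>carrier V.
        (let Z = tensor H (tensor H V) in
         tensor_lift Z (\<lambda>h w. tensor_lift Z (\<lambda>h1 h2.
             tns H (tensor H V) h1 (tns H V h2 w)) (comult H h)) (coact V v)
         = tensor_lift Z (\<lambda>h w. tns H (tensor H V) h (coact V w)) (coact V v)) \<and>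
        tensor_lift V (\<lambda>h w. counit H h \<odot>\<^bsub>V\<^esub> w) (coact V v) = v) \<and>
     (\<forall>h\<in>carrier H. \<forall>v\<in>carrier V.
        coact V (act V h v) =
        (let Z = tensor H V in
         tensor_lift Z (\<lambda>h1 h'. tensor_lift Z (\<lambda>h2 h3. tensor_lift Z (\<lambda>u w.
             tns H V (h1 \<otimes>\<^bsub>H\<^esub> u \<otimes>\<^bsub>H\<^esub> antipode H h3) (act V h2 w))
           (coact V v)) (comult H h')) (comult H h)))"

definition yd_hom ::
    "('k::field, 'h, 'm) bialg_scheme \<Rightarrow> ('k, 'h, 'a, 'n) yd_scheme \<Rightarrow> ('k, 'h, 'b, 'p) yd_scheme \<Rightarrow>
     ('a \<Rightarrow> 'b) \<Rightarrow> bool" where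
  "yd_hom H V W f \<longleftrightarrow> lin_map V W f \<and>
     (\<forall>h\<in>carrier H. \<forall>v\<in>carrier V. f (act V h v) = act W h (f v)) \<and>
     (\<forall>v\<in>carrier V.
        coact W (f v) = tensor_lift (tensor H W) (\<lambda>h w. tns H W h (f w)) (coact V v))"

definition yd_tensor ::
    "('k::field, 'h, 'm) bialg_scheme \<Rightarrow> ('k, 'h, 'a, 'n) yd_scheme \<Rightarrow> ('k, 'h, 'b, 'p) yd_scheme \<Rightarrow>
     ('k, 'h, ('k, 'a, 'b) tensor) yd" where
  "yd_tensor H V W = (let T = tensor V W; Z = tensor H T in module.extend T (yd.fields
     (\<lambda>h t. tensor_lift T (\<lambda>h1 h2. tensor_lift T (\<lambda>v w.
         tns V W (act V h1 v) (act W h2 w)) t) (comult H h))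
     (\<lambda>t. tensor_lift Z (\<lambda>v w. tensor_lift Z (\<lambda>a v0. tensor_lift Z (\<lambda>b w0.
         tns H T (a \<otimes>\<^bsub>H\<^esub> b) (tns V W v0 w0)) (coact W w)) (coact V v)) t)))"

definition yd_unit :: "('k::field, 'h, 'm) bialg_scheme \<Rightarrow> ('k, 'h, 'k) yd" where
  "yd_unit H = module.extend base_alg (yd.fields
     (\<lambda>h c. counit H h * c) (\<lambda>c. tns H base_alg \<one>\<^bsub>H\<^esub> c))"

text \<open>
  The algebra \<open>R \<otimes> R\<close> formed with the braiding \<open>b \<otimes> c \<mapsto> b\<^sub>(\<^sub>-\<^sub>1\<^sub>) \<cdot> c \<otimes> b\<^sub>(\<^sub>0\<^sub>)\<close>:
  \<open>(a \<otimes> b)(c \<otimes> d) = a (b\<^sub>(\<^sub>-\<^sub>1\<^sub>) \<cdot> c) \<otimes> b\<^sub>(\<^sub>0\<^sub>) d\<close>.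
\<close>

definition braided_tensor_alg ::
    "('k::field, 'h, 'a, 'n) yd_scheme \<Rightarrow> ('k, ('k, 'a, 'a) tensor) module" where
  "braided_tensor_alg R = (let Z = tensor R R in Z
     \<lparr>monoid.mult := (\<lambda>s t. tensor_lift Z (\<lambda>a b. tensor_lift Z (\<lambda>c d. tensor_lift Z (\<lambda>u b0.
         tns R R (a \<otimes>\<^bsub>R\<^esub> act R u c) (b0 \<otimes>\<^bsub>R\<^esub> d)) (coact R b)) t) s),
      one := tns R R \<one>\<^bsub>R\<^esub> \<one>\<^bsub>R\<^esub>\<rparr>)"

record (overloaded) ('k, 'h, 'a) bhopf = "('k, 'h, 'a) yd" +
  bcomult :: "'a \<Rightarrow> ('k, 'a, 'a) tensor"
  bcounit :: "'a \<Rightarrow> 'k"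

text \<open>Hopf algebras in the braided category of Yetter-Drinfeld modules over \<open>H\<close>.\<close>

definition braided_hopf_algebra ::
    "('k::field, 'h, 'm) bialg_scheme \<Rightarrow> ('k, 'h, 'a, 'n) bhopf_scheme \<Rightarrow> bool" where
  "braided_hopf_algebra H R \<longleftrightarrow> hopf_algebra H \<and> yd_module H R \<and>
     kalgebra R \<and> coalgebra R (bcomult R) (bcounit R) \<and>
     yd_hom H (yd_tensor H R R) R (tensor_lift R (\<lambda>a b. a \<otimes>\<^bsub>R\<^esub> b)) \<and>
     yd_hom H (yd_unit H) R (\<lambda>c. c \<odot>\<^bsub>R\<^esub> \<one>\<^bsub>R\<^esub>) \<and>
     yd_hom H R (yd_tensor H R R) (bcomult R) \<and>
     yd_hom H R (yd_unit H) (bcounit R) \<and>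
     alg_hom R (braided_tensor_alg R) (bcomult R) \<and> alg_hom R base_alg (bcounit R) \<and>
     (\<exists>S. yd_hom H R R S \<and>
        (\<forall>x\<in>carrier R.
           tensor_lift R (\<lambda>a b. S a \<otimes>\<^bsub>R\<^esub> b) (bcomult R x) = bcounit R x \<odot>\<^bsub>R\<^esub> \<one>\<^bsub>R\<^esub> \<and>
           tensor_lift R (\<lambda>a b. a \<otimes>\<^bsub>R\<^esub> S b) (bcomult R x) = bcounit R x \<odot>\<^bsub>R\<^esub> \<one>\<^bsub>R\<^esub>))"

text \<open>
  The bosonization \<open>R # H\<close> on \<open>R \<otimes> H\<close>: \<open>(r # h)(s # k) = r (h\<^sub>(\<^sub>1\<^sub>) \<cdot> s) # h\<^sub>(\<^sub>2\<^sub>) k\<close> and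
  \<open>\<Delta>(r # h) = (r\<^sup>(\<^sup>1\<^sup>) # (r\<^sup>(\<^sup>2\<^sup>))\<^sub>(\<^sub>-\<^sub>1\<^sub>) h\<^sub>(\<^sub>1\<^sub>)) \<otimes> ((r\<^sup>(\<^sup>2\<^sup>))\<^sub>(\<^sub>0\<^sub>) # h\<^sub>(\<^sub>2\<^sub>))\<close>.
\<close>

definition boson ::
    "('k::field, 'h, 'a, 'n) bhopf_scheme \<Rightarrow> ('k, 'h, 'm) bialg_scheme \<Rightarrow>
     ('k, ('k, 'a, 'h) tensor) bialg" where
  "boson R H = (let T = tensor R H; Z = tensor T T in
     module.extend
       (T\<lparr>monoid.mult := (\<lambda>x y. tensor_lift T (\<lambda>r h. tensor_lift T (\<lambda>s k. tensor_lift T (\<lambda>h1 h2.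
             tns R H (r \<otimes>\<^bsub>R\<^esub> act R h1 s) (h2 \<otimes>\<^bsub>H\<^esub> k)) (comult H h)) y) x),
          one := tns R H \<one>\<^bsub>R\<^esub> \<one>\<^bsub>H\<^esub>\<rparr>)
       (bialg.fields
         (\<lambda>t. tensor_lift Z (\<lambda>r h. tensor_lift Z (\<lambda>r1 r2. tensor_lift Z (\<lambda>h1 h2.
             tensor_lift Z (\<lambda>u r0.
               tns T T (tns R H r1 (u \<otimes>\<^bsub>H\<^esub> h1)) (tns R H r0 h2))
             (coact R r2)) (comult H h)) (bcomult R r)) t)
         (tensor_lift base_alg (\<lambda>r h. bcounit R r * counit H h))))"

text \<open>
  The structure on the coinvariants \<open>K = U\<^bsup>co \<Phi>\<^esup>\<close> of a projection \<open>\<Phi> : U \<rightarrow> H\<close> of Hopf algebras split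
  by \<open>\<Psi>\<close> (Radford, Majid): subalgebra of \<open>U\<close>, action by \<open>ad\<close> through \<open>\<Psi>\<close>, coaction \<open>(\<Phi> \<otimes> id) \<Delta>\<close>,
  comultiplication \<open>a \<mapsto> a\<^sub>(\<^sub>1\<^sub>) \<Psi>(S(\<Phi>(a\<^sub>(\<^sub>2\<^sub>)))) \<otimes> a\<^sub>(\<^sub>3\<^sub>)\<close>.  The last two expressions are elements of
  \<open>H \<otimes> U\<close> and \<open>U \<otimes> U\<close>; they are pulled back along the injective maps \<open>H \<otimes> K \<rightarrow> H \<otimes> U\<close> and
  \<open>K \<otimes> K \<rightarrow> U \<otimes> U\<close> given by the inclusion of \<open>K\<close>.
\<close>

definition coinv ::
    "('k::field, 'a, 'm) bialg_scheme \<Rightarrow> ('k, 'h, 'n) bialg_scheme \<Rightarrow> ('a \<Rightarrow> 'h) \<Rightarrow> 'a set" where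
  "coinv U H \<Phi> = {x \<in> carrier U.
     tensor_lift (tensor U H) (\<lambda>a b. tns U H a (\<Phi> b)) (comult U x) = tns U H x \<one>\<^bsub>H\<^esub>}"

definition coinv_hopf ::
    "('k::field, 'a, 'm) bialg_scheme \<Rightarrow> ('k, 'h, 'n) bialg_scheme \<Rightarrow>
     ('a \<Rightarrow> 'h) \<Rightarrow> ('h \<Rightarrow> 'a) \<Rightarrow> ('k, 'h, 'a) bhopf" where
  "coinv_hopf U H \<Phi> \<Psi> = (let
       K = module.truncate (U\<lparr>carrier := coinv U H \<Phi>\<rparr>);
       HU = tensor H U; UU = tensor U U
     in yd.extend
       (module.extend K (yd.fields
         (\<lambda>h x. ad U (\<Psi> h) x)
         (\<lambda>x. THE t. t \<in> carrier (tensor H K) \<and>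
            tensor_lift HU (tns H U) t = tensor_lift HU (\<lambda>a b. tns H U (\<Phi> a) b) (comult U x))))
       (bhopf.fields
         (\<lambda>x. THE t. t \<in> carrier (tensor K K) \<and>
            tensor_lift UU (tns U U) t =
            tensor_lift UU (\<lambda>a1 a'. tensor_lift UU (\<lambda>a2 a3.
              tns U U (a1 \<otimes>\<^bsub>U\<^esub> \<Psi> (antipode H (\<Phi> a2))) a3) (comult U a')) (comult U x))
         (counit U)))"


section \<open>YD-data and tensor algebras\<close>

definition group_mod :: "('k::field, ('g::ab_group_add, 'k) poly_mapping) module" where
  "group_mod = \<lparr>carrier = UNIV, monoid.mult = (*), one = 1, ring.zero = 0, add = (+), module.smult = scale\<rparr>"

definition group_alg :: "('k::field, ('g::ab_group_add, 'k) poly_mapping) bialg" where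
  "group_alg = module.extend group_mod (bialg.fields
     (lin_ext (tensor group_mod group_mod)
        (\<lambda>a. tns group_mod group_mod (Poly_Mapping.single a 1) (Poly_Mapping.single a 1)))
     (lin_ext base_alg (\<lambda>a. 1)))"

record ('i, 'g, 'k) yd_datum =
  Ind :: "'i set"
  grp :: "'i \<Rightarrow> 'g"
  chr :: "'i \<Rightarrow> 'g \<Rightarrow> 'k"

definition character :: "('g::ab_group_add \<Rightarrow> 'k::field) \<Rightarrow> bool" where
  "character \<chi> \<longleftrightarrow> (\<forall>a. \<chi> a \<noteq> 0) \<and> (\<forall>a b. \<chi> (a + b) = \<chi> a * \<chi> b)"

definition is_yd_datum :: "('i, 'g::ab_group_add, 'k::field) yd_datum \<Rightarrow> bool" where
  "is_yd_datum D \<longleftrightarrow> finite (Ind D) \<and> (\<forall>i\<in>Ind D. character (chr D i))"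

definition qq :: "('i, 'g, 'k) yd_datum \<Rightarrow> 'i \<Rightarrow> 'i \<Rightarrow> 'k" where
  "qq D i j = chr D j (grp D i)"

definition sim :: "('i, 'g, 'k::field) yd_datum \<Rightarrow> ('i \<times> 'i) set" where
  "sim D = Id_on (Ind D) \<union>
     {(i, j). i \<in> Ind D \<and> j \<in> Ind D \<and> qq D i j * qq D j i \<noteq> 1}\<^sup>+"

text \<open>
  \<open>T(X\<^sub>J)\<close> is the free associative algebra on the basis \<open>(x\<^sub>j)\<^sub>j\<^sub>\<in>\<^sub>J\<close> of \<open>X\<^sub>J\<close>; the list
  \<open>[i\<^sub>1, \<dots>, i\<^sub>n]\<close> stands for the monomial \<open>x\<^bsub>i\<^sub>1\<^esub> \<cdots> x\<^bsub>i\<^sub>n\<^esub>\<close>.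
\<close>

definition free_alg :: "'i set \<Rightarrow> ('k::field, ('i list, 'k) poly_mapping) module" where
  "free_alg J =
     \<lparr>carrier = {f. Poly_Mapping.keys f \<subseteq> lists J},
      monoid.mult = (\<lambda>f g. \<Sum>u\<in>Poly_Mapping.keys f. \<Sum>v\<in>Poly_Mapping.keys g.
        Poly_Mapping.single (u @ v) (Poly_Mapping.lookup f u * Poly_Mapping.lookup g v)),
      one = Poly_Mapping.single [] 1, ring.zero = 0, add = (+), module.smult = scale\<rparr>"

definition tensor_yd ::
    "('i, 'g::ab_group_add, 'k::field) yd_datum \<Rightarrow> 'i set \<Rightarrow>
     ('k, ('g, 'k) poly_mapping, ('i list, 'k) poly_mapping) yd" where
  "tensor_yd D J = (let T = free_alg J in module.extend T (yd.fields
     (\<lambda>h f. lin_ext T (\<lambda>a. lin_ext T (\<lambda>w.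
         Poly_Mapping.single w (\<Prod>i\<leftarrow>w. chr D i a)) f) h)
     (lin_ext (tensor group_alg T) (\<lambda>w.
         tns group_alg T (Poly_Mapping.single (\<Sum>i\<leftarrow>w. grp D i) 1) (Poly_Mapping.single w 1)))))"

text \<open>The comultiplication is the algebra map into the braided \<open>T(X\<^sub>J) \<otimes> T(X\<^sub>J)\<close> with \<open>x\<^sub>j\<close> primitive.\<close>

primrec word_comult ::
    "('i, 'g::ab_group_add, 'k::field) yd_datum \<Rightarrow> 'i set \<Rightarrow> 'i list \<Rightarrow>
     ('k, ('i list, 'k) poly_mapping, ('i list, 'k) poly_mapping) tensor" where
  "word_comult D J [] = \<one>\<^bsub>braided_tensor_alg (tensor_yd D J)\<^esub>"
| "word_comult D J (i # w) = (let T = tensor_yd D J; x = Poly_Mapping.single [i] 1 in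
     (tns T T x \<one>\<^bsub>T\<^esub> \<oplus>\<^bsub>tensor T T\<^esub> tns T T \<one>\<^bsub>T\<^esub> x)
       \<otimes>\<^bsub>braided_tensor_alg T\<^esub> word_comult D J w)"

definition tensor_hopf ::
    "('i, 'g::ab_group_add, 'k::field) yd_datum \<Rightarrow> 'i set \<Rightarrow>
     ('k, ('g, 'k) poly_mapping, ('i list, 'k) poly_mapping) bhopf" where
  "tensor_hopf D J = (let T = tensor_yd D J in yd.extend T (bhopf.fields
     (lin_ext (tensor T T) (word_comult D J)) (\<lambda>f. Poly_Mapping.lookup f [])))"

definition homog_part :: "nat \<Rightarrow> ('i list, 'k::field) poly_mapping \<Rightarrow> ('i list, 'k) poly_mapping" where
  "homog_part n f =
     (\<Sum>w | w \<in> Poly_Mapping.keys f \<and> length w = n. Poly_Mapping.single w (Poly_Mapping.lookup f w))"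

definition graded_coideal ::
    "('i, 'g::ab_group_add, 'k::field) yd_datum \<Rightarrow> 'i set \<Rightarrow> ('i list, 'k) poly_mapping set \<Rightarrow> bool"
where
  "graded_coideal D J I \<longleftrightarrow> (let T = tensor_hopf D J in
     ideal I T \<and> (\<forall>f\<in>I. \<forall>n. homog_part n f \<in> I) \<and>
     (\<forall>f\<in>I. bcounit T f = 0 \<and>
        bcomult T f \<in> lin_span (tensor T T)
          ({tns T T a b | a b. a \<in> I \<and> b \<in> carrier T} \<union> {tns T T a b | a b. a \<in> carrier T \<and> b \<in> I})) \<and>
     (\<forall>f\<in>I. homog_part 1 f = f \<longrightarrow> f = 0))"

text \<open>
  In \<open>graded_coideal\<close>, \<open>homog_part 1 f = f\<close> says \<open>f \<in> X\<^sub>J\<close>, so the last clause is \<open>I \<inter> X\<^sub>J = 0\<close>.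
  \<open>I(X\<^sub>J)\<close> is the largest such \<open>I\<close>; \<open>Greatest\<close> is taken with respect to inclusion.
\<close>

definition nichols_ideal ::
    "('i, 'g::ab_group_add, 'k::field) yd_datum \<Rightarrow> 'i set \<Rightarrow> ('i list, 'k) poly_mapping set" where
  "nichols_ideal D J = Greatest (graded_coideal D J)"


section \<open>Linking parameters and the Hopf algebra \<open>U(D, \<lambda>)\<close>\<close>

definition linkable :: "('i, 'g::ab_group_add, 'k::field) yd_datum \<Rightarrow> 'i \<Rightarrow> 'i \<Rightarrow> bool" where
  "linkable D i j \<longleftrightarrow> i \<in> Ind D \<and> j \<in> Ind D \<and> (i, j) \<notin> sim D \<and>
     grp D i + grp D j \<noteq> 0 \<and> (\<forall>a. chr D i a * chr D j a = 1)"

text \<open>A linking parameter is only looked at on pairs \<open>i, j\<close> with \<open>i \<not>\<sim> j\<close>.\<close>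

definition linking_parameter ::
    "('i, 'g::ab_group_add, 'k::field) yd_datum \<Rightarrow> ('i \<Rightarrow> 'i \<Rightarrow> 'k) \<Rightarrow> bool" where
  "linking_parameter D lam \<longleftrightarrow> (\<forall>i\<in>Ind D. \<forall>j\<in>Ind D. (i, j) \<notin> sim D \<longrightarrow>
     (\<not> linkable D i j \<longrightarrow> lam i j = 0) \<and> lam i j = - qq D i j * lam j i)"

definition not_linked :: "('i, 'g, 'k::field) yd_datum \<Rightarrow> ('i \<Rightarrow> 'i \<Rightarrow> 'k) \<Rightarrow> 'i \<Rightarrow> bool" where
  "not_linked D lam i \<longleftrightarrow> i \<in> Ind D \<and> (\<forall>j\<in>Ind D. (i, j) \<notin> sim D \<longrightarrow> lam i j = 0)"

type_synonym ('i, 'g, 'k) smash =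
  "('k, ('i list, 'k) poly_mapping, ('g, 'k) poly_mapping) tensor"

text \<open>\<open>T(X) # \<bbbk>\<Gamma>\<close>, the elements \<open>f # 1\<close> and \<open>1 # g\<close>, and the defining relations of \<open>U(D, \<lambda>)\<close>.\<close>

definition free_boson ::
    "('i, 'g::ab_group_add, 'k::field) yd_datum \<Rightarrow> ('k, ('i, 'g, 'k) smash) bialg" where
  "free_boson D = boson (tensor_hopf D (Ind D)) group_alg"

definition fb_word ::
    "('i, 'g::ab_group_add, 'k::field) yd_datum \<Rightarrow> ('i list, 'k) poly_mapping \<Rightarrow> ('i, 'g, 'k) smash" where
  "fb_word D f = tns (tensor_hopf D (Ind D)) group_alg f \<one>\<^bsub>group_alg\<^esub>"

definition fb_grp ::
    "('i, 'g::ab_group_add, 'k::field) yd_datum \<Rightarrow> 'g \<Rightarrow> ('i, 'g, 'k) smash" where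
  "fb_grp D a =
     tns (tensor_hopf D (Ind D)) group_alg \<one>\<^bsub>tensor_hopf D (Ind D)\<^esub> (Poly_Mapping.single a 1)"

definition fb_x :: "('i, 'g::ab_group_add, 'k::field) yd_datum \<Rightarrow> 'i \<Rightarrow> ('i, 'g, 'k) smash" where
  "fb_x D i = fb_word D (Poly_Mapping.single [i] 1)"

definition link_rel ::
    "('i, 'g::ab_group_add, 'k::field) yd_datum \<Rightarrow> ('i \<Rightarrow> 'i \<Rightarrow> 'k) \<Rightarrow> 'i \<Rightarrow> 'i \<Rightarrow> ('i, 'g, 'k) smash" where
  "link_rel D lam i j = (let F = free_boson D in
     (fb_x D i \<otimes>\<^bsub>F\<^esub> fb_x D j)
     \<ominus>\<^bsub>F\<^esub> (qq D i j \<odot>\<^bsub>F\<^esub> (fb_x D j \<otimes>\<^bsub>F\<^esub> fb_x D i))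
     \<ominus>\<^bsub>F\<^esub> (lam i j \<odot>\<^bsub>F\<^esub> (\<one>\<^bsub>F\<^esub> \<ominus>\<^bsub>F\<^esub> fb_grp D (grp D i + grp D j))))"

definition U_ideal ::
    "('i, 'g::ab_group_add, 'k::field) yd_datum \<Rightarrow> ('i \<Rightarrow> 'i \<Rightarrow> 'k) \<Rightarrow> ('i, 'g, 'k) smash set" where
  "U_ideal D lam = Idl\<^bsub>free_boson D\<^esub>
     ((\<Union>J\<in>Ind D // sim D. fb_word D ` nichols_ideal D J) \<union>
      {link_rel D lam i j | i j. i \<in> Ind D \<and> j \<in> Ind D \<and> (i, j) \<notin> sim D})"

text \<open>
  For \<open>Ind D = {}\<close> there are no relations and \<open>U_alg D lam\<close> is \<open>\<bbbk> # \<bbbk>\<Gamma>\<close> modulo the zero ideal,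
  that is, \<open>\<bbbk>\<Gamma>\<close> up to the evident identification.
\<close>

definition U_alg ::
    "('i, 'g::ab_group_add, 'k::field) yd_datum \<Rightarrow> ('i \<Rightarrow> 'i \<Rightarrow> 'k) \<Rightarrow>
     ('k, ('i, 'g, 'k) smash set) bialg" where
  "U_alg D lam = bialg_quot (free_boson D) (U_ideal D lam)"

definition U_x ::
    "('i, 'g::ab_group_add, 'k::field) yd_datum \<Rightarrow> ('i \<Rightarrow> 'i \<Rightarrow> 'k) \<Rightarrow> 'i \<Rightarrow> ('i, 'g, 'k) smash set" where
  "U_x D lam i = U_ideal D lam +>\<^bsub>free_boson D\<^esub> fb_x D i"

definition U_g ::
    "('i, 'g::ab_group_add, 'k::field) yd_datum \<Rightarrow> ('i \<Rightarrow> 'i \<Rightarrow> 'k) \<Rightarrow> 'g \<Rightarrow> ('i, 'g, 'k) smash set" where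
  "U_g D lam a = U_ideal D lam +>\<^bsub>free_boson D\<^esub> fb_grp D a"

definition U_mon ::
    "('i, 'g::ab_group_add, 'k::field) yd_datum \<Rightarrow> ('i \<Rightarrow> 'i \<Rightarrow> 'k) \<Rightarrow> 'i list \<Rightarrow> ('i, 'g, 'k) smash set"
where
  "U_mon D lam is = foldr (\<lambda>i u. U_x D lam i \<otimes>\<^bsub>U_alg D lam\<^esub> u) is \<one>\<^bsub>U_alg D lam\<^esub>"

definition omit :: "('i, 'g, 'k) yd_datum \<Rightarrow> 'i set \<Rightarrow> ('i, 'g, 'k) yd_datum" where
  "omit D L = D\<lparr>Ind := Ind D - L\<rparr>"

definition omit_link ::
    "('i, 'g, 'k::field) yd_datum \<Rightarrow> ('i \<Rightarrow> 'i \<Rightarrow> 'k) \<Rightarrow> 'i \<Rightarrow> 'i \<Rightarrow> 'k" where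
  "omit_link D lam i j = (if (i, j) \<in> sim D then 0 else lam i j)"

lemma sim_sym:
  assumes "(i, j) \<in> sim D"
  shows "(j, i) \<in> sim D"
proof -
  let ?r = "{(i, j). i \<in> Ind D \<and> j \<in> Ind D \<and> qq D i j * qq D j i \<noteq> 1}"
  have "sym (Id_on (Ind D) \<union> ?r\<^sup>+)"
    by (intro sym_Un sym_Id_on sym_trancl) (auto simp: sym_def mult.commute)
  with assms show ?thesis unfolding sim_def by (rule symD[rotated])
qed

lemma is_yd_datum_omit: "is_yd_datum D \<Longrightarrow> is_yd_datum (omit D L)"
  by (auto simp: is_yd_datum_def omit_def)

lemma linking_parameter_omit:
  assumes "linking_parameter D lam"
  shows "linking_parameter (omit D L) (omit_link D lam)"
  unfolding linking_parameter_def
proof (intro ballI impI)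
  fix i j assume ij: "i \<in> Ind (omit D L)" "j \<in> Ind (omit D L)" "(i, j) \<notin> sim (omit D L)"
  show "(\<not> linkable (omit D L) i j \<longrightarrow> omit_link D lam i j = 0) \<and>
    omit_link D lam i j = - qq (omit D L) i j * omit_link D lam j i"
  proof (cases "(i, j) \<in> sim D")
    case True
    then have "omit_link D lam i j = 0" "omit_link D lam j i = 0"
      using sim_sym[OF True] by (simp_all only: omit_link_def if_True)
    then show ?thesis by (simp only: mult_zero_right simp_thms)
  next
    case False
    have ji: "(j, i) \<notin> sim D" using False sim_sym[of j i D] by (rule contrapos_nn)
    have I: "i \<in> Ind D" "j \<in> Ind D" using ij by (simp_all add: omit_def)
    have lam: "\<not> linkable D i j \<longrightarrow> lam i j = 0" "lam i j = - qq D i j * lam j i"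
      using assms I False unfolding linking_parameter_def by blast+
    have "linkable D i j \<Longrightarrow> linkable (omit D L) i j"
      using ij by (simp add: linkable_def omit_def)
    with lam(1) have "\<not> linkable (omit D L) i j \<longrightarrow> lam i j = 0" by blast
    moreover have "omit_link D lam i j = lam i j" "omit_link D lam j i = lam j i"
      using False ji by (simp_all add: omit_link_def)
    moreover have "qq (omit D L) i j = qq D i j" by (simp add: qq_def omit_def)
    ultimately show ?thesis using lam(2) by (simp only:)
  qed
qed

end

theory Submission
 imports Defs "HOL-Library.Multiset"
begin

text \<open>The radical of the pairing of words with the tensor algebra is the ideal of the Nichols algebra;
as it splits along the equivalence classes, \<open>I(X\<^sub>J)\<close> is compatible with omitting vertices, which gives
\<open>\<Phi>\<close> and \<open>\<Psi>\<close>. The bosonization is the Radford-Majid theorem for Hopf algebra projections.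
For the generators, the subalgebra generated by \<open>S\<close> is stable under the adjoint action of
\<open>U(D', lam')\<close>, and the projection onto \<open>K\<close> maps every monomial into it.\<close>

text \<open>The Nichols ideal is only given as a largest graded coideal, a description that says
  nothing about what happens when vertices disappear. Removing \<open>L\<close> can break a class of
  \<open>sim D\<close> into several classes of the smaller datum, so an element of
  \<open>I(X_J)\<close> has to vanish in an algebra whose relations are just the smaller Nichols
  ideals and quantum commutators between them. The pairing makes this checkable: membership becomes
  a family of scalar equations, stable under multiplication by letters, restriction to sub-alphabets
  and the antipode. One elimination argument turns "all contractions of a tensor lie in the radical"
  into a statement about the tensor itself; it serves the coideal property, orthogonal unions and
  the descent of the coproduct to \<open>U\<close>. The structure maps of \<open>K\<close> are given
  by descriptions inside larger tensor products. They are replaced by formulas that make sense on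
  all of \<open>U\<close> and take values over \<open>K\<close> through the projection
  \<open>rh\<close>, so that every axiom becomes an identity between Sweedler sums.\<close>

abbreviation (input) mult_in ("(_ *[_]/ _)" [70, 0, 71] 70) where "x *[G] y \<equiv> x \<otimes>\<^bsub>G\<^esub> y"
abbreviation (input) smult_in ("(_ *:[_]/ _)" [70, 0, 71] 70) where "c *:[G] y \<equiv> c \<odot>\<^bsub>G\<^esub> y"
abbreviation (input) add_in ("(_ +[_]/ _)" [65, 0, 66] 65) where "x +[G] y \<equiv> x \<oplus>\<^bsub>G\<^esub> y"
abbreviation (input) one_in ("\<one>[_]") where "\<one>[G] \<equiv> \<one>\<^bsub>G\<^esub>"
abbreviation (input) zero_in ("\<zero>[_]") where "\<zero>[G] \<equiv> \<zero>\<^bsub>G\<^esub>"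
abbreviation (input) mem_in ("(_ :[_])" [51, 0] 50) where "x :[G] \<equiv> x \<in> carrier G"


abbreviation "single \<equiv> Poly_Mapping.single"
abbreviation "lookup \<equiv> Poly_Mapping.lookup"
abbreviation "keys \<equiv> Poly_Mapping.keys"

section \<open>Vector spaces and linear maps\<close>

lemma vspaceI:
 fixes V :: "('k::field, 'a, 'm) module_scheme"
 assumes "!!x y. x :[V] ==> y :[V] ==> x +[V] y :[V]"
  and "\<zero>[V] :[V]"
  and "!!x y z. x :[V] ==> y :[V] ==> z :[V] ==>
   (x +[V] y) +[V] z = x +[V] (y +[V] z)"
  and "!!x y. x :[V] ==> y :[V] ==> x +[V] y = y +[V] x"
  and "!!x. x :[V] ==> \<zero>[V] +[V] x = x"
  and "!!c x. x :[V] ==> c *:[V] x :[V]"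
  and "!!c d x. x :[V] ==> (c + d) *:[V] x = c *:[V] x +[V] d *:[V] x"
  and "!!c x y. x :[V] ==> y :[V] ==>
   c *:[V] (x +[V] y) = c *:[V] x +[V] c *:[V] y"
  and "!!c d x. x :[V] ==> (c * d) *:[V] x = c *:[V] (d *:[V] x)"
  and "!!x. x :[V] ==> 1 *:[V] x = x"
  and "!!x. x :[V] ==> 0 *:[V] x = \<zero>[V]"
 shows "vspace V"
proof (rule moduleI)
 show "abelian_group V"
 proof (rule abelian_groupI)
  fix x assume x: "x :[V]"
  have "(- 1) *:[V] x +[V] x = ((- 1) + 1) *:[V] x"
   unfolding assms(7)[OF x] using assms(10)[OF x] by simp
  also have "... = \<zero>[V]" using assms(11)[OF x] by simp
  finally show "\<exists>y\<in>carrier V. y +[V] x = \<zero>[V]" using assms(6) x by blast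
 qed (use assms in auto)
 show "cring (ring_of_type_algebra :: 'k ring)" by (rule cring_from_type_algebra)
qed (use assms in \<open>auto simp: ring_of_type_algebra_def\<close>)

context
 fixes V :: "('k::field, 'a, 'm) module_scheme"
 assumes V: "vspace V"
begin

interpretation module "ring_of_type_algebra :: 'k ring" V by (rule V)

lemma vs_abelian_group: "abelian_group V" by (rule M.abelian_group_axioms)
lemma vs_add[simp]: "x :[V] ==> y :[V] ==> x +[V] y :[V]" by simp
lemma vs_zero[simp]: "\<zero>[V] :[V]" by simp
lemma vs_smult[simp]: "x :[V] ==> c *:[V] x :[V]"
 using smult_closed[of c x] by (simp add: ring_of_type_algebra_def)
lemma vs_uminus[simp]: "x :[V] ==> \<ominus>\<^bsub>V\<^esub> x :[V]" by simp
lemma vs_minus_closed[simp]: "x :[V] ==> y :[V] ==> x \<ominus>\<^bsub>V\<^esub> y :[V]" by simp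
lemma vs_smult_l_distr: "x :[V] ==> (c + d) *:[V] x = c *:[V] x +[V] d *:[V] x"
 using smult_l_distr[of c d x] by (simp add: ring_of_type_algebra_def)
lemma vs_smult_r_distr: "x :[V] ==> y :[V] ==>
 c *:[V] (x +[V] y) = c *:[V] x +[V] c *:[V] y"
 using smult_r_distr[of c x y] by (simp add: ring_of_type_algebra_def)
lemma vs_smult_smult: "x :[V] ==> c *:[V] (d *:[V] x) = (c * d) *:[V] x"
 using smult_assoc1[of c d x] by (simp add: ring_of_type_algebra_def)
lemma vs_one[simp]: "x :[V] ==> 1 *:[V] x = x"
 using smult_one[of x] by (simp add: ring_of_type_algebra_def)
lemma vs_null[simp]: "x :[V] ==> 0 *:[V] x = \<zero>[V]"
 using smult_l_null[of x] by (simp add: ring_of_type_algebra_def)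
lemma vs_smult_zero[simp]: "c *:[V] \<zero>[V] = \<zero>[V]"
 using smult_r_null[of c] by (simp add: ring_of_type_algebra_def)
lemma vs_uminus_eq: "x :[V] ==> \<ominus>\<^bsub>V\<^esub> x = (- 1) *:[V] x"
 by (rule M.minus_equality) (auto simp flip: vs_smult_l_distr[of x "-1" 1, simplified])
lemma vs_minus_eq: "x :[V] ==> y :[V] ==> x \<ominus>\<^bsub>V\<^esub> y = x +[V] (- 1) *:[V] y"
 by (simp add: a_minus_def vs_uminus_eq)
lemma vs_comm: "x :[V] ==> y :[V] ==> x +[V] y = y +[V] x"
 by (rule M.a_comm)
lemma vs_assoc: "x :[V] ==> y :[V] ==> z :[V] ==>
 (x +[V] y) +[V] z = x +[V] (y +[V] z)"
 by (rule M.a_assoc)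
lemma vs_lcomm: "x :[V] ==> y :[V] ==> z :[V] ==>
 x +[V] (y +[V] z) = y +[V] (x +[V] z)"
 by (rule M.a_lcomm)
lemmas vs_ac = vs_assoc vs_comm vs_lcomm
lemma vs_l_zero[simp]: "x :[V] ==> \<zero>[V] +[V] x = x" by simp
lemma vs_r_zero[simp]: "x :[V] ==> x +[V] \<zero>[V] = x" by simp
lemma vs_minus_self: "x :[V] ==> x \<ominus>\<^bsub>V\<^esub> x = \<zero>[V]" by (simp add: a_minus_def M.r_neg)
lemma vs_minus_0_iff: "x :[V] ==> y :[V] ==> x \<ominus>\<^bsub>V\<^esub> y = \<zero>[V] \<longleftrightarrow> x = y"
 by (simp add: a_minus_def) (metis M.minus_equality M.minus_minus M.r_neg M.a_inv_closed)

lemma lin_ext_closed[simp]: "b : keys f \<rightarrow> carrier V ==> lin_ext V b f :[V]"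
 unfolding lin_ext_def by (rule M.finsum_closed) (auto simp: Pi_def)

lemma lin_ext_superset:
 assumes "finite A" "keys f \<subseteq> A" "b : A \<rightarrow> carrier V"
 shows "lin_ext V b f = (\<Oplus>\<^bsub>V\<^esub>x\<in>A. lookup f x *:[V] b x)"
 unfolding lin_ext_def
 by (rule M.add.finprod_mono_neutral_cong_left) (use assms in \<open>auto simp: in_keys_iff Pi_def\<close>)

lemma lin_ext_zero[simp]: "lin_ext V b 0 = \<zero>[V]" by (simp add: lin_ext_def)

lemma lin_ext_add:
 assumes "b : keys f \<union> keys g \<rightarrow> carrier V"
 shows "lin_ext V b (f + g) = lin_ext V b f +[V] lin_ext V b g"
proof -
 let ?A = "keys f \<union> keys g"
 have k: "keys (f + g) \<subseteq> ?A" by (rule Poly_Mapping.keys_add)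
 have "lin_ext V b (f + g) = (\<Oplus>\<^bsub>V\<^esub>x\<in>?A. lookup f x *:[V] b x +[V] lookup g x *:[V] b x)"
  unfolding lin_ext_superset[of ?A "f + g", OF _ k assms, simplified] lookup_add
  by (rule M.finsum_cong') (use assms in \<open>auto simp: vs_smult_l_distr Pi_def\<close>)
 also have "... = (\<Oplus>\<^bsub>V\<^esub>x\<in>?A. lookup f x *:[V] b x) +[V] (\<Oplus>\<^bsub>V\<^esub>x\<in>?A. lookup g x *:[V] b x)"
  by (rule M.finsum_addf) (use assms in \<open>auto simp: Pi_def\<close>)
 also have "... = lin_ext V b f +[V] lin_ext V b g"
  using assms by (simp add: lin_ext_superset[of ?A])
 finally show ?thesis .
qed

end

lemma keys_scale_subset: "keys (scale c f) \<subseteq> keys f"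
 by (auto simp: scale_def in_keys_iff Poly_Mapping.map.rep_eq when_def)

lemma lookup_scale[simp]: "lookup (scale c f) x = c * lookup f x"
 by (auto simp: scale_def Poly_Mapping.map.rep_eq when_def)

lemma scale_simps[simp]:
 "scale c (f + g) = scale c f + scale c g" "scale (c + d) f = scale c f + scale d f"
 "scale c (f - g) = scale c f - scale c g" "scale c (scale d f) = scale (c * d) f"
 "scale 1 f = f" "scale 0 f = 0" "scale c 0 = 0" "scale c (single x d) = single x (c * d)"
 "scale (- c) f = - scale c f" "scale c (- f) = - scale c f"
 by (auto intro!: poly_mapping_eqI simp: lookup_add lookup_minus algebra_simps lookup_single when_def)

lemma lin_map_I:
 assumes "!!x. x :[V] ==> f x :[W]"
  "!!x y. x :[V] ==> y :[V] ==> f (x +[V] y) = f x +[W] f y"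
  "!!c x. x :[V] ==> f (c *:[V] x) = c *:[W] f x"
 shows "lin_map V W f"
 using assms by (auto simp: lin_map_def)

lemma lin_map_closed: "lin_map V W f ==> x :[V] ==> f x :[W]"
 and lin_map_add: "lin_map V W f ==> x :[V] ==> y :[V] ==> f (x +[V] y) = f x +[W] f y"
 and lin_map_smult: "lin_map V W f ==> x :[V] ==> f (c *:[V] x) = c *:[W] f x"
 by (auto simp: lin_map_def)

lemma lin_map_zero: "lin_map V W f ==> vspace V ==> vspace W ==> f \<zero>[V] = \<zero>[W]"
 using lin_map_smult[of V W f "\<zero>[V]" 0] lin_map_closed[of V W f "\<zero>[V]"] by simp

lemma lin_map_uminus: "lin_map V W f ==> vspace V ==> vspace W ==> x :[V] ==>
 f (\<ominus>\<^bsub>V\<^esub> x) = \<ominus>\<^bsub>W\<^esub> f x"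
 by (simp add: vs_uminus_eq lin_map_smult lin_map_closed)

lemma lin_map_minus: "lin_map V W f ==> vspace V ==> vspace W ==> x :[V] ==> y :[V] ==>
 f (x \<ominus>\<^bsub>V\<^esub> y) = f x \<ominus>\<^bsub>W\<^esub> f y"
 by (simp add: vs_minus_eq lin_map_smult lin_map_closed lin_map_add)

lemma lin_map_id[simp]: "lin_map V V (%x. x)" by (simp add: lin_map_def)

lemma lin_map_cong: "(!!x. x :[V] ==> f x = g x) ==> vspace V ==> lin_map V W g ==> lin_map V W f"
 by (simp add: lin_map_def Pi_def)

lemma lin_map_comp: "lin_map V W g ==> lin_map V0 V f ==> lin_map V0 W (%x. g (f x))"
 by (auto simp: lin_map_def Pi_def)

lemma lin_map_const_zero: "vspace W ==> lin_map V W (%x. \<zero>[W])"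
 by (simp add: lin_map_def)

lemma lin_map_add_fun: "vspace W ==> lin_map V W f ==> lin_map V W g ==> lin_map V W (%x. f x +[W] g x)"
 by (rule lin_map_I) (simp_all add: lin_map_closed lin_map_add lin_map_smult vs_smult_r_distr vs_ac)

lemma lin_map_smult_fun: "vspace W ==> lin_map V W f ==> lin_map V W (%x. c *:[W] f x)"
 by (auto intro!: lin_map_I simp: lin_map_closed lin_map_add lin_map_smult vs_smult_r_distr vs_smult_smult mult.commute)

lemma poly_mapping_sum: "(f :: ('a, 'k::field) poly_mapping) = (\<Sum>x\<in>keys f. single x (lookup f x))"
 by (rule poly_mapping_eqI) (auto simp: lookup_sum lookup_single when_def in_keys_iff)

text \<open>Sums are built one term at a time, and the new term may hit a key that is already
  present. Linear statements are insensitive to this, so their induction steps need no case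
  split.\<close>

lemma poly_mapping_lin_induct [consumes 1, case_names zero single]:
 fixes f :: "('a, 'k::field) poly_mapping"
 assumes "keys f \<subseteq> A" "P 0"
  "!!x c f. keys f \<subseteq> A ==> P f ==> x : A ==> P (single x c + f)"
 shows "P f"
proof -
 have "P (\<Sum>x\<in>B. single x (lookup f x)) & keys (\<Sum>x\<in>B. single x (lookup f x)) \<subseteq> A" if "finite B" "B \<subseteq> keys f" for B
  using that
 proof (induction B rule: finite_induct)
  case (insert x B)
  let ?s = "\<Sum>x\<in>B. single x (lookup f x)"
  have IH: "P ?s" "keys ?s \<subseteq> A" and x: "x : A" using insert assms(1) by auto
  have "keys (single x (lookup f x)) \<subseteq> {x}" by simp
  then have "keys (single x (lookup f x) + ?s) \<subseteq> A"
   using IH(2) x Poly_Mapping.keys_add[of "single x (lookup f x)" ?s] by blast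
  then show ?case using insert(1,2) assms(3)[OF IH(2,1) x] by simp
 qed (use assms in simp)
 from this[of "keys f"] show ?thesis using poly_mapping_sum[of f] by simp
qed

lemma lin_ext_single[simp]:
 assumes "vspace V" "b x :[V]"
 shows "lin_ext V b (single x c) = c *:[V] b x"
proof -
 interpret abelian_group V by (rule vs_abelian_group[OF assms(1)])
 have "lin_ext V b (single x c) = (\<Oplus>\<^bsub>V\<^esub>y\<in>{x}. lookup (single x c) y *:[V] b y)"
  by (rule lin_ext_superset) (use assms in auto)
 then show ?thesis using assms by (simp add: finsum_insert)
qed

lemma foldSetD_cong:
 "(A, x) : foldSetD D f e ==> (!!a y. a : A ==> f a y = g a y) ==> (A, x) : foldSetD D g e"
proof (induction rule: foldSetD.induct)
 case (insertI x A y)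
 then show ?case by (metis foldSetD.insertI insertI1 insertI2)
qed (simp add: foldSetD.emptyI)

text \<open>The finite sum unfolds to the graph of a fold over the keys, and that graph depends only
  on the values at the keys. This permits rewriting under \<open>lin_ext\<close> before closure is
  known.\<close>

lemma lin_ext_fun_cong:
 assumes "!!x. x : keys f ==> b x = b' x"
 shows "lin_ext Z b f = lin_ext Z b' f"
proof -
 have "((keys f, y) : foldSetD (carrier Z) ((\<oplus>\<^bsub>Z\<^esub>) \<circ> (%x. lookup f x *:[Z] b x)) \<zero>[Z])
   = ((keys f, y) : foldSetD (carrier Z) ((\<oplus>\<^bsub>Z\<^esub>) \<circ> (%x. lookup f x *:[Z] b' x)) \<zero>[Z])" for y
  by (safe; erule foldSetD_cong) (simp_all add: assms)
 then show ?thesis unfolding lin_ext_def finsum_def finprod_def foldD_def by simp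
qed

lemma lin_ext_scale:
 assumes "vspace V" "b : keys f \<rightarrow> carrier V"
 shows "lin_ext V b (scale c f) = c *:[V] lin_ext V b f"
proof -
 have "keys f \<subseteq> b -` carrier V" using assms by auto
 then show ?thesis
 proof (induction f rule: poly_mapping_lin_induct)
  case (single x d f)
  moreover have "b : keys f \<rightarrow> carrier V" "b : keys (scale c f) \<rightarrow> carrier V"
   using single keys_scale_subset[of c f] by auto
  ultimately show ?case using assms(1)
   by (simp add: lin_ext_add vs_smult_r_distr vs_smult_smult Pi_def)
 qed (use assms in simp)
qed

section \<open>Universal property of the tensor product\<close>

definition bilin where
 "bilin V W Z B \<longleftrightarrow> (\<forall>v\<in>carrier V. lin_map W Z (B v)) & (\<forall>w\<in>carrier W. lin_map V Z (%v. B v w))"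

lemma bilinI: "(!!v. v :[V] ==> lin_map W Z (%w. B v w)) ==>
 (!!w. w :[W] ==> lin_map V Z (%v. B v w)) ==> bilin V W Z B"
 by (simp add: bilin_def)

lemma bilinD: "bilin V W Z B ==> v :[V] ==> lin_map W Z (B v)"
 "bilin V W Z B ==> w :[W] ==> lin_map V Z (%v. B v w)"
 by (auto simp: bilin_def)

lemma bilin_closed: "bilin V W Z B ==> v :[V] ==> w :[W] ==> B v w :[Z]"
 by (auto simp: bilin_def dest: lin_map_closed)

lemma tensor_null_scale: "m : tensor_null V W ==> scale c m : tensor_null V W"
 by (induction rule: tensor_null.induct) (auto intro: tensor_null.intros simp flip: mult.assoc)

lemma tensor_null_uminus: "m : tensor_null V W ==> - m : tensor_null V W"
 using tensor_null_scale[of m V W "-1"] by simp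

lemma tensor_null_diff: "m : tensor_null V W ==> n : tensor_null V W ==> m - n : tensor_null V W"
 using null_plus[OF _ tensor_null_uminus[of n V W], of m] by simp

lemma keys_single3: "keys (single x a - single y b - single z (c :: 'k::field)) \<subseteq> {x, y, z}"
 by (auto simp: in_keys_iff lookup_minus lookup_single when_def split: if_splits)

lemma tensor_null_keys:
 assumes "vspace V" "vspace W" "m : tensor_null V W"
 shows "keys m \<subseteq> carrier V \<times> carrier W"
 using assms(3)
proof (induction rule: tensor_null.induct)
 case (null_plus m n)
 then show ?case using Poly_Mapping.keys_add[of m n] by blast
next
 case (null_add_left v v' w c)
 then show ?case using assms(1) keys_single3[of "(v +[V] v', w)" c "(v, w)" c "(v', w)" c] by auto
next
 case (null_add_right v w w' c)
 then show ?case using assms(2) keys_single3[of "(v, w +[W] w')" c "(v, w)" c "(v, w')" c] by auto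
next
 case (null_smult_left v w a c)
 then show ?case using assms(1) keys_single3[of "(a *:[V] v, w)" c "(v, w)" "c * a" "(v, w)" 0] by auto
next
 case (null_smult_right v w a c)
 then show ?case using assms(2) keys_single3[of "(v, a *:[W] w)" c "(v, w)" "c * a" "(v, w)" 0] by auto
qed simp

lemma tensor_class_self: "f : tensor_class V W f"
 using null_zero[of V W] by (force simp: tensor_class_def)

lemma tensor_class_eq_iff: "tensor_class V W f = tensor_class V W g \<longleftrightarrow> f - g : tensor_null V W"
proof
 assume "tensor_class V W f = tensor_class V W g"
 then have "f : tensor_class V W g" using tensor_class_self[of f V W] by simp
 then show "f - g : tensor_null V W" by (auto simp: tensor_class_def)
next
 assume d: "f - g : tensor_null V W"
 have "f + n = g + (f - g + n)" "g + n = f + (n - (f - g))" for n by auto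
 then show "tensor_class V W f = tensor_class V W g"
  unfolding tensor_class_def using null_plus[OF d] tensor_null_diff[OF _ d] by blast
qed

lemma tensor_rep_class: "tensor_rep (tensor_class V W f) - f : tensor_null V W"
proof -
 have "tensor_rep (tensor_class V W f) : tensor_class V W f"
  unfolding tensor_rep_def by (rule someI) (rule tensor_class_self)
 then show ?thesis by (auto simp: tensor_class_def)
qed

text \<open>Representatives of a class differ by an element of \<open>tensor_null\<close>, which is
  closed under sums and scaling. So the operations, defined through a chosen representative, may be
  computed on any.\<close>

lemma tensor_simps:
 "carrier (tensor V W) = tensor_class V W ` {f. keys f \<subseteq> carrier V \<times> carrier W}"
 "\<zero>[tensor V W] = tensor_class V W 0"
 "tensor_class V W f +[tensor V W] tensor_class V W g = tensor_class V W (f + g)"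
 "c *:[tensor V W] tensor_class V W f = tensor_class V W (scale c f)"
proof -
 have "tensor_rep (tensor_class V W f) + tensor_rep (tensor_class V W g) - (f + g)
   = (tensor_rep (tensor_class V W f) - f) + (tensor_rep (tensor_class V W g) - g)" by (simp add: algebra_simps)
 then show "tensor_class V W f +[tensor V W] tensor_class V W g = tensor_class V W (f + g)"
  using null_plus[OF tensor_rep_class[of V W f] tensor_rep_class[of V W g]]
  by (simp add: tensor_def tensor_class_eq_iff diff_diff_eq add_diff_eq diff_add_eq)
 have "scale c (tensor_rep (tensor_class V W f)) - scale c f = scale c (tensor_rep (tensor_class V W f) - f)" by simp
 then show "c *:[tensor V W] tensor_class V W f = tensor_class V W (scale c f)"
  using tensor_null_scale[OF tensor_rep_class[of V W f], of c]
  by (simp add: tensor_def tensor_class_eq_iff)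
qed (simp_all add: tensor_def)

lemma vspace_tensor[simp]: "vspace (tensor V W)"
proof (rule vspaceI)
 fix x y assume "x : carrier (tensor V W)" "y : carrier (tensor V W)"
 then show "x +[tensor V W] y : carrier (tensor V W)"
  by (auto simp: tensor_simps intro!: imageI dest!: Poly_Mapping.keys_add[THEN subsetD])
next
 fix x c assume "x : carrier (tensor V W)"
 then show "c *:[tensor V W] x : carrier (tensor V W)"
  using keys_scale_subset by (fastforce simp: tensor_simps intro!: imageI)
qed (auto simp: tensor_simps add_ac)

lemma tns_closed[simp]: "v :[V] ==> w :[W] ==> tns V W v w : carrier (tensor V W)"
 by (auto simp: tns_def tensor_simps keys_single)

lemma bilin_tns: "bilin V W (tensor V W) (tns V W)"
proof (intro bilinI lin_map_I)
 fix v w w' c assume *: "v :[V]" "w :[W]" "w' :[W]"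
 from null_add_right[OF this, of 1]
 show "tns V W v (w +[W] w') = tns V W v w +[tensor V W] tns V W v w'"
  by (simp add: tns_def tensor_simps tensor_class_eq_iff diff_diff_add)
 from null_smult_right[OF *(1,2), of c 1] show "tns V W v (c *:[W] w) = c *:[tensor V W] tns V W v w"
  by (simp add: tns_def tensor_simps tensor_class_eq_iff)
next
 fix v v' w c assume *: "v :[V]" "v' :[V]" "w :[W]"
 from null_add_left[OF this, of 1]
 show "tns V W (v +[V] v') w = tns V W v w +[tensor V W] tns V W v' w"
  by (simp add: tns_def tensor_simps tensor_class_eq_iff diff_diff_add)
next
 fix v w c assume *: "v :[V]" "w :[W]"
 from null_smult_left[OF *, of c 1] show "tns V W (c *:[V] v) w = c *:[tensor V W] tns V W v w"
  by (simp add: tns_def tensor_simps tensor_class_eq_iff)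
qed simp_all

lemma tensor_induct [consumes 1, case_names zero tns]:
 assumes "t : carrier (tensor V W)" "P \<zero>[tensor V W]"
  "!!v w c t. v :[V] ==> w :[W] ==> t : carrier (tensor V W) ==> P t ==>
   P (c *:[tensor V W] tns V W v w +[tensor V W] t)"
 shows "P t"
proof -
 obtain f where f: "keys f \<subseteq> carrier V \<times> carrier W" "t = tensor_class V W f"
  using assms(1) by (auto simp: tensor_simps)
 from f(1) have "P (tensor_class V W f)"
 proof (induction f rule: poly_mapping_lin_induct)
  case zero
  then show ?case using assms(2) by (simp add: tensor_simps)
 next
  case (single x c f)
  then have "P (c *:[tensor V W] tns V W (fst x) (snd x) +[tensor V W] tensor_class V W f)"
   by (intro assms(3)) (auto simp: tensor_simps)
  then show ?case by (simp add: tns_def tensor_simps)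
 qed
 then show ?thesis using f by simp
qed

lemma lin_ext_null:
 assumes "vspace V" "vspace W" "vspace Z" "bilin V W Z B" "m : tensor_null V W"
 shows "lin_ext Z (%(v, w). B v w) m = \<zero>[Z]"
proof -
 have cl: "v :[V] ==> w :[W] ==> B v w :[Z]" for v w
  by (rule bilin_closed[OF assms(4)])
 \<comment> \<open>All four bilinearity relations have this three-term shape; the two scalar rules
   take the third coefficient to be 0.\<close>
 have eq: "lin_ext Z (%(v, w). B v w) (single p1 c1 - single p2 c2 - single p3 c3) = \<zero>[Z]"
  if "{p1,p2,p3} \<subseteq> carrier V \<times> carrier W" "c1 *:[Z] case_prod B p1 = c2 *:[Z] case_prod B p2 +[Z] c3 *:[Z] case_prod B p3"
  for p1 p2 p3 c1 c2 c3
 proof -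
  have c: "(%(v, w). B v w) p1 :[Z]" "(%(v, w). B v w) p2 :[Z]" "(%(v, w). B v w) p3 :[Z]"
   using that(1) cl by auto
  have eqn: "single p1 c1 - single p2 c2 - single p3 c3 = single p1 c1 + (single p2 (- c2) + single p3 (- c3))"
   by (simp add: single_uminus)
  have k: "keys (single p2 (- c2) + single p3 (- c3)) \<subseteq> {p2, p3}"
   using Poly_Mapping.keys_add[of "single p2 (- c2)" "single p3 (- c3)"] by (auto split: if_splits)
  have "lin_ext Z (%(v, w). B v w) (single p2 (- c2) + single p3 (- c3))
    = lin_ext Z (%(v, w). B v w) (single p2 (- c2)) +[Z] lin_ext Z (%(v, w). B v w) (single p3 (- c3))"
   by (rule lin_ext_add[OF assms(3)]) (use c in auto)
  moreover have "lin_ext Z (%(v, w). B v w) (single p1 c1 + (single p2 (- c2) + single p3 (- c3)))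
    = lin_ext Z (%(v, w). B v w) (single p1 c1) +[Z] lin_ext Z (%(v, w). B v w) (single p2 (- c2) + single p3 (- c3))"
   by (rule lin_ext_add[OF assms(3)]) (use c k in auto)
  ultimately have "lin_ext Z (%(v, w). B v w) (single p1 c1 - single p2 c2 - single p3 c3)
   = c1 *:[Z] case_prod B p1 +[Z] (- 1) *:[Z] (c2 *:[Z] case_prod B p2 +[Z] c3 *:[Z] case_prod B p3)"
   unfolding eqn using c assms(3) by (simp add: vs_smult_r_distr vs_smult_smult)
  also have "... = \<zero>[Z]"
   unfolding that(2)[symmetric] using vs_minus_self[OF assms(3), of "c1 *:[Z] case_prod B p1"] c assms(3)
   by (simp add: vs_minus_eq)
  finally show ?thesis .
 qed
 from assms(5) show ?thesis
 proof (induction rule: tensor_null.induct)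
  case (null_plus m n)
  moreover have "(%(v, w). B v w) : keys m \<union> keys n \<rightarrow> carrier Z"
   using tensor_null_keys[OF assms(1,2)] null_plus(1,2) cl by fastforce
  ultimately show ?case using assms(3) by (simp add: lin_ext_add)
 next
  case (null_add_left v v' w c)
  then show ?case using assms
   by (intro eq) (auto simp: lin_map_add[OF bilinD(2)[OF assms(4)]] vs_smult_r_distr cl)
 next
  case (null_add_right v w w' c)
  then show ?case using assms
   by (intro eq) (auto simp: lin_map_add[OF bilinD(1)[OF assms(4)]] vs_smult_r_distr cl)
 next
  case (null_smult_left v w a c)
  then show ?case using assms eq[of "(a *:[V] v, w)" "(v,w)" "(v,w)" c "c*a" 0]
   by (auto simp: lin_map_smult[OF bilinD(2)[OF assms(4)]] vs_smult_smult cl)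
 next
  case (null_smult_right v w a c)
  then show ?case using assms eq[of "(v, a *:[W] w)" "(v,w)" "(v,w)" c "c*a" 0]
   by (auto simp: lin_map_smult[OF bilinD(1)[OF assms(4)]] vs_smult_smult cl)
 qed (use assms in simp)
qed

context
 fixes V :: "('k::field, 'a, 'm) module_scheme" and W :: "('k, 'b, 'n) module_scheme"
  and Z :: "('k, 'z, 'o) module_scheme"
 assumes V: "vspace V" and W: "vspace W" and Z: "vspace Z"
begin

lemma tensor_lift_class:
 assumes "bilin V W Z B" "keys f \<subseteq> carrier V \<times> carrier W"
 shows "tensor_lift Z B (tensor_class V W f) = lin_ext Z (%(v, w). B v w) f"
proof -
 let ?r = "tensor_rep (tensor_class V W f)"
 have n: "?r - f : tensor_null V W" by (rule tensor_rep_class)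
 note k = tensor_null_keys[OF V W n]
 have cl: "(%(v, w). B v w) : keys f \<union> keys (?r - f) \<rightarrow> carrier Z"
  using assms k bilin_closed[OF assms(1)] by fastforce
 have "?r = f + (?r - f)" by simp
 then have "tensor_lift Z B (tensor_class V W f) = lin_ext Z (%(v, w). B v w) (f + (?r - f))"
  by (simp add: tensor_lift_def)
 also have "... = lin_ext Z (%(v, w). B v w) f"
  unfolding lin_ext_add[OF Z cl] lin_ext_null[OF V W Z assms(1) n]
  by (rule vs_r_zero[OF Z lin_ext_closed[OF Z]]) (use cl in auto)
 finally show ?thesis .
qed

lemma tensor_lift_tns:
 assumes "bilin V W Z B" "v :[V]" "w :[W]"
 shows "tensor_lift Z B (tns V W v w) = B v w"
 using assms Z bilin_closed[OF assms] by (simp add: tns_def tensor_lift_class keys_single)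

lemma lin_map_tensor_lift:
 assumes "bilin V W Z B"
 shows "lin_map (tensor V W) Z (tensor_lift Z B)"
proof (rule lin_map_I)
 fix x y c assume "x : carrier (tensor V W)" "y : carrier (tensor V W)"
 then obtain f g where f: "keys f \<subseteq> carrier V \<times> carrier W" "x = tensor_class V W f"
  and g: "keys g \<subseteq> carrier V \<times> carrier W" "y = tensor_class V W g" by (auto simp: tensor_simps)
 have "keys (f + g) \<subseteq> carrier V \<times> carrier W" "keys (scale c f) \<subseteq> carrier V \<times> carrier W"
  using f(1) g(1) Poly_Mapping.keys_add[of f g] keys_scale_subset[of c f] by blast+
 moreover have "(%(v, w). B v w) : keys f \<union> keys g \<rightarrow> carrier Z"
  using f(1) g(1) bilin_closed[OF assms] by fastforce
 ultimately show "tensor_lift Z B (x +[tensor V W] y) = tensor_lift Z B x +[Z] tensor_lift Z B y"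
  "tensor_lift Z B (c *:[tensor V W] x) = c *:[Z] tensor_lift Z B x"
  "tensor_lift Z B x :[Z]"
  using f g Z by (auto simp: tensor_simps tensor_lift_class[OF assms] lin_ext_add lin_ext_scale Pi_def)
qed

lemma tensor_lift_closed:
 "bilin V W Z B ==> t : carrier (tensor V W) ==> tensor_lift Z B t :[Z]"
 by (rule lin_map_closed[OF lin_map_tensor_lift])

lemma tensor_ext:
 assumes "lin_map (tensor V W) Z f" "lin_map (tensor V W) Z g"
  "!!v w. v :[V] ==> w :[W] ==> f (tns V W v w) = g (tns V W v w)"
  "t : carrier (tensor V W)"
 shows "f t = g t"
 using assms(4)
proof (induction rule: tensor_induct)
 case zero
 show ?case using assms(1,2) Z by (simp add: lin_map_zero)
next
 case (tns v w c t)
 then show ?case by (simp add: lin_map_add[OF assms(1)] lin_map_add[OF assms(2)]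
  lin_map_smult[OF assms(1)] lin_map_smult[OF assms(2)] assms(3))
qed

text \<open>The chosen representative differs from an admissible one by an element of
  \<open>tensor_null\<close>, whose keys also lie in the carriers. So the integrands are evaluated
  at carrier elements only.\<close>

lemma tensor_lift_cong:
 assumes "t : carrier (tensor V W)" "!!v w. v :[V] ==> w :[W] ==> B v w = B' v w"
 shows "tensor_lift Z B t = tensor_lift Z B' t"
proof -
 obtain f where f: "keys f \<subseteq> carrier V \<times> carrier W" "t = tensor_class V W f"
  using assms(1) by (auto simp: tensor_simps)
 have "keys (tensor_rep t) \<subseteq> carrier V \<times> carrier W"
  using tensor_null_keys[OF V W tensor_rep_class[of V W f]] f
   Poly_Mapping.keys_add[of "tensor_rep (tensor_class V W f) - f" f] by auto
 then show ?thesis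
  unfolding tensor_lift_def by (intro lin_ext_fun_cong) (use assms(2) in auto)
qed

end

section \<open>Multilinear expressions\<close>

text \<open>The collection \<open>mlin\<close> consists of syntax-directed rules for linearity, bilinearity and
 membership of expressions; \<open>(assumption | rule mlin)+\<close> is the resulting decision procedure.\<close>

named_theorems mlin

lemma vspace_transfer:
 assumes "vspace V" "carrier V' = carrier V" "add V' = add V" "\<zero>[V'] = \<zero>[V]" "module.smult V' = module.smult V"
 shows "vspace V'"
 by (rule vspaceI) (use assms(1) in \<open>simp_all add: assms(2-) vs_ac vs_smult_l_distr vs_smult_r_distr vs_smult_smult\<close>)

lemma tensor_null_mono:
 assumes "carrier V' = carrier V" "add V' = add V" "module.smult V' = module.smult V"
  "carrier W' = carrier W" "add W' = add W" "module.smult W' = module.smult W"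
 shows "tensor_null V' W' \<subseteq> tensor_null V W"
proof
 fix m assume "m : tensor_null V' W'"
 then show "m : tensor_null V W"
  by induction (use assms in \<open>auto intro: tensor_null.intros\<close>)
qed

lemma tensor_null_cong:
 assumes "carrier V' = carrier V" "add V' = add V" "module.smult V' = module.smult V"
  "carrier W' = carrier W" "add W' = add W" "module.smult W' = module.smult W"
 shows "tensor_null V' W' = tensor_null V W"
 by (intro equalityI tensor_null_mono) (use assms in simp_all)

text \<open>The tensor product sees only the carrier, the addition and the scalar multiplication.
  Records with further structure can therefore be exchanged for plain vector spaces.\<close>

lemma tensor_cong:
 assumes "carrier V' = carrier V" "add V' = add V" "module.smult V' = module.smult V"
  "carrier W' = carrier W" "add W' = add W" "module.smult W' = module.smult W"
 shows "tensor V' W' = tensor V W" "tns V' W' = tns V W"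
 using tensor_null_cong[OF assms] assms
 by (auto simp: tensor_def tns_def tensor_class_def fun_eq_iff)

lemma lin_ext_target_cong:
 assumes "carrier Z' = carrier Z" "add Z' = add Z" "\<zero>[Z'] = \<zero>[Z]" "module.smult Z' = module.smult Z"
 shows "lin_ext Z' b f = lin_ext Z b f"
 unfolding lin_ext_def finsum_def finprod_def by (simp add: assms)

lemma tensor_lift_target_cong:
 assumes "carrier Z' = carrier Z" "add Z' = add Z" "\<zero>[Z'] = \<zero>[Z]" "module.smult Z' = module.smult Z"
 shows "tensor_lift Z' B t = tensor_lift Z B t"
 unfolding tensor_lift_def by (rule lin_ext_target_cong[OF assms])

lemma lin_map_record_cong:
 assumes "carrier Z' = carrier Z" "add Z' = add Z" "module.smult Z' = module.smult Z"
 shows "lin_map V Z' f = lin_map V Z f" "lin_map Z' V h = lin_map Z V h"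
 by (auto simp: lin_map_def assms)

declare lin_map_id[mlin] bilinI[mlin] vspace_tensor[mlin] tns_closed[mlin]

lemma lin_tns_l[mlin]: "lin_map Y V f ==> w :[W] ==> lin_map Y (tensor V W) (%x. tns V W (f x) w)"
 using lin_map_comp[OF bilinD(2)[OF bilin_tns]] .
lemma lin_tns_r[mlin]: "lin_map Y W f ==> v :[V] ==> lin_map Y (tensor V W) (%x. tns V W v (f x))"
 using lin_map_comp[OF bilinD(1)[OF bilin_tns]] .

lemma tns_smult: "v :[V] ==> w :[W] ==> tns V W (c *:[V] v) w = c *:[tensor V W] tns V W v w"
 "v :[V] ==> w :[W] ==> tns V W v (c *:[W] w) = c *:[tensor V W] tns V W v w"
 by (auto simp: lin_map_smult[OF bilinD(2)[OF bilin_tns]] lin_map_smult[OF bilinD(1)[OF bilin_tns]])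

lemma base_alg_simps[simp]: "carrier base_alg = UNIV" "add base_alg = (+)" "monoid.mult base_alg = (*)"
 "\<zero>[base_alg] = 0" "\<one>[base_alg] = 1" "module.smult base_alg = (*)"
 by (simp_all add: base_alg_def ring.defs ring_of_type_algebra_def module.defs)

lemma vspace_base_alg[simp, mlin]: "vspace base_alg"
 by (rule vspaceI) (auto simp: algebra_simps)

lemma base_alg_memb[simp, mlin]: "x :[base_alg]" by simp

lemma lin_base_mult_l[mlin]: "lin_map Y base_alg f ==> lin_map Y base_alg (%x. f x * c)"
 and lin_base_mult_r[mlin]: "lin_map Y base_alg f ==> lin_map Y base_alg (%x. c * f x)"
 by (auto simp: lin_map_def algebra_simps)

lemma lin_smult_l[mlin]: "lin_map Y base_alg c ==> z :[Z] ==> vspace Z ==> lin_map Y Z (%x. c x *:[Z] z)"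
 by (auto simp: lin_map_def vs_smult_l_distr vs_smult_smult)

lemma lin_smult_r[mlin]: "lin_map Y Z f ==> vspace Z ==> lin_map Y Z (%x. c *:[Z] f x)"
 by (rule lin_map_smult_fun)

lemma smult_closed_lin[mlin]: "x :[Z] ==> vspace Z ==> c *:[Z] x :[Z]" by simp

lemma lin_lift_arg[mlin]: "lin_map Y (tensor V W) f ==> vspace V ==> vspace W ==> vspace Z ==> bilin V W Z B ==>
 lin_map Y Z (%x. tensor_lift Z B (f x))"
 by (rule lin_map_comp[OF lin_map_tensor_lift])

text \<open>For a fixed \<open>t\<close> the lift is a finite combination of the maps
  \<open>B x v w\<close>, each linear in the parameter \<open>x\<close>; induction on
  \<open>t\<close> makes this precise.\<close>

lemma lin_lift_fun[mlin]:
 assumes "t : carrier (tensor V W)" "vspace V" "vspace W" "vspace Z" "vspace Y"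
  "!!a b. a :[V] ==> b :[W] ==> lin_map Y Z (%x. B x a b)"
  "!!x. x :[Y] ==> bilin V W Z (B x)"
 shows "lin_map Y Z (%x. tensor_lift Z (B x) t)"
 using assms(1)
proof (induction rule: tensor_induct)
 case zero
 show ?case
  by (rule lin_map_cong[OF _ assms(5) lin_map_const_zero[OF assms(4)]])
   (rule lin_map_zero[OF lin_map_tensor_lift vspace_tensor assms(4)]; (rule assms; assumption?))
next
 case (tns v w c t)
 show ?case
 proof (rule lin_map_cong[OF _ assms(5)])
  show "lin_map Y Z (%x. c *:[Z] B x v w +[Z] tensor_lift Z (B x) t)"
   by (intro lin_map_add_fun lin_map_smult_fun assms tns)
  fix x assume x: "x :[Y]"
  note l = lin_map_tensor_lift[OF assms(2-4) assms(7)[OF x]]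
  show "tensor_lift Z (B x) (c *:[tensor V W] tns V W v w +[tensor V W] t) =
    c *:[Z] B x v w +[Z] tensor_lift Z (B x) t"
   using tns by (simp add: lin_map_add[OF l] lin_map_smult[OF l] tensor_lift_tns[OF assms(2-4) assms(7)[OF x]])
 qed
qed

lemma lift_closed_lin[mlin]: "t : carrier (tensor V W) ==> vspace V ==> vspace W ==> vspace Z ==> bilin V W Z B ==>
 tensor_lift Z B t :[Z]"
 by (rule tensor_lift_closed)

lemma lift_push:
 assumes "vspace V" "vspace W" "vspace Z" "vspace Z'" "bilin V W Z B" "lin_map Z Z' g" "t : carrier (tensor V W)"
 shows "g (tensor_lift Z B t) = tensor_lift Z' (%a b. g (B a b)) t"
proof -
 have B': "bilin V W Z' (%a b. g (B a b))"
  by (intro bilinI lin_map_comp[OF assms(6)] bilinD[OF assms(5)])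
 show ?thesis
  by (rule tensor_ext[OF assms(1,2,4) lin_map_comp[OF assms(6) lin_map_tensor_lift[OF assms(1-3,5)]]
    lin_map_tensor_lift[OF assms(1,2,4) B'] _ assms(7)])
   (simp add: tensor_lift_tns assms B')
qed

lemma tensor_lift_self:
 assumes "vspace V" "vspace W" "t : carrier (tensor V W)"
 shows "tensor_lift (tensor V W) (tns V W) t = t"
 by (rule tensor_ext[OF assms(1,2) vspace_tensor lin_map_tensor_lift[OF assms(1,2) vspace_tensor bilin_tns] lin_map_id _ assms(3)])
  (simp add: tensor_lift_tns assms bilin_tns)

text \<open>Both sides are linear in \<open>t\<close>, so a pure tensor suffices, and there the lift
  over \<open>t\<close> can be evaluated inside the lift over \<open>s\<close>.\<close>

lemma lift_swap:
 assumes "vspace V" "vspace W" "vspace V'" "vspace W'" "vspace Z"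
  and t: "t : carrier (tensor V W)" and s: "s : carrier (tensor V' W')"
  and 1: "!!a b. a :[V] ==> b :[W] ==> bilin V' W' Z (G a b)"
  and 2: "!!c d. c :[V'] ==> d :[W'] ==> bilin V W Z (%a b. G a b c d)"
 shows "tensor_lift Z (%a b. tensor_lift Z (%c d. G a b c d) s) t = tensor_lift Z (%c d. tensor_lift Z (%a b. G a b c d) t) s"
proof (rule tensor_ext[OF assms(1,2,5) _ _ _ t])
 have b: "bilin V W Z (%a b. tensor_lift Z (G a b) s)"
  by (intro bilinI lin_lift_fun[OF s] assms bilinD[OF 2])
 then show "lin_map (tensor V W) Z (tensor_lift Z (%a b. tensor_lift Z (%c d. G a b c d) s))"
  by (intro lin_map_tensor_lift assms)
 show "lin_map (tensor V W) Z (%t. tensor_lift Z (%c d. tensor_lift Z (%a b. G a b c d) t) s)"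
 proof (rule lin_lift_fun[OF s])
  fix t assume t: "t : carrier (tensor V W)"
  show "bilin V' W' Z (%c d. tensor_lift Z (%a b. G a b c d) t)"
   by (intro bilinI lin_lift_fun[OF t] assms 2) (auto intro!: 1 bilinD[OF 1])
 qed (auto intro!: assms lin_map_tensor_lift 2)
 fix v w assume vw: "v :[V]" "w :[W]"
 have "tensor_lift Z (%a b. tensor_lift Z (%c d. G a b c d) s) (tns V W v w) = tensor_lift Z (G v w) s"
  using tensor_lift_tns[OF assms(1,2,5) b vw] by simp
 also have "... = tensor_lift Z (%c d. tensor_lift Z (%a b. G a b c d) (tns V W v w)) s"
  by (rule tensor_lift_cong[OF assms(3,4,5) s]) (simp add: tensor_lift_tns[OF assms(1,2,5) 2 vw])
 finally show "tensor_lift Z (%a b. tensor_lift Z (%c d. G a b c d) s) (tns V W v w) =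
  tensor_lift Z (%c d. tensor_lift Z (%a b. G a b c d) (tns V W v w)) s" .
qed

section \<open>Algebras\<close>

lemma kalgebraD:
 assumes "kalgebra A"
 shows "vspace A" "ring A" "x :[A] ==> y :[A] ==> (c *:[A] x) *[A] y = c *:[A] (x *[A] y)"
  "x :[A] ==> y :[A] ==> x *[A] (c *:[A] y) = c *:[A] (x *[A] y)"
 using assms by (auto simp: kalgebra_def)

lemma kalg_facts[simp]: assumes "kalgebra A"
 shows "\<one>[A] :[A]" "x :[A] ==> y :[A] ==> x *[A] y :[A]"
  "x :[A] ==> \<one>[A] *[A] x = x" "x :[A] ==> x *[A] \<one>[A] = x"
proof -
 interpret ring A using assms by (rule kalgebraD)
 show "\<one>[A] :[A]" "x :[A] ==> y :[A] ==> x *[A] y :[A]"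
  "x :[A] ==> \<one>[A] *[A] x = x" "x :[A] ==> x *[A] \<one>[A] = x" by auto
qed

lemma kalg_assoc: "kalgebra A ==> x :[A] ==> y :[A] ==> z :[A] ==>
 (x *[A] y) *[A] z = x *[A] (y *[A] z)"
 by (rule monoid.m_assoc[OF ring.axioms(2)[OF kalgebraD(2)]])

lemma kalgebraI:
 assumes V: "vspace A" and b: "bilin A A A (%x y. x *[A] y)" and one: "\<one>[A] :[A]"
  and assoc: "!!x y z. x :[A] ==> y :[A] ==> z :[A] ==>
   (x *[A] y) *[A] z = x *[A] (y *[A] z)"
  and l: "!!x. x :[A] ==> \<one>[A] *[A] x = x" and r: "!!x. x :[A] ==> x *[A] \<one>[A] = x"
 shows "kalgebra A"
 unfolding kalgebra_def
proof (intro conjI ballI allI V)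
 show "ring A"
 proof (intro ringI monoidI)
  show "abelian_group A" using V by (rule vs_abelian_group)
 qed (auto simp: assoc l r one bilin_closed[OF b] lin_map_add[OF bilinD(1)[OF b]] lin_map_add[OF bilinD(2)[OF b]])
qed (simp_all add: lin_map_smult[OF bilinD(1)[OF b]] lin_map_smult[OF bilinD(2)[OF b]])

lemma lin_kmult_l[mlin]: "lin_map Y A f ==> y :[A] ==> kalgebra A ==> lin_map Y A (%x. f x *[A] y)"
 and lin_kmult_r[mlin]: "lin_map Y A f ==> y :[A] ==> kalgebra A ==> lin_map Y A (%x. y *[A] f x)"
 and kmult_closed[mlin]: "x :[A] ==> y :[A] ==> kalgebra A ==> x *[A] y :[A]"
 and kone_closed[mlin]: "kalgebra A ==> \<one>[A] :[A]"
proof -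
 assume A: "kalgebra A"
 interpret ring A using A by (rule kalgebraD)
 note A1 = kalgebraD[OF A]
 show "lin_map Y A f ==> y :[A] ==> lin_map Y A (%x. f x *[A] y)"
  "lin_map Y A f ==> y :[A] ==> lin_map Y A (%x. y *[A] f x)"
  "x :[A] ==> y :[A] ==> x *[A] y :[A]" "\<one>[A] :[A]"
  by (auto intro!: lin_map_I simp: lin_map_closed lin_map_add lin_map_smult l_distr r_distr A1)
qed

lemma alg_homI:
 assumes "lin_map A B f" "!!x y. x :[A] ==> y :[A] ==> f (x *[A] y) = f x *[B] f y" "f \<one>[A] = \<one>[B]"
 shows "alg_hom A B f"
 using assms by (auto simp: alg_hom_def lin_map_def ring_hom_def)

lemma alg_homD: "alg_hom A B f ==> lin_map A B f"
 "alg_hom A B f ==> x :[A] ==> y :[A] ==> f (x *[A] y) = f x *[B] f y"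
 "alg_hom A B f ==> f \<one>[A] = \<one>[B]"
 by (auto simp: alg_hom_def ring_hom_def)

lemma alg_hom_comp:
 assumes f: "alg_hom A B f" and g: "alg_hom B C g" shows "alg_hom A C (%x. g (f x))"
 by (rule alg_homI[OF lin_map_comp[OF alg_homD(1)[OF g] alg_homD(1)[OF f]]])
  (simp_all add: alg_homD(2,3)[OF f] alg_homD(2,3)[OF g] lin_map_closed[OF alg_homD(1)[OF f]])

lemma kalgebra_surj:
 assumes A: "kalgebra A" and B: "vspace B" and f: "lin_map A B f" and surj: "f ` carrier A = carrier B"
  and m: "!!x y. x :[A] ==> y :[A] ==> f (x *[A] y) = f x *[B] f y" and one: "f \<one>[A] = \<one>[B]"
 shows "kalgebra B"
proof -
 interpret ring A using A by (rule kalgebraD)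
 note A1 = kalgebraD[OF A] and f1 = lin_map_closed[OF f] lin_map_add[OF f, symmetric] lin_map_smult[OF f, symmetric]
 have R: "\<exists>a\<in>carrier A. x = f a" if "x :[B]" for x using surj that by auto
 show ?thesis
 proof (rule kalgebraI[OF B])
  show "bilin B B B (%x y. x *[B] y)"
   by (intro bilinI lin_map_I; drule R; (drule R)?; (drule R)?)
    (auto simp: f1 m[symmetric] l_distr r_distr A1 vs_add vs_smult)
  show "\<one>[B] :[B]" using f1(1)[OF one_closed] one by simp
  show "(x *[B] y) *[B] z = x *[B] (y *[B] z)" if "x :[B]" "y :[B]" "z :[B]" for x y z
   using that[THEN R] by (auto simp: m[symmetric] m_assoc)
  show "\<one>[B] *[B] x = x" "x *[B] \<one>[B] = x" if "x :[B]" for x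
   using that[THEN R] by (auto simp: one[symmetric] m[symmetric])
 qed
qed

lemma tensor_alg_simps[simp]:
 "carrier (tensor_alg A B) = carrier (tensor A B)" "add (tensor_alg A B) = add (tensor A B)"
 "\<zero>[tensor_alg A B] = \<zero>[tensor A B]" "module.smult (tensor_alg A B) = module.smult (tensor A B)"
 "\<one>[tensor_alg A B] = tns A B \<one>[A] \<one>[B]"
 by (simp_all add: tensor_alg_def Let_def)

lemma lin_map_tensor_alg[simp]: "lin_map V (tensor_alg A B) f = lin_map V (tensor A B) f"
 "lin_map (tensor_alg A B) V h = lin_map (tensor A B) V h"
 by (rule lin_map_record_cong; simp)+

lemma vspace_tensor_alg[simp]: "vspace (tensor_alg A B)"
 by (rule vspace_transfer[OF vspace_tensor[of A B]]) simp_all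

lemma bilin_tensor_algebra_ext:
 fixes Z :: "('k::field, 'z, 'o) module_scheme"
 assumes V: "vspace V" "vspace W" "vspace Z"
  and f: "bilin (tensor V W) (tensor V W) Z f" and g: "bilin (tensor V W) (tensor V W) Z g"
  and eq: "!!a b c d. a :[V] ==> b :[W] ==> c :[V] ==> d :[W] ==>
   f (tns V W a b) (tns V W c d) = g (tns V W a b) (tns V W c d)"
  and st: "s : carrier (tensor V W)" "t : carrier (tensor V W)"
 shows "f s t = g s t"
proof (rule tensor_ext[OF V bilinD(1)[OF f st(1)] bilinD(1)[OF g st(1)] _ st(2)])
 fix c d assume cd: "c :[V]" "d :[W]"
 show "f s (tns V W c d) = g s (tns V W c d)"
  by (rule tensor_ext[OF V bilinD(2)[OF f] bilinD(2)[OF g] _ st(1)]) (use cd eq in auto)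
qed

context
 fixes A :: "('k::field, 'a, 'm) module_scheme" and B :: "('k, 'b, 'n) module_scheme"
 assumes A: "kalgebra A" and B: "kalgebra B"
begin

lemma bilin_tensor_alg_mult: "bilin (tensor A B) (tensor A B) (tensor A B) (%s t. s *[tensor_alg A B] t)"
proof -
 note [mlin] = A B kalgebraD(1)[OF A] kalgebraD(1)[OF B]
 have "bilin (tensor A B) (tensor A B) (tensor A B) (%s t. tensor_lift (tensor A B) (%a b. tensor_lift (tensor A B) (%c d.
    tns A B (a *[A] c) (b *[B] d)) t) s)"
  by (assumption | rule mlin)+
 then show ?thesis by (simp add: tensor_alg_def Let_def)
qed

lemma tensor_alg_mult_tns:
 assumes "a :[A]" "b :[B]" "c :[A]" "d :[B]"
 shows "tns A B a b *[tensor_alg A B] tns A B c d = tns A B (a *[A] c) (b *[B] d)"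
proof -
 note [mlin] = A B kalgebraD(1)[OF A] kalgebraD(1)[OF B]
 have "tns A B a b *[tensor_alg A B] tns A B c d = tensor_lift (tensor A B) (%a b. tensor_lift (tensor A B) (%c d.
    tns A B (a *[A] c) (b *[B] d)) (tns A B c d)) (tns A B a b)"
  by (simp add: tensor_alg_def Let_def)
 also have "... = tensor_lift (tensor A B) (%c d. tns A B (a *[A] c) (b *[B] d)) (tns A B c d)"
  by (subst tensor_lift_tns[of A B]) (assumption | rule mlin assms refl)+
 also have "... = tns A B (a *[A] c) (b *[B] d)"
  by (subst tensor_lift_tns[of A B]) (assumption | rule mlin assms refl)+
 finally show ?thesis .
qed

text \<open>Associativity is trilinear and is tested on pure tensors: \<open>tensor_ext\<close>
  reduces the last argument, \<open>bilin_tensor_algebra_ext\<close> the other two.\<close>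

lemma kalgebra_tensor_alg: "kalgebra (tensor_alg A B)"
proof (rule kalgebraI)
 note [mlin] = A B kalgebraD(1)[OF A] kalgebraD(1)[OF B]
 note m = bilin_tensor_alg_mult
 have mc: "s : carrier (tensor A B) ==> t : carrier (tensor A B) ==> s *[tensor_alg A B] t : carrier (tensor A B)" for s t
  by (rule bilin_closed[OF m])
 have lm: "lin_map Y (tensor A B) f ==> t : carrier (tensor A B) ==> lin_map Y (tensor A B) (%s. f s *[tensor_alg A B] t)"
  "lin_map Y (tensor A B) f ==> t : carrier (tensor A B) ==> lin_map Y (tensor A B) (%s. t *[tensor_alg A B] f s)" for f t and Y :: "('k, 'y, 'l) module_scheme"
  using lin_map_comp[OF bilinD(1)[OF m]] lin_map_comp[OF bilinD(2)[OF m]] by blast+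
 note v = kalgebraD(1)[OF A] kalgebraD(1)[OF B]
 show "bilin (tensor_alg A B) (tensor_alg A B) (tensor_alg A B) (%s t. s *[tensor_alg A B] t)"
  using m by (simp add: bilin_def)
 show "\<one>[tensor_alg A B] : carrier (tensor_alg A B)" by (simp add: A B)
 fix x y z assume *: "x : carrier (tensor_alg A B)" "y : carrier (tensor_alg A B)" "z : carrier (tensor_alg A B)"
 show "(x *[tensor_alg A B] y) *[tensor_alg A B] z = x *[tensor_alg A B] (y *[tensor_alg A B] z)"
 proof (rule tensor_ext[of A B "tensor A B" "%z. (x *[tensor_alg A B] y) *[tensor_alg A B] z" "%z. x *[tensor_alg A B] (y *[tensor_alg A B] z)"])
  fix e f assume ef: "e :[A]" "f :[B]"
  show "(x *[tensor_alg A B] y) *[tensor_alg A B] tns A B e f = x *[tensor_alg A B] (y *[tensor_alg A B] tns A B e f)"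
   by (rule bilin_tensor_algebra_ext[of A B "tensor A B"])
    (use * ef v in \<open>auto intro!: bilinI lm mc simp: tensor_alg_mult_tns A B kalg_assoc\<close>)
 qed (use * v in \<open>auto intro!: lm mc\<close>)
next
 note m = bilin_tensor_alg_mult
 fix x assume x: "x : carrier (tensor_alg A B)"
 note v = kalgebraD(1)[OF A] kalgebraD(1)[OF B]
 note o = kone_closed[OF A] kone_closed[OF B]
 have t: "tns A B \<one>[A] \<one>[B] : carrier (tensor A B)" using o by simp
 show "\<one>[tensor_alg A B] *[tensor_alg A B] x = x"
  by (rule tensor_ext[OF v vspace_tensor _ lin_map_id])
   (use x v o bilinD(1)[OF m t] in \<open>auto simp: tensor_alg_mult_tns A B\<close>)
 show "x *[tensor_alg A B] \<one>[tensor_alg A B] = x"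
  by (rule tensor_ext[OF v vspace_tensor _ lin_map_id])
   (use x v o bilinD(2)[OF m t] in \<open>auto simp: tensor_alg_mult_tns A B\<close>)
qed simp

end

lemma kalgebra_base_alg[simp, mlin]: "kalgebra base_alg"
 by (rule kalgebraI) (auto intro!: bilinI lin_map_I simp: algebra_simps)

section \<open>Sweedler calculus in a Hopf algebra\<close>

text \<open>Outside the carrier the summand is irrelevant by construction, so that the congruence
 rule below needs no side condition.\<close>

definition sw :: "('k::field, 'a, 'm) bialg_scheme => ('k, 'z, 'n) module_scheme => ('a => 'a => 'z) => 'a => 'z" where
 "sw U Z B x = tensor_lift Z (%a b. if a :[U] & b :[U] then B a b else undefined) (comult U x)"

lemma sw_cong[cong]: "x = y ==> (!!a b. a :[U] ==> b :[U] ==> B a b = B' a b) ==> sw U Z B x = sw U Z B' y"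
 unfolding sw_def by (auto intro!: arg_cong[where f = "%B. tensor_lift Z B (comult U y)"] simp: fun_eq_iff)

lemmas swc = sw_cong[OF refl]

lemma sw_target_cong:
 assumes "carrier Z' = carrier Z" "add Z' = add Z" "\<zero>[Z'] = \<zero>[Z]" "module.smult Z' = module.smult Z"
 shows "sw U Z' B x = sw U Z B x"
 unfolding sw_def by (rule tensor_lift_target_cong[OF assms])

locale hopf =
 fixes U :: "('k::field, 'a, 'm) bialg_scheme" (structure)
 assumes hopf: "hopf_algebra U"
begin

abbreviation S where "S \<equiv> antipode U"

lemma kU[simp, mlin]: "kalgebra U" and vU[simp, mlin]: "vspace U"
 and lin_comult0: "lin_map U (tensor U U) (comult U)"
 and lin_counit0: "lin_map U base_alg (counit U)"
 and comult_hom: "alg_hom U (tensor_alg U U) (comult U)"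
 and counit_hom: "alg_hom U base_alg (counit U)"
proof -
 have b: "bialgebra U" using hopf unfolding hopf_algebra_def by (rule conjunct1)
 then have c: "coalgebra U (comult U) (counit U)" and "kalgebra U" "alg_hom U (tensor_alg U U) (comult U)" "alg_hom U base_alg (counit U)"
  unfolding bialgebra_def by - (elim conjE, assumption)+
 then show "kalgebra U" "alg_hom U (tensor_alg U U) (comult U)" "alg_hom U base_alg (counit U)" by - assumption+
 show "vspace U" "lin_map U (tensor U U) (comult U)" "lin_map U base_alg (counit U)"
  using c unfolding coalgebra_def by - (elim conjE, assumption)+
qed

sublocale ring U by (rule kalgebraD) simp

lemma antipode: "is_antipode U S"
 using hopf someI_ex[of "is_antipode U"] unfolding hopf_algebra_def antipode_def by blast

lemma comult_closed[simp, mlin]: "x :[U] ==> comult U x : carrier (tensor U U)"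
 by (rule lin_map_closed[OF lin_comult0])
lemma lin_comult[mlin]: "lin_map Y U f ==> lin_map Y (tensor U U) (%x. comult U (f x))"
 by (rule lin_map_comp[OF lin_comult0])
lemma lin_counit[mlin]: "lin_map Y U f ==> lin_map Y base_alg (%x. counit U (f x))"
 by (rule lin_map_comp[OF lin_counit0])
lemma lin_S0: "lin_map U U S" using antipode by (simp add: is_antipode_def)
lemma S_closed[simp, mlin]: "x :[U] ==> S x :[U]"
 by (rule lin_map_closed[OF lin_S0])
lemma lin_S[mlin]: "lin_map Y U f ==> lin_map Y U (%x. S (f x))"
 by (rule lin_map_comp[OF lin_S0])

lemma counit_simps[simp]: "x :[U] ==> y :[U] ==> counit U (x \<otimes> y) = counit U x * counit U y"
 "counit U \<one> = 1" "x :[U] ==> counit U (c \<odot> x) = c * counit U x"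
 using alg_homD[OF counit_hom] lin_map_smult[OF lin_counit0] by auto

lemma smult_mult[simp]: "x :[U] ==> y :[U] ==> (c \<odot> x) \<otimes> y = c \<odot> (x \<otimes> y)"
 "x :[U] ==> y :[U] ==> x \<otimes> (c \<odot> y) = c \<odot> (x \<otimes> y)"
 by (simp_all add: kalgebraD)

lemma S_smult[simp]: "x :[U] ==> S (c \<odot> x) = c \<odot> S x" by (rule lin_map_smult[OF lin_S0])

lemma tensor_lift_sw: "vspace Z ==> x :[U] ==> tensor_lift Z B (comult U x) = sw U Z B x"
 unfolding sw_def by (rule tensor_lift_cong[of U U]) simp_all

lemma lin_sw_arg[mlin]:
 assumes "lin_map Y U f" "vspace Z" "bilin U U Z B" shows "lin_map Y Z (%x. sw U Z B (f x))"
proof (rule lin_map_comp[OF _ assms(1)])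
 show "lin_map U Z (sw U Z B)"
  by (rule lin_map_cong[OF tensor_lift_sw[symmetric, OF assms(2)] vU])
   (assumption | rule mlin assms)+
qed

lemma lin_sw_fun[mlin]:
 assumes "vspace Y" "vspace Z" "z :[U]"
  "!!a b. a :[U] ==> b :[U] ==> lin_map Y Z (%y. B y a b)"
  "!!y. y :[Y] ==> bilin U U Z (B y)"
 shows "lin_map Y Z (%y. sw U Z (B y) z)"
 by (rule lin_map_cong[OF tensor_lift_sw[symmetric, OF assms(2,3)] assms(1)], rule lin_lift_fun[of _ U U])
  (use assms in auto)

lemma sw_closed[mlin]: "bilin U U Z B ==> vspace Z ==> x :[U] ==> sw U Z B x :[Z]"
 using tensor_lift_closed[of U U Z B "comult U x"] by (simp add: tensor_lift_sw)

lemma sw_push: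
 assumes "lin_map Z Z' g" "x :[U]" "vspace Z" "vspace Z'" "bilin U U Z B"
 shows "g (sw U Z B x) = sw U Z' (%a b. g (B a b)) x"
 using lift_push[OF vU vU assms(3,4,5,1), of "comult U x"] assms by (simp add: tensor_lift_sw)

lemma sw_tns: "x :[U] ==> sw U (tensor U U) (tns U U) x = comult U x"
 using tensor_lift_self[of U U "comult U x"] by (simp add: tensor_lift_sw)

lemma sw_mult:
 assumes "x :[U]" "y :[U]" "vspace Z" "bilin U U Z F"
 shows "sw U Z F (x \<otimes> y) = sw U Z (%a b. sw U Z (%c d. F (a \<otimes> c) (b \<otimes> d)) y) x"
proof -
 let ?T = "tensor U U"
 note l = lin_map_tensor_lift[OF vU vU assms(3,4)]
 have "comult U (x \<otimes> y) = comult U x *[tensor_alg U U] comult U y"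
  using assms by (simp add: alg_homD[OF comult_hom])
 also have "... = tensor_lift ?T (%a b. tensor_lift ?T (%c d. tns U U (a \<otimes> c) (b \<otimes> d)) (comult U y)) (comult U x)"
  by (simp add: tensor_alg_def Let_def)
 finally have e: "comult U (x \<otimes> y) = sw U ?T (%a b. sw U ?T (%c d. tns U U (a \<otimes> c) (b \<otimes> d)) y) x"
  using assms by (simp add: tensor_lift_sw)
 have "sw U Z F (x \<otimes> y) = tensor_lift Z F (comult U (x \<otimes> y))"
  using assms by (simp add: tensor_lift_sw)
 also have "... = sw U Z (%a b. tensor_lift Z F (sw U ?T (%c d. tns U U (a \<otimes> c) (b \<otimes> d)) y)) x"
  unfolding e by (rule sw_push[OF l]) (assumption | rule mlin assms)+
 also have "... = sw U Z (%a b. sw U Z (%c d. tensor_lift Z F (tns U U (a \<otimes> c) (b \<otimes> d))) y) x"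
  by (rule swc, rule sw_push[OF l]) (assumption | rule mlin assms)+
 also have "... = sw U Z (%a b. sw U Z (%c d. F (a \<otimes> c) (b \<otimes> d)) y) x"
  by (simp add: tensor_lift_tns[OF vU vU assms(3,4)])
 finally show ?thesis .
qed

lemma sw_one: "vspace Z ==> bilin U U Z F ==> sw U Z F \<one> = F \<one> \<one>"
 using alg_homD(3)[OF comult_hom] by (simp flip: tensor_lift_sw add: tensor_lift_tns)

lemma sw_coassoc:
 assumes "x :[U]" "vspace Z"
  and 1: "!!b c. b :[U] ==> c :[U] ==> lin_map U Z (%a. F a b c)"
  and 2: "!!a c. a :[U] ==> c :[U] ==> lin_map U Z (%b. F a b c)"
  and 3: "!!a b. a :[U] ==> b :[U] ==> lin_map U Z (%c. F a b c)"
 shows "sw U Z (%a c. sw U Z (%a1 a2. F a1 a2 c) a) x = sw U Z (%a b. sw U Z (%b1 b2. F a b1 b2) b) x"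
proof -
 let ?T = "tensor U (tensor U U)"
 \<comment> \<open>The linear map on the threefold tensor product that the trilinear
   \<open>F\<close> induces; applied to the coassociativity axiom it yields the claim.\<close>
 let ?g = "tensor_lift Z (%a t. tensor_lift Z (%b c. F a b c) t)"
 note [mlin] = 1 2 3
 have b: "bilin U (tensor U U) Z (%a t. tensor_lift Z (%b c. F a b c) t)"
  and b': "!!a. a :[U] ==> bilin U U Z (%b c. F a b c)"
  by - (assumption | rule mlin assms)+
 note l = lin_map_tensor_lift[OF vU vspace_tensor assms(2) b]
 have g: "?g (tns U (tensor U U) a (tns U U b c)) = F a b c" if "a :[U]" "b :[U]" "c :[U]" for a b c
  using that by (simp add: tensor_lift_tns[OF vU vspace_tensor assms(2) b] tensor_lift_tns[OF vU vU assms(2) b'])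
 have "tensor_lift ?T (%a b. tensor_lift ?T (%a1 a2. tns U (tensor U U) a1 (tns U U a2 b)) (comult U a)) (comult U x)
    = tensor_lift ?T (%a b. tns U (tensor U U) a (comult U b)) (comult U x)"
  using hopf assms(1) by (simp add: hopf_algebra_def bialgebra_def coalgebra_def Let_def)
 then have e: "sw U ?T (%a c. sw U ?T (%a1 a2. tns U (tensor U U) a1 (tns U U a2 c)) a) x =
  sw U ?T (%a b. tns U (tensor U U) a (comult U b)) x"
  using assms(1) by (simp add: tensor_lift_sw)
 have "?g (sw U ?T (%a c. sw U ?T (%a1 a2. tns U (tensor U U) a1 (tns U U a2 c)) a) x)
  = sw U Z (%a c. ?g (sw U ?T (%a1 a2. tns U (tensor U U) a1 (tns U U a2 c)) a)) x"
  by (rule sw_push[OF l]) (assumption | rule mlin assms)+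
 also have "... = sw U Z (%a c. sw U Z (%a1 a2. ?g (tns U (tensor U U) a1 (tns U U a2 c))) a) x"
  by (rule swc, rule sw_push[OF l]) (assumption | rule mlin assms)+
 also have "... = sw U Z (%a c. sw U Z (%a1 a2. F a1 a2 c) a) x" by (simp add: g)
 finally have L: "?g (sw U ?T (%a c. sw U ?T (%a1 a2. tns U (tensor U U) a1 (tns U U a2 c)) a) x) = sw U Z (%a c. sw U Z (%a1 a2. F a1 a2 c) a) x" .
 have "?g (sw U ?T (%a b. tns U (tensor U U) a (comult U b)) x) = sw U Z (%a b. ?g (tns U (tensor U U) a (comult U b))) x"
  by (rule sw_push[OF l]) (assumption | rule mlin assms)+
 also have "... = sw U Z (%a b. sw U Z (%b1 b2. F a b1 b2) b) x"
  by (simp add: tensor_lift_tns[OF vU vspace_tensor assms(2) b] tensor_lift_sw assms(2))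
 finally show ?thesis using L e by simp
qed

lemma sw_counit_l0: "x :[U] ==> sw U U (%a b. counit U a \<odot> b) x = x"
 and sw_counit_r0: "x :[U] ==> sw U U (%a b. counit U b \<odot> a) x = x"
 using hopf by (simp_all flip: tensor_lift_sw add: hopf_algebra_def bialgebra_def coalgebra_def)

lemma sw_S_l: "x :[U] ==> sw U U (%a b. S a \<otimes> b) x = counit U x \<odot> \<one>"
 and sw_S_r: "x :[U] ==> sw U U (%a b. a \<otimes> S b) x = counit U x \<odot> \<one>"
 using antipode by (simp_all flip: tensor_lift_sw add: is_antipode_def)

lemma sw_counit_l:
 assumes "lin_map U Z F" "x :[U]" "vspace Z"
 shows "sw U Z (%a b. counit U a *:[Z] F b) x = F x"
proof -
 have "F (sw U U (%a b. counit U a \<odot> b) x) = sw U Z (%a b. F (counit U a \<odot> b)) x"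
  by (rule sw_push[OF assms(1)]) (assumption | rule mlin assms)+
 then show ?thesis using assms(2) by (simp add: sw_counit_l0 lin_map_smult[OF assms(1)])
qed

lemma sw_counit_r:
 assumes "lin_map U Z F" "x :[U]" "vspace Z"
 shows "sw U Z (%a b. counit U b *:[Z] F a) x = F x"
proof -
 have "F (sw U U (%a b. counit U b \<odot> a) x) = sw U Z (%a b. F (counit U b \<odot> a)) x"
  by (rule sw_push[OF assms(1)]) (assumption | rule mlin assms)+
 then show ?thesis using assms(2) by (simp add: sw_counit_r0 lin_map_smult[OF assms(1)])
qed

lemma sw_antipode_l:
 assumes "lin_map U Z G" "x :[U]" "vspace Z"
 shows "sw U Z (%a b. G (S a \<otimes> b)) x = counit U x *:[Z] G \<one>"
proof -
 have "G (sw U U (%a b. S a \<otimes> b) x) = sw U Z (%a b. G (S a \<otimes> b)) x"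
  by (rule sw_push[OF assms(1)]) (assumption | rule mlin assms)+
 then show ?thesis using assms(2) by (simp add: sw_S_l lin_map_smult[OF assms(1)])
qed

lemma sw_antipode_r:
 assumes "lin_map U Z G" "x :[U]" "vspace Z"
 shows "sw U Z (%a b. G (a \<otimes> S b)) x = counit U x *:[Z] G \<one>"
proof -
 have "G (sw U U (%a b. a \<otimes> S b) x) = sw U Z (%a b. G (a \<otimes> S b)) x"
  by (rule sw_push[OF assms(1)]) (assumption | rule mlin assms)+
 then show ?thesis using assms(2) by (simp add: sw_S_r lin_map_smult[OF assms(1)])
qed

text \<open>In a fourfold coproduct the two middle legs sit in different branches on the left and in
  one branch on the right. The regrouping prepares their cancellation by an antipode axiom.\<close>

lemma sw_wrap:
 assumes "x :[U]" "vspace Z"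
  and [mlin]: "!!b c d. b :[U] ==> c :[U] ==> d :[U] ==> lin_map U Z (%a. F a b c d)"
  "!!a c d. a :[U] ==> c :[U] ==> d :[U] ==> lin_map U Z (%b. F a b c d)"
  "!!a b d. a :[U] ==> b :[U] ==> d :[U] ==> lin_map U Z (%c. F a b c d)"
  "!!a b c. a :[U] ==> b :[U] ==> c :[U] ==> lin_map U Z (%d. F a b c d)"
 shows "sw U Z (%a b. sw U Z (%a1 a2. sw U Z (%b1 b2. F a1 a2 b1 b2) b) a) x =
  sw U Z (%a b. sw U Z (%c d. sw U Z (%c1 c2. F a c1 c2 d) c) b) x"
proof -
 have "sw U Z (%a b. sw U Z (%a1 a2. sw U Z (%b1 b2. F a1 a2 b1 b2) b) a) x =
   sw U Z (%a b. sw U Z (%a2 b'. sw U Z (%b1 b2. F a a2 b1 b2) b') b) x"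
  by (rule sw_coassoc) (assumption | rule mlin assms(1,2))+
 also have "... = sw U Z (%a b. sw U Z (%c d. sw U Z (%c1 c2. F a c1 c2 d) c) b) x"
  by (rule swc, rule sw_coassoc[symmetric]) (assumption | rule mlin assms(1,2))+
 finally show ?thesis .
qed

text \<open>In the convolution algebra of linear maps from \<open>U\<close> to \<open>A\<close>,
  \<open>f\<close> is a left inverse of \<open>g\<close> and \<open>h\<close> a right inverse, and
  one-sided inverses on the two sides agree.\<close>

lemma conv_unique:
 assumes [mlin]: "kalgebra A" and f: "lin_map U A f" and g: "lin_map U A g" and h: "lin_map U A h"
  and fg: "!!x. x :[U] ==> sw U A (%a b. f a *[A] g b) x = counit U x *:[A] \<one>[A]"
  and gh: "!!x. x :[U] ==> sw U A (%a b. g a *[A] h b) x = counit U x *:[A] \<one>[A]"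
  and x: "x :[U]"
 shows "f x = h x"
proof -
 note A = assms(1)
 note [simp] = kalgebraD(1,3,4)[OF A] kalg_facts[OF A] lin_map_closed[OF f] lin_map_closed[OF g] lin_map_closed[OF h]
 note [mlin] = kalgebraD(1)[OF A] lin_map_comp[OF f] lin_map_comp[OF g] lin_map_comp[OF h] lin_map_closed[OF f] lin_map_closed[OF g] lin_map_closed[OF h]
 have "f x = sw U A (%a b. counit U b *:[A] f a) x"
  by (rule sw_counit_r[symmetric, OF f x]) simp
 also have "... = sw U A (%a b. f a *[A] sw U A (%b1 b2. g b1 *[A] h b2) b) x"
  by (simp add: gh cong: sw_cong)
 also have "... = sw U A (%a b. sw U A (%b1 b2. f a *[A] (g b1 *[A] h b2)) b) x"
  by (rule swc, rule sw_push) (assumption | rule mlin)+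
 also have "... = sw U A (%a c. sw U A (%a1 a2. f a1 *[A] (g a2 *[A] h c)) a) x"
  by (rule sw_coassoc[symmetric]) (assumption | rule mlin x)+
 also have "... = sw U A (%a c. sw U A (%a1 a2. (f a1 *[A] g a2) *[A] h c) a) x"
  by (simp add: kalg_assoc[OF A])
 also have "... = sw U A (%a c. sw U A (%a1 a2. f a1 *[A] g a2) a *[A] h c) x"
  by (rule swc, rule sw_push[symmetric]) (assumption | rule mlin)+
 also have "... = h x" by (simp add: fg x sw_counit_l[OF h])
 finally show ?thesis .
qed

lemma antipode_unique: "is_antipode U T ==> x :[U] ==> S x = T x"
 by (rule conv_unique[OF kU, of S "%x. x" T]) (simp_all add: lin_S0 is_antipode_def sw_S_l tensor_lift_sw)

lemma S_one[simp]: "S \<one> = \<one>"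
proof -
 have "sw U U (%a b. S a \<otimes> b) \<one> = S \<one> \<otimes> \<one>" by (rule sw_one) (assumption | rule mlin)+
 then show ?thesis by (simp add: sw_S_l)
qed

lemma counit_S[simp]: "x :[U] ==> counit U (S x) = counit U x"
proof -
 assume x: "x :[U]"
 have l: "lin_map U base_alg (counit U)" by (rule lin_counit0)
 have "counit U x = sw U base_alg (%a b. counit U (S a \<otimes> b)) x"
  using sw_antipode_l[OF l x] by simp
 also have "... = sw U base_alg (%a b. counit U b *:[base_alg] counit U (S a)) x" by (simp add: mult.commute)
 also have "... = counit U (S x)" by (rule sw_counit_r) (assumption | rule mlin x)+
 finally show ?thesis by simp
qed

end

lemma sw_swap:
 assumes "hopf U" "hopf H" "x :[U]" "y :[H]" "vspace Z"
  and 1: "!!a b. a :[U] ==> b :[U] ==> bilin H H Z (G a b)"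
  and 2: "!!c d. c :[H] ==> d :[H] ==> bilin U U Z (%a b. G a b c d)"
 shows "sw U Z (%a b. sw H Z (%c d. G a b c d) y) x = sw H Z (%c d. sw U Z (%a b. G a b c d) x) y"
proof -
 interpret U: hopf U by fact
 interpret H: hopf H by fact
 show ?thesis using lift_swap[of U U H H Z "comult U x" "comult H y" G] assms
  by (simp add: U.tensor_lift_sw H.tensor_lift_sw)
qed

section \<open>The antipode reverses products and coproducts\<close>

context hopf begin

lemma hopfU[mlin]: "hopf U" by unfold_locales

lemma S_mult:
 assumes x: "x :[U]" and y: "y :[U]"
 shows "S (x \<otimes> y) = S y \<otimes> S x"
proof -
 let ?T = "sw U U (%a b. sw U U (%c d. S (a \<otimes> c) \<otimes> sw U U (%b1 b2. sw U U (%d1 d2. (b1 \<otimes> (d1 \<otimes> S d2)) \<otimes> S b2) d) b) y) x"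
 \<comment> \<open>The counits of the second legs of \<open>x\<close> and \<open>y\<close> are
   spelled out as this nested product. After regrouping, \<open>S (a c)\<close> meets
   \<open>b1 d1\<close>, the antipode axiom for the product of the first legs applies, and
   \<open>S d2\<close> times \<open>S b2\<close> is left.\<close>
 have i: "sw U U (%b1 b2. sw U U (%d1 d2. (b1 \<otimes> (d1 \<otimes> S d2)) \<otimes> S b2) d) b = counit U d \<odot> (counit U b \<odot> \<one>)"
  if b: "b :[U]" and d: "d :[U]" for b d
 proof -
  have "sw U U (%b1 b2. sw U U (%d1 d2. (b1 \<otimes> (d1 \<otimes> S d2)) \<otimes> S b2) d) b =
   sw U U (%b1 b2. counit U d \<odot> ((b1 \<otimes> \<one>) \<otimes> S b2)) b"
   by (rule swc, rule sw_antipode_r[where G = "%x. (_ \<otimes> x) \<otimes> S _"]) (assumption | rule mlin d)+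
  also have "... = counit U d \<odot> sw U U (%b1 b2. b1 \<otimes> S b2) b"
   by (subst sw_push[where g = "%x. counit U d \<odot> x"]) ((assumption | rule mlin b)+ | simp)+
  finally show ?thesis using b by (simp add: sw_S_r)
 qed
 have "S (x \<otimes> y) = sw U U (%a b. counit U b \<odot> S (a \<otimes> y)) x"
  by (rule sw_counit_r[symmetric]) (assumption | rule mlin x y)+
 also have "... = sw U U (%a b. sw U U (%c d. counit U d \<odot> (counit U b \<odot> S (a \<otimes> c))) y) x"
  by (rule swc, rule sw_counit_r[symmetric]) (assumption | rule mlin x y)+
 also have "... = ?T" by (simp add: i)
 also have "... = sw U U (%a b. sw U U (%c d. sw U U (%b1 b2. sw U U (%d1 d2. S (a \<otimes> c) \<otimes> ((b1 \<otimes> (d1 \<otimes> S d2)) \<otimes> S b2)) d) b) y) x"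
 proof (rule swc, rule swc)
  fix a b c d assume *: "a :[U]" "b :[U]" "c :[U]" "d :[U]"
  have "S (a \<otimes> c) \<otimes> sw U U (%b1 b2. sw U U (%d1 d2. (b1 \<otimes> (d1 \<otimes> S d2)) \<otimes> S b2) d) b =
   sw U U (%b1 b2. S (a \<otimes> c) \<otimes> sw U U (%d1 d2. (b1 \<otimes> (d1 \<otimes> S d2)) \<otimes> S b2) d) b"
   by (rule sw_push) (assumption | rule mlin *)+
  also have "... = sw U U (%b1 b2. sw U U (%d1 d2. S (a \<otimes> c) \<otimes> ((b1 \<otimes> (d1 \<otimes> S d2)) \<otimes> S b2)) d) b"
   by (rule swc, rule sw_push) (assumption | rule mlin *)+
  finally show "S (a \<otimes> c) \<otimes> sw U U (%b1 b2. sw U U (%d1 d2. (b1 \<otimes> (d1 \<otimes> S d2)) \<otimes> S b2) d) b =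
   sw U U (%b1 b2. sw U U (%d1 d2. S (a \<otimes> c) \<otimes> ((b1 \<otimes> (d1 \<otimes> S d2)) \<otimes> S b2)) d) b" .
 qed
 also have "... = sw U U (%a b. sw U U (%b1 b2. sw U U (%c d. sw U U (%d1 d2. S (a \<otimes> c) \<otimes> ((b1 \<otimes> (d1 \<otimes> S d2)) \<otimes> S b2)) d) y) b) x"
  by (rule swc, rule sw_swap) (assumption | rule mlin x y)+
 also have "... = sw U U (%a b. sw U U (%b1 b2. sw U U (%e d2. sw U U (%c d1. S (a \<otimes> c) \<otimes> ((b1 \<otimes> (d1 \<otimes> S d2)) \<otimes> S b2)) e) y) b) x"
  by (rule swc, rule swc, rule sw_coassoc[symmetric]) (assumption | rule mlin x y)+
 also have "... = sw U U (%f b2. sw U U (%a b1. sw U U (%e d2. sw U U (%c d1. S (a \<otimes> c) \<otimes> ((b1 \<otimes> (d1 \<otimes> S d2)) \<otimes> S b2)) e) y) f) x"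
  by (rule sw_coassoc[symmetric]) (assumption | rule mlin x y)+
 also have "... = sw U U (%f b2. sw U U (%e d2. sw U U (%a b1. sw U U (%c d1. S (a \<otimes> c) \<otimes> ((b1 \<otimes> (d1 \<otimes> S d2)) \<otimes> S b2)) e) f) y) x"
  by (rule swc, rule sw_swap) (assumption | rule mlin x y)+
 also have "... = sw U U (%f b2. sw U U (%e d2. sw U U (%p q. (S p \<otimes> q) \<otimes> (S d2 \<otimes> S b2)) (f \<otimes> e)) y) x"
 proof (rule swc, rule swc)
  fix f b2 e d2 assume *: "f :[U]" "b2 :[U]" "e :[U]" "d2 :[U]"
  have "sw U U (%p q. (S p \<otimes> q) \<otimes> (S d2 \<otimes> S b2)) (f \<otimes> e) =
   sw U U (%a b1. sw U U (%c d1. (S (a \<otimes> c) \<otimes> (b1 \<otimes> d1)) \<otimes> (S d2 \<otimes> S b2)) e) f"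
   by (rule sw_mult) (assumption | rule mlin *)+
  then show "sw U U (%a b1. sw U U (%c d1. S (a \<otimes> c) \<otimes> ((b1 \<otimes> (d1 \<otimes> S d2)) \<otimes> S b2)) e) f =
   sw U U (%p q. (S p \<otimes> q) \<otimes> (S d2 \<otimes> S b2)) (f \<otimes> e)" using * by (simp add: m_assoc)
 qed
 also have "... = sw U U (%f b2. sw U U (%e d2. counit U (f \<otimes> e) \<odot> (\<one> \<otimes> (S d2 \<otimes> S b2))) y) x"
  by (rule swc, rule swc, rule sw_antipode_l[where G = "%z. z \<otimes> (S _ \<otimes> S _)"]) (assumption | rule mlin x y)+
 also have "... = sw U U (%f b2. sw U U (%e d2. counit U e \<odot> (counit U f \<odot> (S d2 \<otimes> S b2))) y) x"
  by (simp add: vs_smult_smult mult.commute)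
 also have "... = sw U U (%f b2. counit U f \<odot> (S y \<otimes> S b2)) x"
  by (rule swc, rule sw_counit_l) (assumption | rule mlin x y)+
 also have "... = S y \<otimes> S x"
  by (rule sw_counit_l) (assumption | rule mlin x y)+
 finally show ?thesis .
qed

text \<open>In the convolution algebra of maps from \<open>U\<close> to its tensor square both sides
  invert \<open>comult\<close>: one from the left because \<open>comult\<close> is multiplicative,
  the other from the right by cancelling the inner legs.\<close>

lemma comult_S:
 assumes x: "x :[U]"
 shows "comult U (S x) = sw U (tensor U U) (%a b. tns U U (S b) (S a)) x"
proof -
 let ?A = "tensor_alg U U" and ?T = "tensor U U"
 have kA[simp]: "kalgebra ?A" by (intro kalgebra_tensor_alg kU)
 note [simp] = tensor_alg_mult_tns[OF kU kU]
 have swA: "sw U ?A B x = sw U ?T B x" for B x by (rule sw_target_cong) simp_all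
 have bA: "bilin Y Y' ?A B = bilin Y Y' ?T B" for Y Y' B by (simp add: bilin_def)
 have l[mlin]: "lin_map Y ?T f ==> t :[?T] ==> lin_map Y ?T (%x. f x *[?A] t)"
  "lin_map Y ?T f ==> t :[?T] ==> lin_map Y ?T (%x. t *[?A] f x)" for f t and Y :: "('k, 'y, 'l) module_scheme"
  using lin_kmult_l[of Y ?A f t] lin_kmult_r[of Y ?A f t] by auto
 show ?thesis
 proof (rule conv_unique[OF kA _ _ _ _ _ x, of _ "comult U"])
  show "lin_map U ?A (%x. comult U (S x))" "lin_map U ?A (comult U)" "lin_map U ?A (%x. sw U ?T (%a b. tns U U (S b) (S a)) x)"
   unfolding lin_map_tensor_alg by (assumption | rule mlin)+
  fix x assume x: "x :[U]"
  have "sw U ?A (%a b. comult U (S a) *[?A] comult U b) x = sw U ?A (%a b. comult U (S a \<otimes> b)) x"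
   by (simp add: alg_homD[OF comult_hom])
  also have "... = counit U x *:[?A] comult U \<one>"
   by (rule sw_antipode_l[OF _ x]) (simp_all add: lin_comult0)
  finally show "sw U ?A (%a b. comult U (S a) *[?A] comult U b) x = counit U x *:[?A] \<one>[?A]"
   by (simp add: alg_homD(3)[OF comult_hom])
  have "sw U ?T (%a b. comult U a *[?A] sw U ?T (%a b. tns U U (S b) (S a)) b) x =
   sw U ?T (%a b. sw U ?T (%a1 a2. tns U U a1 a2) a *[?A] sw U ?T (%a b. tns U U (S b) (S a)) b) x"
   by (simp add: sw_tns)
  also have "... = sw U ?T (%a b. sw U ?T (%a1 a2. tns U U a1 a2 *[?A] sw U ?T (%a b. tns U U (S b) (S a)) b) a) x"
   by (rule swc, rule sw_push[where g = "%t. t *[?A] _"]) (assumption | rule mlin)+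
  also have "... = sw U ?T (%a b. sw U ?T (%a1 a2. sw U ?T (%b1 b2. tns U U a1 a2 *[?A] tns U U (S b2) (S b1)) b) a) x"
   by (rule swc, rule swc, rule sw_push) (assumption | rule mlin)+
  also have "... = sw U ?T (%a b. sw U ?T (%a1 a2. sw U ?T (%b1 b2. tns U U (a1 \<otimes> S b2) (a2 \<otimes> S b1)) b) a) x"
   by simp
  also have "... = sw U ?T (%a b. sw U ?T (%c d. sw U ?T (%c1 c2. tns U U (a \<otimes> S d) (c1 \<otimes> S c2)) c) b) x"
   by (rule sw_wrap) (assumption | rule mlin x)+
  also have "... = sw U ?T (%a b. sw U ?T (%c d. counit U c *:[?T] tns U U (a \<otimes> S d) \<one>) b) x"
   by (rule swc, rule swc, rule sw_antipode_r) (assumption | rule mlin)+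
  also have "... = sw U ?T (%a b. tns U U (a \<otimes> S b) \<one>) x"
   by (rule swc, rule sw_counit_l) (assumption | rule mlin)+
  also have "... = counit U x *:[?T] tns U U \<one> \<one>"
   by (rule sw_antipode_r) (assumption | rule mlin x)+
  finally show "sw U ?A (%a b. comult U a *[?A] sw U ?T (%a b. tns U U (S b) (S a)) b) x = counit U x *:[?A] \<one>[?A]"
   by (simp add: swA)
 qed
qed

lemma sw_S:
 assumes "x :[U]" "vspace Z" "bilin U U Z F"
 shows "sw U Z F (S x) = sw U Z (%a b. F (S b) (S a)) x"
proof -
 note l = lin_map_tensor_lift[OF vU vU assms(2,3)]
 have "sw U Z F (S x) = tensor_lift Z F (comult U (S x))" using assms by (simp add: tensor_lift_sw)
 also have "... = sw U Z (%a b. tensor_lift Z F (tns U U (S b) (S a))) x"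
  unfolding comult_S[OF assms(1)] by (rule sw_push[OF l]) (assumption | rule mlin assms)+
 finally show ?thesis using tensor_lift_tns[OF vU vU assms(2,3)] by simp
qed

end

section \<open>Transport along surjections\<close>

lemma lin_map_surj:
 assumes f: "lin_map V Q f" and surj: "f ` carrier V = carrier Q" and V: "vspace V" and g: "lin_map V Z (%x. g (f x))"
 shows "lin_map Q Z g"
proof (rule lin_map_I)
 have R: "\<exists>a\<in>carrier V. x = f a" if "x :[Q]" for x using surj that by auto
 fix x y c assume "x :[Q]" "y :[Q]"
 then obtain a b where a: "a :[V]" "x = f a" and b: "b :[V]" "y = f b" using R by blast
 show "g x :[Z]" using lin_map_closed[OF g] a by simp
 show "g (x +[Q] y) = g x +[Z] g y"
  using lin_map_add[OF g a(1) b(1)] a b by (simp add: lin_map_add[OF f])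
 show "g (c *:[Q] x) = c *:[Z] g x"
  using lin_map_smult[OF g a(1)] a by (simp add: lin_map_smult[OF f])
qed

context hopf begin

lemma sw_push_lift:
 assumes "vspace V" "vspace W" "vspace Z" "bilin V W Z G" "x :[U]" "bilin U U (tensor V W) B"
 shows "tensor_lift Z G (sw U (tensor V W) B x) = sw U Z (%a b. tensor_lift Z G (B a b)) x"
 by (rule sw_push[OF lin_map_tensor_lift[OF assms(1-4)] assms(5) vspace_tensor assms(3,6)])

lemma sw_lift_tns:
 assumes "vspace V" "vspace W" "vspace Z" "bilin V W Z G" "x :[U]" "lin_map U V f" "lin_map U W g"
 shows "tensor_lift Z G (sw U (tensor V W) (%a b. tns V W (f a) (g b)) x) = sw U Z (%a b. G (f a) (g b)) x"
proof -
 have "tensor_lift Z G (sw U (tensor V W) (%a b. tns V W (f a) (g b)) x) = sw U Z (%a b. tensor_lift Z G (tns V W (f a) (g b))) x"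
  by (rule sw_push_lift) (assumption | rule mlin assms lin_map_closed[OF assms(6)] lin_map_closed[OF assms(7)])+
 then show ?thesis
  by (simp add: tensor_lift_tns[OF assms(1-4)] lin_map_closed[OF assms(6)] lin_map_closed[OF assms(7)])
qed

text \<open>Every element of \<open>Q\<close> is an image, so each coalgebra axiom is pushed forward
  from \<open>U\<close>. Multiplicativity of \<open>f\<close> does not enter, so that the result
  covers the projection onto the coinvariants, which is not an algebra map in general.\<close>

lemma coalgebra_surj:
 assumes Q: "vspace Q" and f: "lin_map U Q f" and surj: "f ` carrier U = carrier Q"
  and \<Delta>: "!!x. x :[U] ==> \<Delta> (f x) = sw U (tensor Q Q) (%a b. tns Q Q (f a) (f b)) x"
  and \<epsilon>: "!!x. x :[U] ==> \<epsilon> (f x) = counit U x"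
 shows "coalgebra Q \<Delta> \<epsilon>"
proof -
 note fc[simp] = lin_map_closed[OF f]
 note [mlin] = Q fc lin_map_comp[OF f]
 have lD: "lin_map Q (tensor Q Q) \<Delta>"
  by (rule lin_map_surj[OF f surj vU], rule lin_map_cong[OF \<Delta> vU]) (assumption | rule mlin)+
 have le: "lin_map Q base_alg \<epsilon>"
  by (rule lin_map_surj[OF f surj vU], rule lin_map_cong[OF \<epsilon> vU]) (assumption | rule mlin)+
 note [mlin] = lin_map_comp[OF lD] lin_map_closed[OF lD] lin_map_comp[OF le]
 have lift: "tensor_lift Z G (\<Delta> (f x)) = sw U Z (%a b. G (f a) (f b)) x"
  if "vspace Z" "bilin Q Q Z G" "x :[U]" for Z :: "('k, 'z, 'l) module_scheme" and G x
  unfolding \<Delta>[OF that(3)] by (rule sw_lift_tns[OF Q Q that(1,2,3) f f])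
 show ?thesis
  unfolding coalgebra_def Let_def
 proof (intro conjI ballI Q lD le)
  let ?Z = "tensor Q (tensor Q Q)"
  fix y assume "y :[Q]"
  then obtain x where x: "x :[U]" and y: "y = f x" using surj by auto
  have "tensor_lift ?Z (%a b. tensor_lift ?Z (%a1 a2. tns Q (tensor Q Q) a1 (tns Q Q a2 b)) (\<Delta> a)) (\<Delta> (f x))
   = sw U ?Z (%a b. tensor_lift ?Z (%a1 a2. tns Q (tensor Q Q) a1 (tns Q Q a2 (f b))) (\<Delta> (f a))) x"
   by (rule lift) (assumption | rule mlin x)+
  also have "... = sw U ?Z (%a b. sw U ?Z (%a1 a2. tns Q (tensor Q Q) (f a1) (tns Q Q (f a2) (f b))) a) x"
   by (rule swc, rule lift) (assumption | rule mlin x)+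
  also have "... = sw U ?Z (%a b. sw U ?Z (%b1 b2. tns Q (tensor Q Q) (f a) (tns Q Q (f b1) (f b2))) b) x"
   by (rule sw_coassoc) (assumption | rule mlin x)+
  also have "... = sw U ?Z (%a b. tns Q (tensor Q Q) (f a) (sw U (tensor Q Q) (%b1 b2. tns Q Q (f b1) (f b2)) b)) x"
   by (rule swc, rule sw_push[symmetric]) (assumption | rule mlin x)+
  also have "... = sw U ?Z (%a b. tns Q (tensor Q Q) (f a) (\<Delta> (f b))) x"
   by (simp add: \<Delta>)
  also have "... = tensor_lift ?Z (%a b. tns Q (tensor Q Q) a (\<Delta> b)) (\<Delta> (f x))"
   by (rule lift[symmetric]) (assumption | rule mlin x)+
  finally show "tensor_lift ?Z (%a b. tensor_lift ?Z (%a1 a2. tns Q (tensor Q Q) a1 (tns Q Q a2 b)) (\<Delta> a)) (\<Delta> y)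
   = tensor_lift ?Z (%a b. tns Q (tensor Q Q) a (\<Delta> b)) (\<Delta> y)" by (simp add: y)
  have "tensor_lift Q (%a b. \<epsilon> a *:[Q] b) (\<Delta> (f x)) = sw U Q (%a b. \<epsilon> (f a) *:[Q] f b) x"
   by (rule lift) (assumption | rule mlin x)+
  also have "... = f x" using x by (simp add: \<epsilon> sw_counit_l[OF f _ Q])
  finally show "tensor_lift Q (%a b. \<epsilon> a *:[Q] b) (\<Delta> y) = y" by (simp add: y)
  have "tensor_lift Q (%a b. \<epsilon> b *:[Q] a) (\<Delta> (f x)) = sw U Q (%a b. \<epsilon> (f b) *:[Q] f a) x"
   by (rule lift) (assumption | rule mlin x)+
  also have "... = f x" using x by (simp add: \<epsilon> sw_counit_r[OF f _ Q])
  finally show "tensor_lift Q (%a b. \<epsilon> b *:[Q] a) (\<Delta> y) = y" by (simp add: y)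
 qed
qed

text \<open>The operations of \<open>B\<close> are prescribed on images, which transports the
  bialgebra axioms. The antipode has to be shown to descend, and for this it suffices that it
  preserves the kernel of \<open>f\<close>.\<close>

lemma hopf_surj:
 fixes B :: "('k, 'b, 'n) bialg_scheme"
 assumes B: "vspace B" and f: "lin_map U B f" and surj: "f ` carrier U = carrier B"
  and m: "!!x y. x :[U] ==> y :[U] ==> f (x \<otimes> y) = f x *[B] f y" and one: "f \<one> = \<one>[B]"
  and \<Delta>: "!!x. x :[U] ==> comult B (f x) = sw U (tensor B B) (%a b. tns B B (f a) (f b)) x"
  and \<epsilon>: "!!x. x :[U] ==> counit B (f x) = counit U x"
  and S0: "!!x. x :[U] ==> f x = \<zero>[B] ==> f (S x) = \<zero>[B]"
 shows "hopf_algebra B" and "hopf_hom U B f"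
proof -
 note fc[simp] = lin_map_closed[OF f]
 have kB: "kalgebra B" by (rule kalgebra_surj[OF kU B f surj m one])
 note [mlin] = kB B fc lin_map_comp[OF f]
 have cB: "coalgebra B (comult B) (counit B)" by (rule coalgebra_surj[OF B f surj \<Delta> \<epsilon>])
 then have lD: "lin_map B (tensor B B) (comult B)" and le: "lin_map B base_alg (counit B)"
  unfolding coalgebra_def by auto
 have lift: "tensor_lift Z G (comult B (f x)) = sw U Z (%a b. G (f a) (f b)) x"
  if "vspace Z" "bilin B B Z G" "x :[U]" for Z :: "('k, 'z, 'l) module_scheme" and G x
  unfolding \<Delta>[OF that(3)] by (rule sw_lift_tns[OF B B that(1,2,3) f f])
 have R: "\<exists>a\<in>carrier U. x = f a" if "x :[B]" for x using surj that by auto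
 let ?T = "tensor B B" and ?A = "tensor_alg B B"
 have aD: "alg_hom B ?A (comult B)"
 proof (rule alg_homI)
  show "lin_map B ?A (comult B)" using lD by simp
  show "comult B \<one>[B] = \<one>[?A]" unfolding one[symmetric] \<Delta>[OF one_closed]
   by (subst sw_one) ((assumption | rule mlin)+ | simp add: one)+
  fix x' y' assume "x' :[B]" "y' :[B]"
  then obtain x y where x: "x :[U]" "x' = f x" and y: "y :[U]" "y' = f y" using R by blast
  have "comult B (f x) *[?A] comult B (f y) =
   tensor_lift ?T (%a b. tensor_lift ?T (%c d. tns B B (a *[B] c) (b *[B] d)) (comult B (f y))) (comult B (f x))"
   by (simp add: tensor_alg_def Let_def)
  also have "... = sw U ?T (%a b. tensor_lift ?T (%c d. tns B B (f a *[B] c) (f b *[B] d)) (comult B (f y))) x"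
   by (rule lift) (assumption | rule mlin x y lin_map_closed[OF lD])+
  also have "... = sw U ?T (%a b. sw U ?T (%c d. tns B B (f a *[B] f c) (f b *[B] f d)) y) x"
   by (rule swc, rule lift) (assumption | rule mlin x y lin_map_closed[OF lD])+
  also have "... = sw U ?T (%a b. sw U ?T (%c d. tns B B (f (a \<otimes> c)) (f (b \<otimes> d))) y) x"
   by (simp add: m)
  also have "... = sw U ?T (%a b. tns B B (f a) (f b)) (x \<otimes> y)"
   by (rule sw_mult[symmetric]) (assumption | rule mlin x y)+
  finally show "comult B (x' *[B] y') = comult B x' *[?A] comult B y'"
   using x y by (simp flip: m add: \<Delta>)
 qed
 have ae: "alg_hom B base_alg (counit B)"
 proof (rule alg_homI[OF le])
  show "counit B \<one>[B] = \<one>[base_alg]" by (simp add: one[symmetric] \<epsilon>)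
  fix x y assume "x :[B]" "y :[B]"
  then show "counit B (x *[B] y) = counit B x *[base_alg] counit B y"
   by (auto dest!: R simp flip: m simp: \<epsilon>)
 qed
 \<comment> \<open>Any preimage will do: two preimages differ by an element of the kernel of
   \<open>f\<close>, which \<open>S\<close> maps into the kernel.\<close>
 define T where "T y = f (S (inv_into (carrier U) f y))" for y
 have T: "T (f x) = f (S x)" if x: "x :[U]" for x
 proof -
  let ?x = "inv_into (carrier U) f (f x)"
  have x': "?x :[U]" "f ?x = f x" using x by (auto intro: inv_into_into f_inv_into_f)
  then have "f (?x \<ominus> x) = \<zero>[B]" using x B by (simp add: lin_map_minus[OF f vU B] vs_minus_self)
  then have "f (S (?x \<ominus> x)) = \<zero>[B]" using x x' by (simp add: S0)
  then have "f (S ?x) \<ominus>\<^bsub>B\<^esub> f (S x) = \<zero>[B]"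
   using x x' by (simp add: lin_map_minus[OF lin_S0 vU vU] lin_map_minus[OF f vU B])
  then show ?thesis using x x' B by (simp add: vs_minus_0_iff T_def)
 qed
 have lT: "lin_map B B T"
  by (rule lin_map_surj[OF f surj vU], rule lin_map_cong[OF T vU]) (assumption | rule mlin)+
 note [mlin] = lin_map_comp[OF lT] lin_map_closed[OF lT]
 have "is_antipode B T"
  unfolding is_antipode_def
 proof (intro conjI ballI lT)
  fix y assume "y :[B]"
  then obtain x where x: "x :[U]" and y: "y = f x" using R by blast
  have "tensor_lift B (%a b. T a *[B] b) (comult B (f x)) = sw U B (%a b. T (f a) *[B] f b) x"
   by (rule lift) (assumption | rule mlin x)+
  also have "... = counit U x *:[B] f \<one>" using x by (simp add: T m[symmetric] sw_antipode_l[OF f _ B])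
  finally show "tensor_lift B (%a b. T a *[B] b) (comult B y) = counit B y *:[B] \<one>[B]"
   using x by (simp add: y one \<epsilon>)
  have "tensor_lift B (%a b. a *[B] T b) (comult B (f x)) = sw U B (%a b. f a *[B] T (f b)) x"
   by (rule lift) (assumption | rule mlin x)+
  also have "... = counit U x *:[B] f \<one>" using x by (simp add: T m[symmetric] sw_antipode_r[OF f _ B])
  finally show "tensor_lift B (%a b. a *[B] T b) (comult B y) = counit B y *:[B] \<one>[B]"
   using x by (simp add: y one \<epsilon>)
 qed
 with kB cB aD ae show hB: "hopf_algebra B" unfolding hopf_algebra_def bialgebra_def by blast
 have "alg_hom U B f" by (rule alg_homI[OF f m one])
 then show "hopf_hom U B f" unfolding hopf_hom_def using hopf hB by (simp add: \<Delta> \<epsilon> tensor_lift_sw)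
qed

lemma sw_hopf_hom:
 assumes "hopf_hom U H f" "x :[U]" "vspace Z" "bilin H H Z F"
 shows "sw H Z F (f x) = sw U Z (%a b. F (f a) (f b)) x"
proof -
 interpret H: hopf H using assms(1) by unfold_locales (simp add: hopf_hom_def)
 have f: "lin_map U H f" using assms(1) by (simp add: hopf_hom_def alg_hom_def)
 have "sw H Z F (f x) = tensor_lift Z F (comult H (f x))"
  using lin_map_closed[OF f] assms by (simp add: H.tensor_lift_sw)
 also have "comult H (f x) = sw U (tensor H H) (%a b. tns H H (f a) (f b)) x"
  using assms(1,2) by (simp add: hopf_hom_def tensor_lift_sw)
 finally show ?thesis by (simp add: sw_lift_tns[OF H.vU H.vU assms(3,4,2) f f])
qed

text \<open>Both maps are convolution inverses of \<open>f\<close>: one because \<open>f\<close> is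
  multiplicative, the other because \<open>f\<close> respects coproducts.\<close>

lemma hopf_hom_S:
 assumes fh: "hopf_hom U H f" and x: "x :[U]"
 shows "antipode H (f x) = f (S x)"
proof -
 interpret H: hopf H using fh by unfold_locales (simp add: hopf_hom_def)
 have a: "alg_hom U H f" and e: "!!x. x :[U] ==> counit H (f x) = counit U x"
  using fh by (auto simp: hopf_hom_def)
 note f = alg_homD(1)[OF a]
 have "f (S x) = antipode H (f x)"
 proof (rule conv_unique[OF H.kU _ f _ _ _ x])
  show "lin_map U H (%x. f (S x))" "lin_map U H (%x. antipode H (f x))"
   by (rule mlin lin_map_comp[OF f] f)+
  fix x assume x: "x :[U]"
  have "sw U H (%a b. f (S a) *[H] f b) x = sw U H (%a b. f (S a \<otimes> b)) x"
   by (simp add: alg_homD(2)[OF a])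
  then show "sw U H (%a b. f (S a) *[H] f b) x = counit U x *:[H] \<one>[H]"
   using x by (simp add: sw_antipode_l[OF f] alg_homD(3)[OF a])
  have "sw U H (%a b. f a *[H] antipode H (f b)) x = sw H H (%a b. a *[H] antipode H b) (f x)"
   by (rule sw_hopf_hom[OF fh, symmetric]) (assumption | rule mlin x)+
  then show "sw U H (%a b. f a *[H] antipode H (f b)) x = counit U x *:[H] \<one>[H]"
   using x lin_map_closed[OF f x] by (simp add: H.sw_S_r e)
 qed
 then show ?thesis by simp
qed

section \<open>The left adjoint action\<close>

lemma ad_sw: "x :[U] ==> ad U x y = sw U U (%a b. a \<otimes> y \<otimes> S b) x"
 by (simp add: ad_def tensor_lift_sw)

lemma ad_closed[simp, mlin]: "x :[U] ==> y :[U] ==> ad U x y :[U]"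
 unfolding ad_sw by (assumption | rule mlin)+

lemma lin_ad_l[mlin]:
 assumes "lin_map Y U f" "y :[U]" shows "lin_map Y U (%x. ad U (f x) y)"
proof -
 have "lin_map U U (%x. ad U x y)"
  by (rule lin_map_cong[OF ad_sw vU]) (assumption | rule mlin assms)+
 then show ?thesis by (rule lin_map_comp[OF _ assms(1)])
qed

lemma lin_ad_r[mlin]:
 assumes "lin_map Y U f" "x :[U]" shows "lin_map Y U (%y. ad U x (f y))"
proof -
 have "lin_map U U (%y. ad U x y)"
  unfolding ad_sw[OF assms(2)] by (assumption | rule mlin assms)+
 then show ?thesis by (rule lin_map_comp[OF _ assms(1)])
qed

lemma ad_mult_left:
 assumes "x :[U]" "y :[U]" "z :[U]"
 shows "ad U (x \<otimes> y) z = ad U x (ad U y z)"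
proof -
 have "ad U (x \<otimes> y) z = sw U U (%a b. sw U U (%c d. a \<otimes> c \<otimes> z \<otimes> S (b \<otimes> d)) y) x"
  unfolding ad_sw[OF m_closed[OF assms(1,2)]] by (rule sw_mult) (assumption | rule mlin assms)+
 also have "... = sw U U (%a b. sw U U (%c d. a \<otimes> (c \<otimes> z \<otimes> S d) \<otimes> S b) y) x"
  using assms by (simp add: S_mult m_assoc)
 also have "... = sw U U (%a b. a \<otimes> sw U U (%c d. c \<otimes> z \<otimes> S d) y \<otimes> S b) x"
  by (rule swc, rule sw_push[where g = "%t. _ \<otimes> t \<otimes> S _", symmetric]) (assumption | rule mlin assms)+
 finally show ?thesis using assms by (simp add: ad_sw)
qed

text \<open>Between \<open>y\<close> and \<open>z\<close> the sum over both adjoint actions contains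
  \<open>S c1\<close> times \<open>c2\<close> for consecutive legs of \<open>x\<close>, which
  collapses to the counit.\<close>

lemma ad_mult_right:
 assumes x: "x :[U]" and y: "y :[U]" and z: "z :[U]"
 shows "ad U x (y \<otimes> z) = sw U U (%a b. ad U a y \<otimes> ad U b z) x"
proof -
 have "sw U U (%a b. ad U a y \<otimes> ad U b z) x = sw U U (%a b. sw U U (%a1 a2. a1 \<otimes> y \<otimes> S a2) a \<otimes> sw U U (%b1 b2. b1 \<otimes> z \<otimes> S b2) b) x"
  by (simp add: ad_sw)
 also have "... = sw U U (%a b. sw U U (%a1 a2. (a1 \<otimes> y \<otimes> S a2) \<otimes> sw U U (%b1 b2. b1 \<otimes> z \<otimes> S b2) b) a) x"
  by (rule swc, rule sw_push[where g = "%t. t \<otimes> _"]) (assumption | rule mlin assms)+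
 also have "... = sw U U (%a b. sw U U (%a1 a2. sw U U (%b1 b2. (a1 \<otimes> y \<otimes> S a2) \<otimes> (b1 \<otimes> z \<otimes> S b2)) b) a) x"
  by (rule swc, rule swc, rule sw_push) (assumption | rule mlin assms)+
 also have "... = sw U U (%a b. sw U U (%c d. sw U U (%c1 c2. (a \<otimes> y \<otimes> S c1) \<otimes> (c2 \<otimes> z \<otimes> S d)) c) b) x"
  by (rule sw_wrap) (assumption | rule mlin assms)+
 also have "... = sw U U (%a b. sw U U (%c d. sw U U (%c1 c2. a \<otimes> y \<otimes> (S c1 \<otimes> c2) \<otimes> (z \<otimes> S d)) c) b) x"
  using y z by (simp add: m_assoc)
 also have "... = sw U U (%a b. sw U U (%c d. counit U c \<odot> (a \<otimes> y \<otimes> \<one> \<otimes> (z \<otimes> S d))) b) x"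
  by (rule swc, rule swc, rule sw_antipode_l[where G = "%t. _ \<otimes> y \<otimes> t \<otimes> (z \<otimes> S _)"]) (assumption | rule mlin assms)+
 also have "... = sw U U (%a b. a \<otimes> y \<otimes> \<one> \<otimes> (z \<otimes> S b)) x"
  by (rule swc, rule sw_counit_l) (assumption | rule mlin assms)+
 also have "... = ad U x (y \<otimes> z)" using x y z by (simp add: ad_sw m_assoc)
 finally show ?thesis by simp
qed

end

section \<open>The projection theorem of Radford and Majid\<close>

locale hopf_proj = U: hopf U + H: hopf H
 for U :: "('k::field, 'a, 'm) bialg_scheme" (structure) and H :: "('k, 'h, 'n) bialg_scheme" +
 fixes \<Phi> :: "'a => 'h" and \<Psi> :: "'h => 'a"
 assumes \<Phi>: "hopf_hom U H \<Phi>" and \<Psi>: "hopf_hom H U \<Psi>" and \<Phi>\<Psi>[simp]: "u :[H] ==> \<Phi> (\<Psi> u) = u"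
begin

lemma \<Phi>_alg: "alg_hom U H \<Phi>" and \<Psi>_alg: "alg_hom H U \<Psi>"
 using \<Phi> \<Psi> by (simp_all add: hopf_hom_def)

lemma \<Phi>_closed[simp, mlin]: "x :[U] ==> \<Phi> x :[H]"
 and \<Psi>_closed[simp, mlin]: "u :[H] ==> \<Psi> u :[U]"
 by (rule lin_map_closed[OF alg_homD(1)[OF \<Phi>_alg]] lin_map_closed[OF alg_homD(1)[OF \<Psi>_alg]]; assumption)+

lemma lin_\<Phi>[mlin]: "lin_map Y U f ==> lin_map Y H (%x. \<Phi> (f x))"
 and lin_\<Psi>[mlin]: "lin_map Y H g ==> lin_map Y U (%x. \<Psi> (g x))"
 by (rule lin_map_comp[OF alg_homD(1)[OF \<Phi>_alg]] lin_map_comp[OF alg_homD(1)[OF \<Psi>_alg]]; assumption)+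

lemma \<Phi>_simps[simp]: "x :[U] ==> y :[U] ==> \<Phi> (x \<otimes> y) = \<Phi> x *[H] \<Phi> y" "\<Phi> \<one> = \<one>[H]"
 "x :[U] ==> counit H (\<Phi> x) = counit U x" "x :[U] ==> \<Phi> (c \<odot> x) = c *:[H] \<Phi> x"
 "x :[U] ==> \<Phi> (U.S x) = H.S (\<Phi> x)"
 using alg_homD[OF \<Phi>_alg] lin_map_smult[OF alg_homD(1)[OF \<Phi>_alg]] \<Phi> U.hopf_hom_S[OF \<Phi>] by (auto simp: hopf_hom_def)

lemma \<Psi>_simps[simp]: "x :[H] ==> y :[H] ==> \<Psi> (x *[H] y) = \<Psi> x \<otimes> \<Psi> y" "\<Psi> \<one>[H] = \<one>"
 "x :[H] ==> counit U (\<Psi> x) = counit H x" "x :[H] ==> \<Psi> (c *:[H] x) = c \<odot> \<Psi> x"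
 "x :[H] ==> \<Psi> (H.S x) = U.S (\<Psi> x)"
 using alg_homD[OF \<Psi>_alg] lin_map_smult[OF alg_homD(1)[OF \<Psi>_alg]] \<Psi> H.hopf_hom_S[OF \<Psi>] by (auto simp: hopf_hom_def)

lemmas sw_\<Phi> = U.sw_hopf_hom[OF \<Phi>] and sw_\<Psi> = H.sw_hopf_hom[OF \<Psi>]

text \<open>\<open>p\<close> is an idempotent Hopf endomorphism of \<open>U\<close> with the image
  of \<open>\<Psi>\<close>, and \<open>s\<close> is its convolution inverse.\<close>

definition p where "p x = \<Psi> (\<Phi> x)"
definition s where "s x = U.S (p x)"

lemma p_closed[simp, mlin]: "x :[U] ==> p x :[U]"
 and s_closed[simp, mlin]: "x :[U] ==> s x :[U]"
 by (simp_all add: p_def s_def)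

lemma lin_p[mlin]: "lin_map Y U f ==> lin_map Y U (%x. p (f x))"
 and lin_s[mlin]: "lin_map Y U f ==> lin_map Y U (%x. s (f x))"
 unfolding s_def p_def by ((rule mlin)+, assumption)+

lemma p_simps[simp]: "x :[U] ==> y :[U] ==> p (x \<otimes> y) = p x \<otimes> p y" "p \<one> = \<one>"
 "x :[U] ==> counit U (p x) = counit U x" "x :[U] ==> p (c \<odot> x) = c \<odot> p x"
 "x :[U] ==> p (U.S x) = s x" "x :[U] ==> p (p x) = p x" "u :[H] ==> p (\<Psi> u) = \<Psi> u"
 "x :[U] ==> \<Phi> (p x) = \<Phi> x"
 by (simp_all add: p_def s_def)

lemma s_simps[simp]: "x :[U] ==> y :[U] ==> s (x \<otimes> y) = s y \<otimes> s x" "s \<one> = \<one>"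
 "x :[U] ==> counit U (s x) = counit U x" "x :[U] ==> s (c \<odot> x) = c \<odot> s x"
 "x :[U] ==> s (p x) = s x" "u :[H] ==> s (\<Psi> u) = \<Psi> (H.S u)" "x :[U] ==> p (s x) = s x"
 "x :[U] ==> \<Phi> (s x) = H.S (\<Phi> x)" "x :[U] ==> s (U.S x) = U.S (s x)" "x :[U] ==> s (s x) = U.S (s x)"
 by (simp_all add: U.S_mult s_def)

lemma sw_p: "x :[U] ==> vspace Z ==> bilin U U Z F ==> sw U Z F (p x) = sw U Z (%a b. F (p a) (p b)) x"
proof -
 assume *: "x :[U]" "vspace Z" "bilin U U Z F"
 note [mlin] = lin_map_comp[OF bilinD(1)[OF *(3)]] lin_map_comp[OF bilinD(2)[OF *(3)]]
 have "sw U Z F (p x) = sw H Z (%a b. F (\<Psi> a) (\<Psi> b)) (\<Phi> x)"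
  unfolding p_def by (rule sw_\<Psi>) (use * in auto)
 also have "... = sw U Z (%a b. F (\<Psi> (\<Phi> a)) (\<Psi> (\<Phi> b))) x"
  by (rule sw_\<Phi>) (assumption | rule mlin *)+
 finally show ?thesis by (simp add: p_def)
qed

lemma sw_s: "x :[U] ==> vspace Z ==> bilin U U Z F ==> sw U Z F (s x) = sw U Z (%a b. F (s b) (s a)) x"
proof -
 assume *: "x :[U]" "vspace Z" "bilin U U Z F"
 note [mlin] = lin_map_comp[OF bilinD(1)[OF *(3)]] lin_map_comp[OF bilinD(2)[OF *(3)]]
 have "sw U Z F (s x) = sw U Z (%a b. F (U.S b) (U.S a)) (p x)"
  unfolding s_def by (rule U.sw_S) (use * in auto)
 also have "... = sw U Z (%a b. F (U.S (p b)) (U.S (p a))) x"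
  by (rule sw_p) (assumption | rule mlin *)+
 finally show ?thesis by (simp add: s_def)
qed

lemma sw_s_p:
 assumes "lin_map U Z G" "x :[U]" "vspace Z"
 shows "sw U Z (%a b. G (s a \<otimes> p b)) x = counit U x *:[Z] G \<one>"
proof -
 note [mlin] = lin_map_comp[OF assms(1)]
 have "sw U Z (%a b. G (U.S a \<otimes> b)) (p x) = sw U Z (%a b. G (U.S (p a) \<otimes> p b)) x"
  by (rule sw_p) (assumption | rule mlin assms)+
 then show ?thesis using U.sw_antipode_l[OF assms(1) p_closed[OF assms(2)] assms(3)] assms(2) by (simp add: s_def)
qed

text \<open>The projection of \<open>U\<close> onto the coinvariants along \<open>U \<Psi>(H\<^sup>+)\<close>.\<close>

definition rh where "rh x = sw U U (%a b. a \<otimes> s b) x"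

lemma lin_rh[mlin]: "lin_map Y U f ==> lin_map Y U (%x. rh (f x))"
 unfolding rh_def by (assumption | rule mlin)+
lemma rh_closed[simp, mlin]: "x :[U] ==> rh x :[U]"
 unfolding rh_def by (assumption | rule mlin)+
lemma rh_smult[simp]: "x :[U] ==> rh (c \<odot> x) = c \<odot> rh x"
 by (rule lin_map_smult[of U]) (rule mlin | assumption)+

lemma counit_rh[simp]: "x :[U] ==> counit U (rh x) = counit U x"
proof -
 assume x: "x :[U]"
 have "counit U (rh x) = sw U base_alg (%a b. counit U (a \<otimes> s b)) x"
  unfolding rh_def by (rule U.sw_push) (assumption | rule mlin x)+
 also have "... = sw U base_alg (%a b. counit U a *:[base_alg] counit U b) x" by simp
 also have "... = counit U x" by (rule U.sw_counit_l) (assumption | rule mlin x)+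
 finally show ?thesis .
qed

lemma rh_mult:
 assumes "x :[U]" "y :[U]"
 shows "rh (x \<otimes> y) = sw U U (%a b. a \<otimes> rh y \<otimes> s b) x"
proof -
 have "rh (x \<otimes> y) = sw U U (%a b. sw U U (%c d. (a \<otimes> c) \<otimes> s (b \<otimes> d)) y) x"
  unfolding rh_def by (rule U.sw_mult) (assumption | rule mlin assms)+
 also have "... = sw U U (%a b. sw U U (%c d. a \<otimes> (c \<otimes> s d) \<otimes> s b) y) x"
  by (simp add: U.m_assoc)
 also have "... = sw U U (%a b. a \<otimes> rh y \<otimes> s b) x" unfolding rh_def
  by (rule swc, rule U.sw_push[where g = "%t. _ \<otimes> t \<otimes> s _", symmetric]) (assumption | rule mlin assms)+
 finally show ?thesis .
qed

lemma rh_\<Psi>[simp]: "h :[H] ==> rh (\<Psi> h) = counit H h \<odot> \<one>"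
proof -
 assume h: "h :[H]"
 have "rh (\<Psi> h) = sw H U (%a b. \<Psi> a \<otimes> s (\<Psi> b)) h"
  unfolding rh_def by (rule sw_\<Psi>) (assumption | rule mlin h)+
 also have "... = sw H U (%a b. \<Psi> (a *[H] H.S b)) h" by simp
 also have "... = counit H h \<odot> \<Psi> \<one>[H]"
  by (rule H.sw_antipode_r) (assumption | rule mlin h)+
 finally show ?thesis by simp
qed

lemma rh_one[simp]: "rh \<one> = \<one>" using rh_\<Psi>[of "\<one>[H]"] by simp

text \<open>By the antipode axiom \<open>rh (\<Psi> h)\<close> is a scalar, so
  \<open>rh_mult\<close> lets a right factor from \<open>H\<close> act through its counit.\<close>

lemma rh_mult_\<Psi>[simp]: "x :[U] ==> h :[H] ==> rh (x \<otimes> \<Psi> h) = counit H h \<odot> rh x"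
proof -
 assume *: "x :[U]" "h :[H]"
 have "rh (x \<otimes> \<Psi> h) = sw U U (%a b. counit H h \<odot> (a \<otimes> s b)) x"
  using * by (simp add: rh_mult)
 also have "... = counit H h \<odot> rh x"
  unfolding rh_def by (rule U.sw_push[symmetric]) (assumption | rule mlin *)+
 finally show ?thesis .
qed

lemma rh_mult_s[simp]: "x :[U] ==> y :[U] ==> rh (x \<otimes> s y) = counit U y \<odot> rh x"
 and rh_mult_p[simp]: "x :[U] ==> y :[U] ==> rh (x \<otimes> p y) = counit U y \<odot> rh x"
 using rh_mult_\<Psi>[of x "H.S (\<Phi> y)"] rh_mult_\<Psi>[of x "\<Phi> y"] by (simp_all add: s_def p_def)

text \<open>On the image of \<open>\<Psi>\<close> the map \<open>s\<close> is the antipode, so the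
  twisted product of \<open>rh_mult\<close> becomes the adjoint action. This is what converts
  monomials in \<open>U\<close> into iterated adjoint actions.\<close>

lemma rh_ad: "h :[H] ==> y :[U] ==> rh (\<Psi> h \<otimes> y) = ad U (\<Psi> h) (rh y)"
proof -
 assume *: "h :[H]" "y :[U]"
 have "rh (\<Psi> h \<otimes> y) = sw U U (%a b. a \<otimes> rh y \<otimes> s b) (\<Psi> h)" by (rule rh_mult) (use * in auto)
 also have "... = sw H U (%a b. \<Psi> a \<otimes> rh y \<otimes> s (\<Psi> b)) h" by (rule sw_\<Psi>) (assumption | rule mlin *)+
 also have "... = sw H U (%a b. \<Psi> a \<otimes> rh y \<otimes> U.S (\<Psi> b)) h" by simp
 also have "... = sw U U (%a b. a \<otimes> rh y \<otimes> U.S b) (\<Psi> h)" by (rule sw_\<Psi>[symmetric]) (assumption | rule mlin *)+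
 finally show ?thesis using * by (simp add: U.ad_sw)
qed

text \<open>Since \<open>s\<close> reverses the coproduct, the last leg of \<open>y\<close> returns
  to the first factor: the coproduct of \<open>rh y\<close> is \<open>y1 s(y3)\<close> tensor
  \<open>rh y2\<close>.\<close>

lemma sw_rh:
 assumes "y :[U]" "vspace Z" "bilin U U Z F"
 shows "sw U Z F (rh y) = sw U Z (%a b. sw U Z (%c d. F (a \<otimes> s d) (rh c)) b) y"
proof -
 note [mlin] = lin_map_comp[OF bilinD(1)[OF assms(3)]] lin_map_comp[OF bilinD(2)[OF assms(3)]]
 have "sw U Z F (rh y) = sw U Z (%a b. sw U Z F (a \<otimes> s b)) y"
  unfolding rh_def by (rule U.sw_push) (assumption | rule mlin assms)+
 also have "... = sw U Z (%a b. sw U Z (%a1 a2. sw U Z (%c d. F (a1 \<otimes> c) (a2 \<otimes> d)) (s b)) a) y"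
  by (rule swc, rule U.sw_mult) (assumption | rule mlin assms)+
 also have "... = sw U Z (%a b. sw U Z (%a1 a2. sw U Z (%b1 b2. F (a1 \<otimes> s b2) (a2 \<otimes> s b1)) b) a) y"
  by (rule swc, rule swc, rule sw_s) (assumption | rule mlin assms)+
 also have "... = sw U Z (%a b. sw U Z (%c d. sw U Z (%c1 c2. F (a \<otimes> s d) (c1 \<otimes> s c2)) c) b) y"
  by (rule U.sw_wrap) (assumption | rule mlin assms)+
 also have "... = sw U Z (%a b. sw U Z (%c d. F (a \<otimes> s d) (rh c)) b) y"
  unfolding rh_def by (rule swc, rule swc, rule U.sw_push[symmetric]) (assumption | rule mlin assms)+
 finally show ?thesis .
qed

lemma \<Phi>_rh[simp]: "y :[U] ==> \<Phi> (rh y) = counit U y *:[H] \<one>[H]"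
proof -
 assume y: "y :[U]"
 have "\<Phi> (rh y) = sw U H (%a b. \<Phi> (a \<otimes> s b)) y"
  unfolding rh_def by (rule U.sw_push) (assumption | rule mlin y)+
 also have "... = sw U H (%a b. \<Phi> a *[H] H.S (\<Phi> b)) y" by simp
 also have "... = sw H H (%a b. a *[H] H.S b) (\<Phi> y)"
  by (rule sw_\<Phi>[symmetric]) (assumption | rule mlin y)+
 finally show ?thesis using y by (simp add: H.sw_S_r)
qed

abbreviation K where "K \<equiv> coinv_hopf U H \<Phi> \<Psi>"

lemma K_simps: "add K = add U" "\<zero>[K] = \<zero>" "module.smult K = module.smult U" "monoid.mult K = monoid.mult U"
 "\<one>[K] = \<one>" "act K h x = ad U (\<Psi> h) x" "bcounit K = counit U"
 by (simp_all add: coinv_hopf_def Let_def yd.defs bhopf.defs module.defs)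

lemma K_carrier: "carrier K = {x : carrier U. sw U (tensor U H) (%a b. tns U H a (\<Phi> b)) x = tns U H x \<one>[H]}"
proof -
 have "carrier K = coinv U H \<Phi>"
  by (simp add: coinv_hopf_def Let_def yd.defs bhopf.defs module.defs)
 then show ?thesis unfolding coinv_def by (auto simp: U.tensor_lift_sw)
qed

lemma K_sub: "x :[K] ==> x :[U]" by (simp add: K_carrier)

text \<open>The defining equation of the coinvariants is an identity in \<open>U\<close> tensor
  \<open>H\<close>; any bilinear map may be applied to it.\<close>

lemma sw_K:
 assumes "x :[K]" "vspace Z" "bilin U H Z F"
 shows "sw U Z (%a b. F a (\<Phi> b)) x = F x \<one>[H]"
proof -
 note x = K_sub[OF assms(1)]
 have "sw U Z (%a b. F a (\<Phi> b)) x = tensor_lift Z F (sw U (tensor U H) (%a b. tns U H a (\<Phi> b)) x)"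
  by (rule U.sw_lift_tns[symmetric]) (assumption | rule mlin assms x)+
 also have "... = tensor_lift Z F (tns U H x \<one>[H])" using assms(1) by (simp add: K_carrier)
 also have "... = F x \<one>[H]" using x assms by (simp add: tensor_lift_tns)
 finally show ?thesis .
qed

lemma rh_K: assumes "x :[K]" shows "rh x = x"
proof -
 have "sw U U (%a b. a \<otimes> U.S (\<Psi> (\<Phi> b))) x = x \<otimes> U.S (\<Psi> \<one>[H])"
  by (rule sw_K[where F = "%a h. a \<otimes> U.S (\<Psi> h)"]) (assumption | rule mlin assms)+
 then show ?thesis using K_sub[OF assms] by (simp add: rh_def s_def p_def)
qed

lemma rh_in_K[simp, mlin]: assumes y: "y :[U]" shows "rh y :[K]"
proof -
 let ?T = "tensor U H"
 have "sw U ?T (%a b. tns U H a (\<Phi> b)) (rh y) = sw U ?T (%a b. sw U ?T (%c d. tns U H (a \<otimes> s d) (\<Phi> (rh c))) b) y"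
  by (rule sw_rh) (assumption | rule mlin y)+
 also have "... = sw U ?T (%a b. sw U ?T (%c d. counit U c *:[?T] tns U H (a \<otimes> s d) \<one>[H]) b) y"
  by (simp add: tns_smult)
 also have "... = sw U ?T (%a b. tns U H (a \<otimes> s b) \<one>[H]) y"
  by (rule swc, rule U.sw_counit_l) (assumption | rule mlin)+
 also have "... = tns U H (rh y) \<one>[H]"
  unfolding rh_def by (rule U.sw_push[where g = "%t. tns U H t \<one>[H]", symmetric]) (assumption | rule mlin y)+
 finally show ?thesis using y by (simp add: K_carrier)
qed

text \<open>\<open>rh\<close> takes values in the coinvariants and fixes them, so membership in
  \<open>K\<close> becomes a fixed-point equation.\<close>

lemma K_eq: "x :[K] \<longleftrightarrow> x :[U] & rh x = x"
 by (metis rh_in_K rh_K K_sub)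

lemma rh_rh[simp]: "x :[U] ==> rh (rh x) = rh x" by (simp add: rh_K)

lemma rh_surj: "rh ` carrier U = carrier K"
 using rh_in_K by (force simp: K_eq image_iff)

lemma lin_K[mlin]: "lin_map K U (%x. x)" by (rule lin_map_I) (simp_all add: K_simps K_sub)

lemma lin_into_K: "lin_map Y U f ==> (!!y. y :[Y] ==> f y :[K]) ==> lin_map Y K f"
 by (auto simp: lin_map_def K_simps)

lemma lin_rh_K[mlin]:
 assumes "lin_map Y U f" shows "lin_map Y K (%x. rh (f x))"
 by (rule lin_into_K[OF lin_rh[OF assms]]) (simp add: lin_map_closed[OF assms])

lemma lin_map_zero_mem: "\<zero> :[K]"
 using lin_map_zero[of U U rh] lin_rh[of U "%x. x"] by (simp add: K_eq)

lemma K_mult_closed[mlin]: "x :[K] ==> y :[K] ==> x \<otimes> y :[K]"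
proof -
 assume *: "x :[K]" "y :[K]"
 have "sw U U (%a b. a \<otimes> y \<otimes> U.S (\<Psi> (\<Phi> b))) x = x \<otimes> y \<otimes> U.S (\<Psi> \<one>[H])"
  by (rule sw_K[where F = "%a h. a \<otimes> y \<otimes> U.S (\<Psi> h)"]) (assumption | rule mlin * K_sub)+
 then show ?thesis using * K_sub[OF *(1)] K_sub[OF *(2)] by (simp add: K_eq rh_mult s_def p_def)
qed

lemma vspace_K[simp, mlin]: "vspace K"
proof (rule vspaceI)
 note l = lin_rh[of U "%x. x", simplified]
 fix x y c d assume "x :[K]" "y :[K]"
 then show "x +[K] y :[K]" "c *:[K] x :[K]"
  by (auto simp: K_eq K_simps lin_map_add[OF l])
qed (auto simp: K_simps K_eq lin_map_zero_mem[unfolded K_eq] vs_ac vs_smult_l_distr vs_smult_r_distr vs_smult_smult)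

lemma kalgebra_K[simp, mlin]: "kalgebra K"
proof (rule kalgebraI)
 show "bilin K K K (%x y. x *[K] y)" unfolding K_simps
  by (intro bilinI lin_into_K K_mult_closed; (assumption | rule mlin K_sub)+)
 show "\<one>[K] :[K]" unfolding K_simps by (simp add: K_eq)
qed (simp_all add: K_simps K_sub U.m_assoc)

lemma one_K[simp, mlin]: "\<one> :[K]" by (simp add: K_eq)

lemma lin_K_mult_l[mlin]: "lin_map Y K f ==> y :[K] ==> lin_map Y K (%x. f x \<otimes> y)"
 and lin_K_mult_r[mlin]: "lin_map Y K f ==> y :[K] ==> lin_map Y K (%x. y \<otimes> f x)"
 using lin_kmult_l[of Y K f y] lin_kmult_r[of Y K f y] by (simp_all add: K_simps)

text \<open>The coinvariants form a left coideal. The coinvariance of \<open>x\<close> applies to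
  the last of three legs, where \<open>s\<close> then contributes the unit; so a second leg may be
  projected or unprojected freely.\<close>

lemma sw_K_rh:
 assumes x: "x :[K]" and Z: "vspace Z" and F: "bilin U U Z F"
 shows "sw U Z (%a b. F a (rh b)) x = sw U Z F x"
proof -
 note xU = K_sub[OF x]
 note [mlin] = lin_map_comp[OF bilinD(1)[OF F]] lin_map_comp[OF bilinD(2)[OF F]] Z F
 have "sw U Z (%a b. F a (rh b)) x = sw U Z (%a b. sw U Z (%c d. F a (c \<otimes> s d)) b) x"
  unfolding rh_def by (rule swc, rule U.sw_push) (assumption | rule mlin xU)+
 also have "... = sw U Z (%e d. sw U Z (%a c. F a (c \<otimes> U.S (\<Psi> (\<Phi> d)))) e) x"
  unfolding s_def p_def by (rule U.sw_coassoc[symmetric]) (assumption | rule mlin xU)+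
 also have "... = sw U Z (%a c. F a (c \<otimes> U.S (\<Psi> \<one>[H]))) x"
  by (rule sw_K[where F = "%e d. sw U Z (%a c. F a (c \<otimes> U.S (\<Psi> d))) e", OF x]) (assumption | rule mlin xU)+
 finally show ?thesis by simp
qed

lemma sw_K3:
 assumes x: "x :[K]" and Z[mlin]: "vspace Z"
  and [mlin]: "!!b c. b :[U] ==> c :[H] ==> lin_map U Z (%a. F a b c)"
  "!!a c. a :[U] ==> c :[H] ==> lin_map U Z (%b. F a b c)"
  and F3: "!!a b. a :[U] ==> b :[U] ==> lin_map H Z (%c. F a b c)"
 shows "sw U Z (%a b. sw U Z (%c d. F a c (\<Phi> d)) b) x = sw U Z (%a c. F a c \<one>[H]) x"
proof -
 note xU = K_sub[OF x]
 note [mlin] = F3 lin_map_comp[OF F3]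
 have "sw U Z (%a b. sw U Z (%c d. F a c (\<Phi> d)) b) x = sw U Z (%e d. sw U Z (%a c. F a c (\<Phi> d)) e) x"
  by (rule U.sw_coassoc[symmetric]) (assumption | rule mlin xU)+
 also have "... = sw U Z (%a c. F a c \<one>[H]) x"
  by (rule sw_K[where F = "%e d. sw U Z (%a c. F a c d) e", OF x]) (assumption | rule mlin xU)+
 finally show ?thesis .
qed

lemma act_K: "h :[H] ==> v :[K] ==> act K h v = rh (\<Psi> h \<otimes> v)"
 by (simp add: K_simps rh_ad K_sub rh_K)

lemma rh_mult_rh[simp]: "x :[U] ==> y :[U] ==> rh (x \<otimes> rh y) = rh (x \<otimes> y)"
 by (simp add: rh_mult)

text \<open>Closed forms for the coaction and the comultiplication that \<open>coinv_hopf\<close>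
  specifies by \<open>THE\<close>. Projecting the legs by \<open>rh\<close> places the values over
  \<open>K\<close> at once and defines both maps on all of \<open>U\<close>.\<close>

definition Coact where "Coact x = sw U (tensor H K) (%a b. tns H K (\<Phi> a) (rh b)) x"
definition Comult where "Comult x = sw U (tensor K K) (%a b. tns K K (rh a) (rh b)) x"

lemma Coact_closed[simp, mlin]: "x :[U] ==> Coact x : carrier (tensor H K)"
 and lin_Coact[mlin]: "lin_map Y U f ==> lin_map Y (tensor H K) (%x. Coact (f x))"
 and Comult_closed[simp, mlin]: "x :[U] ==> Comult x : carrier (tensor K K)"
 and lin_Comult[mlin]: "lin_map Y U f ==> lin_map Y (tensor K K) (%x. Comult (f x))"
 unfolding Coact_def Comult_def by - (assumption | rule mlin)+

lemma lift_Coact: "vspace Z ==> bilin H K Z G ==> x :[U] ==> tensor_lift Z G (Coact x) = sw U Z (%a b. G (\<Phi> a) (rh b)) x"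
 and lift_Comult: "vspace Z ==> bilin K K Z G' ==> x :[U] ==> tensor_lift Z G' (Comult x) = sw U Z (%a b. G' (rh a) (rh b)) x"
 unfolding Coact_def Comult_def by (rule U.sw_lift_tns; (assumption | rule mlin)+)+

text \<open>A tensor product of linear maps with linear retractions has a linear retraction;
  \<open>rh\<close> retracts the inclusion of \<open>K\<close>. This gives the uniqueness behind
  both \<open>THE\<close> descriptions.\<close>

lemma tensor_incl_inj:
 assumes V: "vspace V" and j: "lin_map U V j" and t: "t : carrier (tensor V K)" "t' : carrier (tensor V K)"
  and W: "vspace W" and i: "lin_map V W i" and r: "lin_map W V r" "!!v. v :[V] ==> r (i v) = v"
  and eq: "tensor_lift (tensor W U) (%a b. tns W U (i a) b) t = tensor_lift (tensor W U) (%a b. tns W U (i a) b) t'"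
 shows "t = t'"
proof -
 note [mlin] = V W lin_map_comp[OF i] lin_map_comp[OF r(1)] lin_map_closed[OF r(1)] lin_map_closed[OF i]
 let ?T = "tensor V K" and ?f = "tensor_lift (tensor W U) (%a b. tns W U (i a) b)"
 let ?g = "tensor_lift ?T (%a b. tns V K (r a) (rh b))"
 have bf: "bilin V K (tensor W U) (%a b. tns W U (i a) b)" and bg: "bilin W U ?T (%a b. tns V K (r a) (rh b))"
  by - (assumption | rule mlin K_sub)+
 have "?g (?f t) = t" if "t :[?T]" for t
 proof (rule tensor_ext[OF V vspace_K vspace_tensor _ lin_map_id _ that])
  show "lin_map ?T ?T (%t. ?g (?f t))"
   by (assumption | rule mlin bf bg)+
  fix v w assume "v :[V]" "w :[K]"
  then show "?g (?f (tns V K v w)) = tns V K v w"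
   by (simp add: tensor_lift_tns[OF V vspace_K vspace_tensor bf] tensor_lift_tns[OF W U.vU vspace_tensor bg]
     lin_map_closed[OF i] K_sub r(2) rh_K)
 qed
 then show ?thesis using eq t by metis
qed

lemma coact_K: assumes x: "x :[K]" shows "coact K x = Coact x"
proof -
 let ?HU = "tensor H U" and ?K = "module.truncate (U\<lparr>carrier := coinv U H \<Phi>\<rparr>)"
 have c: "carrier K = carrier ?K" "add ?K = add K" "module.smult ?K = module.smult K"
  by (simp_all add: coinv_hopf_def Let_def yd.defs bhopf.defs module.defs)
 have T: "tensor H ?K = tensor H K" by (rule tensor_cong(1)) (simp_all add: c)
 have K: "coact K x = (THE t. t : carrier (tensor H K) &
      tensor_lift ?HU (tns H U) t = sw U ?HU (%a b. tns H U (\<Phi> a) b) x)"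
  using K_sub[OF x] unfolding T[symmetric] by (simp add: coinv_hopf_def Let_def yd.defs bhopf.defs module.defs U.tensor_lift_sw)
 have b: "bilin H K ?HU (tns H U)" by (assumption | rule mlin K_sub)+
 show ?thesis unfolding K
 proof (rule the_equality)
  have "tensor_lift ?HU (tns H U) (Coact x) = sw U ?HU (%a b. tns H U (\<Phi> a) (rh b)) x"
   by (rule lift_Coact[OF vspace_tensor b K_sub[OF x]])
  also have "... = sw U ?HU (%a b. tns H U (\<Phi> a) b) x"
   by (rule sw_K_rh[OF x]) (assumption | rule mlin)+
  finally show *: "Coact x : carrier (tensor H K) & tensor_lift ?HU (tns H U) (Coact x) = sw U ?HU (%a b. tns H U (\<Phi> a) b) x"
   using K_sub[OF x] by simp
  fix t assume t: "t : carrier (tensor H K) & tensor_lift ?HU (tns H U) t = sw U ?HU (%a b. tns H U (\<Phi> a) b) x"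
  show "t = Coact x"
   by (rule tensor_incl_inj[of H \<Phi> _ _ H "%x. x" "%x. x"]) (use * t in \<open>auto intro: mlin\<close>)
 qed
qed

lemma bcomult_K: assumes x: "x :[K]" shows "bcomult K x = Comult x"
proof -
 let ?UU = "tensor U U" and ?K = "module.truncate (U\<lparr>carrier := coinv U H \<Phi>\<rparr>)"
 have c: "carrier K = carrier ?K" "add ?K = add K" "module.smult ?K = module.smult K"
  by (simp_all add: coinv_hopf_def Let_def yd.defs bhopf.defs module.defs)
 have T: "tensor ?K ?K = tensor K K" by (rule tensor_cong(1)) (simp_all add: c)
 note xU = K_sub[OF x]
 have b: "bilin K K ?UU (tns U U)" by (assumption | rule mlin K_sub)+
 \<comment> \<open>The first two of the three legs combine to \<open>rh\<close>, which turns the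
   comultiplication of Radford and Majid into an expression with one projected leg.\<close>
 have "tensor_lift ?UU (%a1 a'. tensor_lift ?UU (%a2 a3. tns U U (a1 \<otimes> \<Psi> (H.S (\<Phi> a2))) a3) (comult U a')) (comult U x)
  = sw U ?UU (%a b. sw U ?UU (%c d. tns U U (a \<otimes> s c) d) b) x"
  using xU by (simp add: U.tensor_lift_sw s_def p_def)
 also have "... = sw U ?UU (%e d. sw U ?UU (%a c. tns U U (a \<otimes> s c) d) e) x"
  by (rule U.sw_coassoc[symmetric]) (assumption | rule mlin xU)+
 also have "... = sw U ?UU (%e d. tns U U (rh e) d) x"
  unfolding rh_def by (rule swc, rule U.sw_push[where g = "%t. tns U U t _", symmetric]) (assumption | rule mlin xU)+
 finally have K: "bcomult K x = (THE t. t : carrier (tensor K K) &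
      tensor_lift ?UU (tns U U) t = sw U ?UU (%e d. tns U U (rh e) d) x)"
  unfolding T[symmetric] by (simp add: coinv_hopf_def Let_def yd.defs bhopf.defs module.defs)
 show ?thesis unfolding K
 proof (rule the_equality)
  have "tensor_lift ?UU (tns U U) (Comult x) = sw U ?UU (%a b. tns U U (rh a) (rh b)) x"
   by (rule lift_Comult[OF vspace_tensor b K_sub[OF x]])
  also have "... = sw U ?UU (%a b. tns U U (rh a) b) x"
   by (rule sw_K_rh[OF x]) (assumption | rule mlin)+
  finally show *: "Comult x : carrier (tensor K K) & tensor_lift ?UU (tns U U) (Comult x) = sw U ?UU (%a b. tns U U (rh a) b) x"
   using xU by simp
  fix t assume t: "t : carrier (tensor K K) & tensor_lift ?UU (tns U U) t = sw U ?UU (%a b. tns U U (rh a) b) x"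
  show "t = Comult x"
   by (rule tensor_incl_inj[of K rh _ _ U "%x. x" rh]) (use * t in \<open>auto intro: mlin simp: rh_K\<close>)
 qed
qed

end

section \<open>Yetter-Drinfeld and bialgebra structure of the coinvariants\<close>

context hopf_proj begin

lemma Coact_rh:
 assumes "y :[U]"
 shows "Coact (rh y) = sw U (tensor H K) (%a b. sw U (tensor H K) (%c d. tns H K (\<Phi> a *[H] H.S (\<Phi> d)) (rh c)) b) y"
proof -
 have "Coact (rh y) = sw U (tensor H K) (%a b. sw U (tensor H K) (%c d. tns H K (\<Phi> (a \<otimes> s d)) (rh (rh c))) b) y"
  unfolding Coact_def by (rule sw_rh) (assumption | rule mlin assms)+
 then show ?thesis by simp
qed

text \<open>\<open>rh\<close> absorbs a right factor \<open>s d\<close> into its counit, so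
  \<open>Comult\<close> is constant on the fibres of \<open>rh\<close>. In this sense
  \<open>K\<close> is a quotient coalgebra of \<open>U\<close>.\<close>

lemma Comult_rh:
 assumes "y :[U]"
 shows "Comult (rh y) = Comult y"
proof -
 have "Comult (rh y) = sw U (tensor K K) (%a b. sw U (tensor K K) (%c d. tns K K (rh (a \<otimes> s d)) (rh (rh c))) b) y"
  unfolding Comult_def by (rule sw_rh) (assumption | rule mlin assms)+
 also have "... = sw U (tensor K K) (%a b. sw U (tensor K K) (%c d. counit U d *:[tensor K K] tns K K (rh a) (rh c)) b) y"
  by (simp add: tns_smult(1)[of _ K, unfolded K_simps])
 also have "... = Comult y"
  unfolding Comult_def by (rule swc, rule U.sw_counit_r) (assumption | rule mlin assms)+
 finally show ?thesis .
qed

lemma Coact_mult: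
 assumes x: "x :[K]" and y: "y :[K]"
 shows "Coact (x \<otimes> y) = sw U (tensor H K) (%a b. sw U (tensor H K) (%c d. tns H K (\<Phi> a *[H] \<Phi> c) (rh b \<otimes> rh d)) y) x"
proof -
 note xy = K_sub[OF x] K_sub[OF y]
 let ?T = "tensor H K"
 have "Coact (x \<otimes> y) = sw U ?T (%a b. sw U ?T (%c d. tns H K (\<Phi> (a \<otimes> c)) (rh (b \<otimes> d))) y) x"
  unfolding Coact_def by (rule U.sw_mult) (assumption | rule mlin xy)+
 also have "... = sw U ?T (%a b. sw U ?T (%c d. tns H K (\<Phi> (a \<otimes> c)) (rh (b \<otimes> rh d))) y) x"
  by simp
 also have "... = sw U ?T (%a b. sw U ?T (%c d. tns H K (\<Phi> (a \<otimes> c)) (rh (rh b \<otimes> rh d))) y) x"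
  by (rule sw_K_rh[OF x, symmetric]) (assumption | rule mlin xy)+
 also have "... = sw U ?T (%a b. sw U ?T (%c d. tns H K (\<Phi> a *[H] \<Phi> c) (rh b \<otimes> rh d)) y) x"
  by (simp add: rh_K K_mult_closed del: rh_mult_rh)
 finally show ?thesis .
qed

text \<open>Second legs of coinvariants may be taken in \<open>K\<close>, where \<open>rh\<close> of
  a product is the product of the factors. The first leg stays unsplit because \<open>rh\<close> is
  not multiplicative; the braiding accounts for it in \<open>bcomult_alg_hom\<close>.\<close>

lemma Comult_mult:
 assumes x: "x :[K]" and y: "y :[K]"
 shows "Comult (x \<otimes> y) = sw U (tensor K K) (%a b. sw U (tensor K K) (%c d. tns K K (rh (a \<otimes> c)) (rh b \<otimes> rh d)) y) x"
proof -
 note xy = K_sub[OF x] K_sub[OF y]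
 let ?T = "tensor K K"
 have "Comult (x \<otimes> y) = sw U ?T (%a b. sw U ?T (%c d. tns K K (rh (a \<otimes> c)) (rh (b \<otimes> d))) y) x"
  unfolding Comult_def by (rule U.sw_mult) (assumption | rule mlin xy)+
 also have "... = sw U ?T (%a b. sw U ?T (%c d. tns K K (rh (a \<otimes> c)) (rh (b \<otimes> rh d))) y) x"
  by simp
 also have "... = sw U ?T (%a b. sw U ?T (%c d. tns K K (rh (a \<otimes> c)) (rh (rh b \<otimes> rh d))) y) x"
  by (rule sw_K_rh[OF x, symmetric]) (assumption | rule mlin xy)+
 also have "... = sw U ?T (%a b. sw U ?T (%c d. tns K K (rh (a \<otimes> c)) (rh b \<otimes> rh d)) y) x"
  by (simp add: rh_K K_mult_closed del: rh_mult_rh)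
 finally show ?thesis .
qed

lemma Coact_act:
 assumes h: "h :[H]" and v: "v :[K]"
 shows "Coact (rh (\<Psi> h \<otimes> v)) = sw H (tensor H K) (%h1 h'. sw H (tensor H K) (%h2 h3. sw U (tensor H K)
   (%a c. tns H K (h1 *[H] \<Phi> a *[H] H.S h3) (rh (\<Psi> h2 \<otimes> c))) v) h') h"
proof -
 let ?T = "tensor H K"
 note vU = K_sub[OF v]
 let ?G = "%a b. sw U ?T (%c d. tns H K (\<Phi> a *[H] H.S (\<Phi> d)) (rh c)) b"
 have "Coact (rh (\<Psi> h \<otimes> v)) = sw U ?T ?G (\<Psi> h \<otimes> v)"
  by (rule Coact_rh) (use h vU in simp)
 also have "... = sw U ?T (%x q. sw U ?T (%a b. ?G (x \<otimes> a) (q \<otimes> b)) v) (\<Psi> h)"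
  by (rule U.sw_mult) (assumption | rule mlin h vU)+
 also have "... = sw H ?T (%x q. sw U ?T (%a b. ?G (\<Psi> x \<otimes> a) (\<Psi> q \<otimes> b)) v) h"
  by (rule sw_\<Psi>) (assumption | rule mlin h vU)+
 also have "... = sw H ?T (%x q. sw U ?T (%a b. sw H ?T (%q1 q2. sw U ?T (%c d.
   tns H K (\<Phi> (\<Psi> x \<otimes> a) *[H] H.S (\<Phi> (\<Psi> q2 \<otimes> d))) (rh (\<Psi> q1 \<otimes> c))) b) q) v) h"
 proof (rule swc, rule swc)
  fix x q a b assume *: "x :[H]" "q :[H]" "a :[U]" "b :[U]"
  have "?G (\<Psi> x \<otimes> a) (\<Psi> q \<otimes> b) = sw U ?T (%q1 q2. sw U ?T (%c d.
   tns H K (\<Phi> (\<Psi> x \<otimes> a) *[H] H.S (\<Phi> (q2 \<otimes> d))) (rh (q1 \<otimes> c))) b) (\<Psi> q)"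
   by (rule U.sw_mult) (assumption | rule mlin *)+
  also have "... = sw H ?T (%q1 q2. sw U ?T (%c d.
   tns H K (\<Phi> (\<Psi> x \<otimes> a) *[H] H.S (\<Phi> (\<Psi> q2 \<otimes> d))) (rh (\<Psi> q1 \<otimes> c))) b) q"
   by (rule sw_\<Psi>) (assumption | rule mlin *)+
  finally show "?G (\<Psi> x \<otimes> a) (\<Psi> q \<otimes> b) = sw H ?T (%q1 q2. sw U ?T (%c d.
   tns H K (\<Phi> (\<Psi> x \<otimes> a) *[H] H.S (\<Phi> (\<Psi> q2 \<otimes> d))) (rh (\<Psi> q1 \<otimes> c))) b) q" .
 qed
 also have "... = sw H ?T (%x q. sw H ?T (%q1 q2. sw U ?T (%a b. sw U ?T (%c d.
   tns H K (\<Phi> (\<Psi> x \<otimes> a) *[H] H.S (\<Phi> (\<Psi> q2 \<otimes> d))) (rh (\<Psi> q1 \<otimes> c))) b) v) q) h"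
  by (rule swc, rule sw_swap) (assumption | rule mlin vU)+
 also have "... = sw H ?T (%x q. sw H ?T (%q1 q2. sw U ?T (%a b. sw U ?T (%c d.
   tns H K (x *[H] \<Phi> a *[H] (H.S (\<Phi> d) *[H] H.S q2)) (rh (\<Psi> q1 \<otimes> c))) b) v) q) h"
  by (simp add: H.S_mult)
 \<comment> \<open>\<open>v\<close> is coinvariant, so \<open>\<Phi>\<close> of its third leg may be
   replaced by the unit.\<close>
 also have "... = sw H ?T (%x q. sw H ?T (%q1 q2. sw U ?T (%a c.
   tns H K (x *[H] \<Phi> a *[H] (H.S \<one>[H] *[H] H.S q2)) (rh (\<Psi> q1 \<otimes> c))) v) q) h"
  by (rule swc, rule swc, rule sw_K3[where F = "%a c d. tns H K (_ *[H] \<Phi> a *[H] (H.S d *[H] H.S _)) (rh (\<Psi> _ \<otimes> c))", OF v])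
   (assumption | rule mlin vU)+
 finally show ?thesis by simp
qed

lemma yd_module_K: "yd_module H K"
 unfolding yd_module_def Let_def
proof (intro conjI ballI vspace_K)
 let ?T = "tensor H K" and ?Z = "tensor H (tensor H K)"
 have actl: "lin_map K K (act K h)" if "h :[H]" for h
  by (rule lin_map_cong[OF act_K[OF that] vspace_K]) (assumption | rule mlin that)+
 have actr: "lin_map H K (%h. act K h v)" if "v :[K]" for v
  by (rule lin_map_cong[OF act_K[OF _ that] H.vU]) (assumption | rule mlin K_sub[OF that])+
 note [mlin] = lin_map_comp[OF actl] lin_map_comp[OF actr]
 show "lin_map K K (act K h)" if "h :[H]" for h by (rule actl[OF that])
 show "lin_map H K (%h. act K h v)" if "v :[K]" for v by (rule actr[OF that])
 show "act K \<one>[H] v = v" if "v :[K]" for v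
  using that by (simp add: act_K K_sub rh_K)
 show "act K (h *[H] h') v = act K h (act K h' v)" if "h :[H]" "h' :[H]" "v :[K]" for h h' v
  using that by (simp add: act_K K_sub U.m_assoc)
 show lc: "lin_map K ?T (coact K)"
  by (rule lin_map_cong[OF coact_K vspace_K]) (assumption | rule mlin K_sub)+
 note [mlin] = lin_map_comp[OF lc]
 fix v assume v: "v :[K]"
 note vU = K_sub[OF v]
 have "tensor_lift ?Z (%h w. tensor_lift ?Z (%h1 h2. tns H ?T h1 (tns H K h2 w)) (comult H h)) (Coact v)
  = sw U ?Z (%a b. tensor_lift ?Z (%h1 h2. tns H ?T h1 (tns H K h2 (rh b))) (comult H (\<Phi> a))) v"
  by (rule lift_Coact[OF _ _ vU]) (assumption | rule mlin)+
 also have "... = sw U ?Z (%a b. sw H ?Z (%h1 h2. tns H ?T h1 (tns H K h2 (rh b))) (\<Phi> a)) v"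
  by (simp add: H.tensor_lift_sw)
 also have "... = sw U ?Z (%a b. sw U ?Z (%h1 h2. tns H ?T (\<Phi> h1) (tns H K (\<Phi> h2) (rh b))) a) v"
  by (rule swc, rule sw_\<Phi>) (assumption | rule mlin)+
 also have "... = sw U ?Z (%a b. sw U ?Z (%c d. tns H ?T (\<Phi> a) (tns H K (\<Phi> c) (rh d))) b) v"
  by (rule U.sw_coassoc) (assumption | rule mlin vU)+
 also have "... = sw U ?Z (%a b. tns H ?T (\<Phi> a) (Coact b)) v"
  unfolding Coact_def by (rule swc, rule U.sw_push[symmetric]) (assumption | rule mlin vU)+
 also have "... = sw U ?Z (%a b. tns H ?T (\<Phi> a) (Coact (rh b))) v"
  by (rule sw_K_rh[OF v, symmetric]) (assumption | rule mlin)+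
 also have "... = sw U ?Z (%a b. tns H ?T (\<Phi> a) (coact K (rh b))) v"
  by (simp add: coact_K)
 also have "... = tensor_lift ?Z (%h w. tns H ?T h (coact K w)) (Coact v)"
  by (rule lift_Coact[OF _ _ vU, symmetric]) (assumption | rule mlin lin_map_closed[OF lc])+
 finally show "tensor_lift ?Z (%h w. tensor_lift ?Z (%h1 h2. tns H ?T h1 (tns H K h2 w)) (comult H h)) (coact K v)
  = tensor_lift ?Z (%h w. tns H ?T h (coact K w)) (coact K v)" by (simp add: coact_K v)
 have "tensor_lift K (%h w. counit H h *:[K] w) (Coact v) = sw U K (%a b. counit H (\<Phi> a) *:[K] rh b) v"
  by (rule lift_Coact[OF _ _ vU]) (assumption | rule mlin)+
 also have "... = sw U K (%a b. counit U a *:[K] rh b) v" by simp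
 also have "... = rh v" by (rule U.sw_counit_l) (assumption | rule mlin vU)+
 finally show "tensor_lift K (%h w. counit H h *:[K] w) (coact K v) = v" by (simp add: coact_K v rh_K)
 fix h assume h: "h :[H]"
 have "coact K (act K h v) = Coact (rh (\<Psi> h \<otimes> v))"
  using h v vU by (simp add: coact_K act_K)
 also have "... = sw H ?T (%h1 h'. sw H ?T (%h2 h3. sw U ?T
   (%a c. tns H K (h1 *[H] \<Phi> a *[H] H.S h3) (rh (\<Psi> h2 \<otimes> c))) v) h') h"
  by (rule Coact_act[OF h v])
 also have "... = sw H ?T (%h1 h'. sw H ?T (%h2 h3. sw U ?T
   (%a c. tns H K (h1 *[H] \<Phi> a *[H] H.S h3) (act K h2 (rh c))) v) h') h"
  by (simp add: act_K)
 also have "... = sw H ?T (%h1 h'. sw H ?T (%h2 h3. tensor_lift ?T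
   (%u w. tns H K (h1 *[H] u *[H] H.S h3) (act K h2 w)) (Coact v)) h') h"
  by (rule swc, rule swc, rule lift_Coact[OF _ _ vU, symmetric]) (assumption | rule mlin lin_map_closed[OF actl])+
 finally show "coact K (act K h v) = tensor_lift ?T (%h1 h'. tensor_lift ?T (%h2 h3. tensor_lift ?T (%u w.
      tns H K (h1 *[H] u *[H] H.S h3) (act K h2 w)) (coact K v)) (comult H h')) (comult H h)"
  using h by (simp add: H.tensor_lift_sw coact_K v)
qed

lemma lin_act_r[mlin]: "lin_map Y K f ==> h :[H] ==> lin_map Y K (%x. act K h (f x))"
 and lin_act_l[mlin]: "lin_map Y H g ==> v :[K] ==> lin_map Y K (%x. act K (g x) v)"
 and act_closed[simp, mlin]: "h :[H] ==> v :[K] ==> act K h v :[K]"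
 and lin_coact[mlin]: "lin_map Y K f ==> lin_map Y (tensor H K) (%x. coact K (f x))"
 and coact_closed[simp, mlin]: "v :[K] ==> coact K v : carrier (tensor H K)"
 using yd_module_K lin_map_comp[of K K "act K h" Y f] lin_map_comp[of H K "%h. act K h v" Y g]
  lin_map_comp[of K "tensor H K" "coact K" Y f] lin_map_closed[of K K "act K h" v] lin_map_closed[of K "tensor H K" "coact K" v]
 unfolding yd_module_def by blast+

text \<open>Transport from \<open>U\<close> along the surjection \<open>rh\<close>, which is
  possible because \<open>Comult\<close> factors through it.\<close>

lemma coalgebra_K: "coalgebra K (bcomult K) (bcounit K)"
proof (rule U.coalgebra_surj[OF vspace_K _ rh_surj])
 show "lin_map U K rh" using lin_rh_K[of U "%x. x"] by simp
 fix x assume "x :[U]"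
 then show "bcomult K (rh x) = sw U (tensor K K) (%a b. tns K K (rh a) (rh b)) x"
  by (simp add: bcomult_K Comult_rh) (simp add: Comult_def)
qed (simp add: K_simps)

lemma lin_bcomult[mlin]: "lin_map Y K f ==> lin_map Y (tensor K K) (%x. bcomult K (f x))"
 and bcomult_closed[simp, mlin]: "v :[K] ==> bcomult K v : carrier (tensor K K)"
 and lin_bcounit[mlin]: "lin_map Y K f ==> lin_map Y base_alg (%x. counit U (f x))"
 using coalgebra_K lin_map_comp[of K "tensor K K" "bcomult K" Y f] lin_map_closed[of K "tensor K K" "bcomult K" v]
  lin_map_comp[of K base_alg "counit U" Y f]
 unfolding coalgebra_def K_simps by blast+

abbreviation KK where "KK \<equiv> yd_tensor H K K"

lemma KK_simps: "carrier KK = carrier (tensor K K)" "add KK = add (tensor K K)" "module.smult KK = module.smult (tensor K K)"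
 "act KK h t = tensor_lift (tensor K K) (%h1 h2. tensor_lift (tensor K K) (%v w.
    tns K K (act K h1 v) (act K h2 w)) t) (comult H h)"
 "coact KK t = tensor_lift (tensor H (tensor K K)) (%v w. tensor_lift (tensor H (tensor K K)) (%a v0. tensor_lift (tensor H (tensor K K)) (%b w0.
    tns H (tensor K K) (a *[H] b) (tns K K v0 w0)) (coact K w)) (coact K v)) t"
 by (simp_all add: yd_tensor_def Let_def module.defs yd.defs)

lemma lin_KK: "lin_map Y KK f = lin_map Y (tensor K K) f" "lin_map KK Y g = lin_map (tensor K K) Y g"
 by (rule lin_map_record_cong; simp add: KK_simps)+

lemma tensor_KK: "tensor H KK = tensor H (tensor K K)" "tns H KK = tns H (tensor K K)"
 by (rule tensor_cong; simp add: KK_simps)+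

lemma act_KK: "h :[H] ==> act KK h t = sw H (tensor K K) (%h1 h2. tensor_lift (tensor K K) (%v w.
    tns K K (act K h1 v) (act K h2 w)) t) h"
 by (simp add: KK_simps H.tensor_lift_sw)

lemma lin_KK_structure[mlin]: "h :[H] ==> lin_map Y (tensor K K) f ==> lin_map Y (tensor K K) (%x. act KK h (f x))"
 "lin_map Y (tensor K K) f ==> lin_map Y (tensor H (tensor K K)) (%x. coact KK (f x))"
proof -
 assume f: "lin_map Y (tensor K K) f"
 show "lin_map Y (tensor K K) (%x. act KK h (f x))" if h: "h :[H]"
 proof (rule lin_map_comp[OF _ f])
  show "lin_map (tensor K K) (tensor K K) (act KK h)" unfolding act_KK[OF h]
   by (assumption | rule mlin h)+
 qed
 show "lin_map Y (tensor H (tensor K K)) (%x. coact KK (f x))"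
  unfolding KK_simps by (assumption | rule mlin f)+
qed

lemma coact_KK_tns:
 assumes v: "v :[K]" and w: "w :[K]"
 shows "coact KK (tns K K v w) = sw U (tensor H (tensor K K)) (%a b. sw U (tensor H (tensor K K)) (%c d.
  tns H (tensor K K) (\<Phi> a *[H] \<Phi> c) (tns K K (rh b) (rh d))) w) v"
proof -
 let ?Z = "tensor H (tensor K K)"
 have "coact KK (tns K K v w) = tensor_lift ?Z (%a v0. tensor_lift ?Z (%b w0.
    tns H (tensor K K) (a *[H] b) (tns K K v0 w0)) (coact K w)) (coact K v)"
  unfolding KK_simps by (rule tensor_lift_tns) (assumption | rule mlin v w)+
 also have "... = tensor_lift ?Z (%a v0. tensor_lift ?Z (%b w0.
    tns H (tensor K K) (a *[H] b) (tns K K v0 w0)) (Coact w)) (Coact v)"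
  by (simp add: coact_K v w)
 also have "... = sw U ?Z (%a b. tensor_lift ?Z (%c w0.
    tns H (tensor K K) (\<Phi> a *[H] c) (tns K K (rh b) w0)) (Coact w)) v"
  by (rule lift_Coact) (assumption | rule mlin K_sub[OF v] K_sub[OF w])+
 also have "... = sw U ?Z (%a b. sw U ?Z (%c d. tns H (tensor K K) (\<Phi> a *[H] \<Phi> c) (tns K K (rh b) (rh d))) w) v"
  by (rule swc, rule lift_Coact) (assumption | rule mlin K_sub[OF v] K_sub[OF w])+
 finally show ?thesis .
qed

lemma act_K_mult:
 assumes h: "h :[H]" and v: "v :[K]" and w: "w :[K]"
 shows "sw H K (%h1 h2. act K h1 v \<otimes> act K h2 w) h = act K h (v \<otimes> w)"
proof -
 note vw = K_sub[OF v] K_sub[OF w]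
 have "sw H K (%h1 h2. act K h1 v \<otimes> act K h2 w) h = sw H U (%h1 h2. act K h1 v \<otimes> act K h2 w) h"
  by (rule H.sw_push[OF lin_K]) (assumption | rule mlin h v w)+
 also have "... = sw H U (%h1 h2. ad U (\<Psi> h1) v \<otimes> ad U (\<Psi> h2) w) h"
  by (simp add: K_simps)
 also have "... = sw U U (%h1 h2. ad U h1 v \<otimes> ad U h2 w) (\<Psi> h)"
  by (rule sw_\<Psi>[symmetric]) (assumption | rule mlin h vw)+
 also have "... = act K h (v \<otimes> w)" using h vw by (simp add: K_simps U.ad_mult_right)
 finally show ?thesis .
qed

lemma mult_yd_hom: "yd_hom H KK K (tensor_lift K (%a b. a *[K] b))"
 unfolding yd_hom_def lin_KK K_simps(4) KK_simps(1) tensor_KK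
proof (intro conjI ballI)
 let ?m = "tensor_lift K (%a b. a \<otimes> b)" and ?T = "tensor K K" and ?Z = "tensor H (tensor K K)"
 have bm: "bilin K K K (%a b. a \<otimes> b)" by (assumption | rule mlin)+
 show lm: "lin_map ?T K ?m" by (rule lin_map_tensor_lift[OF vspace_K vspace_K vspace_K bm])
 note [mlin] = lin_map_comp[OF lm] lin_map_closed[OF lm]
 show "?m (act KK h t) = act K h (?m t)" if h: "h :[H]" and t: "t :[?T]" for h t
 proof (rule tensor_ext[OF vspace_K vspace_K vspace_K _ _ _ t])
  show "lin_map ?T K (%t. ?m (act KK h t))" "lin_map ?T K (%t. act K h (?m t))"
   by - (assumption | rule mlin h)+
  fix v w assume v: "v :[K]" and w: "w :[K]"
  have "act KK h (tns K K v w) = sw H ?T (%h1 h2. tns K K (act K h1 v) (act K h2 w)) h"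
   unfolding act_KK[OF h] by (rule swc, rule tensor_lift_tns) (assumption | rule mlin v w)+
  then have "?m (act KK h (tns K K v w)) = sw H K (%h1 h2. act K h1 v \<otimes> act K h2 w) h"
   using h v w by (simp add: H.sw_lift_tns[OF vspace_K vspace_K vspace_K bm h lin_act_l[OF lin_map_id] lin_act_l[OF lin_map_id]])
  also have "... = act K h (v \<otimes> w)" by (rule act_K_mult[OF h v w])
  finally show "?m (act KK h (tns K K v w)) = act K h (?m (tns K K v w))"
   using v w by (simp add: tensor_lift_tns bm)
 qed
 show "coact K (?m t) = tensor_lift (tensor H K) (%h w. tns H K h (?m w)) (coact KK t)" if t: "t :[?T]" for t
 proof (rule tensor_ext[OF vspace_K vspace_K vspace_tensor _ _ _ t])
  let ?G = "%h w. tns H K h (?m w)"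
  have bG: "bilin H ?T (tensor H K) ?G" by (assumption | rule mlin)+
  show "lin_map ?T (tensor H K) (%t. coact K (?m t))" "lin_map ?T (tensor H K) (%t. tensor_lift (tensor H K) ?G (coact KK t))"
   by - (assumption | rule mlin bG)+
  fix v w assume v: "v :[K]" and w: "w :[K]"
  note vw = K_sub[OF v] K_sub[OF w]
  have "tensor_lift (tensor H K) ?G (coact KK (tns K K v w))
   = sw U (tensor H K) (%a b. tensor_lift (tensor H K) ?G (sw U ?Z (%c d. tns H ?T (\<Phi> a *[H] \<Phi> c) (tns K K (rh b) (rh d))) w)) v"
   unfolding coact_KK_tns[OF v w] by (rule U.sw_push_lift) (assumption | rule mlin vw bG)+
  also have "... = sw U (tensor H K) (%a b. sw U (tensor H K) (%c d. tensor_lift (tensor H K) ?G (tns H ?T (\<Phi> a *[H] \<Phi> c) (tns K K (rh b) (rh d)))) w) v"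
   by (rule swc, rule U.sw_push_lift) (assumption | rule mlin vw bG)+
  also have "... = Coact (v \<otimes> w)"
   by (simp add: tensor_lift_tns bG tensor_lift_tns[OF vspace_K vspace_K vspace_K bm] Coact_mult[OF v w])
  finally show "coact K (?m (tns K K v w)) = tensor_lift (tensor H K) ?G (coact KK (tns K K v w))"
   using v w by (simp add: tensor_lift_tns[OF vspace_K vspace_K vspace_K bm] coact_K K_mult_closed)
 qed
qed

lemma yd_unit_simps: "carrier (yd_unit H) = UNIV" "add (yd_unit H) = (+)" "module.smult (yd_unit H) = (*)"
 "act (yd_unit H) h c = counit H h * c" "coact (yd_unit H) c = tns H base_alg \<one>[H] c"
 by (simp_all add: yd_unit_def Let_def module.defs yd.defs)

lemma lin_yd_unit: "lin_map Y (yd_unit H) f = lin_map Y base_alg f" "lin_map (yd_unit H) Y g = lin_map base_alg Y g"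
 by (rule lin_map_record_cong; simp add: yd_unit_simps)+

lemma tensor_yd_unit: "tensor H (yd_unit H) = tensor H base_alg" "tns H (yd_unit H) = tns H base_alg"
 by (rule tensor_cong; simp add: yd_unit_simps)+

lemma Coact_smult: "x :[U] ==> Coact (c \<odot> x) = c *:[tensor H K] Coact x"
 using lin_map_smult[OF lin_Coact[OF lin_map_id]] .

lemma Coact_one: "Coact \<one> = tns H K \<one>[H] \<one>"
 unfolding Coact_def by (subst U.sw_one) ((assumption | rule mlin)+ | simp)+

lemma unit_yd_hom: "yd_hom H (yd_unit H) K (%c. c *:[K] \<one>[K])"
 unfolding yd_hom_def lin_yd_unit tensor_yd_unit yd_unit_simps K_simps(3,5)
proof (intro conjI ballI)
 have [mlin]: "!!Y f. lin_map Y base_alg f ==> lin_map Y K (%c. f c \<odot> \<one>)"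
  using lin_smult_l[of _ _ "\<one>" K] by (simp add: K_simps)
 show "lin_map base_alg K (%c. c \<odot> \<one>)" by (assumption | rule mlin)+
 fix c :: 'k
 have b: "bilin H base_alg (tensor H K) (%h w. tns H K h (w \<odot> \<one>))"
  using smult_closed_lin[OF one_K vspace_K] by - (assumption | rule mlin | simp add: K_simps)+
 have c: "c \<odot> \<one> :[K]" using smult_closed_lin[OF one_K vspace_K, of c] by (simp add: K_simps)
 show "(counit H h * c) \<odot> \<one> = act K h (c \<odot> \<one>)" if "h :[H]" for h
  using that rh_mult_\<Psi>[of "\<one>" h] c by (simp add: act_K vs_smult_smult mult.commute)
 show "coact K (c \<odot> \<one>) = tensor_lift (tensor H K) (%h w. tns H K h (w \<odot> \<one>)) (tns H base_alg \<one>[H] c)"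
  using c tns_smult(2)[of "\<one>[H]" H "\<one>" K c] by (simp add: coact_K tensor_lift_tns b Coact_smult Coact_one K_simps)
qed

lemma bcomult_yd_hom: "yd_hom H K KK (bcomult K)"
 unfolding yd_hom_def lin_KK tensor_KK
proof (intro conjI ballI)
 let ?T = "tensor K K" and ?Z = "tensor H (tensor K K)"
 show "lin_map K ?T (bcomult K)" by (assumption | rule mlin)+
 fix v assume v: "v :[K]"
 note vU = K_sub[OF v]
 show "bcomult K (act K h v) = act KK h (bcomult K v)" if h: "h :[H]" for h
 proof -
  have "bcomult K (act K h v) = Comult (\<Psi> h \<otimes> v)" using h v vU by (simp add: bcomult_K act_K Comult_rh)
  also have "... = sw U ?T (%x y. sw U ?T (%a b. tns K K (rh (x \<otimes> a)) (rh (y \<otimes> b))) v) (\<Psi> h)"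
   unfolding Comult_def by (rule U.sw_mult) (assumption | rule mlin h vU)+
  also have "... = sw H ?T (%x y. sw U ?T (%a b. tns K K (rh (\<Psi> x \<otimes> a)) (rh (\<Psi> y \<otimes> b))) v) h"
   by (rule sw_\<Psi>) (assumption | rule mlin h vU)+
  also have "... = sw H ?T (%x y. sw U ?T (%a b. tns K K (act K x (rh a)) (act K y (rh b))) v) h"
   by (simp add: act_K)
  also have "... = sw H ?T (%x y. tensor_lift ?T (%v w. tns K K (act K x v) (act K y w)) (Comult v)) h"
   by (rule swc, rule lift_Comult[symmetric]) (assumption | rule mlin h vU)+
  finally show ?thesis by (simp add: act_KK[OF h] bcomult_K[OF v])
 qed
 have "coact KK (bcomult K v) = sw U ?Z (%a b. coact KK (tns K K (rh a) (rh b))) v"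
  unfolding bcomult_K[OF v] Comult_def by (rule U.sw_push) (assumption | rule mlin vU)+
 also have "... = sw U ?Z (%a b. sw U ?Z (%a1 a2. sw U ?Z (%c d.
   tns H ?T (\<Phi> a1 *[H] \<Phi> c) (tns K K (rh a2) (rh d))) (rh b)) (rh a)) v"
  by (simp add: coact_KK_tns)
 also have "... = sw U ?Z (%a b. sw U ?Z (%a1 a2. sw U ?Z (%c d.
   tns H ?T (\<Phi> a1 *[H] \<Phi> c) (tns K K (rh a2) (rh d))) b) (rh a)) v"
  by (rule sw_K_rh[OF v]) (assumption | rule mlin vU)+
 also have "... = sw U ?Z (%a b. sw U ?Z (%x y. sw U ?Z (%e f. sw U ?Z (%c d.
   tns H ?T (\<Phi> (x \<otimes> s f) *[H] \<Phi> c) (tns K K (rh (rh e)) (rh d))) b) y) a) v"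
  by (rule swc, rule sw_rh) (assumption | rule mlin vU)+
 also have "... = sw U ?Z (%a b. sw U ?Z (%x y. sw U ?Z (%e f. sw U ?Z (%c d.
   tns H ?T (\<Phi> x *[H] \<Phi> (U.S f \<otimes> c)) (tns K K (rh e) (rh d))) b) y) a) v"
  by (simp add: H.m_assoc)
 also have "... = sw U ?Z (%x g. sw U ?Z (%y b. sw U ?Z (%e f. sw U ?Z (%c d.
   tns H ?T (\<Phi> x *[H] \<Phi> (U.S f \<otimes> c)) (tns K K (rh e) (rh d))) b) y) g) v"
  by (rule U.sw_coassoc) (assumption | rule mlin vU)+
 also have "... = sw U ?Z (%x g. sw U ?Z (%e k. sw U ?Z (%l d. sw U ?Z (%f c.
   tns H ?T (\<Phi> x *[H] \<Phi> (U.S f \<otimes> c)) (tns K K (rh e) (rh d))) l) k) g) v"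
  by (rule swc, rule U.sw_wrap) (assumption | rule mlin vU)+
 \<comment> \<open>The leg that \<open>sw_rh\<close> moved into the degree of the first factor
   cancels against the leg that gives the degree of the second, so the two coactions amount to a
   single one.\<close>
 also have "... = sw U ?Z (%x g. sw U ?Z (%e k. sw U ?Z (%l d. counit U l *:[?Z]
   tns H ?T (\<Phi> x *[H] \<Phi> \<one>) (tns K K (rh e) (rh d))) k) g) v"
  by (rule swc, rule swc, rule swc, rule U.sw_antipode_l[where G = "%t. tns H ?T (\<Phi> _ *[H] \<Phi> t) (tns K K (rh _) (rh _))"])
   (assumption | rule mlin vU)+
 also have "... = sw U ?Z (%x g. sw U ?Z (%e k. tns H ?T (\<Phi> x *[H] \<Phi> \<one>) (tns K K (rh e) (rh k))) g) v"
  by (rule swc, rule swc, rule U.sw_counit_l) (assumption | rule mlin vU)+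
 also have "... = sw U ?Z (%x g. sw U ?Z (%e k. tns H ?T (\<Phi> x) (tns K K (rh e) (rh k))) g) v"
  by simp
 also have "... = sw U ?Z (%a b. tns H ?T (\<Phi> a) (Comult b)) v"
  unfolding Comult_def by (rule swc, rule U.sw_push[symmetric]) (assumption | rule mlin vU)+
 also have "... = sw U ?Z (%a b. tns H ?T (\<Phi> a) (bcomult K (rh b))) v"
  by (simp add: bcomult_K Comult_rh)
 also have "... = tensor_lift ?Z (%h w. tns H ?T h (bcomult K w)) (coact K v)"
  unfolding coact_K[OF v] by (rule lift_Coact[symmetric]) (assumption | rule mlin vU)+
 finally show "coact KK (bcomult K v) = tensor_lift ?Z (%h w. tns H ?T h (bcomult K w)) (coact K v)" .
qed

lemma bcounit_yd_hom: "yd_hom H K (yd_unit H) (bcounit K)"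
 unfolding yd_hom_def lin_yd_unit tensor_yd_unit yd_unit_simps K_simps(7)
proof (intro conjI ballI)
 show "lin_map K base_alg (counit U)" by (assumption | rule mlin)+
 fix v assume v: "v :[K]"
 note vU = K_sub[OF v]
 show "counit U (act K h v) = counit H h * counit U v" if "h :[H]" for h
  using that v vU by (simp add: act_K)
 let ?Z = "tensor H base_alg"
 have "tensor_lift ?Z (%h w. tns H base_alg h (counit U w)) (coact K v) = sw U ?Z (%a b. tns H base_alg (\<Phi> a) (counit U (rh b))) v"
  unfolding coact_K[OF v] by (rule lift_Coact) (assumption | rule mlin vU)+
 also have "... = sw U ?Z (%a b. counit U b *:[?Z] tns H base_alg (\<Phi> a) 1) v"
  by (simp add: tns_smult(2)[of _ H 1 base_alg, simplified, symmetric])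
 also have "... = tns H base_alg (\<Phi> v) 1" by (rule U.sw_counit_r) (assumption | rule mlin vU)+
 \<comment> \<open>A coinvariant is fixed by \<open>rh\<close>, so \<open>\<Phi>\<close> maps it to
   a scalar.\<close>
 also have "\<Phi> v = counit U v *:[H] \<one>[H]" using \<Phi>_rh[OF vU] by (simp add: rh_K[OF v])
 also have "tns H base_alg (counit U v *:[H] \<one>[H]) 1 = tns H base_alg \<one>[H] (counit U v)"
  by (simp add: tns_smult(1)) (simp add: tns_smult(2)[of _ H 1 base_alg, simplified, symmetric])
 finally show "tns H base_alg \<one>[H] (counit U v) = tensor_lift ?Z (%h w. tns H base_alg h (counit U w)) (coact K v)" ..
qed

lemma bcomult_alg_hom: "alg_hom K (braided_tensor_alg K) (bcomult K)"
proof (rule alg_homI)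
 let ?B = "braided_tensor_alg K" and ?T = "tensor K K"
 have Bs: "carrier ?B = carrier ?T" "add ?B = add ?T" "module.smult ?B = module.smult ?T" "\<one>[?B] = tns K K \<one> \<one>"
  "!!x y. x *[?B] y = tensor_lift ?T (%a b. tensor_lift ?T (%c d. tensor_lift ?T (%u b0.
    tns K K (a \<otimes> act K u c) (b0 \<otimes> d)) (coact K b)) y) x"
  by (simp_all add: braided_tensor_alg_def Let_def K_simps(4,5))
 show "lin_map K ?B (bcomult K)"
  unfolding lin_map_record_cong(1)[of ?B ?T, OF Bs(1-3)] by (assumption | rule mlin)+
 have "Comult \<one> = tns K K \<one> \<one>" unfolding Comult_def
  by (subst U.sw_one) ((assumption | rule mlin)+ | simp)+
 then show "bcomult K \<one>[K] = \<one>[?B]" by (simp add: bcomult_K Bs K_simps(5))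
 fix x y assume x: "x :[K]" and y: "y :[K]"
 note xy = K_sub[OF x] K_sub[OF y]
 \<comment> \<open>The braiding makes \<open>p e\<close> act on \<open>c\<close>. Next to
   \<open>rh a\<close>, which is \<open>a1 s(a2)\<close>, this action cancels, and the two projected
   factors merge into \<open>rh\<close> of one product.\<close>
 have aux: "sw U K (%a e. rh a \<otimes> rh (p e \<otimes> c)) g = rh (g \<otimes> c)" if c: "c :[U]" and g: "g :[U]" for c g
 proof -
  have "sw U K (%a e. rh a \<otimes> rh (p e \<otimes> c)) g = sw U U (%a e. rh a \<otimes> rh (p e \<otimes> c)) g"
   by (rule U.sw_push[OF lin_K]) (assumption | rule mlin that)+
  also have "... = sw U U (%a e. sw U U (%a1 a2. a1 \<otimes> s a2) a \<otimes> sw U U (%e1 e2. p e1 \<otimes> rh c \<otimes> s e2) e) g"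
  proof (rule swc)
   fix a e assume "a :[U]" and e: "e :[U]"
   have "rh (p e \<otimes> c) = sw U U (%a b. a \<otimes> rh c \<otimes> s b) (p e)" using e c by (simp add: rh_mult)
   also have "... = sw U U (%e1 e2. p e1 \<otimes> rh c \<otimes> s (p e2)) e" by (rule sw_p) (assumption | rule mlin e c)+
   finally show "rh a \<otimes> rh (p e \<otimes> c) = sw U U (%a1 a2. a1 \<otimes> s a2) a \<otimes> sw U U (%e1 e2. p e1 \<otimes> rh c \<otimes> s e2) e"
    unfolding rh_def[of a] by simp
  qed
  also have "... = sw U U (%a e. sw U U (%a1 a2. (a1 \<otimes> s a2) \<otimes> sw U U (%e1 e2. p e1 \<otimes> rh c \<otimes> s e2) e) a) g"
   by (rule swc, rule U.sw_push[where g = "%t. t \<otimes> _"]) (assumption | rule mlin that)+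
  also have "... = sw U U (%a e. sw U U (%a1 a2. sw U U (%e1 e2. (a1 \<otimes> s a2) \<otimes> (p e1 \<otimes> rh c \<otimes> s e2)) e) a) g"
   by (rule swc, rule swc, rule U.sw_push) (assumption | rule mlin that)+
  also have "... = sw U U (%a b. sw U U (%c' d. sw U U (%a2 e1. (a \<otimes> s a2) \<otimes> (p e1 \<otimes> rh c \<otimes> s d)) c') b) g"
   by (rule U.sw_wrap) (assumption | rule mlin that)+
  also have "... = sw U U (%a b. sw U U (%c' d. sw U U (%a2 e1. a \<otimes> (s a2 \<otimes> p e1) \<otimes> (rh c \<otimes> s d)) c') b) g"
   using c by (simp add: U.m_assoc)
  also have "... = sw U U (%a b. sw U U (%c' d. counit U c' \<odot> (a \<otimes> \<one> \<otimes> (rh c \<otimes> s d))) b) g"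
   by (rule swc, rule swc, rule sw_s_p[where G = "%t. _ \<otimes> t \<otimes> (_ \<otimes> _)"]) (assumption | rule mlin that)+
  also have "... = sw U U (%a b. a \<otimes> \<one> \<otimes> (rh c \<otimes> s b)) g"
   by (rule swc, rule U.sw_counit_l) (assumption | rule mlin that)+
  also have "... = rh (g \<otimes> c)" using that by (simp add: rh_mult U.m_assoc)
  finally show ?thesis .
 qed
 have "bcomult K x *[?B] bcomult K y = tensor_lift ?T (%a b. tensor_lift ?T (%c d. tensor_lift ?T (%u b0.
    tns K K (a \<otimes> act K u c) (b0 \<otimes> d)) (coact K b)) (Comult y)) (Comult x)"
  by (simp add: Bs bcomult_K x y)
 also have "... = sw U ?T (%a b. tensor_lift ?T (%c d. tensor_lift ?T (%u b0.
    tns K K (rh a \<otimes> act K u c) (b0 \<otimes> d)) (coact K (rh b))) (Comult y)) x"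
  by (rule lift_Comult) (assumption | rule mlin xy)+
 also have "... = sw U ?T (%a b. sw U ?T (%c d. tensor_lift ?T (%u b0.
    tns K K (rh a \<otimes> act K u (rh c)) (b0 \<otimes> rh d)) (coact K (rh b))) y) x"
  by (rule swc, rule lift_Comult) (assumption | rule mlin xy)+
 also have "... = sw U ?T (%a b. sw U ?T (%c d. tensor_lift ?T (%u b0.
    tns K K (rh a \<otimes> act K u (rh c)) (b0 \<otimes> rh d)) (Coact (rh b))) y) x"
  by (simp add: coact_K)
 also have "... = sw U ?T (%a b. sw U ?T (%c d. tensor_lift ?T (%u b0.
    tns K K (rh a \<otimes> act K u (rh c)) (b0 \<otimes> rh d)) (Coact b)) y) x"
  by (rule sw_K_rh[OF x]) (assumption | rule mlin xy)+
 also have "... = sw U ?T (%a b. sw U ?T (%c d. sw U ?T (%e f.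
    tns K K (rh a \<otimes> act K (\<Phi> e) (rh c)) (rh f \<otimes> rh d)) b) y) x"
  by (rule swc, rule swc, rule lift_Coact) (assumption | rule mlin xy)+
 also have "... = sw U ?T (%a b. sw U ?T (%c d. sw U ?T (%e f.
    tns K K (rh a \<otimes> rh (p e \<otimes> c)) (rh f \<otimes> rh d)) b) y) x"
  by (simp add: act_K p_def)
 also have "... = sw U ?T (%a b. sw U ?T (%e f. sw U ?T (%c d.
    tns K K (rh a \<otimes> rh (p e \<otimes> c)) (rh f \<otimes> rh d)) y) b) x"
  by (rule swc, rule sw_swap) (assumption | rule mlin xy)+
 also have "... = sw U ?T (%g f. sw U ?T (%a e. sw U ?T (%c d.
    tns K K (rh a \<otimes> rh (p e \<otimes> c)) (rh f \<otimes> rh d)) y) g) x"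
  by (rule U.sw_coassoc[symmetric]) (assumption | rule mlin xy)+
 also have "... = sw U ?T (%g f. sw U ?T (%c d. sw U ?T (%a e.
    tns K K (rh a \<otimes> rh (p e \<otimes> c)) (rh f \<otimes> rh d)) g) y) x"
  by (rule swc, rule sw_swap) (assumption | rule mlin xy)+
 also have "... = sw U ?T (%g f. sw U ?T (%c d.
    tns K K (sw U K (%a e. rh a \<otimes> rh (p e \<otimes> c)) g) (rh f \<otimes> rh d)) y) x"
  by (rule swc, rule swc, rule U.sw_push[where g = "%t. tns K K t _", symmetric]) (assumption | rule mlin xy)+
 also have "... = sw U ?T (%g f. sw U ?T (%c d. tns K K (rh (g \<otimes> c)) (rh f \<otimes> rh d)) y) x"
  by (simp add: aux)
 also have "... = Comult (x \<otimes> y)" by (rule Comult_mult[OF x y, symmetric])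
 finally show "bcomult K (x *[K] y) = bcomult K x *[?B] bcomult K y"
  using x y by (simp add: K_simps(4) bcomult_K K_mult_closed)
qed

lemma bcounit_alg_hom: "alg_hom K base_alg (bcounit K)"
 unfolding K_simps(7) by (rule alg_homI) ((assumption | rule mlin)+ | simp add: K_simps K_sub)+

end

section \<open>The braided antipode and the bosonization isomorphism\<close>

context hopf_proj begin

text \<open>The braided antipode of \<open>K\<close>, written down on all of \<open>U\<close> so
  that the Sweedler calculus applies before the values are known to lie in \<open>K\<close>.\<close>

definition T where "T x = sw U U (%a b. p a \<otimes> U.S b) x"

lemma T_closed[simp, mlin]: "x :[U] ==> T x :[U]"
 and lin_T[mlin]: "lin_map Y U f ==> lin_map Y U (%x. T (f x))"
 unfolding T_def by - (assumption | rule mlin)+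

text \<open>The legs added by \<open>rh\<close> meet as \<open>s f\<close> times \<open>p d\<close>
  and cancel, so a projected argument of \<open>T\<close> may be replaced by a plain one.\<close>

lemma T_rh: assumes y: "y :[U]" shows "T (rh y) = T y"
proof -
 have "T (rh y) = sw U U (%a b. sw U U (%c d. p (a \<otimes> s d) \<otimes> U.S (rh c)) b) y"
  unfolding T_def by (rule sw_rh) (assumption | rule mlin y)+
 also have "... = sw U U (%a b. sw U U (%c d. (p a \<otimes> s d) \<otimes> sw U U (%e f. U.S (e \<otimes> s f)) c) b) y"
  unfolding rh_def
  by (rule swc, rule swc, subst U.sw_push[where g = U.S and Z' = U]) ((assumption | rule mlin y)+ | simp)+
 also have "... = sw U U (%a b. sw U U (%c d. sw U U (%e f. (p a \<otimes> s d) \<otimes> U.S (e \<otimes> s f)) c) b) y"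
  by (rule swc, rule swc, rule U.sw_push) (assumption | rule mlin y)+
 also have "... = sw U U (%a b. sw U U (%c d. sw U U (%e f. p a \<otimes> U.S (s f \<otimes> p d) \<otimes> U.S e) c) b) y"
  by (simp add: U.S_mult U.m_assoc s_def)
 also have "... = sw U U (%a b. sw U U (%e g. sw U U (%f d. p a \<otimes> U.S (s f \<otimes> p d) \<otimes> U.S e) g) b) y"
  by (rule swc, rule U.sw_coassoc) (assumption | rule mlin y)+
 also have "... = sw U U (%a b. sw U U (%e g. counit U g \<odot> (p a \<otimes> U.S \<one> \<otimes> U.S e)) b) y"
  by (rule swc, rule swc, rule sw_s_p[where G = "%t. _ \<otimes> U.S t \<otimes> _"]) (assumption | rule mlin y)+
 also have "... = sw U U (%a b. p a \<otimes> U.S \<one> \<otimes> U.S b) y"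
  by (rule swc, rule U.sw_counit_r) (assumption | rule mlin y)+
 finally show ?thesis by (simp add: T_def)
qed

text \<open>The factors that the projection adds combine to \<open>s\<close> of
  \<open>c1 S(c2)\<close>, a scalar. Hence \<open>T\<close> takes values in
  \<open>K\<close>.\<close>

lemma rh_pS:
 assumes c: "c :[U]"
 shows "sw U U (%a b. rh (p a \<otimes> U.S b)) c = T c"
proof -
 have "sw U U (%a b. rh (p a \<otimes> U.S b)) c = sw U U (%a b. sw U U (%a1 a2. sw U U (%b1 b2. p a1 \<otimes> (U.S b2 \<otimes> s (U.S b1)) \<otimes> s a2) b) a) c"
 proof (rule swc)
  fix a b assume a: "a :[U]" and b: "b :[U]"
  have r: "rh (U.S b) = sw U U (%b1 b2. U.S b2 \<otimes> s (U.S b1)) b"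
   unfolding rh_def by (rule U.sw_S) (assumption | rule mlin b)+
  have "rh (p a \<otimes> U.S b) = sw U U (%a1 a2. a1 \<otimes> rh (U.S b) \<otimes> s a2) (p a)"
   by (rule rh_mult) (use a b in auto)
  also have "... = sw U U (%a1 a2. p a1 \<otimes> rh (U.S b) \<otimes> s (p a2)) a"
   by (rule sw_p) (assumption | rule mlin a b)+
  also have "... = sw U U (%a1 a2. p a1 \<otimes> sw U U (%b1 b2. U.S b2 \<otimes> s (U.S b1)) b \<otimes> s a2) a"
   unfolding r by simp
  also have "... = sw U U (%a1 a2. sw U U (%b1 b2. p a1 \<otimes> (U.S b2 \<otimes> s (U.S b1)) \<otimes> s a2) b) a"
   by (rule swc, rule U.sw_push[where g = "%t. _ \<otimes> t \<otimes> s _"]) (assumption | rule mlin a b)+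
  finally show "rh (p a \<otimes> U.S b) = sw U U (%a1 a2. sw U U (%b1 b2. p a1 \<otimes> (U.S b2 \<otimes> s (U.S b1)) \<otimes> s a2) b) a" .
 qed
 also have "... = sw U U (%a b. sw U U (%e d. sw U U (%c1 c2. p a \<otimes> (U.S d \<otimes> s (U.S c2)) \<otimes> s c1) e) b) c"
  by (rule U.sw_wrap) (assumption | rule mlin c)+
 also have "... = sw U U (%a b. sw U U (%e d. sw U U (%c1 c2. p a \<otimes> U.S d \<otimes> s (c1 \<otimes> U.S c2)) e) b) c"
  by (simp add: U.m_assoc)
 also have "... = sw U U (%a b. sw U U (%e d. counit U e \<odot> (p a \<otimes> U.S d \<otimes> s \<one>)) b) c"
  by (rule swc, rule swc, rule U.sw_antipode_r[where G = "%t. _ \<otimes> _ \<otimes> s t"]) (assumption | rule mlin c)+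
 also have "... = sw U U (%a b. p a \<otimes> U.S b \<otimes> s \<one>) c"
  by (rule swc, rule U.sw_counit_l) (assumption | rule mlin c)+
 finally show ?thesis by (simp add: T_def)
qed

lemma rh_T[simp]: "x :[U] ==> rh (T x) = T x"
proof -
 assume x: "x :[U]"
 have "rh (T x) = sw U U (%a b. rh (p a \<otimes> U.S b)) x"
  unfolding T_def by (rule U.sw_push) (assumption | rule mlin x)+
 then show ?thesis by (simp add: rh_pS x)
qed

lemma T_in_K[simp, mlin]: "x :[U] ==> T x :[K]" by (simp add: K_eq)

lemma lin_T_K[mlin]: assumes "lin_map Y U f" shows "lin_map Y K (%x. T (f x))"
 by (rule lin_into_K[OF lin_T[OF assms]]) (simp add: lin_map_closed[OF assms])

lemma sw_KU:
 assumes "x :[U]" "bilin U U K B" shows "sw U K B x = sw U U B x"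
 by (rule U.sw_push[OF lin_K]) (assumption | rule mlin assms)+

lemma T_antipode_l:
 assumes x: "x :[K]"
 shows "tensor_lift K (%a b. T a \<otimes> b) (bcomult K x) = counit U x \<odot> \<one>"
proof -
 note xU = K_sub[OF x]
 have "tensor_lift K (%a b. T a \<otimes> b) (bcomult K x) = sw U K (%a b. T (rh a) \<otimes> rh b) x"
  unfolding bcomult_K[OF x] by (rule lift_Comult) (assumption | rule mlin xU K_sub)+
 also have "... = sw U U (%a b. T (rh a) \<otimes> rh b) x" by (rule sw_KU[OF xU]) (assumption | rule mlin)+
 also have "... = sw U U (%a b. T (rh a) \<otimes> b) x"
  by (rule sw_K_rh[OF x]) (assumption | rule mlin)+
 also have "... = sw U U (%a b. sw U U (%c d. p c \<otimes> U.S d) a \<otimes> b) x"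
  by (simp add: T_rh) (simp add: T_def)
 also have "... = sw U U (%a b. sw U U (%c d. (p c \<otimes> U.S d) \<otimes> b) a) x"
  by (rule swc, rule U.sw_push[where g = "%t. t \<otimes> _"]) (assumption | rule mlin)+
 also have "... = sw U U (%c e. sw U U (%d b. (p c \<otimes> U.S d) \<otimes> b) e) x"
  by (rule U.sw_coassoc) (assumption | rule mlin xU)+
 also have "... = sw U U (%c e. sw U U (%d b. p c \<otimes> (U.S d \<otimes> b)) e) x" by (simp add: U.m_assoc)
 also have "... = sw U U (%c e. counit U e \<odot> (p c \<otimes> \<one>)) x"
  by (rule swc, rule U.sw_antipode_l) (assumption | rule mlin)+
 also have "... = p x \<otimes> \<one>" by (rule U.sw_counit_r) (assumption | rule mlin xU)+
 also have "... = \<Psi> (\<Phi> (rh x))" using x xU by (simp add: rh_K p_def)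
 also have "... = counit U x \<odot> \<one>" using xU by simp
 finally show ?thesis .
qed

lemma T_antipode_r:
 assumes x: "x :[K]"
 shows "tensor_lift K (%a b. a \<otimes> T b) (bcomult K x) = counit U x \<odot> \<one>"
proof -
 note xU = K_sub[OF x]
 have "tensor_lift K (%a b. a \<otimes> T b) (bcomult K x) = sw U K (%a b. rh a \<otimes> T (rh b)) x"
  unfolding bcomult_K[OF x] by (rule lift_Comult) (assumption | rule mlin xU K_sub)+
 also have "... = sw U U (%a b. rh a \<otimes> T (rh b)) x" by (rule sw_KU[OF xU]) (assumption | rule mlin)+
 also have "... = sw U U (%a b. sw U U (%c d. c \<otimes> s d) a \<otimes> sw U U (%e f. p e \<otimes> U.S f) b) x"
  by (simp add: T_rh) (simp add: T_def rh_def)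
 also have "... = sw U U (%a b. sw U U (%c d. (c \<otimes> s d) \<otimes> sw U U (%e f. p e \<otimes> U.S f) b) a) x"
  by (rule swc, rule U.sw_push[where g = "%t. t \<otimes> _"]) (assumption | rule mlin)+
 also have "... = sw U U (%a b. sw U U (%c d. sw U U (%e f. (c \<otimes> s d) \<otimes> (p e \<otimes> U.S f)) b) a) x"
  by (rule swc, rule swc, rule U.sw_push) (assumption | rule mlin)+
 also have "... = sw U U (%c b. sw U U (%g f. sw U U (%d e. (c \<otimes> s d) \<otimes> (p e \<otimes> U.S f)) g) b) x"
  by (rule U.sw_wrap) (assumption | rule mlin xU)+
 also have "... = sw U U (%c b. sw U U (%g f. sw U U (%d e. c \<otimes> (s d \<otimes> p e) \<otimes> U.S f) g) b) x"
  by (simp add: U.m_assoc)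
 also have "... = sw U U (%c b. sw U U (%g f. counit U g \<odot> (c \<otimes> \<one> \<otimes> U.S f)) b) x"
  by (rule swc, rule swc, rule sw_s_p[where G = "%t. _ \<otimes> t \<otimes> _"]) (assumption | rule mlin)+
 also have "... = sw U U (%c b. c \<otimes> \<one> \<otimes> U.S b) x"
  by (rule swc, rule U.sw_counit_l) (assumption | rule mlin)+
 also have "... = counit U x \<odot> \<one>" using xU by (simp add: U.sw_S_r)
 finally show ?thesis .
qed

lemma T_act:
 assumes h: "h :[H]" and v: "v :[K]"
 shows "T (act K h v) = act K h (T v)"
proof -
 note vU = K_sub[OF v]
 have "T (act K h v) = T (\<Psi> h \<otimes> v)" using h v vU by (simp add: act_K T_rh)
 also have "... = sw U U (%x y. sw U U (%a b. p (x \<otimes> a) \<otimes> U.S (y \<otimes> b)) v) (\<Psi> h)"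
  unfolding T_def by (rule U.sw_mult) (assumption | rule mlin h vU)+
 also have "... = sw H U (%x y. sw U U (%a b. p (\<Psi> x \<otimes> a) \<otimes> U.S (\<Psi> y \<otimes> b)) v) h"
  by (rule sw_\<Psi>) (assumption | rule mlin h vU)+
 also have "... = sw H U (%x y. sw U U (%a b. \<Psi> x \<otimes> (p a \<otimes> U.S b) \<otimes> U.S (\<Psi> y)) v) h"
  by (simp add: U.S_mult U.m_assoc)
 also have "... = sw H U (%x y. \<Psi> x \<otimes> T v \<otimes> U.S (\<Psi> y)) h"
  unfolding T_def by (rule swc, rule U.sw_push[where g = "%t. \<Psi> _ \<otimes> t \<otimes> U.S _", symmetric]) (assumption | rule mlin h vU)+
 also have "... = sw U U (%x y. x \<otimes> T v \<otimes> U.S y) (\<Psi> h)"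
  by (rule sw_\<Psi>[symmetric]) (assumption | rule mlin h vU)+
 also have "... = act K h (T v)" using h vU by (simp add: K_simps U.ad_sw)
 finally show ?thesis .
qed

lemma T_coact:
 assumes v: "v :[K]"
 shows "coact K (T v) = tensor_lift (tensor H K) (%h w. tns H K h (T w)) (coact K v)"
proof -
 let ?T = "tensor H K"
 note vU = K_sub[OF v]
 have "coact K (T v) = sw U ?T (%a b. Coact (p a \<otimes> U.S b)) v"
  unfolding coact_K[OF T_in_K[OF vU]] unfolding T_def by (rule U.sw_push) (assumption | rule mlin vU)+
 also have "... = sw U ?T (%a b. sw U ?T (%a1 a2. sw U ?T (%b1 b2. tns H K (\<Phi> (p a1 \<otimes> U.S b2)) (rh (p a2 \<otimes> U.S b1))) b) a) v"
 proof (rule swc)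
  fix a b assume a: "a :[U]" and b: "b :[U]"
  have "Coact (p a \<otimes> U.S b) = sw U ?T (%a1 a2. sw U ?T (%b1 b2. tns H K (\<Phi> (a1 \<otimes> b1)) (rh (a2 \<otimes> b2))) (U.S b)) (p a)"
   unfolding Coact_def by (rule U.sw_mult) (assumption | rule mlin a b)+
  also have "... = sw U ?T (%a1 a2. sw U ?T (%b1 b2. tns H K (\<Phi> (p a1 \<otimes> b1)) (rh (p a2 \<otimes> b2))) (U.S b)) a"
   by (rule sw_p) (assumption | rule mlin a b)+
  also have "... = sw U ?T (%a1 a2. sw U ?T (%b1 b2. tns H K (\<Phi> (p a1 \<otimes> U.S b2)) (rh (p a2 \<otimes> U.S b1))) b) a"
   by (rule swc, rule U.sw_S) (assumption | rule mlin a b)+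
  finally show "Coact (p a \<otimes> U.S b) = sw U ?T (%a1 a2. sw U ?T (%b1 b2. tns H K (\<Phi> (p a1 \<otimes> U.S b2)) (rh (p a2 \<otimes> U.S b1))) b) a" .
 qed
 also have "... = sw U ?T (%a b. sw U ?T (%c d. sw U ?T (%c1 c2. tns H K (\<Phi> (p a \<otimes> U.S d)) (rh (p c1 \<otimes> U.S c2))) c) b) v"
  by (rule U.sw_wrap) (assumption | rule mlin vU)+
 also have "... = sw U ?T (%a b. sw U ?T (%c d. tns H K (\<Phi> (p a \<otimes> U.S d)) (sw U K (%c1 c2. rh (p c1 \<otimes> U.S c2)) c)) b) v"
  by (rule swc, rule swc, rule U.sw_push[symmetric]) (assumption | rule mlin vU)+
 also have "... = sw U ?T (%a b. sw U ?T (%c d. tns H K (\<Phi> (p a \<otimes> U.S d)) (sw U U (%c1 c2. rh (p c1 \<otimes> U.S c2)) c)) b) v"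
  by (rule swc, rule swc, subst sw_KU) ((assumption | rule mlin)+ | simp)+
 also have "... = sw U ?T (%a b. sw U ?T (%c d. tns H K (\<Phi> a *[H] H.S (\<Phi> d)) (T c)) b) v"
  by (simp add: rh_pS)
 also have "... = sw U ?T (%a c. tns H K (\<Phi> a *[H] H.S \<one>[H]) (T c)) v"
  by (rule sw_K3[where F = "%a c d. tns H K (\<Phi> a *[H] H.S d) (T c)", OF v]) (assumption | rule mlin vU)+
 also have "... = sw U ?T (%a c. tns H K (\<Phi> a) (T (rh c))) v"
  by (simp add: T_rh)
 also have "... = tensor_lift ?T (%h w. tns H K h (T w)) (coact K v)"
  unfolding coact_K[OF v] by (rule lift_Coact[symmetric]) (assumption | rule mlin vU K_sub)+
 finally show ?thesis .
qed

theorem braided_hopf_K: "braided_hopf_algebra H K"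
 unfolding braided_hopf_algebra_def
proof (intro conjI H.hopf yd_module_K kalgebra_K coalgebra_K mult_yd_hom unit_yd_hom bcomult_yd_hom bcounit_yd_hom
  bcomult_alg_hom bcounit_alg_hom exI[of _ T])
 show "yd_hom H K K T" unfolding yd_hom_def
  by (intro conjI ballI T_act T_coact) (assumption | rule mlin)+
 show "\<forall>x\<in>carrier K. tensor_lift K (%a b. T a *[K] b) (bcomult K x) = bcounit K x *:[K] \<one>[K] &
     tensor_lift K (%a b. a *[K] T b) (bcomult K x) = bcounit K x *:[K] \<one>[K]"
  by (simp add: K_simps T_antipode_l T_antipode_r)
qed

abbreviation B where "B \<equiv> boson K H"
abbreviation \<mu> where "\<mu> \<equiv> tensor_lift U (%r u. r \<otimes> \<Psi> u)"
text \<open>The inverse of the multiplication map: \<open>rh\<close> splits off the coinvariant part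
  and \<open>\<Phi>\<close> records the rest.\<close>

definition \<nu> where "\<nu> x = sw U (tensor K H) (%a b. tns K H (rh a) (\<Phi> b)) x"

lemma B_simps: "carrier B = carrier (tensor K H)" "add B = add (tensor K H)" "\<zero>[B] = \<zero>[tensor K H]"
 "module.smult B = module.smult (tensor K H)" "\<one>[B] = tns K H \<one> \<one>[H]"
 "x *[B] y = tensor_lift (tensor K H) (%r h. tensor_lift (tensor K H) (%s k. tensor_lift (tensor K H) (%h1 h2.
      tns K H (r \<otimes> act K h1 s) (h2 *[H] k)) (comult H h)) y) x"
 "comult B t = tensor_lift (tensor (tensor K H) (tensor K H)) (%r h. tensor_lift (tensor (tensor K H) (tensor K H)) (%r1 r2.
   tensor_lift (tensor (tensor K H) (tensor K H)) (%h1 h2. tensor_lift (tensor (tensor K H) (tensor K H)) (%u r0.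
   tns (tensor K H) (tensor K H) (tns K H r1 (u *[H] h1)) (tns K H r0 h2)) (coact K r2)) (comult H h)) (bcomult K r)) t"
 "counit B t = tensor_lift base_alg (%r h. counit U r * counit H h) t"
 by (simp_all add: boson_def Let_def module.defs bialg.defs K_simps)

lemma lin_B: "lin_map Y B f = lin_map Y (tensor K H) f" "lin_map B Y g = lin_map (tensor K H) Y g"
 by (rule lin_map_record_cong; simp add: B_simps)+

lemma tensor_B: "tensor B B = tensor (tensor K H) (tensor K H)" "tns B B = tns (tensor K H) (tensor K H)"
 by (rule tensor_cong; simp add: B_simps)+

lemma vspace_B: "vspace B"
 by (rule vspace_transfer[OF vspace_tensor]) (simp_all add: B_simps)

lemma bilin_\<mu>: "bilin K H U (%r u. r \<otimes> \<Psi> u)" by (assumption | rule mlin K_sub)+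

lemmas \<mu>_tns[simp] = tensor_lift_tns[OF vspace_K H.vU U.vU bilin_\<mu>]

lemma lin_\<mu>[mlin]: "lin_map Y (tensor K H) f ==> lin_map Y U (%x. \<mu> (f x))"
 and \<mu>_closed[simp, mlin]: "t : carrier (tensor K H) ==> \<mu> t :[U]"
 and lin_\<nu>[mlin]: "lin_map Y U g ==> lin_map Y (tensor K H) (%x. \<nu> (g x))"
 and \<nu>_closed[simp, mlin]: "x :[U] ==> \<nu> x : carrier (tensor K H)"
 unfolding \<nu>_def by - (assumption | rule mlin bilin_\<mu>)+

lemma \<mu>_\<nu>: assumes x: "x :[U]" shows "\<mu> (\<nu> x) = x"
proof -
 have "\<mu> (\<nu> x) = sw U U (%a b. rh a \<otimes> \<Psi> (\<Phi> b)) x"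
  unfolding \<nu>_def by (rule U.sw_lift_tns[OF vspace_K H.vU U.vU bilin_\<mu> x]) (assumption | rule mlin)+
 also have "... = sw U U (%a b. sw U U (%c d. (c \<otimes> s d) \<otimes> p b) a) x"
  unfolding rh_def p_def[symmetric] by (rule swc, rule U.sw_push[where g = "%t. t \<otimes> _"]) (assumption | rule mlin)+
 also have "... = sw U U (%c e. sw U U (%d b. (c \<otimes> s d) \<otimes> p b) e) x"
  by (rule U.sw_coassoc) (assumption | rule mlin x)+
 also have "... = sw U U (%c e. sw U U (%d b. c \<otimes> (s d \<otimes> p b)) e) x" by (simp add: U.m_assoc)
 also have "... = sw U U (%c e. counit U e \<odot> (c \<otimes> \<one>)) x"
  by (rule swc, rule sw_s_p) (assumption | rule mlin x)+
 also have "... = x \<otimes> \<one>" by (rule U.sw_counit_r) (assumption | rule mlin x)+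
 finally show ?thesis using x by simp
qed

lemma \<nu>_\<mu>: assumes t: "t : carrier (tensor K H)" shows "\<nu> (\<mu> t) = t"
proof (rule tensor_ext[OF vspace_K H.vU vspace_tensor _ lin_map_id _ t])
 let ?T = "tensor K H"
 show "lin_map ?T ?T (%t. \<nu> (\<mu> t))" by (assumption | rule mlin)+
 fix r h assume r: "r :[K]" and h: "h :[H]"
 note rU = K_sub[OF r]
 have "\<nu> (r \<otimes> \<Psi> h) = sw U ?T (%a b. sw U ?T (%c d. tns K H (rh (a \<otimes> c)) (\<Phi> (b \<otimes> d))) (\<Psi> h)) r"
  unfolding \<nu>_def by (rule U.sw_mult) (assumption | rule mlin rU h)+
 also have "... = sw U ?T (%a b. sw H ?T (%c d. tns K H (rh (a \<otimes> \<Psi> c)) (\<Phi> (b \<otimes> \<Psi> d))) h) r"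
  by (rule swc, rule sw_\<Psi>) (assumption | rule mlin rU h)+
 also have "... = sw U ?T (%a b. sw H ?T (%c d. counit H c *:[?T] tns K H (rh a) (\<Phi> b *[H] d)) h) r"
  by (simp add: tns_smult(1)[of _ K, unfolded K_simps])
 also have "... = sw U ?T (%a b. tns K H (rh a) (\<Phi> b *[H] h)) r"
  by (rule swc, rule H.sw_counit_l) (assumption | rule mlin rU h)+
 also have "... = tns K H (rh r) (\<one>[H] *[H] h)"
  by (rule sw_K[where F = "%a b. tns K H (rh a) (b *[H] h)", OF r]) (assumption | rule mlin h)+
 finally show "\<nu> (\<mu> (tns K H r h)) = tns K H r h" using r h by (simp add: rh_K)
qed

lemma bilin_B_mult: "bilin (tensor K H) (tensor K H) (tensor K H) (%x y. x *[B] y)"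
 unfolding B_simps by (assumption | rule mlin)+

text \<open>The smash product acts on \<open>r'\<close> by \<open>ad\<close> of the first leg of
  \<open>h\<close>. The antipode inside this action stands next to the second leg of
  \<open>h\<close>; the two cancel and leave the product in \<open>U\<close>.\<close>

lemma \<mu>_mult:
 assumes "x : carrier (tensor K H)" "y : carrier (tensor K H)"
 shows "\<mu> (x *[B] y) = \<mu> x \<otimes> \<mu> y"
proof (rule bilin_tensor_algebra_ext[OF vspace_K H.vU U.vU _ _ _ assms])
 let ?T = "tensor K H"
 note [mlin] = lin_map_comp[OF bilinD(1)[OF bilin_B_mult]] lin_map_comp[OF bilinD(2)[OF bilin_B_mult]]
 show "bilin ?T ?T U (%x y. \<mu> (x *[B] y))" "bilin ?T ?T U (%x y. \<mu> x \<otimes> \<mu> y)"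
  by - (assumption | rule mlin)+
 fix r h r' k assume r: "r :[K]" and h: "h :[H]" and r': "r' :[K]" and k: "k :[H]"
 note rU = K_sub[OF r] K_sub[OF r']
 have "tns K H r h *[B] tns K H r' k = tensor_lift ?T (%s k. tensor_lift ?T (%h1 h2.
      tns K H (r \<otimes> act K h1 s) (h2 *[H] k)) (comult H h)) (tns K H r' k)"
  unfolding B_simps by (rule tensor_lift_tns) (assumption | rule mlin r h r' k)+
 also have "... = tensor_lift ?T (%h1 h2. tns K H (r \<otimes> act K h1 r') (h2 *[H] k)) (comult H h)"
  by (rule tensor_lift_tns) (assumption | rule mlin r h r' k)+
 also have "... = sw H ?T (%h1 h2. tns K H (r \<otimes> act K h1 r') (h2 *[H] k)) h"
  using h by (simp add: H.tensor_lift_sw)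
 finally have "\<mu> (tns K H r h *[B] tns K H r' k) = sw H U (%h1 h2. \<mu> (tns K H (r \<otimes> act K h1 r') (h2 *[H] k))) h"
  by simp (rule H.sw_push_lift, (assumption | rule mlin bilin_\<mu> r h r' k)+)
 also have "... = sw H U (%h1 h2. r \<otimes> ad U (\<Psi> h1) r' \<otimes> (\<Psi> h2 \<otimes> \<Psi> k)) h"
  using r r' k K_mult_closed[OF r act_closed] by (simp add: K_simps(6)[symmetric])
 also have "... = sw U U (%h1 h2. r \<otimes> ad U h1 r' \<otimes> (h2 \<otimes> \<Psi> k)) (\<Psi> h)"
  by (rule sw_\<Psi>[symmetric]) (assumption | rule mlin rU h k)+
 also have "... = sw U U (%h1 h2. r \<otimes> sw U U (%a b. a \<otimes> r' \<otimes> U.S b) h1 \<otimes> (h2 \<otimes> \<Psi> k)) (\<Psi> h)"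
  by (simp add: U.ad_sw)
 also have "... = sw U U (%h1 h2. sw U U (%a b. r \<otimes> (a \<otimes> r' \<otimes> U.S b) \<otimes> (h2 \<otimes> \<Psi> k)) h1) (\<Psi> h)"
  by (rule swc, rule U.sw_push[where g = "%t. r \<otimes> t \<otimes> _"]) (assumption | rule mlin rU h k)+
 also have "... = sw U U (%a e. sw U U (%b c. r \<otimes> (a \<otimes> r' \<otimes> U.S b) \<otimes> (c \<otimes> \<Psi> k)) e) (\<Psi> h)"
  by (rule U.sw_coassoc) (assumption | rule mlin rU h k)+
 also have "... = sw U U (%a e. sw U U (%b c. r \<otimes> a \<otimes> r' \<otimes> (U.S b \<otimes> c) \<otimes> \<Psi> k) e) (\<Psi> h)"
  using rU k by (simp add: U.m_assoc)
 also have "... = sw U U (%a e. counit U e \<odot> (r \<otimes> a \<otimes> r' \<otimes> \<one> \<otimes> \<Psi> k)) (\<Psi> h)"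
  by (rule swc, rule U.sw_antipode_l[where G = "%t. _ \<otimes> t \<otimes> \<Psi> k"]) (assumption | rule mlin rU h k)+
 also have "... = r \<otimes> \<Psi> h \<otimes> r' \<otimes> \<one> \<otimes> \<Psi> k"
  by (rule U.sw_counit_r) (assumption | rule mlin rU h k)+
 finally show "\<mu> (tns K H r h *[B] tns K H r' k) = \<mu> (tns K H r h) \<otimes> \<mu> (tns K H r' k)"
  using r h r' k rU by (simp add: U.m_assoc)
qed

lemma lin_comult_B: "lin_map (tensor K H) (tensor (tensor K H) (tensor K H)) (comult B)"
 unfolding B_simps by (assumption | rule mlin)+

text \<open>The coaction leg of the second coinvariant stands behind \<open>rh a\<close> in the
  first factor. Together they reassemble a leg of \<open>r\<close>, which is
  \<open>\<mu>_\<nu>\<close> read in Sweedler form.\<close>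

lemma \<mu>_comult:
 assumes t: "t : carrier (tensor K H)"
 shows "tensor_lift (tensor U U) (%a b. tns U U (\<mu> a) (\<mu> b)) (comult B t) = comult U (\<mu> t)"
proof (rule tensor_ext[OF vspace_K H.vU vspace_tensor _ _ _ t])
 let ?T = "tensor K H" and ?Z = "tensor (tensor K H) (tensor K H)" and ?UU = "tensor U U"
 let ?M = "tensor_lift ?UU (%a b. tns U U (\<mu> a) (\<mu> b))"
 have bM: "bilin ?T ?T ?UU (%a b. tns U U (\<mu> a) (\<mu> b))" by (assumption | rule mlin)+
 note lM = lin_map_tensor_lift[OF vspace_tensor vspace_tensor vspace_tensor bM]
 show "lin_map ?T ?UU (%t. ?M (comult B t))" by (rule lin_map_comp[OF lM lin_comult_B])
 show "lin_map ?T ?UU (%t. comult U (\<mu> t))" by (assumption | rule mlin)+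
 fix r h assume r: "r :[K]" and h: "h :[H]"
 note rU = K_sub[OF r]
 have "comult B (tns K H r h) = tensor_lift ?Z (%r1 r2.
   tensor_lift ?Z (%h1 h2. tensor_lift ?Z (%u r0.
   tns ?T ?T (tns K H r1 (u *[H] h1)) (tns K H r0 h2)) (coact K r2)) (comult H h)) (bcomult K r)"
  unfolding B_simps by (rule tensor_lift_tns) (assumption | rule mlin r h)+
 also have "... = sw U ?Z (%a b. tensor_lift ?Z (%h1 h2. tensor_lift ?Z (%u r0.
   tns ?T ?T (tns K H (rh a) (u *[H] h1)) (tns K H r0 h2)) (coact K (rh b))) (comult H h)) r"
  unfolding bcomult_K[OF r] by (rule lift_Comult) (assumption | rule mlin rU h)+
 also have "... = sw U ?Z (%a b. sw H ?Z (%h1 h2. tensor_lift ?Z (%u r0.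
   tns ?T ?T (tns K H (rh a) (u *[H] h1)) (tns K H r0 h2)) (Coact (rh b))) h) r"
  using h by (simp add: H.tensor_lift_sw coact_K)
 also have "... = sw U ?Z (%a b. sw H ?Z (%h1 h2. tensor_lift ?Z (%u r0.
   tns ?T ?T (tns K H (rh a) (u *[H] h1)) (tns K H r0 h2)) (Coact b)) h) r"
  by (rule sw_K_rh[OF r]) (assumption | rule mlin h)+
 also have "... = sw U ?Z (%a b. sw H ?Z (%h1 h2. sw U ?Z (%e f.
   tns ?T ?T (tns K H (rh a) (\<Phi> e *[H] h1)) (tns K H (rh f) h2)) b) h) r"
  by (rule swc, rule swc, rule lift_Coact) (assumption | rule mlin h)+
 finally have "?M (comult B (tns K H r h)) = ?M ..." by simp
 also have "... = sw U ?UU (%a b. ?M (sw H ?Z (%h1 h2. sw U ?Z (%e f.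
   tns ?T ?T (tns K H (rh a) (\<Phi> e *[H] h1)) (tns K H (rh f) h2)) b) h)) r"
  by (rule U.sw_push[OF lM]) (assumption | rule mlin h rU)+
 also have "... = sw U ?UU (%a b. sw H ?UU (%h1 h2. ?M (sw U ?Z (%e f.
   tns ?T ?T (tns K H (rh a) (\<Phi> e *[H] h1)) (tns K H (rh f) h2)) b)) h) r"
  by (rule swc, rule H.sw_push[OF lM]) (assumption | rule mlin h rU)+
 also have "... = sw U ?UU (%a b. sw H ?UU (%h1 h2. sw U ?UU (%e f. ?M (
   tns ?T ?T (tns K H (rh a) (\<Phi> e *[H] h1)) (tns K H (rh f) h2))) b) h) r"
  by (rule swc, rule swc, rule U.sw_push[OF lM]) (assumption | rule mlin h rU)+
 also have "... = sw U ?UU (%a b. sw H ?UU (%h1 h2. sw U ?UU (%e f.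
   tns U U ((rh a \<otimes> p e) \<otimes> \<Psi> h1) (rh f \<otimes> \<Psi> h2)) b) h) r"
  by (simp add: tensor_lift_tns bM p_def U.m_assoc)
 also have "... = sw U ?UU (%a b. sw U ?UU (%e f. sw H ?UU (%h1 h2.
   tns U U ((rh a \<otimes> p e) \<otimes> \<Psi> h1) (rh f \<otimes> \<Psi> h2)) h) b) r"
  by (rule swc, rule sw_swap) (assumption | rule mlin h rU)+
 also have "... = sw U ?UU (%g f. sw U ?UU (%a e. sw H ?UU (%h1 h2.
   tns U U ((rh a \<otimes> p e) \<otimes> \<Psi> h1) (rh f \<otimes> \<Psi> h2)) h) g) r"
  by (rule U.sw_coassoc[symmetric]) (assumption | rule mlin h rU)+
 also have "... = sw U ?UU (%g f. sw H ?UU (%h1 h2. tns U U (sw U U (%a e. rh a \<otimes> p e) g \<otimes> \<Psi> h1) (rh f \<otimes> \<Psi> h2)) h) r"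
  by (rule swc, rule U.sw_push[where g = "%t. sw H ?UU (%h1 h2. tns U U (t \<otimes> \<Psi> h1) (rh _ \<otimes> \<Psi> h2)) h", symmetric])
   (assumption | rule mlin h rU)+
 also have "... = sw U ?UU (%g f. sw H ?UU (%h1 h2. tns U U (g \<otimes> \<Psi> h1) (rh f \<otimes> \<Psi> h2)) h) r"
 proof -
  have "sw U U (%a e. rh a \<otimes> p e) g = g" if g: "g :[U]" for g
  proof -
   have "\<mu> (\<nu> g) = sw U U (%a b. rh a \<otimes> \<Psi> (\<Phi> b)) g"
    unfolding \<nu>_def by (rule U.sw_lift_tns[OF vspace_K H.vU U.vU bilin_\<mu> g]) (assumption | rule mlin)+
   then show ?thesis by (simp add: \<mu>_\<nu>[OF g] p_def)
  qed
  then show ?thesis by simp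
 qed
 also have "... = sw U ?UU (%g f. sw H ?UU (%h1 h2. tns U U (g \<otimes> \<Psi> h1) (f \<otimes> \<Psi> h2)) h) r"
  by (rule sw_K_rh[OF r]) (assumption | rule mlin h)+
 also have "... = sw U ?UU (%g f. sw U ?UU (%h1 h2. tns U U (g \<otimes> h1) (f \<otimes> h2)) (\<Psi> h)) r"
  by (rule swc, rule sw_\<Psi>[symmetric]) (assumption | rule mlin h)+
 also have "... = sw U ?UU (tns U U) (r \<otimes> \<Psi> h)"
  by (rule U.sw_mult[symmetric]) (assumption | rule mlin h rU)+
 also have "... = comult U (\<mu> (tns K H r h))" using r h rU by (simp add: U.sw_tns)
 finally show "?M (comult B (tns K H r h)) = comult U (\<mu> (tns K H r h))" .
qed

lemma \<mu>_counit:
 assumes t: "t : carrier (tensor K H)"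
 shows "counit B t = counit U (\<mu> t)"
proof (rule tensor_ext[OF vspace_K H.vU vspace_base_alg _ _ _ t])
 have b: "bilin K H base_alg (%r h. counit U r * counit H h)" by (assumption | rule mlin)+
 show "lin_map (tensor K H) base_alg (counit B)" unfolding B_simps by (assumption | rule mlin b)+
 show "lin_map (tensor K H) base_alg (%t. counit U (\<mu> t))" by (assumption | rule mlin)+
 fix r h assume "r :[K]" "h :[H]"
 then show "counit B (tns K H r h) = counit U (\<mu> (tns K H r h))"
  by (simp add: B_simps tensor_lift_tns b K_sub)
qed

lemma \<mu>_inj: "t : carrier (tensor K H) ==> t' : carrier (tensor K H) ==> \<mu> t = \<mu> t' ==> t = t'"
 using \<nu>_\<mu> by metis

text \<open>The Hopf axioms of the bosonization are transported from \<open>U\<close> along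
  \<open>\<nu>\<close>. As \<open>\<mu>\<close> respects the operations and is inverse to
  \<open>\<nu>\<close>, so does \<open>\<nu>\<close>.\<close>

theorem boson_iso: "hopf_iso B U \<mu>"
proof -
 let ?T = "tensor K H" and ?Z = "tensor (tensor K H) (tensor K H)" and ?UU = "tensor U U"
 have bM: "bilin ?T ?T ?UU (%a b. tns U U (\<mu> a) (\<mu> b))" by (assumption | rule mlin)+
 have bN: "bilin U U ?Z (%a b. tns ?T ?T (\<nu> a) (\<nu> b))" by (assumption | rule mlin)+
 have NM: "tensor_lift ?Z (%a b. tns ?T ?T (\<nu> a) (\<nu> b)) (tensor_lift ?UU (%a b. tns U U (\<mu> a) (\<mu> b)) z) = z"
  if z: "z :[?Z]" for z
 proof (rule tensor_ext[OF vspace_tensor vspace_tensor vspace_tensor _ lin_map_id _ z])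
  show "lin_map ?Z ?Z (%z. tensor_lift ?Z (%a b. tns ?T ?T (\<nu> a) (\<nu> b)) (tensor_lift ?UU (%a b. tns U U (\<mu> a) (\<mu> b)) z))"
   by (assumption | rule mlin bM bN)+
 qed (simp add: tensor_lift_tns bM bN \<nu>_\<mu>)
 have hB: "hopf_algebra B"
 proof (rule U.hopf_surj(1)[OF vspace_B, of \<nu>])
  show "lin_map U B \<nu>" unfolding lin_B by (assumption | rule mlin)+
  show "\<nu> ` carrier U = carrier B" unfolding B_simps
  proof safe
   fix t assume "t :[?T]"
   then show "t : \<nu> ` carrier U" using \<nu>_\<mu>[of t] \<mu>_closed[of t] by (metis image_eqI)
  qed simp
  show "\<nu> (x \<otimes> y) = \<nu> x *[B] \<nu> y" if "x :[U]" "y :[U]" for x y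
   by (rule \<mu>_inj) (use that bilin_closed[OF bilin_B_mult] in \<open>simp_all add: \<mu>_mult \<mu>_\<nu>\<close>)
  show "\<nu> \<one> = \<one>[B]" unfolding B_simps
   by (rule \<mu>_inj) (simp_all add: \<mu>_\<nu>)
  show "comult B (\<nu> x) = sw U (tensor B B) (%a b. tns B B (\<nu> a) (\<nu> b)) x" if x: "x :[U]" for x
  proof -
   have "comult B (\<nu> x) = tensor_lift ?Z (%a b. tns ?T ?T (\<nu> a) (\<nu> b)) (comult U x)"
    using NM[OF lin_map_closed[OF lin_comult_B \<nu>_closed[OF x]]] x by (simp add: \<mu>_comult \<mu>_\<nu>)
   then show ?thesis unfolding tensor_B using x by (simp add: U.tensor_lift_sw)
  qed
  show "counit B (\<nu> x) = counit U x" if "x :[U]" for x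
   using that by (simp add: \<mu>_counit \<mu>_\<nu>)
  show "\<nu> (U.S x) = \<zero>[B]" if x: "x :[U]" and 0: "\<nu> x = \<zero>[B]" for x
  proof -
   have "x = \<mu> (\<nu> x)" using x by (simp add: \<mu>_\<nu>)
   also have "... = \<zero>" unfolding 0 B_simps
    by (rule lin_map_zero[OF lin_\<mu>[OF lin_map_id]]) simp_all
   finally show ?thesis
    using lin_map_zero[OF U.lin_S0] lin_map_zero[OF lin_\<nu>[OF lin_map_id]] by (simp add: B_simps)
  qed
 qed
 have "bij_betw \<mu> (carrier B) (carrier U)"
  unfolding B_simps by (rule bij_betw_byWitness[where f' = \<nu>]) (use \<nu>_\<mu> \<mu>_\<nu> in auto)
 moreover have "hopf_hom B U \<mu>"
  unfolding hopf_hom_def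
 proof (intro conjI ballI hB U.hopf)
  show "alg_hom B U \<mu>"
   by (rule alg_homI) (auto simp: lin_B \<mu>_mult B_simps(1,5) intro: lin_\<mu>[OF lin_map_id])
  fix t assume "t :[B]"
  then have t: "t :[?T]" by (simp add: B_simps)
  show "comult U (\<mu> t) = tensor_lift ?UU (%a b. tns U U (\<mu> a) (\<mu> b)) (comult B t)"
   by (rule \<mu>_comult[OF t, symmetric])
  show "counit U (\<mu> t) = counit B t" by (rule \<mu>_counit[OF t, symmetric])
 qed
 ultimately show ?thesis by (simp add: hopf_iso_def)
qed

text \<open>Coinvariance of \<open>x\<close> turns the factor \<open>s\<close> in
  \<open>rh_mult\<close> into the unit, so \<open>rh\<close> is left linear over
  \<open>K\<close>.\<close>

lemma rh_K_mult:
 assumes x: "x :[K]" and y: "y :[U]"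
 shows "rh (x \<otimes> y) = x \<otimes> rh y"
proof -
 have "rh (x \<otimes> y) = sw U U (%a b. a \<otimes> rh y \<otimes> U.S (\<Psi> (\<Phi> b))) x"
  using rh_mult[OF K_sub[OF x] y] by (simp add: s_def p_def)
 also have "... = x \<otimes> rh y \<otimes> U.S (\<Psi> \<one>[H])"
  by (rule sw_K[where F = "%a h. a \<otimes> rh y \<otimes> U.S (\<Psi> h)", OF x]) (assumption | rule mlin y)+
 finally show ?thesis using K_sub[OF x] y by simp
qed

end

section \<open>Free modules\<close>

text \<open>Linearity is mostly stated over \<open>fmod UNIV\<close>, where no support condition
  arises; proper subsets \<open>A\<close> enter where a map is meaningful on certain words
  only.\<close>

definition fmod :: "'a set => ('k::field, ('a, 'k) poly_mapping) module" where
 "fmod A = \<lparr>carrier = {f. keys f \<subseteq> A}, monoid.mult = undefined, one = undefined, ring.zero = 0, add = (+), module.smult = scale\<rparr>"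

lemma fmod_simps[simp]: "carrier (fmod A) = {f. keys f \<subseteq> A}" "add (fmod A) = (+)" "\<zero>[fmod A] = 0"
 "module.smult (fmod A) = scale"
 by (simp_all add: fmod_def)

lemma vspace_fmod[simp, mlin]: "vspace (fmod A)"
 by (rule vspaceI) (auto simp: add_ac dest!: subsetD[OF Poly_Mapping.keys_add] subsetD[OF keys_scale_subset])

lemma fmod_UNIV_mem[mlin]: "f : carrier (fmod UNIV)" by simp

lemma lin_ext_lin:
 fixes Z :: "('k::field, 'z, 'm) module_scheme" and b :: "'a => 'z"
 assumes Z: "vspace Z" and b: "!!x. x : A ==> b x :[Z]"
 shows "lin_map (fmod A) Z (lin_ext Z b)"
proof (rule lin_map_I)
 fix f g :: "('a, 'k) poly_mapping" and c :: 'k assume "f : carrier (fmod A)" "g : carrier (fmod A)"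
 then have f: "keys f \<subseteq> A" and g: "keys g \<subseteq> A" by auto
 show "lin_ext Z b f :[Z]" by (rule lin_ext_closed[OF Z]) (use f b in auto)
 show "lin_ext Z b (f +[fmod A] g) = lin_ext Z b f +[Z] lin_ext Z b g"
  by (simp, rule lin_ext_add[OF Z]) (use f g b in auto)
 show "lin_ext Z b (c *:[fmod A] f) = c *:[Z] lin_ext Z b f"
  by (simp, rule lin_ext_scale[OF Z]) (use f b in auto)
qed

lemma fmod_ext:
 assumes f: "lin_map (fmod A) Z f" and g: "lin_map (fmod A) Z g" and Z: "vspace Z"
  and eq: "!!w. w : A ==> f (single w 1) = g (single w 1)" and x: "keys x \<subseteq> A"
 shows "f x = g x"
 using x
proof (induction rule: poly_mapping_lin_induct)
 case zero
 show ?case using lin_map_zero[OF f vspace_fmod Z] lin_map_zero[OF g vspace_fmod Z] by simp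
next
 case (single w c x)
 have s: "single w c = scale c (single w 1)" "single w 1 : carrier (fmod A)" "scale c (single w 1) : carrier (fmod A)" "x : carrier (fmod A)"
  using single by auto
 have "h (single w c + x) = c *:[Z] h (single w 1) +[Z] h x" if h: "lin_map (fmod A) Z h" for h
  using lin_map_add[OF h s(3,4)] lin_map_smult[OF h s(2), of c] unfolding fmod_simps s(1)[symmetric] by (simp only:)
 note h = this
 show ?case unfolding h[OF f] h[OF g] eq[OF single(2)] single(3) ..
qed

lemma lin_ext_lin_UNIV[mlin]:
 assumes "!!x. b x :[Z]" "vspace Z" "lin_map Y (fmod UNIV) f" shows "lin_map Y Z (%x. lin_ext Z b (f x))"
 by (rule lin_map_comp[OF lin_ext_lin assms(3)]) (use assms in auto)

lemma lin_fmod_add[mlin]: "lin_map Y (fmod A) f ==> lin_map Y (fmod A) g ==> lin_map Y (fmod A) (%x. f x + g x)"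
 using lin_map_add_fun[of "fmod A" Y f g] by simp
lemma lin_fmod_scale[mlin]: "lin_map Y (fmod A) f ==> lin_map Y (fmod A) (%x. scale c (f x))"
 using lin_map_smult_fun[of "fmod A" Y f c] by simp
lemma lin_base_add[mlin]: "lin_map Y base_alg f ==> lin_map Y base_alg g ==> lin_map Y base_alg (%x. f x + g x)"
 using lin_map_add_fun[of base_alg Y f g] by simp
lemma lin_fmod_scale_l[mlin]: "lin_map Y base_alg c ==> lin_map Y (fmod UNIV) (%x. scale (c x) f)"
 using lin_smult_l[of Y c f "fmod UNIV"] by simp
lemma lin_zero_fmod[mlin]: "lin_map Y (fmod A) (%x. 0)" and lin_zero_base[mlin]: "lin_map Y base_alg (%x. 0)"
 using lin_map_const_zero[of "fmod A" Y] lin_map_const_zero[of base_alg Y] by simp_all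
lemma lin_fmod_if[mlin]: "lin_map Y Z f ==> lin_map Y Z g ==> lin_map Y Z (%x. if P then f x else g x)"
 by (cases P) simp_all
lemma lin_lookup[mlin]: "lin_map Y (fmod UNIV) f ==> lin_map Y base_alg (%x. lookup (f x) w)"
 by (auto simp: lin_map_def lookup_add)

lemma lin_ext_fun_lin[mlin]:
 assumes "!!x. lin_map Y Z (%y. b y x)" "vspace Z" "vspace Y" shows "lin_map Y Z (%y. lin_ext Z (b y) f)"
proof -
 have "keys f \<subseteq> UNIV" by simp
 then show ?thesis
 proof (induction rule: poly_mapping_lin_induct)
  case zero then show ?case using lin_map_const_zero[OF assms(2)] assms(2) by simp
 next
  case (single x c f)
  show ?case
  proof (rule lin_map_cong[OF _ assms(3)])
   show "lin_map Y Z (%y. c *:[Z] b y x +[Z] lin_ext Z (b y) f)"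
    by (intro lin_map_add_fun lin_map_smult_fun assms single)
   fix y assume "y :[Y]"
   then have "b y z :[Z]" for z using lin_map_closed[OF assms(1)] by blast
   then show "lin_ext Z (b y) (single x c + f) = c *:[Z] b y x +[Z] lin_ext Z (b y) f"
    using assms(2) by (simp add: lin_ext_add)
  qed
 qed
qed

abbreviation lx :: "('a => ('b, 'k::field) poly_mapping) => ('a, 'k) poly_mapping => ('b, 'k) poly_mapping" where
 "lx \<equiv> lin_ext (fmod UNIV)"

lemma lx_simps[simp]: "lx b (f + g) = lx b f + lx b g" "lx b (scale c f) = scale c (lx b f)" "lx b (single x c) = scale c (b x)"
 "lx b 0 = 0"
 using lin_ext_add[of "fmod UNIV" b f g] lin_ext_scale[of "fmod UNIV" b f c] lin_ext_single[of "fmod UNIV" b x c] lin_ext_zero[of "fmod UNIV" b]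
 by simp_all

lemma lx_minus[simp]: "lx b (- f) = - lx b f" "lx b (f - g) = lx b f - lx b g"
 using lx_simps(2)[of b "-1" f] lx_simps(1)[of b f "scale (-1) g"] lx_simps(2)[of b "-1" g] by simp_all

lemma lin_ext_base_simps[simp]: "lin_ext base_alg b (f + g) = lin_ext base_alg b f + lin_ext base_alg b g"
 "lin_ext base_alg b (scale c f) = c * lin_ext base_alg b f" "lin_ext base_alg b (single x c) = c * b x" "lin_ext base_alg b 0 = 0"
 using lin_ext_add[of base_alg b f g] lin_ext_scale[of base_alg b f c] lin_ext_single[of base_alg b x c] lin_ext_zero[of base_alg b]
 by simp_all

lemma fmod_extU:
 assumes "lin_map (fmod UNIV) Z f" "lin_map (fmod UNIV) Z g" "vspace Z" "!!w. f (single w 1) = g (single w 1)"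
 shows "f x = g x"
 by (rule fmod_ext[OF assms(1,2,3)]) (use assms(4) in auto)

lemma lx_eq_sum: "lx b f = (\<Sum>x\<in>keys f. scale (lookup f x) (b x))"
proof -
 interpret abelian_group "fmod UNIV :: ('b, ('a, 'b) poly_mapping) module" by (rule vs_abelian_group) simp
 have "finsum (fmod UNIV) h A = sum h A" if "finite A" for h :: "'c => ('a, 'b) poly_mapping" and A
  using that by (induction A rule: finite_induct) (simp_all add: finsum_insert)
 then show ?thesis by (simp add: lin_ext_def)
qed

lemma keys_lx: "keys (lx b f) \<subseteq> (\<Union>x\<in>keys f. keys (b x))"
proof -
 have "keys (\<Sum>x\<in>A. scale (lookup f x) (b x)) \<subseteq> (\<Union>x\<in>A. keys (b x))" if "finite A" for A
  using that
 proof (induction A rule: finite_induct)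
  case (insert x A)
  then show ?case using Poly_Mapping.keys_add[of "scale (lookup f x) (b x)" "\<Sum>x\<in>A. scale (lookup f x) (b x)"]
    keys_scale_subset[of "lookup f x" "b x"] by auto
 qed simp
 then show ?thesis by (simp add: lx_eq_sum)
qed

lemma lin_map_lx: assumes "lin_map (fmod UNIV) Z g" "vspace Z" shows "g (lx b f) = lin_ext Z (%x. g (b x)) f"
proof -
 have c: "g x :[Z]" for x using lin_map_closed[OF assms(1)] by simp
 note [mlin] = lin_map_comp[OF assms(1)] c assms(2)
 show ?thesis
  by (rule fmod_extU[where x = f]) ((assumption | rule mlin)+ | simp add: assms lin_map_smult[OF assms(1), simplified] c)+
qed

section \<open>Skew derivations of the tensor algebra\<close>

text \<open>\<open>q i j\<close> are the braiding coefficients. The coproduct of a word is \<open>dl q w\<close>; \<open>der q i\<close> is the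
 skew derivation reading off the right tensor factor \<open>x\<^sub>i\<close>, and \<open>derL q i\<close> reads off the left one.\<close>

definition qw :: "('i => 'i => 'k::field) => 'i => 'i list => 'k" where "qw q i w = (\<Prod>j\<leftarrow>w. q i j)"
definition wq :: "('i => 'i => 'k::field) => 'i => 'i list => 'k" where "wq q i w = (\<Prod>j\<leftarrow>w. q j i)"

lemma qw_simps[simp]: "qw q i [] = 1" "qw q i (j # w) = q i j * qw q i w" "wq q i [] = 1" "wq q i (j # w) = q j i * wq q i w"
 "qw q i (v @ w) = qw q i v * qw q i w"
 by (simp_all add: qw_def wq_def)

definition cons :: "'i => ('i list, 'k::field) poly_mapping => ('i list, 'k) poly_mapping" where
 "cons j = lx (%w. single (j # w) 1)"
definition snoc :: "('i list, 'k::field) poly_mapping => 'i => ('i list, 'k) poly_mapping" where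
 "snoc f j = lx (%w. single (w @ [j]) 1) f"
text \<open>One operator covers the scaling by characters, the projections onto homogeneous parts
  and the restriction to words in a set of letters, so that \<open>NN_wt\<close> handles all of
  them.\<close>

definition wt :: "('i multiset => 'k) => ('i list, 'k::field) poly_mapping => ('i list, 'k) poly_mapping" where
 "wt c = lx (%w. single w (c (mset w)))"

primrec dl :: "('i => 'i => 'k::field) => 'i list => ('i list \<times> 'i list, 'k) poly_mapping" where
 "dl q [] = single ([], []) 1"
| "dl q (i # w) = lx (%(u, v). single (i # u, v) 1 + single (u, i # v) (qw q i u)) (dl q w)"

primrec der :: "('i => 'i => 'k::field) => 'i => 'i list => ('i list, 'k) poly_mapping" where
 "der q i [] = 0"
| "der q i (j # w) = cons j (der q i w) + (if i = j then single w (qw q i w) else 0)"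

primrec derL :: "('i => 'i => 'k::field) => 'i => 'i list => ('i list, 'k) poly_mapping" where
 "derL q i [] = 0"
| "derL q i (j # w) = scale (q j i) (cons j (derL q i w)) + (if i = j then single w 1 else 0)"

abbreviation "Der q i \<equiv> lx (der q i)"
abbreviation "DerL q i \<equiv> lx (derL q i)"

primrec derw :: "('i => 'i => 'k::field) => 'i list => ('i list, 'k) poly_mapping => ('i list, 'k) poly_mapping" where
 "derw q [] f = f"
| "derw q (i # w) f = derw q w (Der q i f)"

definition pr where "pr q w f = lookup (derw q w f) []"

text \<open>The radical of the pairing of words with the tensor algebra; it turns out to be the defining
 ideal of the Nichols algebra.\<close>

definition NN :: "('i => 'i => 'k::field) => ('i list, 'k) poly_mapping set" where
 "NN q = {f. \<forall>w. pr q w f = 0}"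

lemma lin_struct[mlin]:
 "lin_map Y (fmod UNIV) f ==> lin_map Y (fmod UNIV) (%x. cons j (f x))"
 "lin_map Y (fmod UNIV) f ==> lin_map Y (fmod UNIV) (%x. snoc (f x) j)"
 "lin_map Y (fmod UNIV) f ==> lin_map Y (fmod UNIV) (%x. wt c (f x))"
 unfolding cons_def snoc_def wt_def by - (assumption | rule mlin)+

lemma lin_derw[mlin]: "lin_map Y (fmod UNIV) f ==> lin_map Y (fmod UNIV) (%x. derw q w (f x))"
proof (induction w arbitrary: f)
 case (Cons i w)
 show ?case unfolding derw.simps by (rule Cons.IH) (assumption | rule mlin Cons.prems)+
qed simp
lemma lin_pr[mlin]: "lin_map Y (fmod UNIV) f ==> lin_map Y base_alg (%x. pr q w (f x))"
 unfolding pr_def by (assumption | rule mlin)+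

lemma struct_simps[simp]:
 "cons j (f + g) = cons j f + cons j g" "cons j (scale c f) = scale c (cons j f)" "cons j (single w c) = single (j # w) c" "cons j 0 = 0"
 "snoc (f + g) j = snoc f j + snoc g j" "snoc (scale c f) j = scale c (snoc f j)" "snoc (single w c) j = single (w @ [j]) c" "snoc 0 j = 0"
 "wt d (f + g) = wt d f + wt d g" "wt d (scale c f) = scale c (wt d f)" "wt d (single w c) = single w (c * d (mset w))" "wt d 0 = 0"
 by (simp_all add: cons_def snoc_def wt_def)

lemma pr_simps[simp]: "pr q w (f + g) = pr q w f + pr q w g" "pr q w (scale c f) = c * pr q w f" "pr q w 0 = 0"
 "pr q [] f = lookup f []" "pr q (i # w) f = pr q w (Der q i f)"
proof -
 note l = lin_pr[OF lin_map_id, of q w]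
 show "pr q w (f + g) = pr q w f + pr q w g" "pr q w (scale c f) = c * pr q w f" "pr q w 0 = 0"
  using lin_map_add[OF l, of f g] lin_map_smult[OF l, of f c] lin_map_zero[OF l] by simp_all
qed (simp_all add: pr_def)

lemma NN_sub: "0 : NN q" "f : NN q ==> g : NN q ==> f + g : NN q" "f : NN q ==> scale c f : NN q"
 by (simp_all add: NN_def)

lemma NN_Der: "f : NN q ==> Der q i f : NN q"
 unfolding NN_def mem_Collect_eq by (metis pr_simps(5))

lemma NN_derw: "f : NN q ==> derw q w f : NN q"
 by (induction w arbitrary: f) (simp_all add: NN_Der)

lemma lx_cons_der: "Der q i (cons j f) = cons j (Der q i f) + (if i = j then lx (%w. single w (qw q i w)) f else 0)"
 by (rule fmod_extU[where x = f]) ((assumption | rule mlin)+ | simp)+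

lemma keys_der: "u : keys (der q i w) ==> mset w = add_mset i (mset u)"
proof (induction w arbitrary: u)
 case (Cons j w)
 then consider "u : keys (cons j (der q i w))" | "i = j" "u = w"
  using Poly_Mapping.keys_add[of "cons j (der q i w)" "if i = j then single w (qw q i w) else 0"] by (auto split: if_splits)
 then show ?case
 proof cases
  case 1
  then obtain v where "v : keys (der q i w)" "u = j # v"
   using keys_lx[of "%w. single (j # w) 1" "der q i w"] unfolding cons_def by auto
  then show ?thesis using Cons.IH by simp
 qed simp
qed simp

lemma keys_derL: "u : keys (derL q i w) ==> mset w = add_mset i (mset u)"
proof (induction w arbitrary: u)
 case (Cons j w)
 then consider "u : keys (cons j (derL q i w))" | "i = j" "u = w"
  using Poly_Mapping.keys_add[of "scale (q j i) (cons j (derL q i w))" "if i = j then single w 1 else 0"]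
   keys_scale_subset[of "q j i" "cons j (derL q i w)"] by (auto split: if_splits)
 then show ?case
 proof cases
  case 1
  then obtain v where "v : keys (derL q i w)" "u = j # v"
   using keys_lx[of "%w. single (j # w) 1" "derL q i w"] unfolding cons_def by auto
  then show ?thesis using Cons.IH by simp
 qed simp
qed simp

lemma lx_cong: "(!!x. x : keys f ==> b x = b' x) ==> lx b f = lx b' f"
 by (rule lin_ext_fun_cong)

lemma lx_id: "lx (%w. single w c) f = scale c f"
 by (rule fmod_extU[where x = f]) ((assumption | rule mlin)+ | simp)+

lemma wt_homog: "(!!u. u : keys f ==> c (mset u) = d) ==> wt c f = scale d f"
 unfolding wt_def lx_id[symmetric] by (rule lx_cong) simp

lemma Der_wt: "Der q i (wt c f) = wt (%m. c (add_mset i m)) (Der q i f)"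
proof (rule fmod_extU[where x = f])
 fix w
 have "wt (%m. c (add_mset i m)) (der q i w) = scale (c (mset w)) (der q i w)"
  by (rule wt_homog) (auto dest: keys_der)
 then show "Der q i (wt c (single w 1)) = wt (%m. c (add_mset i m)) (Der q i (single w 1))" by simp
qed (assumption | rule mlin | simp)+

text \<open>Each derivation removes one letter, so the pairing with \<open>w\<close> sees only words
  with the same multiset of letters, and on these \<open>wt c\<close> is a scalar.\<close>

lemma pr_wt: "pr q w (wt c f) = c (mset w) * pr q w f"
proof (induction w arbitrary: c f)
 case Nil
 show ?case unfolding pr_simps
  by (rule fmod_extU[where x = f]) ((assumption | rule mlin)+ | simp add: lookup_single when_def)+
qed (simp add: Der_wt)

lemma NN_wt: "f : NN q ==> wt c f : NN q" by (simp add: NN_def pr_wt)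

lemma qw_mset: "qw q i w = (\<Prod>j\<in>#mset w. q i j)" "wq q i w = (\<Prod>j\<in>#mset w. q j i)"
 by (induction w) simp_all

text \<open>By the skew Leibniz rule a derivative of \<open>x_j f\<close> is \<open>x_j\<close>
  times a derivative of \<open>f\<close>, plus possibly a weighted copy of \<open>f\<close>. Both
  inputs are radical again, hence the induction for all \<open>f\<close> at once.\<close>

lemma NN_cons: "f : NN q ==> cons j f : NN q"
proof -
 have "pr q w (cons j f) = 0" if "f : NN q" for w f
  using that
 proof (induction w arbitrary: f)
  case Nil
  have "lookup (cons j f) [] = (0 :: 'b)"
   by (rule fmod_extU[where x = f and g = "%_. 0"]) ((assumption | rule mlin)+ | simp add: lookup_single)+
  then show ?case by simp
 next
  case (Cons i w)
  have "lx (%w. single w (qw q i w)) f = wt (%m. \<Prod>j\<in>#m. q i j) f" by (simp add: wt_def qw_mset)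
  then have "lx (%w. single w (qw q i w)) f : NN q" using NN_wt[OF Cons.prems] by simp
  then show ?case using Cons.IH[OF NN_Der[OF Cons.prems]] by (auto simp: lx_cons_der NN_def)
 qed
 then show "f : NN q ==> cons j f : NN q" by (simp add: NN_def)
qed

lemma cons_snoc: "cons j (snoc f k) = snoc (cons j f) k"
 by (rule fmod_extU[where x = f]) ((assumption | rule mlin)+ | simp)+

lemma Der_snoc: "Der q i (snoc f j) = scale (q i j) (snoc (Der q i f) j) + (if i = j then f else 0)"
proof (rule fmod_extU[where x = f])
 fix w
 have "der q i (w @ [j]) = scale (q i j) (snoc (der q i w) j) + (if i = j then single w 1 else 0)"
  by (induction w) (auto simp: cons_snoc algebra_simps)
 then show "Der q i (snoc (single w 1) j) = scale (q i j) (snoc (Der q i (single w 1)) j) + (if i = j then single w 1 else 0)" by simp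
qed (assumption | rule mlin | simp)+

lemma NN_snoc: "f : NN q ==> snoc f j : NN q"
proof -
 have "pr q w (snoc f j) = 0" if "f : NN q" for w f
  using that
 proof (induction w arbitrary: f)
  case Nil
  have "lookup (snoc f j) [] = (0 :: 'b)"
   by (rule fmod_extU[where x = f and g = "%_. 0"]) ((assumption | rule mlin)+ | simp add: lookup_single)+
  then show ?case by simp
 next
  case (Cons i w)
  then show ?case using Cons.IH[OF NN_Der[OF Cons.prems]] by (simp add: Der_snoc) (simp add: NN_def)
 qed
 then show "f : NN q ==> snoc f j : NN q" by (simp add: NN_def)
qed

lemma lx_cons_derL: "DerL q i (cons j f) = scale (q j i) (cons j (DerL q i f)) + (if i = j then f else 0)"
 by (rule fmod_extU[where x = f]) ((assumption | rule mlin)+ | simp)+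

text \<open>Contractions of the left and of the right leg commute, a form of coassociativity. In the
  inductive step the weight attached by \<open>der\<close> has to be compared before and after the
  letter \<open>i\<close> is removed.\<close>

lemma DerL_Der: "DerL q i (Der q k f) = Der q k (DerL q i f)"
proof (rule fmod_extU[where x = f])
 fix w
 have "DerL q i (der q k w) = Der q k (derL q i w)"
 proof (induction w)
  case (Cons j w)
  have "scale (q k i) (lx (%w. single w (qw q k w)) f) = wt (%m. q k i * (\<Prod>j\<in>#m. q k j)) f" for f
   by (rule fmod_extU[where x = f]) ((assumption | rule mlin)+ | simp add: qw_mset)+
  also have "wt (%m. q k i * (\<Prod>j\<in>#m. q k j)) (derL q i w) = scale (qw q k w) (derL q i w)"
   by (rule wt_homog) (simp add: qw_mset keys_derL)
  finally have e: "scale (q k i) (lx (%w. single w (qw q k w)) (derL q i w)) = scale (qw q k w) (derL q i w)" .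
  show ?case using Cons e by (auto simp: lx_cons_derL lx_cons_der)
 qed simp
 then show "DerL q i (Der q k (single w 1)) = Der q k (DerL q i (single w 1))" by simp
qed (assumption | rule mlin | simp)+

text \<open>Left and right derivations have the same constant term, and \<open>DerL\<close> commutes
  with the right derivations that define the radical.\<close>

lemma NN_DerL: "f : NN q ==> DerL q i f : NN q"
proof -
 have "pr q w (DerL q i f) = 0" if "f : NN q" for w f
  using that
 proof (induction w arbitrary: f)
  case Nil
  have "lookup (DerL q i f) [] = lookup (Der q i f) []"
  proof (rule fmod_extU[where x = f])
   have z: "lookup (cons j g) [] = (0 :: 'b)" for j and g :: "('a list, 'b) poly_mapping"
    by (rule fmod_extU[where x = g and g = "%_. 0"]) ((assumption | rule mlin)+ | simp add: lookup_single)+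
   fix w show "lookup (DerL q i (single w 1)) [] = lookup (Der q i (single w 1)) []"
    by (cases w) (auto simp: lookup_add z lookup_single when_def)
  qed (assumption | rule mlin | simp)+
  then show ?case using NN_Der[OF Nil, of i] by (simp add: NN_def) (metis pr_simps(4))
 next
  case (Cons k w)
  then show ?case using Cons.IH[OF NN_Der[OF Cons.prems, of k]] by (simp add: DerL_Der)
 qed
 then show "f : NN q ==> DerL q i f : NN q" by (simp add: NN_def)
qed

text \<open>The twisted reversal describes the antipode: \<open>S(w # 1) = rho(w) # g\<^sub>w\<^sup>-\<^sup>1\<close>.\<close>

primrec rho :: "('i => 'i => 'k::field) => 'i list => ('i list, 'k) poly_mapping" where
 "rho q [] = single [] 1"
| "rho q (j # w) = scale (- inverse (q j j * wq q j w)) (snoc (rho q w) j)"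

lemma keys_rho: "u : keys (rho q w) ==> u = rev w"
proof (induction w arbitrary: u)
 case (Cons j w)
 then have "u : keys (snoc (rho q w) j)" using keys_scale_subset by fastforce
 then show ?case using Cons.IH keys_lx[of "%w. single (w @ [j]) 1" "rho q w"] unfolding snoc_def by fastforce
qed (simp split: if_splits)

text \<open>The antipode reverses words, so it exchanges the right skew derivation with the left
  one, up to the scalar for moving \<open>x_i\<close> and \<open>w\<close> past each other.\<close>

lemma Der_rho:
 assumes q: "!!i j. i : J ==> j : J ==> q i j ~= 0" and i: "i : J" and w: "w : lists J"
 shows "Der q i (rho q w) = lx (rho q) (scale (- inverse (wq q i w)) (derL q i w))"
 using w
proof (induction w)
 case (Cons j w)
 then have j: "j : J" and w: "w : lists J" by auto
 have wne: "wq q k w ~= 0" if "k : J" for k using w that by (induction w) (auto simp: q)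
 have rc: "lx (rho q) (cons j f) = lx (%w. scale (- inverse (q j j * wq q j w)) (snoc (rho q w) j)) f" for f
  by (rule fmod_extU[where x = f]) ((assumption | rule mlin)+ | simp)+
 have "lx (%u. scale (- inverse (q j j * wq q j u)) (snoc (rho q u) j)) (derL q i w)
  = lx (%u. scale (- inverse (q j j * wq q j w) * q i j) (snoc (rho q u) j)) (derL q i w)"
 proof (rule lx_cong)
  fix u assume "u : keys (derL q i w)"
  then have "wq q j w = q i j * wq q j u" by (auto simp: qw_mset dest!: keys_derL)
  then show "scale (- inverse (q j j * wq q j u)) (snoc (rho q u) j) = scale (- inverse (q j j * wq q j w) * q i j) (snoc (rho q u) j)"
   using q[OF i j] by (simp add: field_simps)
 qed
 also have "... = scale (- inverse (q j j * wq q j w) * q i j) (snoc (lx (rho q) (derL q i w)) j)"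
  by (rule fmod_extU[where x = "derL q i w"]) ((assumption | rule mlin)+ | simp)+
 finally have e: "lx (rho q) (cons j (derL q i w)) = scale (- inverse (q j j * wq q j w) * q i j) (snoc (lx (rho q) (derL q i w)) j)"
  unfolding rc .
 let ?L = "lx (rho q) (derL q i w)"
 define A where "A = - inverse (wq q i w)"
 define A' where "A' = - inverse (wq q i (j # w))"
 define C where "C = - inverse (q j j * wq q j w)"
 have c: "A' * q j i = A" "i = j ==> A' = C"
  using q[OF j i] wne[OF i] by (auto simp: A_def A'_def C_def field_simps)
 have IH: "Der q i (rho q w) = scale A ?L" using Cons.IH unfolding A_def[symmetric] by simp
 have "Der q i (rho q (j # w)) = scale (C * q i j * A) (snoc ?L j) + (if i = j then scale C (rho q w) else 0)"
  unfolding rho.simps C_def[symmetric] lx_simps Der_snoc IH by (simp add: mult.assoc)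
 also have "... = scale (A' * q j i * (C * q i j)) (snoc ?L j) + (if i = j then scale A' (rho q w) else 0)"
  using c by (simp add: mult_ac)
 also have "... = lx (rho q) (scale A' (derL q i (j # w)))"
  using e unfolding C_def[symmetric] by (simp add: mult.assoc)
 finally show ?case unfolding A'_def .
qed simp

lemma NN_rho:
 assumes q: "!!i j. i : J ==> j : J ==> q i j ~= 0" and f: "f : NN q" "keys f \<subseteq> lists J"
 shows "lx (rho q) f : NN q"
proof -
 have sub: "keys (wt c f) \<subseteq> keys f" for c :: "'a multiset => 'b" and f
  using keys_lx[of "%w. single w (c (mset w))" f] unfolding wt_def by (auto split: if_splits)
 have subL: "keys (DerL q i f) \<subseteq> lists J" if "keys f \<subseteq> lists J" for f i
 proof
  fix u assume "u : keys (DerL q i f)"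
  then obtain w where w: "w : keys f" "u : keys (derL q i w)" using keys_lx[of "derL q i" f] by auto
  then have "set_mset (mset u) \<subseteq> set_mset (mset w)" using keys_derL[OF w(2)] by auto
  then show "u : lists J" using w that by auto
 qed
 \<comment> \<open>The coefficients are known to be nonzero on \<open>J\<close> only. A derivation
   by a letter outside \<open>J\<close> kills all words in \<open>J\<close> and is treated
   separately.\<close>
 have outJ: "Der q i (lx (rho q) f) = 0" if "i \<notin> J" "keys f \<subseteq> lists J" for i f
 proof -
  have "Der q i (lx (rho q) f) = lx (%w. Der q i (rho q w)) f" by (rule lin_map_lx) (assumption | rule mlin)+
  also have "... = lx (%w. 0) f"
  proof (rule lx_cong)
   fix w assume w: "w : keys f"
   have "lx (der q i) (rho q w) = lx (%_. 0) (rho q w)"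
   proof (rule lx_cong)
    fix u assume "u : keys (rho q w)"
    then have "set u \<subseteq> J" using keys_rho[of u q w] w that by auto
    have False if "v : keys (der q i u)" for v
    proof -
     have "i : set_mset (mset u)" unfolding keys_der[OF that] by simp
     then show False using \<open>set u \<subseteq> J\<close> \<open>i \<notin> J\<close> by auto
    qed
    then have "keys (der q i u) = {}" by blast
    then show "der q i u = 0" by simp
   qed
   then show "Der q i (rho q w) = 0" using lx_id[of 0 "rho q w"] by simp
  qed
  finally show ?thesis using lx_id[of 0 f] by simp
 qed
 have "pr q w (lx (rho q) f) = 0" if "f : NN q" "keys f \<subseteq> lists J" for w f
  using that
 proof (induction w arbitrary: f)
  case Nil
  have "lookup (lx (rho q) f) [] = lookup f []"
  proof (rule fmod_extU[where x = f])
   have z: "lookup (snoc g j) [] = (0 :: 'b)" for j and g :: "('a list, 'b) poly_mapping"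
    by (rule fmod_extU[where x = g and g = "%_. 0"]) ((assumption | rule mlin)+ | simp add: lookup_single)+
   fix w show "lookup (lx (rho q) (single w 1)) [] = lookup (single w 1) []"
    by (cases w) (auto simp: z lookup_single when_def)
  qed (assumption | rule mlin | simp)+
  then show ?case using Nil by (simp add: NN_def) (metis pr_simps(4))
 next
  case (Cons i w)
  show ?case
  proof (cases "i : J")
   case True
   let ?c = "%m. - inverse (\<Prod>j\<in>#m. q j i)"
   have "Der q i (lx (rho q) f) = lx (%w. Der q i (rho q w)) f" by (rule lin_map_lx) (assumption | rule mlin)+
   also have "... = lx (%w. lx (rho q) (DerL q i (single w (?c (mset w))))) f"
   proof (rule lx_cong)
    fix w assume "w : keys f"
    then have w: "w : lists J" using Cons.prems(2) by auto
    have "Der q i (rho q w) = lx (rho q) (scale (- inverse (wq q i w)) (derL q i w))"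
     by (rule Der_rho[of J q i w]) (use q True w in auto)
    then show "Der q i (rho q w) = lx (rho q) (DerL q i (single w (?c (mset w))))" by (simp add: qw_mset)
   qed
   also have "... = lx (rho q) (DerL q i (wt ?c f))"
    unfolding wt_def by (rule lin_map_lx[symmetric, where g = "%x. lx (rho q) (DerL q i x)"]) (assumption | rule mlin)+
   finally show ?thesis
    using Cons.IH[of "DerL q i (wt ?c f)"] NN_DerL[OF NN_wt[OF Cons.prems(1)]] subL[OF order_trans[OF sub Cons.prems(2)]]
    by simp
  qed (simp add: outJ Cons.prems)
 qed
 then show ?thesis using f by (simp add: NN_def)
qed

text \<open>Every skew derivation kills this element; for the letter \<open>j\<close> that is the
  relation \<open>q i j * q j i = 1\<close>.\<close>

lemma NN_commutator:
 assumes "i ~= j" "q i j * q j i = 1"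
 shows "single [i, j] 1 - single [j, i] (q i j) : NN q"
proof -
 have "pr q w (single [i, j] 1 + scale (- q i j) (single [j, i] 1)) = 0" for w
 proof (cases w)
  case (Cons k v)
  have "Der q k (single [i, j] 1 + scale (- q i j) (single [j, i] 1)) = 0"
   using assms by (auto simp: single_uminus mult.commute)
  then show ?thesis unfolding Cons pr_simps(5) by (simp only: pr_simps)
 qed (simp add: lookup_add lookup_single)
 then show ?thesis by (simp add: NN_def single_uminus)
qed

section \<open>A rank argument\<close>

text \<open>A sum of \<open>\<beta> a b\<close> over a list of pairs lies in \<open>W\<close> as soon as all contractions with the
 functionals \<open>\<phi> v\<close> lie in \<open>NA\<close>: eliminate one pair at a time by solving for its first component
 modulo \<open>NA\<close>.\<close>

context
 fixes Z :: "('k::field, 'z, 'm) module_scheme" and W :: "'z set"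
  and \<beta> :: "('a, 'k) poly_mapping => ('b, 'k) poly_mapping => 'z"
  and NA :: "('a, 'k) poly_mapping set" and \<phi> :: "'v => ('b, 'k) poly_mapping => 'k" and I :: "'v set"
 assumes Z: "vspace Z" and W0: "\<zero>[Z] : W" and Wadd: "!!x y. x : W ==> y : W ==> x +[Z] y : W"
  and \<beta>: "bilin (fmod UNIV) (fmod UNIV) Z \<beta>"
  and NA: "!!x y. x : NA ==> y : NA ==> x + y : NA" "!!c x. x : NA ==> scale c x : NA"
  and \<beta>A: "!!a b. a : NA ==> \<beta> a b : W"
  and \<beta>B: "!!a b. (!!v. v : I ==> \<phi> v b = 0) ==> \<beta> a b : W"
  and \<phi>: "!!v. v : I ==> lin_map (fmod UNIV) base_alg (\<phi> v)"
begin

lemma rank_list: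
 assumes "!!v. v : I ==> (\<Sum>(a, b)\<leftarrow>ps. scale (\<phi> v b) a) : NA"
 shows "foldr (%(a, b) z. \<beta> a b +[Z] z) ps \<zero>[Z] : W"
 using assms
proof (induction "length ps" arbitrary: ps)
 case (Suc n)
 let ?R = "%ps. foldr (%(a, b) z. \<beta> a b +[Z] z) ps \<zero>[Z]"
 obtain a b qs where ps: "ps = (a, b) # qs" and n: "n = length qs" using Suc(2) by (cases ps) auto
 have bc[simp]: "\<beta> x y :[Z]" for x y
  using bilin_closed[OF \<beta>, of x y] by simp
 have lin[simp]: "\<beta> (x + x') y = \<beta> x y +[Z] \<beta> x' y" "\<beta> x (y + y') = \<beta> x y +[Z] \<beta> x y'"
  "\<beta> (scale c x) y = c *:[Z] \<beta> x y" "\<beta> x (scale c y) = c *:[Z] \<beta> x y" for x x' y y' c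
  using lin_map_add[OF bilinD(2)[OF \<beta>, of y], of x x'] lin_map_add[OF bilinD(1)[OF \<beta>, of x], of y y']
   lin_map_smult[OF bilinD(2)[OF \<beta>, of y], of x c] lin_map_smult[OF bilinD(1)[OF \<beta>, of x], of y c] by simp_all
 have b0[simp]: "\<beta> 0 y = \<zero>[Z]" for y using lin_map_zero[OF bilinD(2)[OF \<beta>, of y] vspace_fmod Z] by simp
 have Rc[simp]: "?R xs :[Z]" for xs using Z by (induction xs) auto
 have f[simp]: "\<phi> u (x + y) = \<phi> u x + \<phi> u y" "\<phi> u (scale c x) = c * \<phi> u x" if "u : I" for u x y c
  using lin_map_add[OF \<phi>[OF that], of x y] lin_map_smult[OF \<phi>[OF that], of x c] by simp_all
 show ?case
 proof (cases "\<forall>v\<in>I. \<phi> v b = 0")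
  case True
  have "?R qs : W"
   by (rule Suc(1)[OF n]) (use Suc.prems True in \<open>auto simp: ps\<close>)
  then show ?thesis using Wadd[OF \<beta>B] True by (simp add: ps)
 next
  case False
  then obtain v where v: "v : I" "\<phi> v b ~= 0" by blast
  \<comment> \<open>With these multiples of \<open>b\<close> added, the other second components
    vanish under \<open>\<phi> v\<close>. Bilinearity moves the correction into the partner of
    \<open>b\<close>, and the hypothesis at \<open>v\<close> puts the corrected partner into
    \<open>NA\<close>.\<close>
  define e where "e b' = - (\<phi> v b' / \<phi> v b)" for b'
  let ?s = "%xs. \<Sum>(a', b')\<leftarrow>xs. scale (e b') a'" and ?S = "%u xs. \<Sum>(a', b')\<leftarrow>xs. scale (\<phi> u b') a'"
  let ?r = "map (%(a', b'). (a', b' + scale (e b') b))"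
  have 1: "?S u (?r xs) = ?S u xs + scale (\<phi> u b) (?s xs)" if "u : I" for u xs
   using that by (induction xs) (auto simp: algebra_simps)
  have 2: "?R (?r xs) = \<beta> (?s xs) b +[Z] ?R xs" for xs
   using Z by (induction xs) (auto simp: vs_ac)
  have "scale (\<phi> v b) (?s xs) = - ?S v xs" for xs
   using v(2) by (induction xs) (auto simp: e_def)
  from this[of qs] have "scale (1 / \<phi> v b) (?S v ps) = a + scale (1 / \<phi> v b) (- scale (\<phi> v b) (?s qs))"
   using v(2) by (simp add: ps)
  also have "... = a - ?s qs" using v(2) by simp
  finally have m: "a - ?s qs : NA" using NA(2)[OF Suc.prems[OF v(1)], of "1 / \<phi> v b"] by simp
  have "?R (?r qs) : W"
  proof (rule Suc(1))
   fix u assume u: "u : I"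
   have "?S u (?r qs) = ?S u ps + scale (- \<phi> u b) (a - ?s qs)"
    using 1[OF u, of qs] by (simp add: ps)
   then show "?S u (?r qs) : NA"
    using NA(1)[OF Suc.prems[OF u] NA(2)[OF m]] by (simp only:)
  qed (simp add: n)
  moreover have "?R ps = \<beta> ((a - ?s qs) + ?s qs) b +[Z] ?R qs" by (simp add: ps del: lin)
  then have "?R ps = \<beta> (a - ?s qs) b +[Z] ?R (?r qs)"
   unfolding 2 lin(1) using Z by (simp add: vs_assoc)
  ultimately show ?thesis using Wadd[OF \<beta>A[OF m]] by simp
 qed
qed (use W0 in simp)

text \<open>A finitely supported coordinate tensor is a list of pairs of one-word vectors, to which
  \<open>rank_list\<close> applies.\<close>

lemma rank_pm:
 assumes "!!v. v : I ==> lx (%(u, w). single u (\<phi> v (single w 1))) t : NA"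
 shows "lin_ext Z (%(u, w). \<beta> (single u 1) (single w 1)) t : W"
proof -
 let ?R = "%ps. foldr (%(a, b) z. \<beta> a b +[Z] z) ps \<zero>[Z]"
 have bc: "\<beta> x y :[Z]" for x y
  using bilin_closed[OF \<beta>, of x y] by simp
 have "keys t \<subseteq> UNIV" by simp
 then have "\<exists>ps. lin_ext Z (%(u, w). \<beta> (single u 1) (single w 1)) t = ?R ps &
   (\<forall>v. lx (%(u, w). single u (\<phi> v (single w 1))) t = (\<Sum>(a, b)\<leftarrow>ps. scale (\<phi> v b) a))"
 proof (induction t rule: poly_mapping_lin_induct)
  case zero
  show ?case by (rule exI[of _ "[]"]) (use Z in simp)
 next
  case (single x c t)
  obtain u w where x: "x = (u, w)" by force
  obtain ps where ps: "lin_ext Z (%(u, w). \<beta> (single u 1) (single w 1)) t = ?R ps"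
   "!!v. lx (%(u, w). single u (\<phi> v (single w 1))) t = (\<Sum>(a, b)\<leftarrow>ps. scale (\<phi> v b) a)"
   using single by blast
  have cl: "(%(u, w). \<beta> (single u 1) (single w 1)) : keys (single x c) \<union> keys t \<rightarrow> carrier Z"
   using bc by (auto split: prod.splits)
  have "\<beta> (single u c) (single w 1) = c *:[Z] \<beta> (single u 1) (single w 1)"
   using lin_map_smult[OF bilinD(2)[OF \<beta>, of "single w 1"], of "single u 1" c] by simp
  then have "lin_ext Z (%(u, w). \<beta> (single u 1) (single w 1)) (single x c + t) = ?R ((single u c, single w 1) # ps)"
   using lin_ext_add[OF Z cl] ps(1) Z x bc by simp
  then show ?case using ps
   by (intro exI[of _ "(single u c, single w 1) # ps"]) (auto simp: x mult.commute)
 qed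
 then obtain ps where e: "lin_ext Z (%(u, w). \<beta> (single u 1) (single w 1)) t = ?R ps"
  and s: "!!v. lx (%(u, w). single u (\<phi> v (single w 1))) t = (\<Sum>(a, b)\<leftarrow>ps. scale (\<phi> v b) a)" by blast
 show ?thesis unfolding e by (rule rank_list) (use assms s in auto)
qed

end

text \<open>The projection onto the span of the words in the letters \<open>J\<close>.\<close>

definition res where "res J = wt (%m. if set_mset m \<subseteq> J then 1 else 0)"

lemma lin_res[mlin]: "lin_map Y (fmod UNIV) f ==> lin_map Y (fmod UNIV) (%x. res J (f x))"
 unfolding res_def by (rule mlin)

lemma keys_res: "keys (res J f) \<subseteq> lists J"
proof -
 have "keys (res J f) \<subseteq> (\<Union>w\<in>keys f. keys (single w (if set w \<subseteq> J then 1 else 0 :: 'b)))"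
  using keys_lx[of "%w. single w (if set w \<subseteq> J then 1 else 0 :: 'b)" f] by (simp add: res_def wt_def)
 also have "... \<subseteq> lists J" by (auto split: if_splits)
 finally show ?thesis .
qed

lemma lin_res_fmod: "lin_map (fmod UNIV) (fmod (lists J)) (res J)"
 using keys_res by (intro lin_map_I) (simp_all add: res_def)

lemma res_single: "res J (single w c) = (if w : lists J then single w c else 0)"
 by (auto simp: res_def subset_eq)

lemma res_id: "keys f \<subseteq> lists J ==> res J f = f"
 unfolding res_def by (rule trans[OF wt_homog[where d = 1]]) (auto simp: subset_eq)

lemma NN_res: "f : NN q ==> res J f : NN q" unfolding res_def by (rule NN_wt)

text \<open>After restriction to words in \<open>J\<close>, the pairings with all other words vanish
  by weight.\<close>

lemma res_NN_I: "(!!v. v : lists J ==> pr q v f = 0) ==> res J f : NN q"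
 unfolding res_def NN_def mem_Collect_eq pr_wt by (simp add: lists_eq_set)

section \<open>The coproduct of words\<close>

text \<open>Contraction of the right tensor factor against the word \<open>w\<close>.\<close>

definition rp :: "('i => 'i => 'k::field) => 'i list => ('i list \<times> 'i list, 'k) poly_mapping => ('i list, 'k) poly_mapping" where
 "rp q w = lx (%(u, v). single u (pr q w (single v 1)))"

definition pairl :: "'i list => ('i list, 'k::field) poly_mapping => ('i list \<times> 'i list, 'k) poly_mapping" where
 "pairl u = lx (%v. single (u, v) 1)"

definition idder where "idder q i = lx (%(u, v). pairl u (der q i v))"

text \<open>Left multiplication by the coproduct of \<open>x_i\<close> in the braided tensor square.
  As a map on all coordinate tensors it lets the recursion for \<open>dl\<close> be used inside
  linear maps.\<close>

definition dstep where "dstep q i = lx (%(u, v). single (i # u, v) 1 + single (u, i # v) (qw q i u))"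

lemma lin_dl_struct[mlin]:
 "lin_map Y (fmod UNIV) f ==> lin_map Y (fmod UNIV) (%x. rp q w (f x))"
 "lin_map Y (fmod UNIV) g ==> lin_map Y (fmod UNIV) (%x. pairl u (g x))"
 "lin_map Y (fmod UNIV) f ==> lin_map Y (fmod UNIV) (%x. idder q i (f x))"
 "lin_map Y (fmod UNIV) f ==> lin_map Y (fmod UNIV) (%x. dstep q i (f x))"
 unfolding rp_def pairl_def idder_def dstep_def by - (assumption | rule mlin)+

lemma dl_struct_simps[simp]:
 "rp q w (f + g) = rp q w f + rp q w g" "rp q w (scale c f) = scale c (rp q w f)" "rp q w (single (u, v) c) = single u (c * pr q w (single v 1))"
 "pairl u (h + h') = pairl u h + pairl u h'" "pairl u (scale c h) = scale c (pairl u h)" "pairl u (single v c) = single (u, v) c"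
 "idder q i (f + g) = idder q i f + idder q i g" "idder q i (scale c f) = scale c (idder q i f)" "idder q i (single (u, v) c) = scale c (pairl u (der q i v))"
 "dstep q i (f + g) = dstep q i f + dstep q i g" "dstep q i (scale c f) = scale c (dstep q i f)"
 "dstep q i (single (u, v) c) = single (i # u, v) c + single (u, i # v) (c * qw q i u)"
 "rp q w 0 = 0" "pairl u 0 = 0" "idder q i 0 = 0" "dstep q i 0 = 0" "dl q (i # w) = dstep q i (dl q w)"
 by (simp_all add: rp_def pairl_def idder_def dstep_def)

declare dl.simps(2)[simp del]

lemma idder_dstep: "idder q i (dstep q j t) = dstep q j (idder q i t) + (if i = j then lx (%(u, v). single (u, v) (qw q i u * qw q i v)) t else 0)"
proof (rule fmod_extU[where x = t])
 fix x :: "'a list \<times> 'a list"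
 obtain u v where x: "x = (u, v)" by force
 have a: "pairl (j # u) g + scale (qw q j u) (pairl u (cons j g)) = dstep q j (pairl u g)" for g
  by (rule fmod_extU[where x = g]) ((assumption | rule mlin)+ | simp)+
 show "idder q i (dstep q j (single x 1)) = dstep q j (idder q i (single x 1)) + (if i = j then lx (%(u, v). single (u, v) (qw q i u * qw q i v)) (single x 1) else 0)"
  using a[of "der q i v"] by (auto simp: x algebra_simps)
qed (assumption | rule mlin | simp)+

lemma dl_weight: "lx (%(u, v). single (u, v) (qw q i u * qw q i v)) (dl q w) = scale (qw q i w) (dl q w)"
proof (induction w)
 case (Cons j w)
 have "lx (%(u, v). single (u, v) (qw q i u * qw q i v)) (dstep q j t) = scale (q i j) (dstep q j (lx (%(u, v). single (u, v) (qw q i u * qw q i v)) t))" for t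
  by (rule fmod_extU[where x = t]) ((assumption | rule mlin)+ | auto simp: algebra_simps split_beta)+
 then show ?case using Cons by simp
qed simp

text \<open>In coordinates this is coassociativity: a derivation is the contraction of a right leg
  of the coproduct.\<close>

lemma dl_der: "idder q i (dl q w) = lx (dl q) (der q i w)"
proof (induction w)
 case (Cons j w)
 have "lx (dl q) (cons j g) = dstep q j (lx (dl q) g)" for g
  by (rule fmod_extU[where x = g]) ((assumption | rule mlin)+ | simp)+
 then show ?case using Cons by (auto simp: idder_dstep dl_weight)
qed simp

lemma rp_idder: "rp q w (idder q i t) = rp q (i # w) t"
proof (rule fmod_extU[where x = t])
 fix x :: "'a list \<times> 'a list"
 obtain u v where x: "x = (u, v)" by force
 have "rp q w (pairl u g) = single u (pr q w g)" for g
  by (rule fmod_extU[where x = g])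
   ((assumption | rule mlin)+ | auto intro!: lin_map_I simp: single_add)+
 then show "rp q w (idder q i (single x 1)) = rp q (i # w) (single x 1)" by (simp add: x)
qed (assumption | rule mlin | simp)+

text \<open>All contractions of the coproduct of a radical element are iterated derivatives and thus
  radical, which is the input that \<open>rank_pm\<close> asks for.\<close>

lemma rp_dl: "rp q w (lx (dl q) f) = derw q w f"
proof (induction w arbitrary: f)
 case Nil
 have d: "rp q [] (dl q v) = single v 1" for v
 proof (induction v)
  case (Cons i v)
  have "rp q [] (dstep q i t) = cons i (rp q [] t)" for t
   by (rule fmod_extU[where x = t]) ((assumption | rule mlin)+ | auto simp: lookup_single when_def)+
  then show ?case using Cons by simp
 qed simp
 have "rp q [] (lx (dl q) f) = f"
  by (rule fmod_extU[where x = f]) ((assumption | rule mlin)+ | simp add: d)+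
 then show ?case by simp
next
 case (Cons i w)
 have "idder q i (lx (dl q) f) = lx (dl q) (Der q i f)"
  by (rule fmod_extU[where x = f]) ((assumption | rule mlin)+ | simp add: dl_der)+
 then show ?case using Cons[of "Der q i f"] by (simp flip: rp_idder)
qed

lemma keys_dl: "w : lists J ==> keys (dl q w) \<subseteq> lists J \<times> lists J"
proof (induction w)
 case (Cons i w)
 have "keys (dstep q i (dl q w)) \<subseteq> (\<Union>x\<in>keys (dl q w). keys (case x of (u, v) => single (i # u, v) 1 + single (u, i # v) (qw q i u)))"
  unfolding dstep_def by (rule keys_lx)
 also have "... \<subseteq> (\<Union>(u, v)\<in>keys (dl q w). {(i # u, v), (u, i # v)})"
  using Poly_Mapping.keys_add by (fastforce split: if_splits)
 also have "... \<subseteq> lists J \<times> lists J" using Cons by fastforce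
 finally show ?case by simp
qed simp

lemma dl_mset: "(u, v) : keys (dl q w) ==> mset w = mset u + mset v"
proof (induction w arbitrary: u v)
 case (Cons i w)
 have "keys (dstep q i (dl q w)) \<subseteq> (\<Union>x\<in>keys (dl q w). keys (case x of (u, v) => single (i # u, v) 1 + single (u, i # v) (qw q i u)))"
  unfolding dstep_def by (rule keys_lx)
 also have "... \<subseteq> (\<Union>(u, v)\<in>keys (dl q w). {(i # u, v), (u, i # v)})"
  using Poly_Mapping.keys_add by (fastforce split: if_splits)
 finally show ?case using Cons by fastforce
qed (simp split: if_splits)

section \<open>Orthogonal decompositions\<close>

text \<open>\<open>shuf\<close> moves the letters in \<open>A\<close> to the left, using that the letters outside \<open>A\<close> commute with
 them up to the factors \<open>q i j\<close>.\<close>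

primrec shc :: "('i => 'i => 'k::field) => 'i set => 'i list => 'k" where
 "shc q A [] = 1"
| "shc q A (i # w) = (if i : A then 1 else qw q i (filter (%j. j : A) w)) * shc q A w"

definition shuf where
 "shuf q A = lx (%w. single (filter (%j. j : A) w, filter (%j. j \<notin> A) w) (shc q A w))"

lemma lin_shuf[mlin]: "lin_map Y (fmod UNIV) f ==> lin_map Y (fmod UNIV) (%x. shuf q A (f x))"
 unfolding shuf_def by (assumption | rule mlin)+

lemma shuf_simps[simp]: "shuf q A (f + g) = shuf q A f + shuf q A g" "shuf q A (scale c f) = scale c (shuf q A f)" "shuf q A 0 = 0"
 "shuf q A (single w c) = single (filter (%j. j : A) w, filter (%j. j \<notin> A) w) (c * shc q A w)"
 by (simp_all add: shuf_def)

lemma qw_split: "qw q i w = qw q i (filter P w) * qw q i (filter (%j. \<not> P j) w)"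
 by (induction w) auto

text \<open>A letter outside \<open>A\<close> ends up in the right component only. The scalar that
  the derivation collects from letters of \<open>A\<close> is the one already stored in
  \<open>shc\<close>.\<close>

lemma shuf_der:
 assumes i: "i \<notin> A"
 shows "shuf q A (Der q i f) = idder q i (shuf q A f)"
proof (rule fmod_extU[where x = f])
 fix w
 have "shuf q A (der q i w) = idder q i (shuf q A (single w 1))"
 proof (induction w)
  case (Cons j w)
  show ?case
  proof (cases "j : A")
   case True
   let ?C = "lx (%(u, v). single (j # u, v) 1)"
   have 1: "shuf q A (cons j g) = ?C (shuf q A g)" for g
    by (rule fmod_extU[where x = g]) ((assumption | rule mlin)+ | simp add: True)+
   have 2: "?C (pairl u g) = pairl (j # u) g" for u and g :: "('a list, 'b) poly_mapping"
    by (rule fmod_extU[where x = g]) ((assumption | rule mlin)+ | simp)+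
   show ?thesis using True i Cons by (auto simp: 1 2)
  next
   case False
   let ?C = "lx (%(u, v). single (u, j # v) (qw q j u))"
   have 1: "shuf q A (cons j g) = ?C (shuf q A g)" for g
    by (rule fmod_extU[where x = g]) ((assumption | rule mlin)+ | simp add: False mult.commute)+
   have 2: "?C (pairl u g) = scale (qw q j u) (pairl u (cons j g))" for u and g :: "('a list, 'b) poly_mapping"
    by (rule fmod_extU[where x = g]) ((assumption | rule mlin)+ | simp)+
   show ?thesis using False Cons
    by (auto simp: 1 2 mult_ac qw_split[of q j w "%k. k : A"])
  qed
 qed simp
 then show "shuf q A (Der q i (single w 1)) = idder q i (shuf q A (single w 1))" by simp
qed (assumption | rule mlin | simp)+

text \<open>Words outside \<open>A\<close> contract the right component completely, and what remains
  is the part of the iterated derivative supported on \<open>A\<close>.\<close>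

lemma rp_shuf:
 assumes "set v \<inter> A = {}"
 shows "rp q v (shuf q A f) = res A (derw q v f)"
 using assms
proof (induction v arbitrary: f)
 case Nil
 have c: "set w \<subseteq> A ==> shc q A w = 1" for w by (induction w) auto
 have "rp q [] (shuf q A f) = res A f"
 proof (rule fmod_extU[where x = f])
  fix w
  have "filter (%j. j \<notin> A) w = [] \<longleftrightarrow> set w \<subseteq> A" "set w \<subseteq> A ==> filter (%j. j : A) w = w"
   by (auto simp: filter_empty_conv filter_id_conv)
  then show "rp q [] (shuf q A (single w 1)) = res A (single w 1)"
   using c by (auto simp: res_single lookup_single when_def)
 qed (assumption | rule mlin | simp)+
 then show ?case by simp
next
 case (Cons i v)
 then show ?case by (simp flip: rp_idder add: shuf_der[symmetric])
qed

text \<open>The radical over an orthogonal union is generated by the radicals of the two parts and the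
 commutators: a multiplicative map that kills these kills the radical of the union.\<close>

lemma NN_union:
 fixes Z :: "('k::field, 'z, 'm) module_scheme" and A :: "'i set"
 assumes Z: "kalgebra Z" and AB: "A \<inter> B = {}"
  and \<phi>: "lin_map (fmod (lists (A \<union> B))) Z \<phi>"
  and mult: "!!u v. u : lists (A \<union> B) ==> v : lists (A \<union> B) ==> \<phi> (single (u @ v) 1) = \<phi> (single u 1) *[Z] \<phi> (single v 1)"
  and comm: "!!i j. i : B ==> j : A ==> \<phi> (single [i, j] 1) = q i j *:[Z] \<phi> (single [j, i] 1)"
  and kA: "!!f. f : NN q ==> keys f \<subseteq> lists A ==> \<phi> f = \<zero>[Z]"
  and kB: "!!f. f : NN q ==> keys f \<subseteq> lists B ==> \<phi> f = \<zero>[Z]"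
  and f: "f : NN q" "keys f \<subseteq> lists (A \<union> B)"
 shows "\<phi> f = \<zero>[Z]"
proof -
 note vZ = kalgebraD(1)[OF Z]
 have cl: "\<phi> x :[Z]" if "keys x \<subseteq> lists (A \<union> B)" for x using lin_map_closed[OF \<phi>] that by simp
 have cls: "\<phi> (single w 1) :[Z]" if "set w \<subseteq> A \<union> B" for w using cl[of "single w 1"] that by auto
 have mult': "\<phi> (single (i # w) 1) = \<phi> (single [i] 1) *[Z] \<phi> (single w 1)" if "i : A \<union> B" "set w \<subseteq> A \<union> B" for i w
  using mult[of "[i]" w] that by auto
 \<comment> \<open>A letter of \<open>B\<close> passes a word in \<open>A\<close> at the cost of the
   braiding scalar, by repeated use of \<open>comm\<close>.\<close>
 have move: "\<phi> (single [i] 1) *[Z] \<phi> (single w 1) = qw q i w *:[Z] (\<phi> (single w 1) *[Z] \<phi> (single [i] 1))"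
  if i: "i : B" and w: "set w \<subseteq> A" for i w
  using w
 proof (induction w)
  case Nil
  then show ?case using mult[of "[i]" "[]"] mult[of "[]" "[i]"] i vZ cls[of "[i]"] by simp
 next
  case (Cons j w)
  then have j: "j : A" "set w \<subseteq> A" by auto
  have c: "\<phi> (single [i] 1) :[Z]" "\<phi> (single [j] 1) :[Z]" "\<phi> (single w 1) :[Z]"
   using i j by (auto intro!: cls)
  have ij: "\<phi> (single [i] 1) *[Z] \<phi> (single [j] 1) = q i j *:[Z] (\<phi> (single [j] 1) *[Z] \<phi> (single [i] 1))"
   using comm[OF i j(1)] mult[of "[i]" "[j]"] mult[of "[j]" "[i]"] i j by simp
  have "\<phi> (single [i] 1) *[Z] (\<phi> (single [j] 1) *[Z] \<phi> (single w 1))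
   = (\<phi> (single [i] 1) *[Z] \<phi> (single [j] 1)) *[Z] \<phi> (single w 1)"
   using c Z by (simp add: kalg_assoc)
  also have "... = q i j *:[Z] (\<phi> (single [j] 1) *[Z] (\<phi> (single [i] 1) *[Z] \<phi> (single w 1)))"
   unfolding ij using c Z by (simp add: kalg_assoc kalgebraD)
  also have "... = (q i j * qw q i w) *:[Z] (\<phi> (single [j] 1) *[Z] (\<phi> (single w 1) *[Z] \<phi> (single [i] 1)))"
   unfolding Cons.IH[OF j(2)] using c Z vZ by (simp add: kalgebraD(4) vs_smult_smult)
  moreover have "\<phi> (single (j # w) 1) = \<phi> (single [j] 1) *[Z] \<phi> (single w 1)"
   by (rule mult') (use j in auto)
  ultimately show ?case using c Z by (simp add: kalg_assoc)
 qed
 let ?\<beta> = "%a b. \<phi> a *[Z] \<phi> b"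
 have sh: "\<phi> (single w 1) = shc q A w *:[Z] ?\<beta> (single (filter (%j. j : A) w) 1) (single (filter (%j. j \<notin> A) w) 1)"
  if w: "set w \<subseteq> A \<union> B" for w
  using w
 proof (induction w)
  case Nil
  then show ?case using mult[of "[]" "[]"] cls[of "[]"] vZ Z by simp
 next
  case (Cons i w)
  let ?a = "\<phi> (single (filter (%j. j : A) w) 1)" and ?b = "\<phi> (single (filter (%j. j \<notin> A) w) 1)" and ?i = "\<phi> (single [i] 1)"
  have w: "set w \<subseteq> A \<union> B" "i : A \<union> B" using Cons.prems by auto
  have c: "?a :[Z]" "?b :[Z]" "?i :[Z]" using w by (auto intro!: cls)
  have e: "\<phi> (single (i # w) 1) = shc q A w *:[Z] ((?i *[Z] ?a) *[Z] ?b)"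
   using mult'[OF w(2,1)] Cons.IH[OF w(1)] c Z by (simp add: kalg_assoc kalgebraD(4))
  show ?case
  proof (cases "i : A")
   case True
   have "\<phi> (single (i # filter (%j. j : A) w) 1) = ?i *[Z] ?a"
    by (rule mult') (use w in auto)
   then show ?thesis using e True by simp
  next
   case False
   have "?i *[Z] ?a = qw q i (filter (%j. j : A) w) *:[Z] (?a *[Z] ?i)"
    by (rule move) (use False w in auto)
   moreover have "\<phi> (single (i # filter (%j. j \<notin> A) w) 1) = ?i *[Z] ?b"
    by (rule mult') (use w in auto)
   ultimately show ?thesis using False e c Z vZ
    by (simp add: kalgebraD(3) kalg_assoc vs_smult_smult mult.commute)
  qed
 qed
 \<comment> \<open>Restricting by \<open>res\<close> extends the product of values to all of
   \<open>fmod UNIV\<close>, where elimination takes place; on shuffled words it changes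
   nothing.\<close>
 let ?\<gamma> = "%a b. \<phi> (res A a) *[Z] \<phi> (res B b)"
 have lr: "lin_map (fmod UNIV) Z (%x. \<phi> (res C x))" if "C \<subseteq> A \<union> B" for C
 proof (rule lin_map_comp[OF \<phi>])
  show "lin_map (fmod UNIV) (fmod (lists (A \<union> B))) (res C)"
   using lin_res_fmod[of C] lists_mono[OF that] unfolding lin_map_def by auto
 qed
 note rA = lr[of A] and rB = lr[of B]
 have b: "bilin (fmod UNIV) (fmod UNIV) Z ?\<gamma>"
  using lin_map_closed[OF rA] lin_map_closed[OF rB]
  by (intro bilinI lin_kmult_l lin_kmult_r rA rB Z) auto
 \<comment> \<open>Elimination with target zero: contractions of the shuffled element with words in
   \<open>B\<close> are restrictions of derivatives of \<open>f\<close>, hence radical.\<close>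
 have "lin_ext Z (%(u, w). ?\<gamma> (single u 1) (single w 1)) (shuf q A f) : {\<zero>[Z]}"
 proof (rule rank_pm[where NA = "NN q" and I = "lists B" and \<phi> = "pr q", OF vZ _ _ b])
  show "?\<gamma> a b : {\<zero>[Z]}" if "a : NN q" for a b
   using kA[OF NN_res[OF that] keys_res] lin_map_closed[OF rB, of b] ring.ring_simprules(24)[OF kalgebraD(2)[OF Z]] by simp
  show "lin_map (fmod UNIV) base_alg (pr q v)" for v
   using lin_pr[OF lin_map_id, of q v] .
  show "?\<gamma> a b : {\<zero>[Z]}" if "!!v. v : lists B ==> pr q v b = 0" for a b
   using kB[OF res_NN_I[OF that] keys_res] lin_map_closed[OF rA, of a] ring.ring_simprules(25)[OF kalgebraD(2)[OF Z]] by simp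
  show "lx (%(u, w). single u (pr q v (single w 1))) (shuf q A f) : NN q" if "v : lists B" for v
  proof -
   have "set v \<inter> A = {}" using that AB by (auto simp: in_lists_conv_set)
   then show ?thesis using rp_shuf[of v A q f] NN_res[OF NN_derw[OF f(1)]] unfolding rp_def by simp
  qed
 qed (use vZ in \<open>auto simp: NN_sub\<close>)
 moreover have "\<phi> (res (A \<union> B) f) = lin_ext Z (%(u, w). ?\<gamma> (single u 1) (single w 1)) (shuf q A (res (A \<union> B) f))"
 proof (rule fmod_extU[where x = f, OF lr _ vZ])
  have gc: "!!x. (case x of (u, w) => ?\<gamma> (single u 1) (single w 1)) :[Z]"
   using bilin_closed[OF b] by (auto split: prod.split)
  show "lin_map (fmod UNIV) Z (%f. lin_ext Z (%(u, w). ?\<gamma> (single u 1) (single w 1)) (shuf q A (res (A \<union> B) f)))"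
   by (assumption | rule gc vZ mlin)+
  fix w :: "'i list"
  show "\<phi> (res (A \<union> B) (single w 1)) = lin_ext Z (%(u, w). ?\<gamma> (single u 1) (single w 1)) (shuf q A (res (A \<union> B) (single w 1)))"
  proof (cases "w : lists (A \<union> B)")
   case True
   then have "filter (%j. j : A) w : lists A" "filter (%j. j \<notin> A) w : lists B" by auto
   then show ?thesis using sh[of w] True vZ gc[of "(filter (%j. j : A) w, filter (%j. j \<notin> A) w)"] by (auto simp: res_single)
  next
   case False
   then show ?thesis using lin_map_zero[OF \<phi> vspace_fmod vZ] vZ by (simp add: res_single)
  qed
 qed simp
 ultimately show ?thesis using f(2) by (simp add: res_id)
qed

section \<open>The tensor algebra of a YD-datum\<close>

definition conc :: "('i list, 'k::field) poly_mapping => ('i list, 'k) poly_mapping => ('i list, 'k) poly_mapping" where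
 "conc f g = lx (%u. lx (%v. single (u @ v) 1) g) f"

definition ch :: "('i, 'g, 'k::field) yd_datum => 'i list => 'g => 'k" where "ch D w a = (\<Prod>i\<leftarrow>w. chr D i a)"
definition gr :: "('i, 'g::ab_group_add, 'k) yd_datum => 'i list => 'g" where "gr D w = (\<Sum>i\<leftarrow>w. grp D i)"

definition actf where "actf D h f = lx (%a. lx (%w. single w (ch D w a)) f) h"

definition coactf where "coactf D J = lin_ext (tensor (fmod UNIV) (fmod (lists J)))
 (%w. tns (fmod UNIV) (fmod (lists J)) (single (gr D w) 1) (single w 1))"

lemma ch_gr_simps[simp]: "ch D [] a = 1" "ch D (i # w) a = chr D i a * ch D w a" "ch D (v @ w) a = ch D v a * ch D w a"
 "gr D [] = 0" "gr D (i # w) = grp D i + gr D w" "gr D (v @ w) = gr D v + gr D w"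
 by (simp_all add: ch_def gr_def)

lemma ch_qw: "ch D w (grp D i) = qw (qq D) i w" by (simp add: ch_def qw_def qq_def)

lemma ch_gr_mset: "ch D w a = (\<Prod>i\<in>#mset w. chr D i a)" "gr D w = (\<Sum>i\<in>#mset w. grp D i)"
 by (induction w) simp_all

lemma scale_sum: "scale c (sum h A) = (\<Sum>x\<in>A. scale c (h x))"
 by (induction A rule: infinite_finite_induct) simp_all

lemma lin_map_fmod_iff: "lin_map Y (fmod A) f \<longleftrightarrow> lin_map Y (fmod UNIV) f & (\<forall>x\<in>carrier Y. keys (f x) \<subseteq> A)"
 by (auto simp: lin_map_def)

lemma lin_map_fmod_sub: "lin_map (fmod UNIV) Z f ==> lin_map (fmod A) Z f"
 by (auto simp: lin_map_def)

text \<open>\<open>lin_ext\<close> sees \<open>b\<close> on the keys of \<open>f\<close> only, so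
  \<open>b\<close> may be truncated to zero elsewhere; all its values then lie in
  \<open>fmod A\<close>.\<close>

lemma lin_ext_fmod:
 assumes "!!x. x : keys f ==> keys (b x) \<subseteq> A"
 shows "lin_ext (fmod A) b f = lx b f"
proof -
 define b' where "b' x = (if x : keys f then b x else 0)" for x
 have b': "keys (b' x) \<subseteq> A" for x using assms by (simp add: b'_def)
 have "lin_ext (fmod A) b' g = lx b' g" if "keys g \<subseteq> UNIV" for g
  using that
 proof (induction rule: poly_mapping_lin_induct)
  case (single x c g)
  show ?case using lin_ext_add[of "fmod A" b' "single x c" g] single lin_ext_single[of "fmod A" b' x c] b' by auto
 qed simp
 moreover have "lin_ext (fmod A) b f = lin_ext (fmod A) b' f" "lx b f = lx b' f"
  by (rule lin_ext_fun_cong, simp add: b'_def)+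
 ultimately show ?thesis by simp
qed

lemma lin_conc_U[mlin]:
 "lin_map Y (fmod UNIV) f ==> lin_map Y (fmod UNIV) (%x. conc (f x) g)"
 "vspace Y ==> lin_map Y (fmod UNIV) f ==> lin_map Y (fmod UNIV) (%x. conc g (f x))"
 "lin_map Y (fmod UNIV) f' ==> lin_map Y (fmod UNIV) (%x. actf D (f' x) h)"
 "vspace Y ==> lin_map Y (fmod UNIV) f ==> lin_map Y (fmod UNIV) (%x. actf D h' (f x))"
 unfolding conc_def actf_def by (assumption | rule mlin)+

lemma conc_simps[simp]: "conc (f + f') g = conc f g + conc f' g" "conc (scale c f) g = scale c (conc f g)"
 "conc f (g + g') = conc f g + conc f g'" "conc f (scale c g) = scale c (conc f g)"
 "conc (single u c) (single v d) = single (u @ v) (c * d)" "conc 0 g = 0" "conc f 0 = 0"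
 "conc (single [] c) g = scale c g" "conc (single [i] 1) g = cons i g"
proof -
 have l: "lin_map (fmod UNIV) (fmod UNIV) (conc f)"
  by (rule lin_conc_U) (simp_all add: lin_map_def)
 show "conc f (g + g') = conc f g + conc f g'" "conc f (scale c g) = scale c (conc f g)"
  using lin_map_add[OF l, of g g'] lin_map_smult[OF l, of g c] by simp_all
 show "conc f 0 = 0" using lin_map_zero[OF l] by simp
qed (simp_all add: conc_def cons_def lx_id[of 1] mult.commute)

lemma conc_nil[simp]: "conc f (single [] 1) = f"
 by (rule fmod_extU[where x = f]) ((assumption | rule mlin)+ | simp)+

lemma keys_conc: "keys f \<subseteq> lists J ==> keys g \<subseteq> lists J ==> keys (conc f g) \<subseteq> lists J"
 unfolding conc_def by (rule subset_trans[OF keys_lx], rule UN_least, rule subset_trans[OF keys_lx])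
  (auto simp: subset_eq in_lists_conv_set)

lemma keys_actf: "keys f \<subseteq> A ==> keys (actf D h f) \<subseteq> A"
 unfolding actf_def by (rule subset_trans[OF keys_lx], rule UN_least, rule subset_trans[OF keys_lx]) (auto split: if_splits)

lemma keys_lists_memI[mlin]: "keys f \<subseteq> A ==> f : carrier (fmod A)" by simp

lemma lin_conc[mlin]:
 "lin_map Y (fmod (lists J)) f ==> g : carrier (fmod (lists J)) ==> lin_map Y (fmod (lists J)) (%x. conc (f x) g)"
 "vspace Y ==> lin_map Y (fmod (lists J)) f ==> g : carrier (fmod (lists J)) ==> lin_map Y (fmod (lists J)) (%x. conc g (f x))"
 "lin_map Y (fmod UNIV) f' ==> h : carrier (fmod (lists J)) ==> lin_map Y (fmod (lists J)) (%x. actf D (f' x) h)"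
 "vspace Y ==> lin_map Y (fmod (lists J)) f ==> lin_map Y (fmod (lists J)) (%x. actf D h' (f x))"
 "f0 : carrier (fmod (lists J)) ==> g : carrier (fmod (lists J)) ==> conc f0 g : carrier (fmod (lists J))"
 "f0 : carrier (fmod (lists J)) ==> actf D h' f0 : carrier (fmod (lists J))"
 by (auto simp: lin_map_fmod_iff[of _ "lists J"] keys_conc keys_actf intro: lin_conc_U)

lemma lin_coactf[mlin]: "lin_map Y (fmod (lists J)) f ==> lin_map Y (tensor (fmod UNIV) (fmod (lists J))) (%x. coactf D J (f x))"
 unfolding coactf_def by (rule lin_map_comp[OF lin_ext_lin]) auto

lemma coactf_single[simp]: "w : lists J ==> coactf D J (single w 1) = tns (fmod UNIV) (fmod (lists J)) (single (gr D w) 1) (single w 1)"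
 unfolding coactf_def by (subst lin_ext_single) auto

lemma coactf_closed[mlin]: "f : carrier (fmod (lists J)) ==> coactf D J f : carrier (tensor (fmod UNIV) (fmod (lists J)))"
 using lin_map_closed[OF lin_coactf[OF lin_map_id]] .

lemma free_alg_mult: "f *[free_alg J] g = conc f g"
 unfolding conc_def lx_eq_sum by (simp add: free_alg_def scale_sum)

lemma tensor_yd_simps[simp]:
 "carrier (tensor_yd D J) = {f. keys f \<subseteq> lists J}" "add (tensor_yd D J) = (+)" "\<zero>[tensor_yd D J] = 0"
 "module.smult (tensor_yd D J) = scale" "\<one>[tensor_yd D J] = single [] 1" "f *[tensor_yd D J] g = conc f g"
 "carrier (tensor_hopf D J) = {f. keys f \<subseteq> lists J}" "add (tensor_hopf D J) = (+)" "\<zero>[tensor_hopf D J] = 0"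
 "module.smult (tensor_hopf D J) = scale" "\<one>[tensor_hopf D J] = single [] 1" "f *[tensor_hopf D J] g = conc f g"
 "act (tensor_hopf D J) = act (tensor_yd D J)" "coact (tensor_hopf D J) = coact (tensor_yd D J)"
 "bcounit (tensor_hopf D J) f = lookup f []"
 using free_alg_mult[of J f g]
 by (simp_all add: tensor_hopf_def tensor_yd_def free_alg_def module.defs yd.defs bhopf.defs Let_def)

lemma group_alg_simps[simp]:
 "carrier group_alg = UNIV" "add group_alg = (+)" "\<zero>[group_alg] = 0" "module.smult group_alg = scale"
 "\<one>[group_alg] = 1" "monoid.mult group_alg = (*)"
 by (simp_all add: group_alg_def group_mod_def module.defs bialg.defs)

lemma tensor_yd_tensor[simp]:
 "tensor (tensor_yd D J) (tensor_yd D J) = tensor (fmod (lists J)) (fmod (lists J))"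
 "tns (tensor_yd D J) (tensor_yd D J) = tns (fmod (lists J)) (fmod (lists J))"
 "tensor (tensor_hopf D J) (tensor_hopf D J) = tensor (fmod (lists J)) (fmod (lists J))"
 "tns (tensor_hopf D J) (tensor_hopf D J) = tns (fmod (lists J)) (fmod (lists J))"
 "tensor (tensor_hopf D J) group_alg = tensor (fmod (lists J)) (fmod UNIV)"
 "tns (tensor_hopf D J) group_alg = tns (fmod (lists J)) (fmod UNIV)"
 by (rule tensor_cong; simp)+

lemma group_mod_tensor:
 "tensor group_mod group_mod = tensor (fmod UNIV) (fmod UNIV)" "tns group_mod group_mod = tns (fmod UNIV) (fmod UNIV)"
 "tensor group_alg (free_alg J) = tensor (fmod UNIV) (fmod (lists J))" "tns group_alg (free_alg J) = tns (fmod UNIV) (fmod (lists J))"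
 by (rule tensor_cong; simp add: group_mod_def free_alg_def)+

lemma coact_tensor_yd[simp]: "coact (tensor_yd D J) = coactf D J"
 by (simp add: tensor_yd_def yd.defs module.defs Let_def coactf_def gr_def group_mod_tensor)

lemma act_tensor_yd:
 assumes "keys f \<subseteq> lists J"
 shows "act (tensor_yd D J) h f = actf D h f"
proof -
 have e: "lin_ext (free_alg J) b = lin_ext (fmod (lists J)) b" for b :: "'x => _"
  by (rule ext) (rule lin_ext_target_cong; simp add: free_alg_def)
 have k: "keys (lx (%w. single w (ch D w a)) f) \<subseteq> lists J" for a
  by (rule subset_trans[OF keys_lx]) (use assms in \<open>auto split: if_splits\<close>)
 have i: "lin_ext (fmod (lists J)) (%w. single w (ch D w a)) f = lx (%w. single w (ch D w a)) f" for a
  by (rule lin_ext_fmod) (use assms in auto)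
 have "act (tensor_yd D J) h f = lin_ext (fmod (lists J)) (%a. lin_ext (fmod (lists J)) (%w. single w (ch D w a)) f) h"
  by (simp add: tensor_yd_def yd.defs module.defs Let_def ch_def e)
 also have "... = actf D h f" unfolding i actf_def by (rule lin_ext_fmod) (rule k)
 finally show ?thesis .
qed

lemma kalgebra_tensor_hopf: "kalgebra (tensor_hopf D J)"
proof (rule kalgebraI)
 show "vspace (tensor_hopf D J)" by (rule vspace_transfer[of "fmod (lists J)"]) simp_all
 show "bilin (tensor_hopf D J) (tensor_hopf D J) (tensor_hopf D J) (%x y. x *[tensor_hopf D J] y)"
 proof -
  have "bilin (fmod (lists J)) (fmod (lists J)) (fmod (lists J)) conc"
   by (rule bilinI) (assumption | rule mlin lin_map_id)+
  then show ?thesis by (simp add: bilin_def lin_map_def)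
 qed
 fix x y z assume "x : carrier (tensor_hopf D J)" "y : carrier (tensor_hopf D J)" "z : carrier (tensor_hopf D J)"
 have 1: "conc (conc (single u 1) (single v 1)) z = conc (single u 1) (conc (single v 1) z)" for u v
  by (rule fmod_extU[where x = z]) ((assumption | rule mlin)+ | simp)+
 have 2: "conc (conc (single u 1) y) z = conc (single u 1) (conc y z)" for u
  by (rule fmod_extU[where x = y]) ((assumption | rule mlin)+ | simp only: 1)+
 have "conc (conc x y) z = conc x (conc y z)"
  by (rule fmod_extU[where x = x]) ((assumption | rule mlin)+ | simp only: 2)+
 then show "(x *[tensor_hopf D J] y) *[tensor_hopf D J] z = x *[tensor_hopf D J] (y *[tensor_hopf D J] z)" by simp
next
 fix x assume "x : carrier (tensor_hopf D J)"
 show "x *[tensor_hopf D J] \<one>[tensor_hopf D J] = x" by simp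
qed simp_all

text \<open>Computations with \<open>dl\<close> take place on pairs of words; this map carries them
  to the abstract tensor square.\<close>

definition em :: "'i set => ('i list \<times> 'i list, 'k::field) poly_mapping => ('k, ('i list, 'k) poly_mapping, ('i list, 'k) poly_mapping) tensor" where
 "em J = lin_ext (tensor (fmod (lists J)) (fmod (lists J))) (%(u, v). tns (fmod (lists J)) (fmod (lists J)) (single u 1) (single v 1))"

lemma tns_words[simp]: "u : lists J ==> v : lists J' ==>
 tns (fmod (lists J)) (fmod (lists J')) (single u c) (single v d) : carrier (tensor (fmod (lists J)) (fmod (lists J')))"
 by (rule tns_closed) (auto split: if_splits)

lemma lin_em: "lin_map (fmod (lists J \<times> lists J)) (tensor (fmod (lists J)) (fmod (lists J))) (em J)"
 unfolding em_def
proof (rule lin_ext_lin)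
 fix x assume "x : lists J \<times> lists J"
 then show "(case x of (u, v) => tns (fmod (lists J)) (fmod (lists J)) (single u 1) (single v (1 :: 'b)))
   : carrier (tensor (fmod (lists J)) (fmod (lists J)))"
  by (simp only: split_beta tns_words mem_Times_iff)
qed simp

lemma keys_lx_dl: "keys f \<subseteq> lists J ==> keys (lx (dl q) f) \<subseteq> lists J \<times> lists J"
 by (rule subset_trans[OF keys_lx], rule UN_least, rule keys_dl, rule subsetD)

section \<open>The Nichols ideal is the radical of the pairing\<close>

locale ydd =
 fixes D :: "('i, 'g::ab_group_add, 'k::field) yd_datum" and J :: "'i set"
 assumes D: "is_yd_datum D" and J: "J \<subseteq> Ind D"
begin

lemma chr_nz: "i : Ind D ==> chr D i a ~= 0" and chr_add: "i : Ind D ==> chr D i (a + b) = chr D i a * chr D i b"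
 using D by (simp_all add: is_yd_datum_def character_def)

lemma chr_0: "i : Ind D ==> chr D i 0 = 1"
 using chr_add[of i 0 0] chr_nz[of i 0] by simp

abbreviation "V \<equiv> fmod (lists J) :: ('k, ('i list, 'k) poly_mapping) module"

lemma ch_0: "w : lists J ==> ch D w 0 = 1" using J by (induction w) (auto simp: chr_0)

lemma actf_0: assumes "keys f \<subseteq> lists J" shows "actf D (single 0 1) f = f"
proof -
 have "actf D (single 0 1) f = lx (%w. single w (ch D w 0)) f" by (simp add: actf_def del: single_one)
 also have "... = lx (%w. single w 1) f" by (rule lx_cong) (use ch_0[OF subsetD[OF assms]] in simp)
 finally show ?thesis by (simp add: lx_id)
qed

text \<open>Against a pure tensor of words, only the summand with \<open>x_i\<close> in the right
  factor braids nontrivially, which produces the scalar \<open>qw\<close>. Iteration identifies the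
  comultiplication with \<open>dl\<close>.\<close>

lemma br_step:
 assumes i: "i : J" and t: "keys t \<subseteq> lists J \<times> lists J"
 shows "(tns V V (single [i] 1) (single [] 1) +[tensor V V] tns V V (single [] 1) (single [i] 1))
  *[braided_tensor_alg (tensor_yd D J)] em J t = em J (dstep (qq D) i t)"
proof -
 let ?Z = "tensor V V"
 define P where "P a b (t :: ('k, ('i list, 'k) poly_mapping, ('i list, 'k) poly_mapping) tensor) = tensor_lift ?Z (%c d. tensor_lift ?Z (%u b0. tns V V (conc a (actf D u c)) (conc b0 d)) (coactf D J b)) t" for a b t
 have iJ: "single [i] 1 :[V]" "single [] 1 :[V]" using i by auto
 have bc: "bilin V V ?Z (%c d. tensor_lift ?Z (%u b0. tns V V (conc a (actf D u c)) (conc b0 d)) (coactf D J b))"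
  if "a :[V]" "b :[V]" for a b
  using that by - (assumption | rule mlin bilinI)+
 have bP: "bilin V V ?Z (%a b. P a b t)" if "t :[?Z]" for t
  unfolding P_def using that by - (assumption | rule mlin bilinI)+
 have emc: "em J s :[?Z]" if "keys s \<subseteq> lists J \<times> lists J" for s
  using lin_map_closed[OF lin_em] that by simp
 note lem = lin_em
 have m: "s *[braided_tensor_alg (tensor_yd D J)] t = tensor_lift ?Z (%a b. P a b t) s"
  if "s :[?Z]" "t :[?Z]" for s t
 proof -
  have "s *[braided_tensor_alg (tensor_yd D J)] t = tensor_lift ?Z (%a b. tensor_lift ?Z (%c d. tensor_lift ?Z (%u b0.
    tns V V (conc a (act (tensor_yd D J) u c)) (conc b0 d)) (coactf D J b)) t) s"
   by (simp add: braided_tensor_alg_def Let_def)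
  also have "... = tensor_lift ?Z (%a b. P a b t) s"
   unfolding P_def
   by (rule tensor_lift_cong[OF _ _ _ that(1)], simp, simp, simp, rule tensor_lift_cong[OF _ _ _ that(2)], simp, simp, simp)
    (simp add: act_tensor_yd)
  finally show ?thesis .
 qed
 have 1: "(tns V V (single [i] 1) (single [] 1) +[tensor V V] tns V V (single [] 1) (single [i] 1))
  *[braided_tensor_alg (tensor_yd D J)] em J t = P (single [i] 1) (single [] 1) (em J t) +[?Z] P (single [] 1) (single [i] 1) (em J t)"
  using lin_map_add[OF lin_map_tensor_lift[OF _ _ _ bP[OF emc[OF t]]]] iJ emc[OF t]
  by (simp add: m tensor_lift_tns[OF _ _ _ bP] del: fmod_simps(1))
 have "P (single [i] 1) (single [] 1) (em J t) +[?Z] P (single [] 1) (single [i] 1) (em J t) = em J (dstep (qq D) i t)"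
 proof (rule fmod_ext[where A = "lists J \<times> lists J" and x = t])
  show "lin_map (fmod (lists J \<times> lists J)) ?Z (%t. P (single [i] 1) (single [] 1) (em J t) +[?Z] P (single [] 1) (single [i] 1) (em J t))"
   unfolding P_def
   by (intro lin_map_add_fun vspace_tensor vspace_fmod iJ
    lin_map_comp[OF lin_map_tensor_lift[OF vspace_fmod vspace_fmod vspace_tensor bc] lem])
  have "lin_map (fmod (lists J \<times> lists J)) (fmod (lists J \<times> lists J)) (dstep (qq D) i)"
   unfolding lin_map_fmod_iff[of _ "lists J \<times> lists J"]
  proof
   show "lin_map (fmod (lists J \<times> lists J)) (fmod UNIV) (dstep (qq D) i)"
    by (rule lin_map_fmod_sub) (assumption | rule mlin lin_map_id)+
   have "keys (dstep (qq D) i x) \<subseteq> lists J \<times> lists J" if "keys x \<subseteq> lists J \<times> lists J" for x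
    unfolding dstep_def
    by (rule subset_trans[OF keys_lx], rule UN_least)
     (use that i in \<open>fastforce split: if_splits dest!: subsetD[OF Poly_Mapping.keys_add]\<close>)
   then show "\<forall>x\<in>carrier (fmod (lists J \<times> lists J)). keys (dstep (qq D) i x) \<subseteq> lists J \<times> lists J" by simp
  qed
  then show "lin_map (fmod (lists J \<times> lists J)) ?Z (%t. em J (dstep (qq D) i t))"
   by (rule lin_map_comp[OF lem])
 next
  fix x assume "x : lists J \<times> lists J"
  then obtain u v where x: "x = (u, v)" "u : lists J" "v : lists J" by auto
  have c: "single u 1 :[V]" "single v 1 :[V]" "single (i # u) 1 :[V]" "single (i # v) 1 :[V]"
   using x i by auto
  have e: "em J (single (a, b) r) = r *:[?Z] tns V V (single a 1) (single b 1)" if "a : lists J" "b : lists J" for a b r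
   unfolding em_def using that by (subst lin_ext_single) auto
  have k: "lin_map V ?Z (%a. tns V V a (single (i # v) 1))" by (rule lin_tns_l[OF lin_map_id c(4)])
  have a: "actf D (single h 1) (single u 1) = single u (ch D u h)" for h by (simp add: actf_def)
  have "em J (dstep (qq D) i (single x 1)) = em J (single (i # u, v) 1) +[?Z] em J (single (u, i # v) (qw (qq D) i u))"
   using lin_map_add[OF lem, where x = "single (i # u, v) 1" and y = "single (u, i # v) (qw (qq D) i u)"] x i by (simp split: if_splits)
  moreover have pp: "P p (single y 1) (tns V V (single u 1) (single v 1)) = tns V V (conc p (actf D (single (gr D y) 1) (single u 1))) (conc (single y 1) (single v 1))"
   if "p :[V]" "y : lists J" for p y
  proof -
   have y: "single y 1 :[V]" using that by auto
   have "P p (single y 1) (tns V V (single u 1) (single v 1)) = tensor_lift ?Z (%ua b0. tns V V (conc p (actf D ua (single u 1))) (conc b0 (single v 1))) (coactf D J (single y 1))"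
    unfolding P_def by (rule tensor_lift_tns[OF _ _ _ bc]) (use that y c in simp_all)
   also have "... = tns V V (conc p (actf D (single (gr D y) 1) (single u 1))) (conc (single y 1) (single v 1))"
    unfolding coactf_single[OF that(2)] by (rule tensor_lift_tns) (insert that y c, (assumption | rule mlin)+)
   finally show ?thesis .
  qed
  moreover have "P (single [i] 1) (single [] 1) (em J (single x 1)) = em J (single (i # u, v) 1)"
   using x i pp[OF iJ(1), of "[]"] actf_0[of "single u 1"] by (simp add: e)
  moreover have "P (single [] 1) (single [i] 1) (em J (single x 1)) = em J (single (u, i # v) (qw (qq D) i u))"
   using x i pp[OF iJ(2), of "[i]"] lin_map_smult[OF k c(1), of "qw (qq D) i u"] by (simp add: e a ch_qw)
  ultimately show "P (single [i] 1) (single [] 1) (em J (single x 1)) +[?Z] P (single [] 1) (single [i] 1) (em J (single x 1)) = em J (dstep (qq D) i (single x 1))"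
   by simp
 qed (use t in simp_all)
 with 1 show ?thesis by simp
qed

lemma word_comult_dl: "w : lists J ==> word_comult D J w = em J (dl (qq D) w)"
proof (induction w)
 case Nil
 show ?case by (simp add: braided_tensor_alg_def Let_def em_def)
next
 case (Cons i w)
 then show ?case using br_step[of i "dl (qq D) w"] keys_dl[of w J "qq D"] by (simp add: Let_def)
qed

lemma bcomult_dl:
 assumes "keys f \<subseteq> lists J"
 shows "bcomult (tensor_hopf D J) f = em J (lx (dl (qq D)) f)"
proof -
 have "bcomult (tensor_hopf D J) f = lin_ext (tensor V V) (%w. em J (dl (qq D) w)) f"
 proof -
  have "bcomult (tensor_hopf D J) f = lin_ext (tensor V V) (word_comult D J) f"
   by (simp add: tensor_hopf_def Let_def yd.defs bhopf.defs)
  also have "... = lin_ext (tensor V V) (%w. em J (dl (qq D) w)) f"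
   by (rule lin_ext_fun_cong) (rule word_comult_dl[OF subsetD[OF assms]])
  finally show ?thesis .
 qed
 also have "... = em J (lx (dl (qq D)) f)"
  using assms
 proof (induction f rule: poly_mapping_lin_induct)
  case (single w c f)
  note lem = lin_em[of J]
  have k: "keys (lx (dl (qq D)) f) \<subseteq> lists J \<times> lists J"
   by (rule keys_lx_dl[OF single.hyps(1)])
  have m: "em J (dl (qq D) w) : carrier (tensor V V)" if "w : lists J" for w
   using lin_map_closed[OF lem, of "dl (qq D) w"] keys_dl[OF that, of "qq D"] by simp
  have "keys (single w c) \<union> keys f \<subseteq> lists J" using single by auto
  then have "(%w. em J (dl (qq D) w)) : keys (single w c) \<union> keys f \<rightarrow> carrier (tensor V V)"
   using m by blast
  then have "lin_ext (tensor V V) (%w. em J (dl (qq D) w)) (single w c + f)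
   = c *:[tensor V V] em J (dl (qq D) w) +[tensor V V] em J (lx (dl (qq D)) f)"
   using lin_ext_add[where V = "tensor V V" and b = "%w. em J (dl (qq D) w)" and f = "single w c" and g = f] lin_ext_single[where b = "%w. em J (dl (qq D) w)", OF vspace_tensor m[OF single.hyps(2)], of c] single.IH by (simp del: keys_single)
  also have "... = em J (scale c (dl (qq D) w)) +[tensor V V] em J (lx (dl (qq D)) f)"
   using lin_map_smult[OF lem, where x = "dl (qq D) w" and c = c] keys_dl[OF single.hyps(2), of "qq D"] by simp
  also have "... = em J (scale c (dl (qq D) w) + lx (dl (qq D)) f)"
   using lin_map_add[OF lem, where x = "scale c (dl (qq D) w)" and y = "lx (dl (qq D)) f"] k
    subset_trans[OF keys_scale_subset keys_dl[OF single.hyps(2), of "qq D"]] by simp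
  finally show ?case by simp
 qed (simp add: em_def)
 finally show ?thesis .
qed

definition "NJ = {f : NN (qq D). keys f \<subseteq> lists J}"

lemma NJ_sub: "0 : NJ" "f : NJ ==> g : NJ ==> f + g : NJ" "f : NJ ==> scale c f : NJ"
 using subset_trans[OF Poly_Mapping.keys_add[of f g], of "lists J"] subset_trans[OF keys_scale_subset[of c f], of "lists J"]
 by (simp_all add: NJ_def NN_sub)

lemma NN_conc: "f : NN q ==> conc g f : NN q" "f : NN q ==> conc f g : NN q"
proof -
 assume f: "f : NN q"
 have g: "keys g \<subseteq> UNIV" by simp
 have 1: "conc (single w c) f = scale c (foldr cons w f)" for w c
 proof -
  have "conc (single w 1) f = foldr cons w f"
  proof (induction w)
   case (Cons i w)
   have "conc (single (i # w) 1) f = cons i (conc (single w 1) f)"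
    by (rule fmod_extU[where x = f]) ((assumption | rule mlin)+ | simp)+
   then show ?case using Cons by simp
  qed simp
  then show ?thesis using conc_simps(2)[of c "single w 1" f] by simp
 qed
 have 2: "conc f (single w c) = scale c (foldl snoc f w)" for w c
 proof -
  have "conc f (single w 1) = foldl snoc f w"
  proof (induction w rule: rev_induct)
   case (snoc i w)
   have "conc f (single (w @ [i]) 1) = Submission.snoc (conc f (single w 1)) i"
    by (rule fmod_extU[where x = f]) ((assumption | rule mlin)+ | simp)+
   then show ?case using snoc by simp
  qed simp
  then show ?thesis using conc_simps(4)[of f c "single w 1"] by simp
 qed
 have "foldr cons w f : NN q" for w using f by (induction w) (simp_all add: NN_cons)
 with g show "conc g f : NN q"
  by (induction g rule: poly_mapping_lin_induct) (simp_all add: 1 NN_sub)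
 have "foldl snoc f w : NN q" for w using f by (induction w rule: rev_induct) (simp_all add: NN_snoc)
 with g show "conc f g : NN q"
  by (induction g rule: poly_mapping_lin_induct) (simp_all add: 2 NN_sub)
qed

lemma homog_part_wt: "homog_part n f = wt (%m. if size m = n then 1 else 0) f"
 unfolding homog_part_def wt_def lx_eq_sum by (simp add: if_distrib sum.inter_filter cong: if_cong)

lemma keys_wt: "keys (wt c f) \<subseteq> keys f"
 unfolding wt_def using keys_lx[of "%w. single w (c (mset w))" f] by (auto split: if_splits)

lemma lookup_wt: "lookup (wt c f) w = c (mset w) * lookup f w"
 by (rule fmod_extU[where x = f and Z = base_alg]) ((assumption | rule mlin)+ | simp add: lookup_single when_def)+

lemma pr_letter:
 fixes f :: "('x list, 'y::field) poly_mapping"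
 shows "pr q [i] f = lookup f [i]"
proof (rule fmod_extU[where x = f and Z = base_alg])
 fix w
 have "lookup (cons j g) [] = 0" for j and g :: "('x list, 'y) poly_mapping"
  by (rule fmod_extU[where x = g and Z = base_alg]) ((assumption | rule mlin)+ | simp add: lookup_single when_def)+
 then show "pr q [i] (single w 1) = lookup (single w 1) [i]"
  by (cases w) (auto simp: lookup_add lookup_single when_def)
qed (assumption | rule mlin | simp)+

lemma lin_span_sub:
 assumes "vspace Z" "M \<subseteq> carrier Z"
 shows "\<zero>[Z] : lin_span Z M" "x : lin_span Z M ==> y : lin_span Z M ==> x +[Z] y : lin_span Z M" "x : M ==> x : lin_span Z M"
proof -
 show "\<zero>[Z] : lin_span Z M" unfolding lin_span_def using assms by (auto intro!: exI[of _ 0])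
 show "x : lin_span Z M" if "x : M"
  unfolding lin_span_def mem_Collect_eq by (rule exI[of _ "single x 1"]) (use assms that in auto)
 assume "x : lin_span Z M" "y : lin_span Z M"
 then obtain f g where "x = lin_ext Z (%x. x) f" "y = lin_ext Z (%x. x) g" "keys f \<subseteq> M" "keys g \<subseteq> M"
  unfolding lin_span_def by auto
 then show "x +[Z] y : lin_span Z M"
  unfolding lin_span_def mem_Collect_eq
  using assms(2) subset_trans[OF Poly_Mapping.keys_add[of f g], of M]
  by (intro exI[of _ "f + g"]) (simp add: lin_ext_add[OF assms(1)] subset_iff Pi_def)
qed

lemma lin_span_image:
 assumes L: "lin_map Z Z' L" and Z: "vspace Z" "vspace Z'" and M: "M \<subseteq> carrier Z" and x: "x : lin_span Z M"
  and B: "!!y. y : M ==> L y : B" "\<zero>[Z'] : B" "!!y z. y : B ==> z : B ==> y +[Z'] z : B"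
   "!!c y. y : B ==> c *:[Z'] y : B"
 shows "L x : B"
proof -
 obtain f where f: "x = lin_ext Z (%x. x) f" "keys f \<subseteq> M" using x unfolding lin_span_def by auto
 have "L (lin_ext Z (%x. x) f) : B" using f(2)
 proof (induction f rule: poly_mapping_lin_induct)
  case zero
  show ?case using B lin_map_zero[OF L Z] Z by simp
 next
  case (single y c f)
  have c: "lin_ext Z (%x. x) f :[Z]" "y :[Z]" using single M by (auto intro!: lin_ext_closed Z)
  have "(%x. x) : keys (single y c) \<union> keys f \<rightarrow> carrier Z" using single M by (auto split: if_splits)
  then show ?case
   using single B c Z lin_map_add[OF L] lin_map_smult[OF L] by (simp add: lin_ext_add)
 qed
 then show ?thesis using f by simp
qed

lemma graded_coideal_NJ: "graded_coideal D J NJ"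
proof -
 let ?T = "tensor_hopf D J" and ?Z = "tensor V V"
 let ?M = "{tns V V a b | a b. a : NJ & b :[?T]} \<union> {tns V V a b | a b. a :[?T] & b : NJ}"
 interpret T: ring ?T by (rule kalgebraD(2)[OF kalgebra_tensor_hopf])
 have M: "?M \<subseteq> carrier ?Z" by (auto simp: NJ_def)
 have neg: "\<ominus>\<^bsub>?T\<^esub> f = scale (- 1) f" if "f : NJ" for f
  using vs_uminus_eq[OF kalgebraD(1)[OF kalgebra_tensor_hopf], of f D J] that by (simp add: NJ_def)
 have "ideal NJ ?T"
 proof (rule idealI)
  show "ring ?T" by (rule T.ring_axioms)
  show "subgroup NJ (add_monoid ?T)"
   by (rule T.add.subgroupI) (use NJ_sub neg NJ_sub(3)[of _ "- 1"] in \<open>auto simp: NJ_def a_inv_def\<close>)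
 qed (auto simp: NJ_def keys_conc NN_conc)
 moreover have "homog_part n f : NJ" if "f : NJ" for f n
  using that keys_wt[of _ f] by (auto simp: NJ_def homog_part_wt NN_wt)
 moreover have "f = 0" if "f : NJ" "homog_part 1 f = f" for f
 proof (rule poly_mapping_eqI)
  fix w
  have "lookup f w = 0" if "length w = 1"
   using \<open>f : NJ\<close> pr_letter[of "qq D" _ f] that by (auto simp: NJ_def NN_def length_Suc_conv simp del: pr_simps)
  moreover have "lookup f w = 0" if "length w ~= 1"
   using lookup_wt[of "%m. if size m = 1 then 1 else 0" f w] \<open>homog_part 1 f = f\<close> that by (simp add: homog_part_wt)
  ultimately show "lookup f w = lookup 0 w" by auto
 qed
 moreover have "bcounit ?T f = 0" if "f : NJ" for f
  using that pr_simps(4)[of "qq D" f] by (auto simp: NJ_def NN_def simp del: pr_simps)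
 moreover have "bcomult ?T f : lin_span ?Z ?M" if f: "f : NJ" for f
 proof -
  \<comment> \<open>The restrictions make these tensors meaningful for arbitrary arguments, as
    elimination requires.\<close>
  let ?\<beta> = "%a b. tns V V (res J a) (res J b)"
  have rc: "res J x :[V]" for x :: "('i list, 'k) poly_mapping" using keys_res[of J x] by simp
  have k: "keys (lx (dl (qq D)) f) \<subseteq> lists J \<times> lists J"
   by (rule keys_lx_dl) (use f in \<open>simp add: NJ_def\<close>)
  have "em J (lx (dl (qq D)) f) = lin_ext ?Z (%(u, w). ?\<beta> (single u 1) (single w 1)) (lx (dl (qq D)) f)"
   unfolding em_def
  proof (rule lin_ext_fun_cong)
   fix x assume "x : keys (lx (dl (qq D)) f)"
   then have "x : lists J \<times> lists J" by (rule subsetD[OF k])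
   then have "fst x : lists J" "snd x : lists J" by (simp_all only: mem_Times_iff)
   then show "(case x of (u, v) => tns V V (single u 1) (single v 1)) = (case x of (u, w) => ?\<beta> (single u 1) (single w 1))"
    by (simp only: split_beta res_single if_True)
  qed
  \<comment> \<open>Contractions of the coproduct of \<open>f\<close> are radical, so elimination
    places the coproduct in the span of tensors with one radical component.\<close>
  also have "... : lin_span ?Z ?M"
  proof (rule rank_pm[where NA = "NN (qq D)" and I = UNIV and \<phi> = "pr (qq D)", OF vspace_tensor])
   show "bilin (fmod UNIV) (fmod UNIV) ?Z ?\<beta>"
    by (intro bilinI lin_tns_l lin_tns_r lin_res_fmod rc)
   show "?\<beta> a b : lin_span ?Z ?M" if "a : NN (qq D)" for a b
    by (rule lin_span_sub(3)[OF vspace_tensor M]) (use NN_res[OF that] keys_res[of J a] rc[of b] in \<open>auto simp: NJ_def\<close>)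
   show "?\<beta> a b : lin_span ?Z ?M" if "!!v. v : UNIV ==> pr (qq D) v b = 0" for a b
    by (rule lin_span_sub(3)[OF vspace_tensor M])
     (use NN_res[of b "qq D" J] that keys_res[of J b] rc[of a] in \<open>auto simp: NJ_def NN_def simp del: pr_simps\<close>)
   show "lin_map (fmod UNIV) base_alg (pr (qq D) v)" for v
    using lin_pr[OF lin_map_id, of "qq D" v] .
   show "lx (%(u, w). single u (pr (qq D) v (single w 1))) (lx (dl (qq D)) f) : NN (qq D)" for v
    using rp_dl[of "qq D" v f] NN_derw[of f "qq D" v] f by (simp add: rp_def NJ_def)
  qed (use lin_span_sub[OF vspace_tensor M] NN_sub in auto)
  finally show ?thesis using f by (simp add: bcomult_dl NJ_def)
 qed
 ultimately show ?thesis unfolding graded_coideal_def Let_def by simp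
qed

text \<open>Contracting the coideal condition with the coefficient of a letter, which vanishes on
  \<open>I\<close>, shows that skew derivations preserve \<open>I\<close>. Every pairing then
  reduces to the counit, which vanishes on \<open>I\<close> as well.\<close>

lemma graded_coideal_le_NJ:
 assumes I: "graded_coideal D J I" shows "I \<subseteq> NJ"
proof -
 let ?T = "tensor_hopf D J" and ?Z = "tensor V V"
 let ?M = "{tns V V a b | a b. a : I & b :[?T]} \<union> {tns V V a b | a b. a :[?T] & b : I}"
 have id: "ideal I ?T" and h: "!!f n. f : I ==> homog_part n f : I" and e: "!!f. f : I ==> lookup f [] = 0"
  and d: "!!f. f : I ==> bcomult ?T f : lin_span ?Z ?M" and p: "!!f. f : I ==> homog_part 1 f = f ==> f = 0"
  using I unfolding graded_coideal_def Let_def by simp_all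
 interpret I: ideal I ?T by (rule id)
 have IJ: "keys f \<subseteq> lists J" if "f : I" for f using I.a_subset that by auto
 have sub: "0 : I" "!!f g. f : I ==> g : I ==> f + g : I" "!!c f. f : I ==> scale c f : I"
  using additive_subgroup.zero_closed[OF ideal.axioms(1)[OF id]] additive_subgroup.a_closed[OF ideal.axioms(1)[OF id]]
   I.I_l_closed[of _ "single [] _"] by (auto split: if_splits)
 \<comment> \<open>The degree-one part of \<open>b\<close> lies in \<open>I\<close> by gradedness,
   and \<open>I\<close> meets the span of the letters in zero.\<close>
 have l: "lookup b [i] = 0" if "b : I" for b i
 proof -
  have "homog_part 1 b = 0"
   by (rule p[OF h[OF that]]) (rule poly_mapping_eqI, simp add: homog_part_wt lookup_wt)
  then have "lookup (homog_part 1 b) [i] = 0" by simp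
  then show ?thesis by (simp add: homog_part_wt lookup_wt)
 qed
 have der: "Der (qq D) i f : I" if f: "f : I" for f i
 proof -
  have [mlin]: "lin_map Y V f ==> lin_map Y base_alg (%x. lookup (f x) w)" for Y :: "('k, 'y, 'z) module_scheme" and f w
   by (auto simp: lin_map_def lookup_add)
  have sm: "lin_map Y base_alg f ==> a :[V] ==> lin_map Y V (%x. scale (f x) a)" for Y :: "('k, 'y, 'z) module_scheme" and f a
   using lin_smult_l[of Y f a V] by simp
  have b: "bilin V V V (%a b. scale (lookup b [i]) a)"
   by (rule bilinI) (assumption | rule mlin sm)+
  let ?L = "tensor_lift V (%a b. scale (lookup b [i]) a)"
  have lL: "lin_map ?Z V ?L" by (rule lin_map_tensor_lift[OF vspace_fmod vspace_fmod vspace_fmod b])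
  have em: "?L (em J t) = rp (qq D) [i] t" if t: "keys t \<subseteq> lists J \<times> lists J" for t
  proof (rule fmod_ext[OF lin_map_comp[OF lin_map_comp[OF _ lL] lin_em] _ vspace_fmod _ t])
   show "lin_map V (fmod UNIV) (%x. x)" by (simp add: lin_map_def)
   show "lin_map (fmod (lists J \<times> lists J)) (fmod UNIV) (rp (qq D) [i])"
    by (rule lin_map_fmod_sub) (assumption | rule mlin lin_map_id)+
   fix x assume "x : lists J \<times> lists J"
   then obtain u v where x: "x = (u, v)" "u : lists J" "v : lists J" by auto
   then have c: "single u 1 :[V]" "single v 1 :[V]" by auto
   have "?L (em J (single x 1)) = ?L (tns V V (single u 1) (single v 1))"
    unfolding em_def using x by (subst lin_ext_single) auto
   also have "... = rp (qq D) [i] (single x 1)"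
    using tensor_lift_tns[OF vspace_fmod vspace_fmod vspace_fmod b c]
    by (simp add: x pr_letter del: pr_simps)
   finally show "?L (em J (single x 1)) = rp (qq D) [i] (single x 1)" .
  qed
  have k: "keys (lx (dl (qq D)) f) \<subseteq> lists J \<times> lists J"
   by (rule keys_lx_dl[OF IJ[OF f]])
  have "?L (bcomult ?T f) : I"
  proof (rule lin_span_image[OF lL vspace_tensor vspace_fmod _ d[OF f]])
   fix y assume "y : ?M"
   then show "?L y : I"
    using tensor_lift_tns[OF vspace_fmod vspace_fmod vspace_fmod b] IJ sub l by auto
  qed (use sub IJ in auto)
  then show ?thesis using bcomult_dl[OF IJ[OF f]] em[OF k] rp_dl[of "qq D" "[i]" f] by simp
 qed
 have "pr (qq D) w f = 0" if "f : I" for f w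
  using that
 proof (induction w arbitrary: f)
  case (Cons i w)
  then show ?case using der by simp
 qed (simp add: e)
 then have "f : NJ" if "f : I" for f using IJ[OF that] that by (simp add: NJ_def NN_def del: pr_simps)
 then show ?thesis by blast
qed

lemma nichols_ideal_NN: "nichols_ideal D J = {f : NN (qq D). keys f \<subseteq> lists J}"
 unfolding nichols_ideal_def NJ_def[symmetric]
 by (rule Greatest_equality) (rule graded_coideal_NJ, rule graded_coideal_le_NJ)

end

section \<open>The bosonization of the tensor algebra\<close>

lemma lin_map_ext:
 assumes g: "lin_map Z Z' g" and Z: "vspace Z" "vspace Z'" and b: "!!x. x : keys f ==> b x :[Z]"
 shows "g (lin_ext Z b f) = lin_ext Z' (%x. g (b x)) f"
proof -
 have "g (lin_ext Z b h) = lin_ext Z' (%x. g (b x)) h" if "keys h \<subseteq> keys f" for h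
 proof (rule fmod_ext[OF _ _ Z(2) _ that])
  show "lin_map (fmod (keys f)) Z' (%h. g (lin_ext Z b h))"
   by (rule lin_map_comp[OF g]) (rule lin_ext_lin[OF Z(1) b])
  show "lin_map (fmod (keys f)) Z' (lin_ext Z' (%x. g (b x)))"
   by (rule lin_ext_lin[OF Z(2)]) (rule lin_map_closed[OF g b])
  show "g (lin_ext Z b (single w 1)) = lin_ext Z' (%x. g (b x)) (single w 1)" if "w : keys f" for w
   using b[OF that] lin_map_closed[OF g b[OF that]] Z by (simp add: lin_ext_single)
 qed
 then show ?thesis by simp
qed

lemma bilin_cong:
 assumes "bilin V W Z B" "vspace V" "vspace W" "!!v w. v :[V] ==> w :[W] ==> B' v w = B v w"
 shows "bilin V W Z B'"
 by (rule bilinI) (rule lin_map_cong[OF assms(4) _ bilinD(1)[OF assms(1)]] lin_map_cong[OF assms(4) _ bilinD(2)[OF assms(1)]]; (assumption | rule assms))+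

lemma lin_lookup_fmod[mlin]: "lin_map Y (fmod A) f ==> lin_map Y base_alg (%x. lookup (f x) w)"
 by (auto simp: lin_map_def lookup_add)

lemma scale_mult: "scale c f * g = scale c (f * g)" "f * scale c g = scale c (f * (g :: ('g::ab_group_add, 'k::field) poly_mapping))"
proof -
 have s: "scale c h = single 0 c * h" for h :: "('g, 'k) poly_mapping"
 proof -
  have "keys h \<subseteq> UNIV" by simp
  then show ?thesis by (induction h rule: poly_mapping_lin_induct) (simp_all add: mult_single distrib_left)
 qed
 show "scale c f * g = scale c (f * g)" "f * scale c g = scale c (f * g)" by (simp_all add: s mult_ac)
qed

lemma lin_group_mult[mlin]:
 fixes c :: "('g::ab_group_add, 'k::field) poly_mapping"
 shows "lin_map Y (fmod UNIV) f ==> lin_map Y (fmod UNIV) (%x. f x * c)" "lin_map Y (fmod UNIV) f ==> lin_map Y (fmod UNIV) (%x. c * f x)"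
 by (auto simp: lin_map_def algebra_simps scale_mult)

definition gcom :: "('g::ab_group_add, 'k::field) poly_mapping => _" where
 "gcom = lin_ext (tensor (fmod UNIV) (fmod UNIV)) (%a. tns (fmod UNIV) (fmod UNIV) (single a 1) (single a 1))"

lemma gcom[mlin]: "lin_map Y (fmod UNIV) f ==> lin_map Y (tensor (fmod UNIV) (fmod UNIV)) (%x. gcom (f x))"
 "gcom (single a 1) = tns (fmod UNIV) (fmod UNIV) (single a 1) (single a 1)"
 "gcom h : carrier (tensor (fmod UNIV) (fmod UNIV))"
 unfolding gcom_def by (rule lin_ext_lin_UNIV; simp) (simp_all add: lin_ext_single)

lemma group_alg_coalg[simp]: "comult group_alg = gcom" "counit group_alg = lin_ext base_alg (%a. 1)"
 by (simp_all add: group_alg_def gcom_def bialg.defs module.defs group_mod_tensor)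

locale datum = ydd D "Ind D" for D :: "('i, 'g::ab_group_add, 'k::field) yd_datum"
begin

abbreviation "F \<equiv> free_boson D"
abbreviation "I \<equiv> Ind D"
abbreviation "G \<equiv> fmod UNIV :: ('k, ('g, 'k) poly_mapping) module"
abbreviation "q \<equiv> qq D"

definition fbf :: "('i list, 'k) poly_mapping => 'g => ('i, 'g, 'k) smash" where "fbf f a = tns V G f (single a 1)"
abbreviation "fb w a \<equiv> fbf (single w 1) a"

lemma F_simps[simp]: "carrier F = carrier (tensor V G)" "add F = add (tensor V G)" "\<zero>[F] = \<zero>[tensor V G]"
 "module.smult F = module.smult (tensor V G)"
 by (simp_all add: free_boson_def boson_def Let_def module.defs bialg.defs)

lemma vspace_F[simp, mlin]: "vspace F" by (rule vspace_transfer[of "tensor V G"]) simp_all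

lemma tensor_FF: "tensor (tensor V G) (tensor V G) = tensor F F" "tns (tensor V G) (tensor V G) = tns F F"
 by (rule tensor_cong; simp)+

lemma lin_F: "lin_map Y (tensor V G) f = lin_map Y F f" "lin_map (tensor V G) Z f' = lin_map F Z f'"
 by (rule lin_map_record_cong[symmetric]; simp)+

abbreviation "T \<equiv> tensor V G"

lemma F_mult: "x :[F] ==> y :[F] ==> x *[F] y = tensor_lift T (%r h. tensor_lift T (%s k.
  tensor_lift T (%h1 h2. tns V G (conc r (actf D h1 s)) (h2 * k)) (gcom h)) y) x"
proof -
 assume xy: "x :[F]" "y :[F]"
 have "x *[F] y = tensor_lift T (%r h. tensor_lift T (%s k.
  tensor_lift T (%h1 h2. tns V G (conc r (act (tensor_yd D I) h1 s)) (h2 * k)) (gcom h)) y) x"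
  by (simp add: free_boson_def boson_def Let_def module.defs bialg.defs)
 also have "... = tensor_lift T (%r h. tensor_lift T (%s k.
  tensor_lift T (%h1 h2. tns V G (conc r (actf D h1 s)) (h2 * k)) (gcom h)) y) x"
  by (rule tensor_lift_cong[of V G], simp, simp, simp, use xy in simp, rule tensor_lift_cong[of V G], simp, simp, simp, use xy in simp)
   (simp add: act_tensor_yd)
 finally show ?thesis .
qed

lemma lin_tns_VG[mlin]: "lin_map Y V f ==> h :[G] ==> lin_map Y F (%x. tns V G (f x) h)"
 "lin_map Y G g ==> r :[V] ==> lin_map Y F (%x. tns V G r (g x))"
 using lin_tns_l[of Y V f h G] lin_tns_r[of Y G g r V] by (simp_all add: lin_F del: fmod_simps(1))

lemma bilin_F_mult: "bilin F F F (%x y. x *[F] y)"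
proof (rule bilin_cong)
 have "bilin T T T (%x y. tensor_lift T (%r h. tensor_lift T (%s k.
  tensor_lift T (%h1 h2. tns V G (conc r (actf D h1 s)) (h2 * k)) (gcom h)) y) x)"
  by (assumption | rule mlin)+
 then show "bilin F F F (%x y. tensor_lift T (%r h. tensor_lift T (%s k.
  tensor_lift T (%h1 h2. tns V G (conc r (actf D h1 s)) (h2 * k)) (gcom h)) y) x)"
  by (simp add: bilin_def lin_F)
qed (simp_all add: F_mult)

lemma fbf_closed[simp, mlin]: "keys f \<subseteq> lists I ==> fbf f a : carrier (tensor V G)"
 unfolding fbf_def by (rule tns_closed) simp_all

lemma fb_closed[simp, mlin]: "w : lists I ==> fb w a : carrier (tensor V G)"
 unfolding fbf_def by (rule tns_closed) auto

lemma lin_fbf[mlin]: "lin_map Y V f ==> lin_map Y F (%x. fbf (f x) a)"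
 unfolding fbf_def by (assumption | rule mlin)+ simp

lemma fbf_mult:
 assumes f: "keys f \<subseteq> lists I" and g: "keys g \<subseteq> lists I"
 shows "fbf f a *[F] fbf g b = fbf (conc f (actf D (single a 1) g)) (a + b)"
proof -
 have c: "f :[V]" "g :[V]" "!!h. h :[G]" using f g by simp_all
 have "fbf f a *[F] fbf g b = tensor_lift T (%r h. tensor_lift T (%s k.
  tensor_lift T (%h1 h2. tns V G (conc r (actf D h1 s)) (h2 * k)) (gcom h)) (tns V G g (single b 1))) (tns V G f (single a 1))"
  using F_mult[of "fbf f a" "fbf g b"] fbf_closed[OF f] fbf_closed[OF g] by (simp add: fbf_def)
 also have "... = tensor_lift T (%s k. tensor_lift T (%h1 h2. tns V G (conc f (actf D h1 s)) (h2 * k)) (gcom (single a 1))) (tns V G g (single b 1))"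
  by (rule tensor_lift_tns) (insert c, (assumption | rule mlin)+)
 also have "... = tensor_lift T (%h1 h2. tns V G (conc f (actf D h1 g)) (h2 * single b 1)) (gcom (single a 1))"
  by (rule tensor_lift_tns) (insert c, (assumption | rule mlin)+)
 also have "... = tns V G (conc f (actf D (single a 1) g)) (single a 1 * single b 1)"
  unfolding gcom(2) by (rule tensor_lift_tns) (insert c, (assumption | rule mlin)+)
 finally show ?thesis by (simp add: fbf_def mult_single)
qed

lemma fbf_smult: "keys f \<subseteq> lists I ==> fbf (scale c f) a = c *:[F] fbf f a"
 using lin_map_smult[OF lin_fbf[OF lin_map_id], of f c a] by simp

lemma fb_smult: "w : lists I ==> fbf (single w c) a = c *:[F] fb w a"
 using fbf_smult[of "single w 1" c a] by (simp split: if_splits)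

lemma actf_single: "actf D (single a 1) (single w c) = single w (c * ch D w a)" by (simp add: actf_def)

lemma fb_mult: "w : lists I ==> v : lists I ==> fb w a *[F] fb v b = ch D v a *:[F] fb (w @ v) (a + b)"
 using fb_smult[of "w @ v" "ch D v a" "a + b"] by (subst fbf_mult) (simp_all add: actf_single)

lemma fb_ext:
 assumes f: "lin_map F Z f" and g: "lin_map F Z g" and Z: "vspace Z"
  and eq: "!!w a. w : lists I ==> f (fb w a) = g (fb w a)" and x: "x :[F]"
 shows "f x = g x"
proof (rule tensor_ext[OF vspace_fmod vspace_fmod Z])
 show "lin_map (tensor V G) Z f" "lin_map (tensor V G) Z g" using f g by (simp_all add: lin_F)
 fix r h assume r: "r :[V]" and h: "h :[G]"
 have [mlin]: "lin_map Y Z (%x. f (k x))" "lin_map Y Z (%x. g (k x))" if "lin_map Y F k" for Y :: "('k, 'y, 'n) module_scheme" and k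
  using lin_map_comp[OF f that] lin_map_comp[OF g that] .
 have 1: "f (tns V G (single w 1) h) = g (tns V G (single w 1) h)" if w: "w : lists I" for w
 proof -
  have "single w 1 :[V]" using w by auto
  note [mlin] = this
  show ?thesis
   by (rule fmod_extU[where x = h]) ((assumption | rule mlin Z)+, use eq[OF w] in \<open>simp add: fbf_def\<close>)
 qed
 show "f (tns V G r h) = g (tns V G r h)"
  by (rule fmod_ext[where x = r and A = "lists I"]) (insert h, (assumption | rule mlin Z 1)+, use r in simp)
qed (use x in simp)

lemma F_one: "\<one>[F] = fb [] 0"
 by (simp add: free_boson_def boson_def Let_def module.defs bialg.defs fbf_def del: single_one) (simp add: single_one)

lemma kalgebra_F[simp, mlin]: "kalgebra F"
proof (rule kalgebraI[OF vspace_F bilin_F_mult])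
 have l: "lin_map Y F (%x. f x *[F] y)" "lin_map Y F (%x. y *[F] f x)" if "lin_map Y F f" "y :[F]" for Y :: "('k, 'y, 'n) module_scheme" and f y
  using lin_map_comp[OF bilinD(2)[OF bilin_F_mult that(2)] that(1)] lin_map_comp[OF bilinD(1)[OF bilin_F_mult that(2)] that(1)] .
 have c: "x *[F] y :[F]" if "x :[F]" "y :[F]" for x y
  by (rule bilin_closed[OF bilin_F_mult that])
 have s: "(c *:[F] x) *[F] y = c *:[F] (x *[F] y)" "x *[F] (c *:[F] y) = c *:[F] (x *[F] y)" if "x :[F]" "y :[F]" for x y c
  using lin_map_smult[OF bilinD(2)[OF bilin_F_mult that(2)] that(1)] lin_map_smult[OF bilinD(1)[OF bilin_F_mult that(1)] that(2)] .
 have fc: "fb w a :[F]" if "w : lists I" for w a using that by simp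
 fix x y z assume x: "x :[F]" and y: "y :[F]" and z: "z :[F]"
 have ch: "ch D w (a + b) = ch D w a * ch D w b" if "w : lists I" for w a b
  using that by (induction w) (auto simp: chr_add)
 have 1: "(fb w a *[F] fb v b) *[F] z = fb w a *[F] (fb v b *[F] z)" if wv: "w : lists I" "v : lists I" for w v a b
 proof (rule fb_ext[OF _ _ vspace_F _ z])
  fix u c assume u: "u : lists I"
  have "w @ v : lists I" "v @ u : lists I" using wv u by auto
  then show "(fb w a *[F] fb v b) *[F] fb u c = fb w a *[F] (fb v b *[F] fb u c)"
   using wv u fc by (simp add: fb_mult s vs_smult_smult ch add.assoc mult_ac del: F_simps)
 qed (intro l c fc wv lin_map_id)+
 have 2: "(fb w a *[F] y) *[F] z = fb w a *[F] (y *[F] z)" if w: "w : lists I" for w a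
  by (rule fb_ext[OF _ _ vspace_F _ y]) (intro l c fc w z lin_map_id 1 | assumption)+
 show "(x *[F] y) *[F] z = x *[F] (y *[F] z)"
  by (rule fb_ext[OF _ _ vspace_F _ x]) (intro l c y z lin_map_id 2 | assumption)+
next
 fix x assume x: "x :[F]"
 have 0: "fb [] 0 :[F]" by simp
 note l = bilinD[OF bilin_F_mult 0]
 show "\<one>[F] *[F] x = x" "x *[F] \<one>[F] = x"
  unfolding F_one
  by (rule fb_ext[OF _ lin_map_id vspace_F _ x], rule l, simp add: fb_mult ch_0)+
qed (simp add: F_one)

definition fb_lift :: "('k, 'b, 'm) module_scheme => ('i list => 'g => 'b) => ('i, 'g, 'k) smash => 'b" where
 "fb_lift B m = tensor_lift B (%r h. lin_ext B (%w. lin_ext B (%a. m w a) h) r)"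

lemma fb_lift:
 assumes B: "vspace B" and m: "!!w a. w : lists I ==> m w a :[B]"
 shows "lin_map F B (fb_lift B m)" "!!w a. w : lists I ==> fb_lift B m (fb w a) = m w a"
proof -
 \<comment> \<open>The default value zero outside the words in \<open>I\<close> makes the family
   total, so that linearity can be derived over \<open>fmod UNIV\<close>.\<close>
 define m' where "m' w a = (if w : lists I then m w a else \<zero>[B])" for w a
 have m'[mlin]: "m' w a :[B]" for w a using m B by (simp add: m'_def)
 have c[mlin]: "lin_ext B (m' w) h :[B]" for w h by (rule lin_ext_closed) (use B m' in auto)
 note B[mlin]
 have b: "bilin V G B (%r h. lin_ext B (%w. lin_ext B (%a. m' w a) h) r)"
 proof (rule bilinI)
  show "lin_map G B (%h. lin_ext B (%w. lin_ext B (%a. m' w a) h) r)" for r by (assumption | rule mlin)+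
  show "lin_map V B (%r. lin_ext B (%w. lin_ext B (%a. m' w a) h) r)" for h
   by (rule lin_map_fmod_sub) (assumption | rule mlin)+
 qed
 have e: "lin_ext B (%w. lin_ext B (%a. m' w a) h) r = lin_ext B (%w. lin_ext B (%a. m w a) h) r" if "r :[V]" for r h
 proof (rule lin_ext_fun_cong)
  fix w assume "w : keys r"
  then have "w : lists I" using that by auto
  then show "lin_ext B (m' w) h = lin_ext B (m w) h" by (intro lin_ext_fun_cong) (simp add: m'_def)
 qed
 have b': "bilin V G B (%r h. lin_ext B (%w. lin_ext B (%a. m w a) h) r)"
  by (rule bilin_cong[OF b]) (use e in simp_all)
 show "lin_map F B (fb_lift B m)"
  unfolding fb_lift_def lin_F(2)[symmetric] by (rule lin_map_tensor_lift[OF vspace_fmod vspace_fmod B b'])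
 fix w a assume w: "w : lists I"
 have "single w 1 :[V]" "single a 1 :[G]" using w by auto
 then show "fb_lift B m (fb w a) = m w a"
  unfolding fb_lift_def fbf_def using tensor_lift_tns[OF vspace_fmod vspace_fmod B b'] m[OF w] B
  by (simp add: lin_ext_single del: fmod_simps(1))
qed

text \<open>A word is a product of letters, so multiplicativity follows by induction on the left
  factor from the cases of a letter and of a group element.\<close>

lemma fb_alg_homI:
 assumes B: "kalgebra B" and f: "lin_map F B f" and 1: "f (fb [] 0) = \<one>[B]"
  and x: "!!i w a. i : I ==> w : lists I ==> f (fb (i # w) a) = f (fb [i] 0) *[B] f (fb w a)"
  and g: "!!w a b. w : lists I ==> f (fb [] a) *[B] f (fb w b) = ch D w a *:[B] f (fb w (a + b))"
 shows "alg_hom F B f"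
proof (rule alg_homI[OF f])
 note vB = kalgebraD(1)[OF B]
 have cl: "f (fb w a) :[B]" if "w : lists I" for w a using lin_map_closed[OF f] that by simp
 have e: "f (fb w a *[F] fb v b) = f (fb w a) *[B] f (fb v b)" if "w : lists I" "v : lists I" for w v a b
  using that(1)
 proof (induction w)
  case Nil
  show ?case using that lin_map_smult[OF f, of "fb v (a + b)"] by (simp add: fb_mult g)
 next
  case (Cons i w)
  then have w: "i : I" "w : lists I" "w @ v : lists I" "i # w : lists I" "[i] : lists I" using that by auto
  have "f (fb (i # w) a *[F] fb v b) = ch D v a *:[B] (f (fb [i] 0) *[B] f (fb (w @ v) (a + b)))"
   using w that lin_map_smult[OF f, of "fb (i # w @ v) (a + b)"] x[of i "w @ v"] by (simp add: fb_mult)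
  also have "... = f (fb [i] 0) *[B] f (fb w a *[F] fb v b)"
   using w that lin_map_smult[OF f, of "fb (w @ v) (a + b)"] cl B by (simp add: fb_mult kalgebraD(4))
  finally show ?case using Cons w that cl B x[of i w a] by (simp add: kalg_assoc)
 qed
 fix y z assume y: "y :[F]" and z: "z :[F]"
 have e2: "f (fb w a *[F] z) = f (fb w a) *[B] f z" if w: "w : lists I" for w a
 proof (rule fb_ext[OF _ _ vB _ z])
  have c: "fb w a :[F]" using w by simp
  show "lin_map F B (%z. f (fb w a *[F] z))" by (rule lin_map_comp[OF f bilinD(1)[OF bilin_F_mult c]])
  show "lin_map F B (%z. f (fb w a) *[B] f z)" by (rule lin_kmult_r[OF f cl[OF w] B])
 qed (rule e[OF w])
 show "f (y *[F] z) = f y *[B] f z"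
 proof (rule fb_ext[OF _ _ vB _ y])
  show "lin_map F B (%y. f (y *[F] z))" by (rule lin_map_comp[OF f bilinD(2)[OF bilin_F_mult z]])
  show "lin_map F B (%y. f y *[B] f z)" by (rule lin_kmult_l[OF f lin_map_closed[OF f z] B])
 qed (rule e2)
qed (use 1 in \<open>simp add: F_one\<close>)

end

section \<open>Coassociativity and counit for words\<close>

lemma lin_ext_lx:
 assumes b: "!!x. x : keys f ==> keys (b x) \<subseteq> A" and H: "!!y. y : A ==> H y :[Z]" and Z: "vspace Z"
 shows "lin_ext Z H (lx b f) = lin_ext Z (%x. lin_ext Z H (b x)) f"
proof -
 have "lin_ext Z H (lin_ext (fmod A) b f) = lin_ext Z (%x. lin_ext Z H (b x)) f"
  by (rule lin_map_ext[OF lin_ext_lin[OF Z H] vspace_fmod Z]) (use b in simp_all)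
 moreover have "lin_ext (fmod A) b f = lx b f" by (rule lin_ext_fmod) (rule b)
 ultimately show ?thesis by simp
qed

text \<open>\<open>dlL\<close> and \<open>dlR\<close> apply the coproduct to one of two legs;
  \<open>dstep3\<close> is left multiplication by the threefold coproduct of a letter.\<close>

definition dlL where "dlL q = lx (%(u, v). lx (%(x, y). single (x, y, v) 1) (dl q u))"
definition dlR where "dlR q = lx (%(u, v). lx (%(x, y). single (u, x, y) 1) (dl q v))"
definition dstep3 where "dstep3 q i = lx (%(u, v, x). single (i # u, v, x) 1 + single (u, i # v, x) (qw q i u) + single (u, v, i # x) (qw q i u * qw q i v))"

lemma lin_dl3[mlin]:
 "lin_map Y (fmod UNIV) f ==> lin_map Y (fmod UNIV) (%x. dlL q (f x))"
 "lin_map Y (fmod UNIV) f ==> lin_map Y (fmod UNIV) (%x. dlR q (f x))"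
 "lin_map Y (fmod UNIV) g ==> lin_map Y (fmod UNIV) (%x. dstep3 q i (g x))"
 unfolding dlL_def dlR_def dstep3_def by - (assumption | rule mlin)+

text \<open>Both iterated coproducts obey the same recursion, in which a letter acts by
  \<open>dstep3\<close>. For \<open>dlL\<close> this uses \<open>dl_weight\<close>: the two legs of
  a word together braid like the word itself.\<close>

lemma dl_coassoc: "dlL q (dl q w) = dlR q (dl q w)"
proof (induction w)
 case (Cons i w)
 have L: "dlL q (dstep q i t) = dstep3 q i (dlL q t)" for t
 proof (rule fmod_extU[where x = t])
  fix x :: "'a list \<times> 'a list"
  obtain u v where x: "x = (u, v)" by force
  have 1: "lx (%(x, y). single (x, y, v) 1) (dstep q i s) + lx (%(x, y). single (x, y, i # v) 1) (lx (%(u, v). single (u, v) (qw q i u * qw q i v)) s)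
   = dstep3 q i (lx (%(x, y). single (x, y, v) 1) s)" for s
   by (rule fmod_extU[where x = s]) ((assumption | rule mlin)+ | auto simp: dstep3_def)+
  show "dlL q (dstep q i (single x 1)) = dstep3 q i (dlL q (single x 1))"
   using 1[of "dl q u"] by (simp add: x dlL_def dl_weight)
 qed (assumption | rule mlin | simp)+
 have R: "dlR q (dstep q i t) = dstep3 q i (dlR q t)" for t
 proof (rule fmod_extU[where x = t])
  fix x :: "'a list \<times> 'a list"
  obtain u v where x: "x = (u, v)" by force
  have 1: "lx (%(x, y). single (i # u, x, y) 1) s + scale (qw q i u) (lx (%(x, y). single (u, x, y) 1) (dstep q i s))
   = dstep3 q i (lx (%(x, y). single (u, x, y) 1) s)" for s
   by (rule fmod_extU[where x = s]) ((assumption | rule mlin)+ | auto simp: dstep3_def)+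
  show "dlR q (dstep q i (single x 1)) = dstep3 q i (dlR q (single x 1))"
   using 1[of "dl q v"] by (simp add: x dlR_def)
 qed (assumption | rule mlin | simp)+
 show ?case using Cons by (simp add: L R)
qed (simp add: dlL_def dlR_def)

lemma dl_counit:
 "lx (%(u, v). single v (if u = [] then 1 else 0)) (dl q w) = single w 1"
 "lx (%(u, v). single u (if v = [] then 1 else 0)) (dl q w) = single w 1"
proof (induction w)
 case (Cons i w)
 have "lx (%(u, v). single v (if u = [] then 1 else 0)) (dstep q i t) = cons i (lx (%(u, v). single v (if u = [] then 1 else 0)) t)"
  "lx (%(u, v). single u (if v = [] then 1 else 0)) (dstep q i t) = cons i (lx (%(u, v). single u (if v = [] then 1 else 0)) t)" for t
  by (rule fmod_extU[where x = t], (assumption | rule mlin | auto)+)+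
 then show "lx (%(u, v). single v (if u = [] then 1 else 0)) (dl q (i # w)) = single (i # w) 1"
  "lx (%(u, v). single u (if v = [] then 1 else 0)) (dl q (i # w)) = single (i # w) 1"
  using Cons by simp_all
qed simp_all

section \<open>The bosonized tensor algebra as a bialgebra\<close>

context datum
begin

abbreviation "W2 \<equiv> lists I \<times> lists I"
abbreviation "FF \<equiv> tensor F F"

lemma fbf_0: "fbf 0 a = \<zero>[T]"
 using lin_map_zero[OF lin_fbf[OF lin_map_id] vspace_fmod vspace_F, of a] by simp

lemma lin_bcomult[mlin]: "lin_map Y V f ==> lin_map Y (tensor V V) (%x. bcomult (tensor_hopf D I) (f x))"
proof -
 have "bcomult (tensor_hopf D I) = lin_ext (tensor V V) (word_comult D I)"
  by (simp add: tensor_hopf_def Let_def yd.defs bhopf.defs)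
 moreover have "word_comult D I w : carrier (tensor V V)" if "w : lists I" for w
  using word_comult_dl[OF that] lin_map_closed[OF lin_em[of I], of "dl q w"] keys_dl[OF that, of q] by simp
 ultimately have "lin_map V (tensor V V) (bcomult (tensor_hopf D I))"
  using lin_ext_lin[OF vspace_tensor] by metis
 then show "lin_map Y V f ==> lin_map Y (tensor V V) (%x. bcomult (tensor_hopf D I) (f x))" by (rule lin_map_comp)
qed

lemma bcomult_closed[mlin]: "r :[V] ==> bcomult (tensor_hopf D I) r : carrier (tensor V V)"
 by (rule lin_map_closed[OF lin_bcomult[OF lin_map_id]])

lemma ch_add: "w : lists I ==> ch D w (a + b) = ch D w a * ch D w b" by (induction w) (auto simp: chr_add)

lemma ch_neg: "w : lists I ==> ch D w a * ch D w (- a) = 1" using ch_add[of w a "- a"] by (simp add: ch_0)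

text \<open>Carries a coordinate tensor to the coproduct of the bosonization: the degree of the
  right word \<open>v\<close> is its coaction leg and becomes a group element in the left
  factor.\<close>

definition cm :: "'g => ('i list \<times> 'i list, 'k) poly_mapping => _" where
 "cm a = lin_ext FF (%(u, v). tns F F (fb u (gr D v + a)) (fb v a))"

lemma fb2_closed[simp]: "u : lists I ==> v : lists I ==> tns F F (fb u a) (fb v b) :[FF]"
 by (rule tns_closed) simp_all

lemma fb2_W2: "x : W2 ==> (case x of (u, v) => tns F F (fb u (gr D v + a)) (fb v a)) :[FF]"
 by (auto simp only: mem_Times_iff split_beta intro!: fb2_closed)

lemma lin_cm: "lin_map (fmod W2) FF (cm a)"
 unfolding cm_def by (rule lin_ext_lin[OF vspace_tensor fb2_W2])

lemma cm_single: "u : lists I ==> v : lists I ==> cm a (single (u, v) c) = c *:[FF] tns F F (fb u (gr D v + a)) (fb v a)"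
 unfolding cm_def by (subst lin_ext_single) simp_all

lemma cm_map:
 assumes "lin_map FF Z g" "vspace Z" "keys t \<subseteq> W2"
 shows "g (cm a t) = lin_ext Z (%(u, v). g (tns F F (fb u (gr D v + a)) (fb v a))) t"
 unfolding cm_def
 by (subst lin_map_ext[OF assms(1) vspace_tensor assms(2)]) (use fb2_W2 subsetD[OF assms(3)] in \<open>auto simp: case_prod_unfold\<close>)

lemma cm_lift:
 assumes "bilin F F Z Q" "vspace Z" "keys t \<subseteq> W2"
 shows "tensor_lift Z Q (cm a t) = lin_ext Z (%(u, v). Q (fb u (gr D v + a)) (fb v a)) t"
 unfolding cm_map[OF lin_map_tensor_lift[OF vspace_F vspace_F assms(2,1)] assms(2,3)]
proof (rule lin_ext_fun_cong)
 fix x assume "x : keys t"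
 then have "x : W2" by (rule subsetD[OF assms(3)])
 then have "fb (fst x) b :[F]" "fb (snd x) b :[F]" for b
  by (simp_all only: mem_Times_iff F_simps fb_closed)
 then show "(case x of (u, v) => tensor_lift Z Q (tns F F (fb u (gr D v + a)) (fb v a))) = (case x of (u, v) => Q (fb u (gr D v + a)) (fb v a))"
  unfolding split_beta by (intro tensor_lift_tns[OF vspace_F vspace_F assms(2,1)])
qed

lemma dl_W2: "w : lists I ==> keys (dl q w) \<subseteq> W2" by (rule keys_dl)

lemma lin_comult_F: "lin_map F FF (comult F)"
 and comult_fb: "w : lists I ==> comult F (fb w a) = cm a (dl q w)"
proof -
 let ?TT = "tensor T T"
 let ?C = "%r1 r2 h. tensor_lift ?TT (%h1 h2. tensor_lift ?TT (%u r0. tns T T (tns V G r1 (u * h1)) (tns V G r0 h2)) (coactf D I r2)) (gcom h)"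
 have e: "comult F x = tensor_lift ?TT (%r h. tensor_lift ?TT (%r1 r2. ?C r1 r2 h) (bcomult (tensor_hopf D I) r)) x" for x
  by (simp add: free_boson_def boson_def Let_def module.defs bialg.defs)
 have l: "lin_map T ?TT (%x. tensor_lift ?TT (%r h. tensor_lift ?TT (%r1 r2. ?C r1 r2 h) (bcomult (tensor_hopf D I) r)) x)"
  by (assumption | rule mlin)+
 have e': "comult F = (%x. tensor_lift ?TT (%r h. tensor_lift ?TT (%r1 r2. ?C r1 r2 h) (bcomult (tensor_hopf D I) r)) x)"
  by (rule ext) (rule e)
 have "lin_map T ?TT (comult F)" unfolding e' by (rule l)
 then show "lin_map F FF (comult F)" by (simp only: lin_F(2) tensor_FF(1))
 assume w: "w : lists I"
 have c: "single w 1 :[V]" "single a 1 :[G]" using w by auto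
 have bc: "bilin V V ?TT (%r1 r2. ?C r1 r2 h)" for h by (assumption | rule mlin)+
 have "comult F (fb w a) = tensor_lift ?TT (%r1 r2. ?C r1 r2 (single a 1)) (bcomult (tensor_hopf D I) (single w 1))"
  unfolding e fbf_def by (rule tensor_lift_tns) (insert c, (assumption | rule mlin)+)
 also have "bcomult (tensor_hopf D I) (single w 1) = em I (dl q w)" using bcomult_dl[of "single w 1"] w by (simp split: if_splits)
 also have "tensor_lift ?TT (%r1 r2. ?C r1 r2 (single a 1)) (em I (dl q w))
  = lin_ext ?TT (%x. tensor_lift ?TT (%r1 r2. ?C r1 r2 (single a 1)) (case x of (u, v) => tns V V (single u 1) (single v 1))) (dl q w)"
  unfolding em_def
  by (rule lin_map_ext[OF lin_map_tensor_lift[OF vspace_fmod vspace_fmod vspace_tensor bc] vspace_tensor vspace_tensor])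
   (use subsetD[OF dl_W2[OF w]] in \<open>auto simp only: mem_Times_iff split_beta intro!: tns_words\<close>)
 also have "... = cm a (dl q w)"
  unfolding cm_def tensor_FF(1)[symmetric]
 proof (rule lin_ext_fun_cong)
  fix x assume "x : keys (dl q w)"
  then have "x : W2" by (rule subsetD[OF dl_W2[OF w]])
  then obtain u v where x: "x = (u, v)" "u : lists I" "v : lists I" by auto
  have c: "single u 1 :[V]" "single v 1 :[V]" using x by auto
  have "tensor_lift ?TT (%r1 r2. ?C r1 r2 (single a 1)) (tns V V (single u 1) (single v 1)) = ?C (single u 1) (single v 1) (single a 1)"
   by (rule tensor_lift_tns[OF vspace_fmod vspace_fmod vspace_tensor bc c])
  also have "... = tensor_lift ?TT (%b r0. tns T T (tns V G (single u 1) (b * single a 1)) (tns V G r0 (single a 1))) (coactf D I (single v 1))"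
   unfolding gcom(2) by (rule tensor_lift_tns) (insert c, (assumption | rule mlin)+)
  also have "... = tns T T (tns V G (single u 1) (single (gr D v) 1 * single a 1)) (tns V G (single v 1) (single a 1))"
   unfolding coactf_single[OF x(3)] by (rule tensor_lift_tns) (insert c, (assumption | rule mlin)+)
  finally show "tensor_lift ?TT (%r1 r2. ?C r1 r2 (single a 1)) (case x of (u, v) => tns V V (single u 1) (single v 1))
   = (case x of (u, v) => tns F F (fb u (gr D v + a)) (fb v a))"
   by (simp add: x fbf_def mult_single tensor_FF)
 qed
 finally show "comult F (fb w a) = cm a (dl q w)" .
qed

lemma counit_fb: "w : lists I ==> counit F (fb w a) = (if w = [] then 1 else 0)"
 and lin_counit_F: "lin_map F base_alg (counit F)"
proof -
 have e: "counit F = tensor_lift base_alg (%r h. lookup r [] * lin_ext base_alg (%a. 1) h)"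
  by (simp add: free_boson_def boson_def Let_def module.defs bialg.defs)
 have b: "bilin V G base_alg (%r h. lookup r [] * lin_ext base_alg (%a. 1) h)"
  by (assumption | rule mlin)+
 show "lin_map F base_alg (counit F)" unfolding e
  by (subst lin_F(2)[symmetric]) (rule lin_map_tensor_lift[OF vspace_fmod vspace_fmod vspace_base_alg b])
 assume "w : lists I"
 then have "single w 1 :[V]" "single a 1 :[G]" by auto
 then show "counit F (fb w a) = (if w = [] then 1 else 0)"
  unfolding e fbf_def by (subst tensor_lift_tns[OF vspace_fmod vspace_fmod vspace_base_alg b]) (auto simp: lookup_single when_def)
qed

abbreviation "FA \<equiv> tensor_alg F F"
lemma kFA: "kalgebra FA" by (rule kalgebra_tensor_alg[OF kalgebra_F kalgebra_F])

lemmas FA_mult = tensor_alg_mult_tns[OF kalgebra_F kalgebra_F]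

lemma cm_mult_x:
 assumes i: "i : I" and t: "keys t \<subseteq> W2"
 shows "(tns F F (fb [i] 0) (fb [] 0) +[FF] tns F F (fb [] (grp D i)) (fb [i] 0)) *[FA] cm a t = cm a (dstep q i t)"
proof (rule fmod_ext[where A = W2 and x = t and Z = FF])
 let ?x = "tns F F (fb [i] 0) (fb [] 0)" and ?y = "tns F F (fb [] (grp D i)) (fb [i] 0)"
 have xy: "?x :[FF]" "?y :[FF]" using i by simp_all
 have "lin_map (fmod W2) FA (%t. (?x +[FF] ?y) *[FA] cm a t)"
  by (rule lin_kmult_r[OF _ _ kFA]) (use lin_cm xy in simp_all)
 then show "lin_map (fmod W2) FF (%t. (?x +[FF] ?y) *[FA] cm a t)" by simp
 have "lin_map (fmod W2) (fmod W2) (dstep q i)"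
  unfolding lin_map_fmod_iff[of _ W2]
 proof
  show "lin_map (fmod W2) (fmod UNIV) (dstep q i)"
   by (rule lin_map_fmod_sub) (assumption | rule mlin lin_map_id)+
  have "keys (dstep q i x) \<subseteq> W2" if "keys x \<subseteq> W2" for x
   unfolding dstep_def
   by (rule subset_trans[OF keys_lx], rule UN_least)
    (use that i in \<open>fastforce split: if_splits dest!: subsetD[OF Poly_Mapping.keys_add]\<close>)
  then show "\<forall>x\<in>carrier (fmod W2). keys (dstep q i x) \<subseteq> W2" by simp
 qed
 then show "lin_map (fmod W2) FF (%t. cm a (dstep q i t))" by (rule lin_map_comp[OF lin_cm])
 fix x assume "x : W2"
 then obtain u v where x: "x = (u, v)" "u : lists I" "v : lists I" by auto
 then have l: "i # u : lists I" "i # v : lists I" "[i] : lists I" using i by auto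
 note c = fb_closed[folded F_simps(1)]
 have "(?x +[FF] ?y) *[FA] tns F F (fb u (gr D v + a)) (fb v a)
  = (?x *[FA] tns F F (fb u (gr D v + a)) (fb v a)) +[FF] (?y *[FA] tns F F (fb u (gr D v + a)) (fb v a))"
  using ring.ring_simprules(13)[OF kalgebraD(2)[OF kFA], of ?x ?y] xy x fb2_closed[of u v] by simp
 also have "... = tns F F (fb (i # u) (gr D v + a)) (fb v a) +[FF] (qw q i u *:[FF] tns F F (fb u (gr D (i # v) + a)) (fb (i # v) a))"
  using x l c[of u] c[of v] c[of "i # u"] c[of "i # v"] c[of "[i]"] c[of "[]"]
  by (simp add: tns_smult FA_mult fb_mult ch_0 ch_qw add.assoc del: F_simps)
 also have "... = cm a (dstep q i (single x 1))"
  using lin_map_add[OF lin_cm, where x = "single (i # u, v) 1" and y = "single (u, i # v) (qw q i u)"] x l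
  by (simp add: cm_single split: if_splits)
 finally show "(?x +[FF] ?y) *[FA] cm a (single x 1) = cm a (dstep q i (single x 1))"
  using x by (simp add: cm_single)
qed (use t in simp_all)

lemma cm_mult_g:
 assumes t: "keys t \<subseteq> W2" and k: "!!u v. (u, v) : keys t ==> ch D u a * ch D v a = k"
 shows "tns F F (fb [] a) (fb [] a) *[FA] cm b t = k *:[FF] cm (a + b) t"
proof -
 have c0: "tns F F (fb [] a) (fb [] a) :[FF]" by simp
 have l: "lin_map FF FF (%z. tns F F (fb [] a) (fb [] a) *[FA] z)"
  using lin_kmult_r[OF lin_map_id _ kFA, of "tns F F (fb [] a) (fb [] a)"] c0 by simp
 have l2: "lin_map FF FF (%z. k *:[FF] z)" by (assumption | rule mlin)+
 show ?thesis unfolding cm_map[OF l vspace_tensor t] cm_map[OF l2 vspace_tensor t]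
 proof (rule lin_ext_fun_cong)
  fix x assume x: "x : keys t"
  then have "x : W2" by (rule subsetD[OF t])
  then obtain u v where uv: "x = (u, v)" "u : lists I" "v : lists I" by auto
  note c = fb_closed[folded F_simps(1)]
  have s: "tns F F (k1 *:[F] y) (k2 *:[F] z) = (k1 * k2) *:[FF] tns F F y z" if "y :[F]" "z :[F]" for k1 k2 y z
   using that by (simp add: tns_smult vs_smult_smult tns_closed mult.commute del: F_simps)
  show "(case x of (u, v) => tns F F (fb [] a) (fb [] a) *[FA] tns F F (fb u (gr D v + b)) (fb v b))
   = (case x of (u, v) => k *:[FF] tns F F (fb u (gr D v + (a + b))) (fb v (a + b)))"
   using uv k[of u v] x c[of u] c[of v] c[of "[]"]
   by (simp add: FA_mult fb_mult s ac_simps del: F_simps)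
 qed
qed

text \<open>A group element rescales every term of a coproduct by the character of the whole word,
  because the two legs together carry its letters; letters act by \<open>dstep\<close>, as in the
  recursion for \<open>dl\<close>.\<close>

lemma comult_F_hom: "alg_hom F FA (comult F)"
proof (rule fb_alg_homI[OF kFA])
 show "lin_map F FA (comult F)" using lin_comult_F by simp
 have e: "comult F (fb [] a) = tns F F (fb [] a) (fb [] a)" for a by (simp add: comult_fb cm_single)
 show "comult F (fb [] 0) = \<one>[FA]" by (simp add: e F_one)
 fix w a b assume w: "w : lists I"
 show "comult F (fb [] a) *[FA] comult F (fb w b) = ch D w a *:[FA] comult F (fb w (a + b))"
  using cm_mult_g[OF dl_W2[OF w], of a "ch D w a" b] dl_mset[of _ _ q w] w by (simp add: e comult_fb ch_gr_mset)
next
 fix i w a assume i: "i : I" and w: "w : lists I"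
 have "comult F (fb [i] 0) = tns F F (fb [i] 0) (fb [] 0) +[FF] tns F F (fb [] (grp D i)) (fb [i] 0)"
  using lin_map_add[OF lin_cm, where x = "single ([i], []) 1" and y = "single ([], [i]) 1"] i
  by (simp add: comult_fb cm_single split: if_splits)
 then show "comult F (fb (i # w) a) = comult F (fb [i] 0) *[FA] comult F (fb w a)"
  using cm_mult_x[OF i dl_W2[OF w], of a] i w by (simp add: comult_fb)
qed

lemma counit_F_hom: "alg_hom F base_alg (counit F)"
 by (rule fb_alg_homI[OF kalgebra_base_alg lin_counit_F]) (auto simp: counit_fb)

lemma coalgebra_F: "coalgebra F (comult F) (counit F)"
proof -
 let ?Z = "tensor F FF"
 note [mlin] = lin_map_comp[OF lin_comult_F] lin_map_closed[OF lin_comult_F] lin_map_comp[OF lin_counit_F]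
 have b1: "bilin F F ?Z (%x1 x2. tns F FF x1 (tns F F x2 y))" if "y :[F]" for y
  using that by - (assumption | rule mlin)+
 have l: "lin_map F ?Z (%x. tensor_lift ?Z (%a b. tensor_lift ?Z (%a1 a2. tns F FF a1 (tns F F a2 b)) (comult F a)) (comult F x))"
  by (assumption | rule mlin)+
 have b2: "bilin F F ?Z (%a b. tensor_lift ?Z (%a1 a2. tns F FF a1 (tns F F a2 b)) (comult F a))"
  by (assumption | rule mlin)+
 have b3: "bilin F F ?Z (%a b. tns F FF a (comult F b))"
  by (assumption | rule mlin)+
 have r: "lin_map F ?Z (%x. tensor_lift ?Z (%a b. tns F FF a (comult F b)) (comult F x))"
  by (assumption | rule mlin)+
 have b4: "bilin F F F (%a b. counit F a *:[F] b)" "bilin F F F (%a b. counit F b *:[F] a)"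
  by (assumption | rule mlin)+
 have l4: "lin_map F F (%x. tensor_lift F (%a b. counit F a *:[F] b) (comult F x))"
  "lin_map F F (%x. tensor_lift F (%a b. counit F b *:[F] a) (comult F x))"
  by (assumption | rule mlin)+
 note c = fb_closed[folded F_simps(1)]
 { fix x assume x: "x :[F]"
  have "tensor_lift ?Z (%a b. tensor_lift ?Z (%a1 a2. tns F FF a1 (tns F F a2 b)) (comult F a)) (comult F x)
   = tensor_lift ?Z (%a b. tns F FF a (comult F b)) (comult F x)"
  proof (rule fb_ext[OF l r vspace_tensor _ x])
   fix w a assume w: "w : lists I"
   \<comment> \<open>The threefold tensors to which both sides are reduced; each word carries the
     degrees of the words to its right.\<close>
   define H where "H = (%(u, v, x). tns F FF (fb u (gr D v + gr D x + a)) (tns F F (fb v (gr D x + a)) (fb x a)))"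
   have Hc: "H y :[?Z]" if "y : lists I \<times> lists I \<times> lists I" for y
    using that unfolding H_def by (auto simp only: mem_Times_iff split_beta intro!: tns_closed c)
   have "tensor_lift ?Z (%a b. tensor_lift ?Z (%a1 a2. tns F FF a1 (tns F F a2 b)) (comult F a)) (comult F (fb w a))
    = lin_ext ?Z (%(u, v). tensor_lift ?Z (%a1 a2. tns F FF a1 (tns F F a2 (fb v a))) (comult F (fb u (gr D v + a)))) (dl q w)"
    unfolding comult_fb[OF w] by (rule cm_lift[OF b2 vspace_tensor dl_W2[OF w]])
   also have "... = lin_ext ?Z (%x. lin_ext ?Z H (case x of (u, v) => lx (%(x, y). single (x, y, v) 1) (dl q u))) (dl q w)"
   proof (rule lin_ext_fun_cong)
    fix x assume "x : keys (dl q w)"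
    then have "x : W2" by (rule subsetD[OF dl_W2[OF w]])
    then obtain u v where x: "x = (u, v)" "u : lists I" "v : lists I" by auto
    have "tensor_lift ?Z (%a1 a2. tns F FF a1 (tns F F a2 (fb v a))) (comult F (fb u (gr D v + a)))
     = lin_ext ?Z (%(x, y). H (x, y, v)) (dl q u)"
     unfolding comult_fb[OF x(2)] cm_lift[OF b1[OF c[OF x(3)]] vspace_tensor dl_W2[OF x(2)]]
     by (rule lin_ext_fun_cong) (auto simp: H_def ac_simps)
    also have "... = lin_ext ?Z H (lx (%(x, y). single (x, y, v) 1) (dl q u))"
    proof -
     have m: "(case z of (x, y) => (x, y, v)) : lists I \<times> lists I \<times> lists I" if "z : keys (dl q u)" for z
      using subsetD[OF dl_W2[OF x(2)] that] x(3) by (simp only: mem_Times_iff split_beta fst_conv snd_conv)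
     have "lin_ext ?Z H (lx (%(x, y). single (x, y, v) 1) (dl q u)) = lin_ext ?Z (%z. lin_ext ?Z H (case z of (x, y) => single (x, y, v) 1)) (dl q u)"
      by (rule lin_ext_lx[where A = "lists I \<times> lists I \<times> lists I", OF _ Hc vspace_tensor]) (use m in \<open>simp_all add: split_beta\<close>)
     also have "... = lin_ext ?Z (%(x, y). H (x, y, v)) (dl q u)"
     proof (rule lin_ext_fun_cong)
      fix z assume z: "z : keys (dl q u)"
      show "lin_ext ?Z H (case z of (x, y) => single (x, y, v) 1) = (case z of (x, y) => H (x, y, v))"
       using lin_ext_single[where b = H and V = ?Z and c = 1, OF vspace_tensor Hc[OF m[OF z]]] Hc[OF m[OF z]]
       by (simp only: split_beta vs_one vspace_tensor)
     qed
     finally show ?thesis by (rule sym)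
    qed
    finally show "(case x of (u, v) => tensor_lift ?Z (%a1 a2. tns F FF a1 (tns F F a2 (fb v a))) (comult F (fb u (gr D v + a))))
     = lin_ext ?Z H (case x of (u, v) => lx (%(x, y). single (x, y, v) 1) (dl q u))" by (simp add: x)
   qed
   also have "... = lin_ext ?Z H (dlL q (dl q w))"
    unfolding dlL_def
   proof (rule lin_ext_lx[where A = "lists I \<times> lists I \<times> lists I", symmetric, OF _ Hc vspace_tensor])
    fix x assume "x : keys (dl q w)"
    then have "x : W2" by (rule subsetD[OF dl_W2[OF w]])
    then obtain u v where x: "x = (u, v)" "u : lists I" "v : lists I" by auto
    show "keys (case x of (u, v) => lx (%(x, y). single (x, y, v) 1) (dl q u)) \<subseteq> lists I \<times> lists I \<times> lists I"
     unfolding x prod.case by (rule subset_trans[OF keys_lx]) (use subsetD[OF dl_W2[OF x(2)]] x(3) in fastforce)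
   qed
   also have "... = lin_ext ?Z H (dlR q (dl q w))" by (simp add: dl_coassoc)
   also have "... = lin_ext ?Z (%x. lin_ext ?Z H (case x of (u, v) => lx (%(x, y). single (u, x, y) 1) (dl q v))) (dl q w)"
    unfolding dlR_def
   proof (rule lin_ext_lx[where A = "lists I \<times> lists I \<times> lists I", OF _ Hc vspace_tensor])
    fix x assume "x : keys (dl q w)"
    then have "x : W2" by (rule subsetD[OF dl_W2[OF w]])
    then obtain u v where x: "x = (u, v)" "u : lists I" "v : lists I" by auto
    show "keys (case x of (u, v) => lx (%(x, y). single (u, x, y) 1) (dl q v)) \<subseteq> lists I \<times> lists I \<times> lists I"
     unfolding x prod.case by (rule subset_trans[OF keys_lx]) (use subsetD[OF dl_W2[OF x(3)]] x(2) in fastforce)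
   qed
   also have "... = lin_ext ?Z (%(u, v). tns F FF (fb u (gr D v + a)) (comult F (fb v a))) (dl q w)"
   proof (rule lin_ext_fun_cong)
    fix x assume xk: "x : keys (dl q w)"
    then have "x : W2" by (rule subsetD[OF dl_W2[OF w]])
    then obtain u v where x: "x = (u, v)" "u : lists I" "v : lists I" by auto
    have lu: "lin_map FF ?Z (%z. tns F FF (fb u (gr D v + a)) z)" by (rule lin_tns_r[OF lin_map_id c[OF x(2)]])
    have "tns F FF (fb u (gr D v + a)) (comult F (fb v a)) = lin_ext ?Z (%(x, y). H (u, x, y)) (dl q v)"
     unfolding comult_fb[OF x(3)] cm_map[OF lu vspace_tensor dl_W2[OF x(3)]]
     by (rule lin_ext_fun_cong) (auto simp: H_def ch_gr_mset(2) dest!: dl_mset)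
    also have "... = lin_ext ?Z H (lx (%(x, y). single (u, x, y) 1) (dl q v))"
    proof -
     have m: "(case z of (x, y) => (u, x, y)) : lists I \<times> lists I \<times> lists I" if "z : keys (dl q v)" for z
      using subsetD[OF dl_W2[OF x(3)] that] x(2) by (simp only: mem_Times_iff split_beta fst_conv snd_conv)
     have "lin_ext ?Z H (lx (%(x, y). single (u, x, y) 1) (dl q v)) = lin_ext ?Z (%z. lin_ext ?Z H (case z of (x, y) => single (u, x, y) 1)) (dl q v)"
      by (rule lin_ext_lx[where A = "lists I \<times> lists I \<times> lists I", OF _ Hc vspace_tensor]) (use m in \<open>simp_all add: split_beta\<close>)
     also have "... = lin_ext ?Z (%(x, y). H (u, x, y)) (dl q v)"
     proof (rule lin_ext_fun_cong)
      fix z assume z: "z : keys (dl q v)"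
      show "lin_ext ?Z H (case z of (x, y) => single (u, x, y) 1) = (case z of (x, y) => H (u, x, y))"
       using lin_ext_single[where b = H and V = ?Z and c = 1, OF vspace_tensor Hc[OF m[OF z]]] Hc[OF m[OF z]]
       by (simp only: split_beta vs_one vspace_tensor)
     qed
     finally show ?thesis by (rule sym)
    qed
    finally show "lin_ext ?Z H (case x of (u, v) => lx (%(x, y). single (u, x, y) 1) (dl q v))
     = (case x of (u, v) => tns F FF (fb u (gr D v + a)) (comult F (fb v a)))" by (simp add: x)
   qed
   also have "... = tensor_lift ?Z (%a b. tns F FF a (comult F b)) (comult F (fb w a))"
    unfolding comult_fb[OF w] by (rule cm_lift[OF b3 vspace_tensor dl_W2[OF w], symmetric])
   finally show "tensor_lift ?Z (%a b. tensor_lift ?Z (%a1 a2. tns F FF a1 (tns F F a2 b)) (comult F a)) (comult F (fb w a))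
    = tensor_lift ?Z (%a b. tns F FF a (comult F b)) (comult F (fb w a))" .
  qed
  moreover have "tensor_lift F (%a b. counit F a *:[F] b) (comult F x) = x & tensor_lift F (%a b. counit F b *:[F] a) (comult F x) = x"
  proof (intro conjI fb_ext[OF _ lin_map_id vspace_F _ x] l4)
   fix w a assume w: "w : lists I"
   have f: "fbf (lx b (dl q w)) a = lin_ext F (%x. fbf (b x) a) (dl q w)" if b: "!!x. x : keys (dl q w) ==> keys (b x) \<subseteq> lists I" for b
   proof -
    have "fbf (lin_ext V b (dl q w)) a = lin_ext F (%x. fbf (b x) a) (dl q w)"
     by (rule lin_map_ext[OF lin_fbf[OF lin_map_id] vspace_fmod vspace_F]) (use b in simp)
    moreover have "lin_ext V b (dl q w) = lx b (dl q w)" by (rule lin_ext_fmod) (rule b)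
    ultimately show ?thesis by simp
   qed
   have W: "fst x : lists I" "snd x : lists I" if "x : keys (dl q w)" for x
    using subsetD[OF dl_W2[OF w] that] by (simp_all only: mem_Times_iff)
   have "tensor_lift F (%a b. counit F a *:[F] b) (comult F (fb w a)) = lin_ext F (%x. fbf (case x of (u, v) => single v (if u = [] then 1 else 0)) a) (dl q w)"
    unfolding comult_fb[OF w] cm_lift[OF b4(1) vspace_F dl_W2[OF w]]
   proof (rule lin_ext_fun_cong)
    fix x assume x: "x : keys (dl q w)"
    obtain u v where uv: "x = (u, v)" by force
    then have "u : lists I" "v : lists I" using W[OF x] by simp_all
    then show "(case x of (u, v) => counit F (fb u (gr D v + a)) *:[F] fb v (a)) = fbf (case x of (u, v) => single v (if u = [] then 1 else 0)) a"
     using fb_smult[of v "if u = [] then 1 else 0" a] by (auto simp: uv counit_fb fbf_0)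
   qed
   also have "... = fbf (lx (%(u, v). single v (if u = [] then 1 else 0)) (dl q w)) a"
    by (rule f[symmetric]) (use W in \<open>simp add: split_beta\<close>)
   finally show "tensor_lift F (%a b. counit F a *:[F] b) (comult F (fb w a)) = fb w a" by (simp only: dl_counit)
   have "tensor_lift F (%a b. counit F b *:[F] a) (comult F (fb w a)) = lin_ext F (%x. fbf (case x of (u, v) => single u (if v = [] then 1 else 0)) a) (dl q w)"
    unfolding comult_fb[OF w] cm_lift[OF b4(2) vspace_F dl_W2[OF w]]
   proof (rule lin_ext_fun_cong)
    fix x assume x: "x : keys (dl q w)"
    obtain u v where uv: "x = (u, v)" by force
    then have "u : lists I" "v : lists I" using W[OF x] by simp_all
    then show "(case x of (u, v) => counit F (fb v (a)) *:[F] fb u (gr D v + a)) = fbf (case x of (u, v) => single u (if v = [] then 1 else 0)) a"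
     using fb_smult[of u "if v = [] then 1 else 0" a] by (auto simp: uv counit_fb fbf_0)
   qed
   also have "... = fbf (lx (%(u, v). single u (if v = [] then 1 else 0)) (dl q w)) a"
    by (rule f[symmetric]) (use W in \<open>simp add: split_beta\<close>)
   finally show "tensor_lift F (%a b. counit F b *:[F] a) (comult F (fb w a)) = fb w a" by (simp only: dl_counit)
  qed
  ultimately have "tensor_lift ?Z (%a b. tensor_lift ?Z (%a1 a2. tns F FF a1 (tns F F a2 b)) (comult F a)) (comult F x)
   = tensor_lift ?Z (%a b. tns F FF a (comult F b)) (comult F x) &
   tensor_lift F (%a b. counit F a *:[F] b) (comult F x) = x & tensor_lift F (%a b. counit F b *:[F] a) (comult F x) = x" by blast }
 then show ?thesis unfolding coalgebra_def Let_def using lin_comult_F lin_counit_F vspace_F by blast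
qed

end

section \<open>Antipode and universal property of the bosonized tensor algebra\<close>

context datum
begin

text \<open>\<open>rho q w\<close> is a multiple of the reversed word, and \<open>rc w\<close> is
  the factor.\<close>

definition rc where "rc w = lookup (rho q w) (rev w)"

lemma rho_rc: "rho q w = single (rev w) (rc w)"
 by (rule poly_mapping_eqI) (use keys_rho[of _ q w] in \<open>auto simp: rc_def lookup_single when_def in_keys_iff\<close>)

lemma rc_Cons: "rc (i # w) = - inverse (q i i * wq q i w) * rc w"
 by (simp add: rc_def[of "i # w"] rho_rc lookup_single)

definition SF where "SF = fb_lift F (%w a. (rc w * ch D w (- a)) *:[F] fb (rev w) (- a - gr D w))"

lemma lin_SF: "lin_map F F SF"
 and SF_fb: "w : lists I ==> SF (fb w a) = (rc w * ch D w (- a)) *:[F] fb (rev w) (- a - gr D w)"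
proof -
 have c: "(rc w * ch D w (- a)) *:[F] fb (rev w) (- a - gr D w) :[F]" if "w : lists I" for w a
  using that fb_closed[of "rev w"] by (simp add: in_lists_conv_set)
 show "lin_map F F SF" "w : lists I ==> SF (fb w a) = (rc w * ch D w (- a)) *:[F] fb (rev w) (- a - gr D w)"
  unfolding SF_def using fb_lift[OF vspace_F c] by simp_all
qed

lemma SF_closed[mlin]: "x :[F] ==> SF x :[F]" by (rule lin_map_closed[OF lin_SF])
lemma lin_SF'[mlin]: "lin_map Y F f ==> lin_map Y F (%x. SF (f x))" by (rule lin_map_comp[OF lin_SF])

lemma ch_gr_sym: "i : I ==> chr D i (gr D w) = wq q i w"
 by (induction w) (simp_all add: chr_add chr_0 qq_def)

lemma fbF[mlin]: "w : lists I ==> fb w a :[F]" by simp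

lemma SF_g:
 assumes p: "p :[F]" shows "SF (fb [] b *[F] p) = SF p *[F] fb [] (- b)"
proof (rule fb_ext[where x = p and Z = F])
 have n: "fb [] a :[F]" for a by simp
 note [mlin] = n
 show "lin_map F F (%p. SF (fb [] b *[F] p))" "lin_map F F (%p. SF p *[F] fb [] (- b))"
  by (assumption | rule mlin)+
 fix w a assume w: "w : lists I"
 have r: "rev w : lists I" using w by (simp add: in_lists_conv_set)
 have "ch D w b * ch D w (- (b + a)) = ch D w (- a)"
  using ch_add[OF w, of b "- (b + a)"] by simp
 then show "SF (fb [] b *[F] fb w a) = SF (fb w a) *[F] fb [] (- b)"
  using w r fbF[OF w] fbF[OF r] n lin_map_smult[OF lin_SF fbF[OF w]]
  by (simp add: fb_mult SF_fb vs_smult_smult kalgebraD(3) algebra_simps del: F_simps)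
qed (use p in simp_all)

lemma SF_x:
 assumes p: "p :[F]" and i: "i : I" shows "SF (fb [i] 0 *[F] p) = SF p *[F] SF (fb [i] 0)"
proof (rule fb_ext[where x = p and Z = F])
 have n: "fb [i] a :[F]" for a using i by simp
 note [mlin] = n
 show "lin_map F F (%p. SF (fb [i] 0 *[F] p))" "lin_map F F (%p. SF p *[F] SF (fb [i] 0))"
  by (assumption | rule mlin)+
 fix w a assume w: "w : lists I"
 have r: "rev w : lists I" "rev w @ [i] : lists I" "[i] : lists I" "i # w : lists I" using w i by (auto simp: in_lists_conv_set)
 have z: "chr D i (gr D w) ~= 0" by (rule chr_nz[OF i])
 have "chr D i (gr D w) * chr D i (- a - gr D w) = chr D i (- a)"
  using chr_add[OF i, of "gr D w" "- a - gr D w"] by simp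
 then have 1: "chr D i (- a - gr D w) = inverse (wq q i w) * chr D i (- a)"
  using z ch_gr_sym[OF i, of w] by (simp add: field_simps)
 show "SF (fb [i] 0 *[F] fb w a) = SF (fb w a) *[F] SF (fb [i] 0)"
  using w r i fbF[OF w] fbF[OF r(1)] fbF[OF r(2)] n lin_map_smult[OF lin_SF fbF[OF r(4)]]
  by (simp add: fb_mult SF_fb vs_smult_smult kalgebraD(3,4) 1 ch_0 rc_Cons algebra_simps chr_0 del: F_simps)
   (simp add: rc_def chr_0)
qed (use p in simp_all)

lemma comult_x: "i : I ==> comult F (fb [i] 0) = tns F F (fb [i] 0) (fb [] 0) +[FF] tns F F (fb [] (grp D i)) (fb [i] 0)"
 and comult_g: "comult F (fb [] a) = tns F F (fb [] a) (fb [] a)"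
 using lin_map_add[OF lin_cm, where x = "single ([i], []) 1" and y = "single ([], [i]) 1"]
 by (simp_all add: comult_fb cm_single split: if_splits)

lemma fb_Cons: "i : I ==> w : lists I ==> fb (i # w) a = fb [i] 0 *[F] fb w a"
 using fbF[of "i # w"] by (simp add: fb_mult ch_0)

text \<open>Induction on the word. After multiplication by the coproduct of a letter the left
  identity gives zero on every tensor, since \<open>S(x) = - g^-1 x\<close>. On the right the inner
  sum is a scalar by induction, and \<open>x + g S(x) = 0\<close> finishes.\<close>

lemma antipode_SF: "is_antipode F SF"
proof -
 interpret kF: ring F by (rule kalgebraD(2)[OF kalgebra_F])
 have bl: "bilin F F F (%a b. SF a *[F] b)" and br: "bilin F F F (%a b. a *[F] SF b)"
  by (assumption | rule mlin)+
 let ?L = "tensor_lift F (%a b. SF a *[F] b)" and ?R = "tensor_lift F (%a b. a *[F] SF b)"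
 note L = lin_map_tensor_lift[OF vspace_F vspace_F vspace_F bl] tensor_lift_tns[OF vspace_F vspace_F vspace_F bl]
 note R = lin_map_tensor_lift[OF vspace_F vspace_F vspace_F br] tensor_lift_tns[OF vspace_F vspace_F vspace_F br]
 have n: "fb [] a :[F]" for a by simp
 have SFg: "SF (fb [] a) = fb [] (- a)" for a using n[of "- a"] by (simp add: SF_fb rc_def del: F_simps)
 have gg: "fb [] a *[F] fb [] b = fb [] (a + b)" for a b using n[of "a + b"] by (simp add: fb_mult del: F_simps)
 have cc: "comult F x :[FF]" if "x :[F]" for x by (rule lin_map_closed[OF lin_comult_F that])
 have dist: "(x +[FF] y) *[FA] t = (x *[FA] t) +[FF] (y *[FA] t)" if "x :[FF]" "y :[FF]" "t :[FF]" for x y t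
  using ring.ring_simprules(13)[OF kalgebraD(2)[OF kFA], of x y t] that by simp
 have main: "?L (comult F (fb w a)) = counit F (fb w a) *:[F] \<one>[F] & ?R (comult F (fb w a)) = counit F (fb w a) *:[F] \<one>[F]" if "w : lists I" for w a
  using that
 proof (induction w)
  case Nil
  have "counit F (fb [] a) *:[F] \<one>[F] = \<one>[F]" by (simp add: counit_fb F_one)
  then show ?case by (simp only: comult_g L(2)[OF n n] R(2)[OF n n] SFg gg) (simp add: F_one)
 next
  case (Cons i w)
  then have i: "i : I" and w: "w : lists I" by auto
  have xi: "fb [i] a :[F]" for a using i by simp
  let ?x = "fb [i] 0" and ?g = "fb [] (grp D i)"
  have Sx: "SF ?x = \<ominus>\<^bsub>F\<^esub> (fb [] (- grp D i) *[F] ?x)"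
  proof -
   have "inverse (q i i) = chr D i (- grp D i)"
    using ch_neg[of "[i]" "grp D i"] i chr_nz[OF i, of "grp D i"] by (simp add: qq_def field_simps)
   then have "SF ?x = (- chr D i (- grp D i)) *:[F] fb [i] (- grp D i)"
    using i by (simp add: SF_fb rc_Cons[of i "[]"] chr_0 del: F_simps) (simp add: rc_def)
   also have "... = \<ominus>\<^bsub>F\<^esub> (chr D i (- grp D i) *:[F] fb [i] (- grp D i))"
    using vs_uminus_eq[OF vspace_F] xi by (simp add: vs_smult_smult del: F_simps)
   finally show ?thesis using i by (simp add: fb_mult del: F_simps)
  qed
  have gSx: "?g *[F] SF ?x = \<ominus>\<^bsub>F\<^esub> ?x"
  proof -
   have "?g *[F] SF ?x = \<ominus>\<^bsub>F\<^esub> ((?g *[F] fb [] (- grp D i)) *[F] ?x)"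
    unfolding Sx using n xi by (simp add: kF.r_minus kF.m_assoc del: F_simps)
   then show ?thesis unfolding gg using kF.l_one[OF xi[of 0]] by (simp only: F_one right_minus)
  qed
  have tx: "tns F F ?x (fb [] 0) :[FF]" "tns F F ?g ?x :[FF]" using i by simp_all
  have Lt: "?L ((tns F F ?x (fb [] 0) +[FF] tns F F ?g ?x) *[FA] t) = \<zero>[F]" if t: "t :[FF]" for t
  proof (rule tensor_ext[OF vspace_F vspace_F vspace_F _ _ _ t])
   have "lin_map FA FA (%t. (tns F F ?x (fb [] 0) +[FF] tns F F ?g ?x) *[FA] t)"
    by (rule lin_kmult_r[OF lin_map_id _ kFA]) (use tx in simp)
   then show "lin_map FF F (%t. ?L ((tns F F ?x (fb [] 0) +[FF] tns F F ?g ?x) *[FA] t))"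
    by (intro lin_map_comp[OF L(1)]) simp
   show "lin_map FF F (%t. \<zero>[F])" by (rule lin_map_const_zero[OF vspace_F])
   fix c d assume cd: "c :[F]" "d :[F]"
   have "?L ((tns F F ?x (fb [] 0) +[FF] tns F F ?g ?x) *[FA] tns F F c d)
    = (SF (?x *[F] c) *[F] (fb [] 0 *[F] d)) +[F] (SF (?g *[F] c) *[F] (?x *[F] d))"
    using cd tx xi n lin_map_add[OF L(1)]
    by (simp add: dist FA_mult L(2) tns_closed kF.m_closed del: F_simps)
   also have "... = (SF c *[F] SF ?x *[F] d) +[F] (SF c *[F] (fb [] (- grp D i) *[F] ?x) *[F] d)"
    using cd xi n SF_closed kF.l_one by (simp add: SF_x[OF _ i] SF_g kF.m_assoc F_one del: F_simps)
   also have "... = \<zero>[F]"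
    using cd xi n SF_closed by (simp add: Sx kF.r_minus kF.l_minus kF.l_neg del: F_simps)
   finally show "?L ((tns F F ?x (fb [] 0) +[FF] tns F F ?g ?x) *[FA] tns F F c d) = \<zero>[F]" .
  qed
  have Rt: "?R ((tns F F ?x (fb [] 0) +[FF] tns F F ?g ?x) *[FA] t) = (?x *[F] ?R t) +[F] (?g *[F] ?R t *[F] SF ?x)" if t: "t :[FF]" for t
  proof (rule tensor_ext[OF vspace_F vspace_F vspace_F _ _ _ t])
   have "lin_map FA FA (%t. (tns F F ?x (fb [] 0) +[FF] tns F F ?g ?x) *[FA] t)"
    by (rule lin_kmult_r[OF lin_map_id _ kFA]) (use tx in simp)
   then show "lin_map FF F (%t. ?R ((tns F F ?x (fb [] 0) +[FF] tns F F ?g ?x) *[FA] t))"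
    by (intro lin_map_comp[OF R(1)]) simp
   show "lin_map FF F (%t. (?x *[F] ?R t) +[F] (?g *[F] ?R t *[F] SF ?x))"
    by (intro lin_map_add_fun vspace_F lin_kmult_r lin_kmult_l R(1) kalgebra_F xi n SF_closed)
   fix c d assume cd: "c :[F]" "d :[F]"
   have "?R ((tns F F ?x (fb [] 0) +[FF] tns F F ?g ?x) *[FA] tns F F c d)
    = (?x *[F] c *[F] SF (fb [] 0 *[F] d)) +[F] (?g *[F] c *[F] SF (?x *[F] d))"
    using cd tx xi n lin_map_add[OF R(1)]
    by (simp add: dist FA_mult R(2) tns_closed kF.m_closed del: F_simps)
   also have "... = (?x *[F] ?R (tns F F c d)) +[F] (?g *[F] ?R (tns F F c d) *[F] SF ?x)"
    using cd xi n SF_closed kF.l_one[OF cd(2)] by (simp add: SF_x[OF _ i] R(2) kF.m_assoc F_one del: F_simps)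
   finally show "?R ((tns F F ?x (fb [] 0) +[FF] tns F F ?g ?x) *[FA] tns F F c d)
    = (?x *[F] ?R (tns F F c d)) +[F] (?g *[F] ?R (tns F F c d) *[F] SF ?x)" .
  qed
  have ci: "comult F (fb (i # w) a) = (tns F F ?x (fb [] 0) +[FF] tns F F ?g ?x) *[FA] comult F (fb w a)"
   unfolding fb_Cons[OF i w, of a] using alg_homD(2)[OF comult_F_hom xi[of 0] fbF[OF w]] comult_x[OF i] by simp
  have z: "counit F (fb (i # w) a) *:[F] \<one>[F] = \<zero>[F]" using i w by (simp add: counit_fb F_one)
  have "(?x *[F] (k *:[F] \<one>[F])) +[F] (?g *[F] (k *:[F] \<one>[F]) *[F] SF ?x) = \<zero>[F]" for k
  proof -
   have "(?x *[F] (k *:[F] \<one>[F])) +[F] (?g *[F] (k *:[F] \<one>[F]) *[F] SF ?x) = k *:[F] (?x +[F] (?g *[F] SF ?x))"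
    using xi n SF_closed by (simp add: kalgebraD(3,4) vs_smult_r_distr kF.m_closed del: F_simps)
   then show ?thesis unfolding gSx using xi by (simp add: kF.r_neg del: F_simps)
  qed
  then show ?case unfolding ci Lt[OF cc[OF fbF[OF w]]] Rt[OF cc[OF fbF[OF w]]] z using Cons.IH by simp
 qed
 have lc: "lin_map F F (%x. counit F x *:[F] \<one>[F])"
  by (rule lin_smult_l[OF lin_counit_F]) (simp_all add: F_one)
 have "?L (comult F x) = counit F x *:[F] \<one>[F]" "?R (comult F x) = counit F x *:[F] \<one>[F]" if "x :[F]" for x
  by (rule fb_ext[OF lin_map_comp[OF L(1) lin_comult_F] lc vspace_F _ that], use main in blast)
   (rule fb_ext[OF lin_map_comp[OF R(1) lin_comult_F] lc vspace_F _ that], use main in blast)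
 then show ?thesis unfolding is_antipode_def using lin_SF by blast
qed

lemma hopf_F: "hopf_algebra F"
  unfolding hopf_algebra_def bialgebra_def
  using coalgebra_F comult_F_hom counit_F_hom kalgebra_F antipode_SF by blast

sublocale hF: hopf F by unfold_locales (rule hopf_F)

lemma antipode_F: "x :[F] ==> antipode F x = SF x"
 by (rule hF.antipode_unique[OF antipode_SF])

text \<open>On words of one common degree the group part of the antipode is constant, and the word
  part is the twisted reversal. This is where homogeneity becomes important.\<close>

lemma SF_fbf:
 assumes "keys f \<subseteq> lists I" "!!w. w : keys f ==> gr D w = a"
 shows "SF (fbf f 0) = fbf (lx (rho q) f) (- a)"
proof (rule fmod_ext[where x = f and A = "{w : lists I. gr D w = a}" and Z = F])
 let ?A = "{w : lists I. gr D w = a}"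
 have "lin_map (fmod ?A) V (%x. x)" by (auto simp: lin_map_def subset_iff)
 then have A: "lin_map V Z h ==> lin_map (fmod ?A) Z h" for Z :: "('k, 'z, 'm) module_scheme" and h
  using lin_map_comp[of V Z h "fmod ?A" "%x. x"] by simp
 show "lin_map (fmod ?A) F (%f. SF (fbf f 0))" by (rule A) (intro lin_SF' lin_fbf lin_map_id)
 have "lin_map V V (lx (rho q))"
  unfolding lin_map_fmod_iff[of _ "lists I"]
 proof
  show "lin_map V (fmod UNIV) (lx (rho q))" by (rule lin_map_fmod_sub) (assumption | rule mlin)+
  show "\<forall>x\<in>carrier V. keys (lx (rho q) x) \<subseteq> lists I"
  proof
   fix x assume "x :[V]"
   then show "keys (lx (rho q) x) \<subseteq> lists I"
    by (intro subset_trans[OF keys_lx] UN_least) (auto simp: rho_rc in_lists_conv_set subset_iff split: if_splits)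
  qed
 qed
 then show "lin_map (fmod ?A) F (%f. fbf (lx (rho q) f) (- a))" by (intro A lin_fbf)
 fix w assume "w : ?A"
 then have "w : lists I" "rev w : lists I" "gr D w = a" by (auto simp: in_lists_conv_set)
 then show "SF (fbf (single w 1) 0) = fbf (lx (rho q) (single w 1)) (- a)"
  using fb_smult[of "rev w" "rc w" "- a"] by (simp add: SF_fb ch_0 rho_rc del: F_simps)
qed (use assms in auto)

text \<open>The smash product has no relations besides those of the group and the commutation of
  group elements with letters; the latter moves \<open>g a\<close> past a word by induction.\<close>

lemma fb_UP:
 assumes B: "kalgebra B" and x: "!!i. i : I ==> x i :[B]" and g: "!!a. g a :[B]"
  and g0: "g 0 = \<one>[B]" and gg: "!!a b. g (a + b) = g a *[B] g b"
  and gx: "!!i a. i : I ==> g a *[B] x i = chr D i a *:[B] (x i *[B] g a)"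
 shows "\<exists>f. alg_hom F B f & (\<forall>i\<in>I. f (fb [i] 0) = x i) & (\<forall>a. f (fb [] a) = g a) &
  (\<forall>w\<in>lists I. f (fb w 0) = foldr (%i y. x i *[B] y) w \<one>[B])"
proof -
 define m where "m w a = foldr (%i y. x i *[B] y) w (g a)" for w a
 have mc: "m w a :[B]" if "w : lists I" for w a
  using that unfolding m_def by (induction w) (auto intro: kmult_closed x g B)
 have ms[simp]: "m [] a = g a" "m (i # w) a = x i *[B] m w a" for i w a by (simp_all add: m_def)
 interpret ring B by (rule kalgebraD(2)[OF B])
 have f: "lin_map F B (fb_lift B m)" "!!w a. w : lists I ==> fb_lift B m (fb w a) = m w a"
  by (rule fb_lift[OF kalgebraD(1)[OF B]], (rule mc, assumption)+)+
 have "alg_hom F B (fb_lift B m)"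
 proof (rule fb_alg_homI[OF B f(1)])
  show "fb_lift B m (fb [] 0) = \<one>[B]" using f(2)[of "[]"] g0 by simp
  fix w a b assume w: "w : lists I"
  have "g a *[B] m w b = ch D w a *:[B] m w (a + b)" using w
  proof (induction w)
   case (Cons i w)
   then have i: "i : I" "w : lists I" by auto
   have "g a *[B] (x i *[B] m w b) = (g a *[B] x i) *[B] m w b" using i x g mc by (simp add: m_assoc)
   also have "... = chr D i a *:[B] (x i *[B] (g a *[B] m w b))" using i x g mc B by (simp add: gx kalgebraD(3) m_assoc)
   also have "... = (chr D i a * ch D w a) *:[B] (x i *[B] m w (a + b))"
    using i x g mc B Cons kalgebraD(1)[OF B] by (simp add: kalgebraD(4) vs_smult_smult)
   finally show ?case by simp
  qed (use g kalgebraD(1)[OF B] in \<open>simp add: gg\<close>)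
  then show "fb_lift B m (fb [] a) *[B] fb_lift B m (fb w b) = ch D w a *:[B] fb_lift B m (fb w (a + b))"
   using w f(2) by simp
 next
  fix i w a assume "i : I" "w : lists I"
  then show "fb_lift B m (fb (i # w) a) = fb_lift B m (fb [i] 0) *[B] fb_lift B m (fb w a)"
   using f(2)[of "i # w"] f(2)[of "[i]"] f(2)[of w] x g0 by simp
 qed
 moreover have "fb_lift B m (fb [i] 0) = x i" if "i : I" for i using f(2)[of "[i]" 0] x g0 that by simp
 moreover have "fb_lift B m (fb [] a) = g a" for a using f(2)[of "[]"] by simp
 moreover have "fb_lift B m (fb w 0) = foldr (%i y. x i *[B] y) w \<one>[B]" if "w : lists I" for w
  using f(2)[OF that, of 0] g0 by (simp add: m_def)
 ultimately show ?thesis by blast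
qed

lemma fb_gen_ext:
 assumes f: "alg_hom F B f" and f': "alg_hom F B f'" and B: "kalgebra B"
  and x: "!!i. i : I ==> f (fb [i] 0) = f' (fb [i] 0)" and g: "!!a. f (fb [] a) = f' (fb [] a)" and y: "y :[F]"
 shows "f y = f' y"
proof (rule fb_ext[OF alg_homD(1)[OF f] alg_homD(1)[OF f'] kalgebraD(1)[OF B] _ y])
 show "f (fb w a) = f' (fb w a)" if "w : lists I" for w a
  using that
 proof (induction w)
  case (Cons i w)
  then have i: "i : I" "w : lists I" by auto
  then have "fb [i] 0 :[F]" "fb w a :[F]" by simp_all
  then show ?case using i Cons x
   by (simp add: fb_Cons[OF i, of a] alg_homD(2)[OF f] alg_homD(2)[OF f'] del: F_simps)
 qed (simp add: g)
qed

end

section \<open>The Hopf algebra of a linking parameter\<close>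

lemma vspace_surj:
 assumes V: "vspace V" and s: "f ` carrier V = carrier B"
  and a: "!!x y. x :[V] ==> y :[V] ==> f x +[B] f y = f (x +[V] y)"
  and z: "\<zero>[B] = f \<zero>[V]" and m: "!!c x. x :[V] ==> c *:[B] f x = f (c *:[V] x)"
 shows "vspace B"
proof -
 have "f (x +[V] y) = f (y +[V] x)" if "x :[V]" "y :[V]" for x y
  using vs_comm[OF V that] by simp
 then show ?thesis
  by (intro vspaceI)
   (use V in \<open>auto simp: a z m s[symmetric] vs_assoc vs_smult_l_distr vs_smult_r_distr vs_smult_smult intro!: imageI\<close>)
qed

lemma lin_ext_zero_fun: "vspace Z ==> lin_ext Z (%x. \<zero>[Z]) f = \<zero>[Z]"
 using lin_map_ext[OF lin_map_const_zero[of Z Z], of f "%x. \<zero>[Z]"] by simp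

lemma lin_map_expand:
 assumes g: "lin_map (fmod A) Z g" and Z: "vspace Z" and h: "keys h \<subseteq> A"
 shows "g h = lin_ext Z (%v. g (single v 1)) h"
proof -
 have h': "lin_ext (fmod A) (%v. single v 1) h = h"
  using lin_ext_fmod[of h "%v. single v 1" A] subsetD[OF h] by (simp add: lx_id)
 have "g (lin_ext (fmod A) (%v. single v 1) h) = lin_ext Z (%v. g (single v 1)) h"
  by (rule lin_map_ext[OF g vspace_fmod Z]) (use h in auto)
 then show ?thesis unfolding h' .
qed

lemma alg_hom_Idl:
 assumes A: "kalgebra A" and B: "kalgebra B" and f: "alg_hom A B f" and S: "S \<subseteq> carrier A"
  and k: "!!x. x : S ==> f x = \<zero>[B]" and x: "x : Idl\<^bsub>A\<^esub> S"
 shows "f x = \<zero>[B]"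
proof -
 interpret ring_hom_ring A B f
  by (rule ring_hom_ringI2[OF kalgebraD(2)[OF A] kalgebraD(2)[OF B]]) (use f in \<open>simp add: alg_hom_def\<close>)
 have "S \<subseteq> a_kernel A B f" unfolding a_kernel_def' using S k by blast
 then have "x : a_kernel A B f" using R.genideal_minimal[OF kernel_is_ideal] x by blast
 then show ?thesis unfolding a_kernel_def' by blast
qed

context datum
begin

text \<open>Splitting off the words with the degree of a chosen key is a weight operation, so it
  preserves the radical and leaves fewer keys. The reduction serves formulas that are twisted word
  by word by group degrees.\<close>

lemma gr_homogeneous_ext:
 assumes \<phi>: "lin_map V Z \<phi>" and Z: "vspace Z" and f: "f : NN q" "keys f \<subseteq> lists I"
  and h: "!!h a. h : NN q ==> keys h \<subseteq> keys f ==> (!!w. w : keys h ==> gr D w = a) ==> \<phi> h = \<zero>[Z]"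
 shows "\<phi> f = \<zero>[Z]"
 using f h
proof (induction "card (keys f)" arbitrary: f rule: less_induct)
 case less
 show ?case
 proof (cases "keys f = {}")
  case True
  then show ?thesis using lin_map_zero[OF \<phi> vspace_fmod Z] by simp
 next
  case False
  then obtain w where w: "w : keys f" by blast
  define c1 c2 where "c1 m = (if (\<Sum>i\<in>#m. grp D i) = gr D w then 1 else 0 :: 'k)" and "c2 m = 1 - c1 m" for m
  have e: "f = wt c1 f + wt c2 f" by (rule poly_mapping_eqI) (simp add: lookup_add lookup_wt c2_def algebra_simps)
  have k: "keys (wt c1 f) \<subseteq> keys f" "keys (wt c2 f) \<subseteq> keys f" by (rule keys_wt)+
  have "w \<notin> keys (wt c2 f)" by (simp add: in_keys_iff lookup_wt c2_def c1_def ch_gr_mset)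
  then have "card (keys (wt c2 f)) < card (keys f)" using k w by (intro psubset_card_mono) auto
  moreover have "wt c2 f : NN q" "keys (wt c2 f) \<subseteq> lists I" using less.prems k by (auto intro: NN_wt)
  ultimately have "\<phi> (wt c2 f) = \<zero>[Z]" by (rule less.hyps) (use less.prems(3) k in blast)
  moreover have "gr D v = gr D w" if "v : keys (wt c1 f)" for v
   using that by (auto simp: in_keys_iff lookup_wt c1_def ch_gr_mset split: if_splits)
  then have "\<phi> (wt c1 f) = \<zero>[Z]" by (rule less.prems(3)[OF NN_wt[OF less.prems(1)] k(1)])
  moreover have "keys (wt c1 f) \<subseteq> lists I" "keys (wt c2 f) \<subseteq> lists I" using less.prems(2) k by auto
  ultimately have "\<phi> (wt c1 f + wt c2 f) = \<zero>[Z]"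
   using lin_map_add[OF \<phi>, of "wt c1 f" "wt c2 f"] Z by simp
  then show ?thesis by (simp flip: e)
 qed
qed

lemma fbf_g: "keys f \<subseteq> lists I ==> fbf f a *[F] fb [] b = fbf f (a + b)"
 by (subst fbf_mult) (simp_all add: actf_single del: single_one)

lemma comult_fbf:
 assumes "keys f \<subseteq> lists I" shows "comult F (fbf f a) = cm a (lx (dl q) f)"
proof (rule fmod_ext[OF lin_map_comp[OF lin_comult_F lin_fbf[OF lin_map_id]] lin_map_comp[OF lin_cm] vspace_tensor _ assms])
 show "lin_map V (fmod W2) (lx (dl q))"
  unfolding lin_map_fmod_iff[of _ W2]
 proof
  show "lin_map V (fmod UNIV) (lx (dl q))" by (rule lin_map_fmod_sub) (assumption | rule mlin)+
  show "\<forall>x\<in>carrier V. keys (lx (dl q) x) \<subseteq> W2"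
  proof
   fix x assume "x :[V]"
   then have "keys x \<subseteq> lists I" by simp
   then show "keys (lx (dl q) x) \<subseteq> W2" by (rule keys_lx_dl)
  qed
 qed
qed (simp add: comult_fb)

end

section \<open>The quotient by the Nichols and linking relations\<close>

locale linked = datum D for D :: "('i, 'g::ab_group_add, 'k::field) yd_datum" +
 fixes lam :: "'i => 'i => 'k"
 assumes lp: "linking_parameter D lam"
begin

abbreviation "U \<equiv> U_alg D lam"
abbreviation "J0 \<equiv> U_ideal D lam"
definition "p a = J0 +>\<^bsub>F\<^esub> a"
definition "NJs = {fbf f 0 | f J. J : I // sim D & f : NN q & keys f \<subseteq> lists J}"
definition "lr i j = fbf (single [i, j] 1 - single [j, i] (q i j)) 0"
definition "rels = NJs \<union> {lr i j \<ominus>\<^bsub>F\<^esub> lam i j *:[F] (fb [] 0 \<ominus>\<^bsub>F\<^esub> fb [] (grp D i + grp D j)) | i j. i : I & j : I & (i, j) \<notin> sim D}"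

lemma class_sub: "J : I // sim D ==> J \<subseteq> I"
proof -
 have "sim D \<subseteq> I \<times> I" unfolding sim_def by (intro Un_least trancl_subset_Sigma) auto
 then show "J : I // sim D ==> J \<subseteq> I" unfolding quotient_def by auto
qed

lemma lr_eq:
 assumes "i : I" "j : I"
 shows "lr i j = fb [i, j] 0 \<ominus>\<^bsub>F\<^esub> q i j *:[F] fb [j, i] 0"
proof -
 have c: "single [i, j] 1 :[V]" "single [j, i] (q i j) :[V]" using assms by auto
 have "single [i, j] 1 \<ominus>\<^bsub>V\<^esub> single [j, i] (q i j) = single [i, j] 1 - single [j, i] (q i j)"
  using vs_minus_eq[OF vspace_fmod c] by (simp add: single_uminus)
 then have "lr i j = fb [i, j] 0 \<ominus>\<^bsub>F\<^esub> fbf (single [j, i] (q i j)) 0"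
  unfolding lr_def by (metis lin_map_minus[OF lin_fbf[OF lin_map_id] vspace_fmod vspace_F c, of 0])
 then show ?thesis using fb_smult[of "[j, i]" "q i j" 0] assms by simp
qed

text \<open>\<open>nichols_ideal_NN\<close> turns the Nichols ideals of the definition into
  radicals, so that later arguments run on explicit generators.\<close>

lemma ideal_rels: "J0 = Idl\<^bsub>F\<^esub> rels"
proof -
 have 1: "fb_word D ` nichols_ideal D J = {fbf f 0 | f. f : NN q & keys f \<subseteq> lists J}" if "J : I // sim D" for J
 proof -
  interpret J: ydd D J using D class_sub[OF that] by unfold_locales
  show ?thesis unfolding J.nichols_ideal_NN fb_word_def by (auto simp: fbf_def)
 qed
 have 2: "link_rel D lam i j = lr i j \<ominus>\<^bsub>F\<^esub> lam i j *:[F] (fb [] 0 \<ominus>\<^bsub>F\<^esub> fb [] (grp D i + grp D j))" if "i : I" "j : I" for i j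
 proof -
  have x: "fb_x D k = fb [k] 0" for k by (simp add: fb_x_def fb_word_def fbf_def)
  have g: "fb_grp D a = fb [] a" for a by (simp add: fb_grp_def fbf_def)
  show ?thesis using that lr_eq[OF that] fbF[of "[i, j]" 0] fbF[of "[j, i]" 0]
   by (simp add: link_rel_def Let_def x g fb_mult chr_0 F_one del: F_simps)
 qed
 have "(\<Union>J\<in>I // sim D. fb_word D ` nichols_ideal D J) = (\<Union>J\<in>I // sim D. {fbf f 0 | f. f : NN q & keys f \<subseteq> lists J})"
  by (rule SUP_cong[OF refl 1])
 also have "... = NJs" unfolding NJs_def by auto
 finally have 3: "(\<Union>J\<in>I // sim D. fb_word D ` nichols_ideal D J) = NJs" .
 have 4: "{link_rel D lam i j | i j. i : I & j : I & (i, j) \<notin> sim D}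
  = {lr i j \<ominus>\<^bsub>F\<^esub> lam i j *:[F] (fb [] 0 \<ominus>\<^bsub>F\<^esub> fb [] (grp D i + grp D j)) | i j. i : I & j : I & (i, j) \<notin> sim D}"
  by (intro Collect_cong iff_exI) (metis 2)
 show ?thesis unfolding U_ideal_def rels_def 3 4 ..
qed

lemma NJs_F: "NJs \<subseteq> carrier F"
 unfolding NJs_def using class_sub lists_mono by (fastforce intro!: fbf_closed)

lemma lr_closed: "i : I ==> j : I ==> lr i j :[F]"
 unfolding lr_def by (simp, rule fbf_closed, rule subset_trans[OF keys_diff]) (auto split: if_splits)

lemma rels_F: "rels \<subseteq> carrier F"
 unfolding rels_def using NJs_F lr_closed vs_minus_closed[OF vspace_F] vs_smult[OF vspace_F] fbF[of "[]"] by auto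

lemma ideal_J0: "ideal J0 F" unfolding ideal_rels by (rule hF.genideal_ideal[OF rels_F])

lemma rels_J0: "x : rels ==> x : J0" unfolding ideal_rels using hF.genideal_self[OF rels_F] by blast

lemma J0_smult: "x : J0 ==> c *:[F] x : J0"
proof -
 assume x: "x : J0"
 interpret J: ideal J0 F by (rule ideal_J0)
 have "x :[F]" using x J.a_subset by blast
 then have "c *:[F] x = (c *:[F] \<one>[F]) *[F] x"
  using kalgebraD(3)[OF kalgebra_F hF.one_closed, of x c] hF.l_one by simp
 then show ?thesis using J.I_l_closed[OF x] vs_smult[OF vspace_F hF.one_closed] by simp
qed

lemma p_eq: "x :[F] ==> y :[F] ==> p x = p y \<longleftrightarrow> x \<ominus>\<^bsub>F\<^esub> y : J0"
 unfolding p_def using hF.quotient_eq_iff_same_a_r_cos[OF ideal_J0] by simp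

lemma p_rep: "x :[F] ==> (SOME a. a : p x) :[F] & p (SOME a. a : p x) = p x"
proof -
 assume x: "x :[F]"
 interpret J: ideal J0 F by (rule ideal_J0)
 have "x : p x" unfolding p_def using J.a_rcos_self[OF x] .
 then have s: "(SOME a. a : p x) : p x" by (rule someI)
 then have c: "(SOME a. a : p x) :[F]" unfolding p_def using hF.a_r_coset_subset_G[OF J.a_subset x] by blast
 moreover have "p (SOME a. a : p x) = p x" using J.a_repr_independence'[OF s[unfolded p_def] x] by (simp add: p_def)
 ultimately show ?thesis ..
qed

lemma U_simps:
 "carrier U = p ` carrier F" "x :[F] ==> y :[F] ==> p x *[U] p y = p (x *[F] y)"
 "x :[F] ==> y :[F] ==> p x +[U] p y = p (x +[F] y)"
 "\<one>[U] = p \<one>[F]" "\<zero>[U] = p \<zero>[F]" "x :[F] ==> c *:[U] p x = p (c *:[F] x)"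
proof -
 interpret J: ideal J0 F by (rule ideal_J0)
 show "carrier U = p ` carrier F"
  by (auto simp: U_alg_def bialg_quot_def Let_def module.defs ring.defs bialg.defs FactRing_def A_RCOSETS_def' p_def)
 have h: "p : ring_hom F (F Quot J0)" unfolding p_def[abs_def] by (rule J.rcos_ring_hom)
 have s: "monoid.mult U = monoid.mult (F Quot J0)" "add U = add (F Quot J0)" "one U = one (F Quot J0)" "zero U = zero (F Quot J0)"
  by (simp_all add: U_alg_def bialg_quot_def Let_def module.defs ring.defs bialg.defs)
 show "p x *[U] p y = p (x *[F] y)" "p x +[U] p y = p (x +[F] y)" if "x :[F]" "y :[F]" for x y
  using ring_hom_mult[OF h that] ring_hom_add[OF h that] by (simp_all add: s)
 show "\<one>[U] = p \<one>[F]" using ring_hom_one[OF h] by (simp add: s)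
 show "\<zero>[U] = p \<zero>[F]" using ring_hom_zero[OF h hF.ring_axioms J.quotient_is_ring] by (simp add: s)
 assume x: "x :[F]"
 let ?r = "SOME a. a : p x"
 have "c *:[U] p x = p (c *:[F] ?r)"
  by (simp add: U_alg_def bialg_quot_def Let_def module.defs ring.defs bialg.defs p_def)
 moreover have "c *:[F] ?r \<ominus>\<^bsub>F\<^esub> c *:[F] x : J0"
 proof -
  have r: "?r :[F]" "?r \<ominus>\<^bsub>F\<^esub> x : J0" using p_rep[OF x] p_eq[of ?r x] x by auto
  have "c *:[F] ?r \<ominus>\<^bsub>F\<^esub> c *:[F] x = c *:[F] (?r \<ominus>\<^bsub>F\<^esub> x)"
   using vspace_F r(1) x by (simp add: vs_minus_eq vs_smult_r_distr vs_smult_smult mult.commute del: F_simps)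
  then show ?thesis using J0_smult[OF r(2)] by simp
 qed
 ultimately show "c *:[U] p x = p (c *:[F] x)"
  using p_eq[of "c *:[F] ?r" "c *:[F] x"] vs_smult[OF vspace_F] p_rep[OF x] x by simp
qed

lemma vspace_U[simp, mlin]: "vspace U"
 by (rule vspace_surj[OF vspace_F U_simps(1)[symmetric]]) (simp_all add: U_simps del: F_simps)

lemma lin_p0: "lin_map F U p"
 by (rule lin_map_I) (auto simp: U_simps simp del: F_simps)

lemma lin_p[mlin]: "lin_map Y F f ==> lin_map Y U (%x. p (f x))" by (rule lin_map_comp[OF lin_p0])

lemma p_closed[simp, mlin]: "x :[F] ==> p x :[U]" by (rule lin_map_closed[OF lin_p0])

lemma kalgebra_U[simp, mlin]: "kalgebra U"
 by (rule kalgebra_surj[OF kalgebra_F vspace_U lin_p0 U_simps(1)[symmetric]]) (simp_all add: U_simps del: F_simps)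

lemma alg_hom_p: "alg_hom F U p" by (rule alg_homI[OF lin_p0]) (simp_all add: U_simps del: F_simps)

lemma p_zero: "x :[F] ==> p x = \<zero>[U] \<longleftrightarrow> x : J0"
 using p_eq[of x "\<zero>[F]"] by (simp add: U_simps a_minus_def del: F_simps)

lemma p_NJ:
 assumes "J : I // sim D" "f : NN q" "keys f \<subseteq> lists J" shows "p (fbf f a) = \<zero>[U]"
proof -
 have k: "keys f \<subseteq> lists I" using assms(3) lists_mono[OF class_sub[OF assms(1)]] by blast
 have c: "fbf f 0 :[F]" "fb [] a :[F]" using fbf_closed[OF k] by simp_all
 have "fbf f 0 : rels" using assms unfolding rels_def NJs_def by blast
 then have "p (fbf f 0) = \<zero>[U]" using p_zero[OF c(1)] rels_J0 by blast
 then have "p (fbf f 0 *[F] fb [] a) = \<zero>[U]"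
  using U_simps(2)[OF c] c ring.ring_simprules(24)[OF kalgebraD(2)[OF kalgebra_U], of "p (fb [] a)"] by simp
 then show ?thesis by (simp add: fbf_g[OF k])
qed

lemma not_sim: "i : I ==> j : I ==> (i, j) \<notin> sim D ==> i ~= j & q i j * q j i = 1"
 unfolding sim_def by auto

lemma p_lr:
 assumes "i : I" "j : I" "(i, j) \<notin> sim D"
 shows "p (lr i j) = lam i j *:[U] (p (fb [] 0) \<ominus>\<^bsub>U\<^esub> p (fb [] (grp D i + grp D j)))"
proof -
 let ?y = "lam i j *:[F] (fb [] 0 \<ominus>\<^bsub>F\<^esub> fb [] (grp D i + grp D j))"
 have n: "fb [] a :[F]" for a by simp
 have y: "?y :[F]" by (intro vs_smult vs_minus_closed vspace_F n)
 have "lr i j \<ominus>\<^bsub>F\<^esub> ?y : rels" using assms unfolding rels_def by blast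
 then have "p (lr i j) = p ?y" using p_eq[OF lr_closed y] rels_J0 assms by blast
 also have "... = lam i j *:[U] p (fb [] 0 \<ominus>\<^bsub>F\<^esub> fb [] (grp D i + grp D j))"
  by (rule U_simps(6)[symmetric]) (intro vs_minus_closed vspace_F n)
 also have "p (fb [] 0 \<ominus>\<^bsub>F\<^esub> fb [] (grp D i + grp D j)) = p (fb [] 0) \<ominus>\<^bsub>U\<^esub> p (fb [] (grp D i + grp D j))"
  by (rule lin_map_minus[OF lin_p0 vspace_F vspace_U n n])
 finally show ?thesis .
qed

end

lemma vs_telescope:
 assumes "vspace V" "x :[V]" "y :[V]" "z :[V]"
 shows "c *:[V] (x \<ominus>\<^bsub>V\<^esub> y) +[V] c *:[V] (y \<ominus>\<^bsub>V\<^esub> z) = c *:[V] (x \<ominus>\<^bsub>V\<^esub> z)"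
proof -
 interpret abelian_group V by (rule vs_abelian_group[OF assms(1)])
 have "(x \<ominus>\<^bsub>V\<^esub> y) +[V] (y \<ominus>\<^bsub>V\<^esub> z) = x \<ominus>\<^bsub>V\<^esub> z"
  using assms(2-4) by (simp add: minus_eq a_assoc r_neg1)
 then show ?thesis using assms by (simp flip: vs_smult_r_distr)
qed

lemma alg_hom_tensor:
 assumes f: "alg_hom A B f" and A[mlin]: "kalgebra A" and B[mlin]: "kalgebra B"
 shows "alg_hom (tensor_alg A A) (tensor_alg B B) (tensor_lift (tensor B B) (%a b. tns B B (f a) (f b)))"
  (is "alg_hom _ _ ?f")
proof (rule alg_homI)
 note vA = kalgebraD(1)[OF A] and vB = kalgebraD(1)[OF B]
 note fl = alg_homD(1)[OF f] and fc = lin_map_closed[OF alg_homD(1)[OF f]]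
 have b: "bilin A A (tensor B B) (%a b. tns B B (f a) (f b))"
  by (intro bilinI lin_tns_l lin_tns_r fl fc)
 note l = lin_map_tensor_lift[OF vA vA vspace_tensor b] and t = tensor_lift_tns[OF vA vA vspace_tensor b]
 show "lin_map (tensor_alg A A) (tensor_alg B B) ?f" using l by simp
 show "?f \<one>[tensor_alg A A] = \<one>[tensor_alg B B]"
  using t[OF kone_closed[OF A] kone_closed[OF A]] by (simp add: alg_homD(3)[OF f])
 fix s u assume "s : carrier (tensor_alg A A)" "u : carrier (tensor_alg A A)"
 then have su: "s : carrier (tensor A A)" "u : carrier (tensor A A)" by simp_all
 note mA = bilin_tensor_alg_mult[OF A A] and mB = bilin_tensor_alg_mult[OF B B]
 show "?f (s *[tensor_alg A A] u) = ?f s *[tensor_alg B B] ?f u"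
 proof (rule bilin_tensor_algebra_ext[OF vA vA vspace_tensor _ _ _ su, where f = "%s u. ?f (s *[tensor_alg A A] u)" and g = "%s u. ?f s *[tensor_alg B B] ?f u"])
  show "bilin (tensor A A) (tensor A A) (tensor B B) (%s u. ?f (s *[tensor_alg A A] u))"
   by (rule bilinI) (rule lin_map_comp[OF l bilinD(1)[OF mA]] lin_map_comp[OF l bilinD(2)[OF mA]]; assumption)+
  show "bilin (tensor A A) (tensor A A) (tensor B B) (%s u. ?f s *[tensor_alg B B] ?f u)"
   by (rule bilinI) (rule lin_map_comp[OF bilinD(1)[OF mB lin_map_closed[OF l]] l] lin_map_comp[OF bilinD(2)[OF mB lin_map_closed[OF l]] l]; assumption)+
  fix a b c d assume "a :[A]" "b :[A]" "c :[A]" "d :[A]"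
  then show "?f (tns A A a b *[tensor_alg A A] tns A A c d) = ?f (tns A A a b) *[tensor_alg B B] ?f (tns A A c d)"
   by (simp add: tensor_alg_mult_tns[OF A A] tensor_alg_mult_tns[OF B B] t alg_homD(2)[OF f] fc kmult_closed A)
 qed
qed

section \<open>Descent of the coproduct\<close>

context linked
begin

abbreviation "UU \<equiv> tensor U U"
abbreviation "UA \<equiv> tensor_alg U U"
lemma kUA: "kalgebra UA" by (rule kalgebra_tensor_alg[OF kalgebra_U kalgebra_U])

definition "pp = tensor_lift UU (%a b. tns U U (p a) (p b))"
text \<open>Becomes the coproduct of \<open>U\<close> once it is known to vanish on the defining
  ideal.\<close>

definition "D2 x = pp (comult F x)"

lemma bilin_pp: "bilin F F UU (%a b. tns U U (p a) (p b))" by (assumption | rule mlin)+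

lemma lin_pp: "lin_map FF UU pp"
 unfolding pp_def by (rule lin_map_tensor_lift[OF vspace_F vspace_F vspace_tensor bilin_pp])

lemma pp_tns: "a :[F] ==> b :[F] ==> pp (tns F F a b) = tns U U (p a) (p b)"
 unfolding pp_def by (rule tensor_lift_tns[OF vspace_F vspace_F vspace_tensor bilin_pp])

lemma alg_hom_D2: "alg_hom F UA D2"
 unfolding D2_def pp_def by (rule alg_hom_comp[OF comult_F_hom alg_hom_tensor[OF alg_hom_p kalgebra_F kalgebra_U]])

definition kap where "kap = (%(u, v). tns U U (p (fb u (gr D v))) (p (fb v 0)))"

lemma kap_closed: "x : W2 ==> kap x :[UU]"
 unfolding kap_def by (auto simp only: mem_Times_iff split_beta intro!: tns_closed p_closed fbF)

lemma D2_fbf: assumes f: "keys f \<subseteq> lists I" shows "D2 (fbf f 0) = lin_ext UU kap (lx (dl q) f)"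
 unfolding D2_def comult_fbf[OF f] cm_map[OF lin_pp vspace_tensor keys_lx_dl[OF f]]
proof (rule lin_ext_fun_cong)
 fix x assume "x : keys (lx (dl q) f)"
 then have "x : W2" by (rule subsetD[OF keys_lx_dl[OF f]])
 then show "(case x of (u, v) => pp (tns F F (fb u (gr D v + 0)) (fb v 0))) = kap x"
  by (auto simp only: kap_def mem_Times_iff split_beta add_0_right intro!: pp_tns fbF)
qed

lemma tns_U0: "z :[U] ==> tns U U \<zero>[U] z = \<zero>[UU]" "z :[U] ==> tns U U z \<zero>[U] = \<zero>[UU]"
 by (rule lin_map_zero[OF lin_tns_l[OF lin_map_id] vspace_U vspace_tensor], assumption)
  (rule lin_map_zero[OF lin_tns_r[OF lin_map_id] vspace_U vspace_tensor], assumption)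

text \<open>Elimination applies to the coproduct of \<open>f\<close>, now with target zero, since
  \<open>p\<close> kills radical elements on either leg. The left leg carries the degree of the
  right word, so \<open>\<beta>\<close> is set up word by word, and radical right arguments are
  treated by homogeneous parts.\<close>

lemma D2_NJ:
 assumes J: "J : I // sim D" and f: "f : NN q" "keys f \<subseteq> lists J"
 shows "D2 (fbf f 0) = \<zero>[UU]"
proof -
 have JI: "lists J \<subseteq> lists I" by (rule lists_mono[OF class_sub[OF J]])
 have rJ: "keys (res J x) \<subseteq> lists I" for x :: "('i list, 'k) poly_mapping" using keys_res[of J x] JI by blast
 have [mlin]: "lin_map Y (fmod UNIV) g ==> lin_map Y V (%x. res J (g x))" for Y :: "('k, 'y, 'z) module_scheme" and g
  unfolding lin_map_fmod_iff[of _ "lists I"] using lin_res rJ by blast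
 have pc[mlin]: "p (fbf (res J x) g) :[U]" for x g by (rule p_closed) (simp add: rJ)
 define \<beta> where "\<beta> a = lin_ext UU (%v. tns U U (p (fbf (res J a) (gr D v))) (p (fbf (res J (single v 1)) 0)))" for a
 have b: "bilin (fmod UNIV) (fmod UNIV) UU \<beta>"
 proof (rule bilinI)
  show "lin_map (fmod UNIV) UU (\<beta> v)" for v unfolding \<beta>_def by (assumption | rule mlin)+
  show "lin_map (fmod UNIV) UU (%v. \<beta> v w)" for w unfolding \<beta>_def by (assumption | rule mlin)+
 qed
 have W0: "lin_ext UU (%(u, w). \<beta> (single u 1) (single w 1)) (lx (dl q) f) : {\<zero>[UU]}"
 proof (rule rank_pm[where NA = "NN q" and I = UNIV and \<phi> = "pr q", OF vspace_tensor _ _ b])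
  show "\<beta> a c : {\<zero>[UU]}" if "a : NN q" for a c
   unfolding \<beta>_def by (simp add: p_NJ[OF J NN_res[OF that] keys_res] tns_U0 pc lin_ext_zero_fun del: F_simps)
  show "lin_map (fmod UNIV) base_alg (pr q v)" for v using lin_pr[OF lin_map_id, of q v] .
  show "lx (%(u, w). single u (pr q v (single w 1))) (lx (dl q) f) : NN q" for v
   using rp_dl[of q v f] NN_derw[OF f(1), of v] by (simp add: rp_def)
  show "\<beta> a c : {\<zero>[UU]}" if "!!v. v : UNIV ==> pr q v c = 0" for a c
  proof -
   have "c : NN q" using that by (simp add: NN_def del: pr_simps)
   then have c: "res J c : NN q" by (rule NN_res)
   have "\<beta> a c = \<beta> a (res J c)"
   proof (rule fmod_extU[where x = c, OF bilinD(1)[OF b] lin_map_comp[OF bilinD(1)[OF b] lin_res[OF lin_map_id]] vspace_tensor])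
    fix w :: "'i list"
    have "lin_ext UU g (single w 1) = g w" if "g w :[UU]" for g using that by (simp add: lin_ext_single)
    then have 1: "\<beta> a (single w 1) = tns U U (p (fbf (res J a) (gr D w))) (p (fbf (res J (single w 1)) 0))"
     unfolding \<beta>_def using pc by simp
    show "\<beta> a (single w 1) = \<beta> a (res J (single w 1))"
    proof (cases "w : lists J")
     case False
     then have "\<beta> a (single w 1) = \<zero>[UU]"
      unfolding 1 using lin_map_zero[OF lin_p0 vspace_F vspace_U] pc by (simp add: res_single fbf_0 tns_U0)
     then show ?thesis using False lin_map_zero[OF bilinD(1)[OF b, of a] vspace_fmod vspace_tensor] by (simp add: res_single)
    qed (simp add: res_single)
   qed simp_all
   \<comment> \<open>On a homogeneous part the group degree is constant, so the form is a pure
     tensor again and \<open>p\<close> kills its right component.\<close>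
   also have "\<beta> a (res J c) = \<zero>[UU]"
   proof (rule gr_homogeneous_ext[OF lin_map_fmod_sub[OF bilinD(1)[OF b]] vspace_tensor c rJ])
    fix h g assume h: "h : NN q" "keys h \<subseteq> keys (res J c)" "!!w. w : keys h ==> gr D w = g"
    have "lin_map (fmod UNIV) UU (%x. tns U U (p (fbf (res J a) g)) (p (fbf (res J x) 0)))"
     by (assumption | rule mlin)+
    from lin_map_expand[OF this vspace_tensor, of h]
    have "lin_ext UU (%v. tns U U (p (fbf (res J a) g)) (p (fbf (res J (single v 1)) 0))) h = \<zero>[UU]"
     by (simp add: p_NJ[OF J NN_res[OF h(1)] keys_res] tns_U0 pc del: F_simps)
    moreover have "\<beta> a h = lin_ext UU (%v. tns U U (p (fbf (res J a) g)) (p (fbf (res J (single v 1)) 0))) h"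
     unfolding \<beta>_def by (rule lin_ext_fun_cong) (simp add: h(3))
    ultimately show "\<beta> a h = \<zero>[UU]" by simp
   qed simp
   finally show ?thesis by simp
  qed
 qed (simp_all add: NN_sub)
 have "lin_ext UU kap (lx (dl q) f) = lin_ext UU (%(u, w). \<beta> (single u 1) (single w 1)) (lx (dl q) f)"
 proof (rule lin_ext_fun_cong)
  fix x assume "x : keys (lx (dl q) f)"
  then have "x : lists J \<times> lists J" by (rule subsetD[OF keys_lx_dl[OF f(2)]])
  then obtain u v where x: "x = (u, v)" "u : lists J" "v : lists J" by auto
  have "lin_ext UU g (single v 1) = g v" if "g v :[UU]" for g using that by (simp add: lin_ext_single)
  then have "\<beta> (single u 1) (single v 1) = tns U U (p (fbf (res J (single u 1)) (gr D v))) (p (fbf (res J (single v 1)) 0))"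
   unfolding \<beta>_def using pc by simp
  then show "kap x = (case x of (u, w) => \<beta> (single u 1) (single w 1))" using x by (simp add: kap_def res_single)
 qed
 then show ?thesis using D2_fbf[of f] f(2) JI W0 by auto
qed

lemma D2_g: "D2 (fb [] a) = tns U U (p (fb [] a)) (p (fb [] a))"
 unfolding D2_def by (simp add: comult_g pp_tns)

lemma D2_lr:
 assumes ij: "i : I" "j : I" "(i, j) \<notin> sim D"
 shows "D2 (lr i j) = tns U U (p (lr i j)) (p (fb [] 0)) +[UU] tns U U (p (fb [] (grp D i + grp D j))) (p (lr i j))"
proof -
 let ?f = "single [i, j] 1 - single [j, i] (q i j)" and ?g = "grp D i + grp D j"
 have k2: "keys ?f \<subseteq> {[i, j], [j, i]}" by (rule subset_trans[OF keys_diff]) (auto split: if_splits)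
 have k: "keys ?f \<subseteq> lists I" using k2 ij by auto
 \<comment> \<open>The mixed terms cancel because \<open>q i j * q j i = 1\<close>: the quantum
   commutator is primitive in the braided sense.\<close>
 have d: "lx (dl q) ?f = lx (%w. single (w, []) 1) ?f + lx (%w. single ([], w) 1) ?f"
  using not_sim[OF ij] by (simp add: algebra_simps)
 have "D2 (fbf ?f 0) = lin_ext UU kap (lx (%w. single (w, []) 1) ?f + lx (%w. single ([], w) 1) ?f)"
  by (simp only: D2_fbf[OF k] d)
 also have "... = lin_ext UU kap (lx (%w. single (w, []) 1) ?f) +[UU] lin_ext UU kap (lx (%w. single ([], w) 1) ?f)"
 proof -
  have "keys (lx (%w. single (w, []) (1::'k)) ?f) \<union> keys (lx (%w. single ([], w) (1::'k)) ?f) \<subseteq> W2"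
   using keys_lx[of "%w. single (w, []) (1::'k)" ?f] keys_lx[of "%w. single ([], w) (1::'k)" ?f] subsetD[OF k] by fastforce
  then show ?thesis by (intro lin_ext_add vspace_tensor Pi_I kap_closed) blast
 qed
 also have "lin_ext UU kap (lx (%w. single (w, []) 1) ?f) = lin_ext UU (%w. lin_ext UU kap (single (w, []) 1)) ?f"
  by (rule lin_ext_lx[where A = W2, OF _ kap_closed vspace_tensor]) (use subsetD[OF k] in simp)
 also have "... = lin_ext UU (%w. tns U U (p (fbf (single w 1) 0)) (p (fb [] 0))) ?f"
  by (rule lin_ext_fun_cong, subst lin_ext_single[where b = kap and V = UU, OF vspace_tensor kap_closed], use subsetD[OF k] in simp,
   subst vs_one[OF vspace_tensor kap_closed], use subsetD[OF k] in simp, simp add: kap_def)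
 also have "... = tns U U (p (fbf ?f 0)) (p (fb [] 0))"
  by (rule lin_map_expand[OF _ vspace_tensor k, symmetric]) (intro lin_tns_l lin_p lin_fbf lin_map_id p_closed fbF lists.Nil)
 also have "lin_ext UU kap (lx (%w. single ([], w) 1) ?f) = lin_ext UU (%w. lin_ext UU kap (single ([], w) 1)) ?f"
  by (rule lin_ext_lx[where A = W2, OF _ kap_closed vspace_tensor]) (use subsetD[OF k] in simp)
 also have "... = lin_ext UU (%w. tns U U (p (fb [] ?g)) (p (fbf (single w 1) 0))) ?f"
  by (rule lin_ext_fun_cong, subst lin_ext_single[where b = kap and V = UU, OF vspace_tensor kap_closed], use subsetD[OF k] in simp,
   subst vs_one[OF vspace_tensor kap_closed], use subsetD[OF k] in simp, use subsetD[OF k2] in \<open>fastforce simp: kap_def add.commute\<close>)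
 also have "... = tns U U (p (fb [] ?g)) (p (fbf ?f 0))"
  by (rule lin_map_expand[OF _ vspace_tensor k, symmetric]) (intro lin_tns_r lin_p lin_fbf lin_map_id p_closed fbF lists.Nil)
 finally show ?thesis by (simp add: lr_def)
qed

lemma D2_J0: "x : J0 ==> D2 x = \<zero>[UU]"
proof -
 have n: "fb [] a :[F]" "p (fb [] a) :[U]" for a by (rule fbF p_closed[OF fbF]; simp)+
 have l: "lin_map F UU D2" using alg_homD(1)[OF alg_hom_D2] by simp
 have "D2 x = \<zero>[UA]" if "x : Idl\<^bsub>F\<^esub> rels"
 proof (rule alg_hom_Idl[OF kalgebra_F kUA alg_hom_D2 rels_F _ that])
  fix x assume "x : rels"
  then consider f J where "x = fbf f 0" "J : I // sim D" "f : NN q" "keys f \<subseteq> lists J"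
   | i j where "x = lr i j \<ominus>\<^bsub>F\<^esub> lam i j *:[F] (fb [] 0 \<ominus>\<^bsub>F\<^esub> fb [] (grp D i + grp D j))" "i : I" "j : I" "(i, j) \<notin> sim D"
   unfolding rels_def NJs_def by blast
  then show "D2 x = \<zero>[UA]"
  proof cases
   case 1
   then show ?thesis using D2_NJ by simp
  next
   case 2
   let ?e = "p (fb [] 0)" and ?g = "p (fb [] (grp D i + grp D j))"
   let ?y = "fb [] 0 \<ominus>\<^bsub>F\<^esub> fb [] (grp D i + grp D j)"
   have y: "?y :[F]" by (intro vs_minus_closed vspace_F n)
   have t: "tns U U (a \<ominus>\<^bsub>U\<^esub> b) c = tns U U a c \<ominus>\<^bsub>UU\<^esub> tns U U b c" "tns U U c (a \<ominus>\<^bsub>U\<^esub> b) = tns U U c a \<ominus>\<^bsub>UU\<^esub> tns U U c b"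
    "tns U U (k *:[U] a) c = k *:[UU] tns U U a c" "tns U U c (k *:[U] a) = k *:[UU] tns U U c a"
    if "a :[U]" "b :[U]" "c :[U]" for a b c k
    using that lin_map_minus[OF lin_tns_l[OF lin_map_id that(3)] vspace_U vspace_tensor] lin_map_minus[OF lin_tns_r[OF lin_map_id that(3)] vspace_U vspace_tensor]
     lin_map_smult[OF lin_tns_l[OF lin_map_id that(3)]] lin_map_smult[OF lin_tns_r[OF lin_map_id that(3)]] by simp_all
   have "D2 (lam i j *:[F] ?y) = lam i j *:[UU] (tns U U ?e ?e \<ominus>\<^bsub>UU\<^esub> tns U U ?g ?g)"
    using lin_map_smult[OF l y] lin_map_minus[OF l vspace_F vspace_tensor n(1) n(1)] by (simp only: D2_g)
   \<comment> \<open>The quantum commutator and one minus a group element are skew primitive for the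
     same group element, so the two tensors telescope.\<close>
   also have "... = D2 (lr i j)"
    unfolding D2_lr[OF 2(2-4)] p_lr[OF 2(2-4)] t(3,4)[OF vs_minus_closed[OF vspace_U n(2) n(2)] n(2) n(2)] t(1,2)[OF n(2) n(2) n(2)]
    by (rule vs_telescope[symmetric, OF vspace_tensor tns_closed tns_closed tns_closed]) (rule n(2))+
   finally have "D2 (lr i j) = D2 (lam i j *:[F] ?y)" ..
   then show ?thesis unfolding 2(1)
    using lin_map_minus[OF l vspace_F vspace_tensor lr_closed[OF 2(2,3)] vs_smult[OF vspace_F y]]
     vs_minus_self[OF vspace_tensor lin_map_closed[OF l lr_closed[OF 2(2,3)]]] by simp
  qed
 qed
 then show "x : J0 ==> D2 x = \<zero>[UU]" by (simp add: ideal_rels)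
qed

end

section \<open>Counit, antipode and universal property of the quotient\<close>

context linked
begin

lemma counit_fbf: "keys f \<subseteq> lists I ==> counit F (fbf f a) = lookup f []"
 by (rule fmod_ext[OF lin_map_comp[OF lin_counit_F lin_fbf[OF lin_map_id]] lin_lookup_fmod[OF lin_map_id] vspace_base_alg])
  (auto simp: counit_fb lookup_single when_def)

lemma rels_cases:
 assumes "x : rels"
 obtains f J where "x = fbf f 0" "J : I // sim D" "f : NN q" "keys f \<subseteq> lists J" "keys f \<subseteq> lists I"
 | i j where "x = lr i j \<ominus>\<^bsub>F\<^esub> lam i j *:[F] (fb [] 0 \<ominus>\<^bsub>F\<^esub> fb [] (grp D i + grp D j))" "i : I" "j : I" "(i, j) \<notin> sim D"
 using assms lists_mono[OF class_sub] unfolding rels_def NJs_def by blast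

lemma g_closed: "fb [] 0 \<ominus>\<^bsub>F\<^esub> fb [] a :[F]"
 by (intro vs_minus_closed vspace_F fbF lists.Nil)

lemma rel_map:
 assumes l: "lin_map F Z h" and Z: "vspace Z" and ij: "i : I" "j : I"
  and e: "h (lr i j) = c *:[Z] (h (fb [] 0) \<ominus>\<^bsub>Z\<^esub> h (fb [] a))"
 shows "h (lr i j \<ominus>\<^bsub>F\<^esub> c *:[F] (fb [] 0 \<ominus>\<^bsub>F\<^esub> fb [] a)) = \<zero>[Z]"
proof -
 have n: "fb [] b :[F]" for b by simp
 have "h (c *:[F] (fb [] 0 \<ominus>\<^bsub>F\<^esub> fb [] a)) = h (lr i j)"
  unfolding e using lin_map_smult[OF l g_closed, of c a] lin_map_minus[OF l vspace_F Z n n, of 0 a] by simp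
 then show ?thesis
  using lin_map_minus[OF l vspace_F Z lr_closed[OF ij] vs_smult[OF vspace_F g_closed]]
   vs_minus_self[OF Z lin_map_closed[OF l lr_closed[OF ij]]] by simp
qed

lemma counit_J0:
 assumes "x : J0" shows "counit F x = 0"
proof -
 have "counit F x = \<zero>[base_alg]"
 proof (rule alg_hom_Idl[OF kalgebra_F kalgebra_base_alg counit_F_hom rels_F _ assms[unfolded ideal_rels]])
  fix x assume "x : rels"
  then show "counit F x = \<zero>[base_alg]"
  proof (cases rule: rels_cases)
   case (1 f J)
   have "pr q [] f = 0" using 1(3) by (simp only: NN_def mem_Collect_eq)
   then show ?thesis using 1 counit_fbf[of f 0] by simp
  next
   case (2 i j)
   have k: "keys (single [i, j] 1 - single [j, i] (q i j)) \<subseteq> lists I"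
    by (rule subset_trans[OF keys_diff]) (use 2 in \<open>auto split: if_splits\<close>)
   have "counit F (lr i j) = lookup (single [i, j] 1 - single [j, i] (q i j)) []"
    unfolding lr_def by (rule counit_fbf[OF k])
   then have "counit F (lr i j) = 0" by (simp add: lookup_minus lookup_single)
   moreover have "counit F (fb [] 0) \<ominus>\<^bsub>base_alg\<^esub> counit F (fb [] (grp D i + grp D j)) = \<zero>[base_alg]"
    by (simp only: counit_fb lists.Nil if_True) (rule vs_minus_self[OF vspace_base_alg], simp)
   ultimately show ?thesis unfolding 2(1)
    by (intro rel_map[OF lin_counit_F vspace_base_alg 2(2,3)]) simp
  qed
 qed
 then show ?thesis by simp
qed

lemma SF_mult: "x :[F] ==> y :[F] ==> SF (x *[F] y) = SF y *[F] SF x"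
 using hF.S_mult[of x y] antipode_F kmult_closed[OF _ _ kalgebra_F, of x y] by simp

lemma p_SF_rels:
 assumes "x : rels" shows "p (SF x) = \<zero>[U]"
 using assms
proof (cases rule: rels_cases)
 case (1 f J)
 \<comment> \<open>The antipode formula \<open>SF_fbf\<close> asks for a common degree, so radical
   elements are treated by homogeneous parts.\<close>
 have "p (SF (fbf f 0)) = \<zero>[U]"
 proof (rule gr_homogeneous_ext[OF _ vspace_U 1(3,5)])
  show "lin_map V U (%f. p (SF (fbf f 0)))" by (intro lin_p lin_SF' lin_fbf lin_map_id)
  fix h a assume h: "h : NN q" "keys h \<subseteq> keys f" "!!w. w : keys h ==> gr D w = a"
  have k: "keys h \<subseteq> lists J" "keys h \<subseteq> lists I" using h(2) 1 by auto
  have "q i j ~= 0" if "i : J" "j : J" for i j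
   using class_sub[OF 1(2)] that chr_nz unfolding qq_def by blast
  then have "lx (rho q) h : NN q" by (rule NN_rho[OF _ h(1) k(1)])
  moreover have "keys (lx (rho q) h) \<subseteq> lists J"
   by (rule subset_trans[OF keys_lx], rule UN_least) (use subsetD[OF k(1)] in \<open>simp add: rho_rc in_lists_conv_set\<close>)
  ultimately show "p (SF (fbf h 0)) = \<zero>[U]" using SF_fbf[OF k(2) h(3)] p_NJ[OF 1(2)] by simp
 qed
 then show ?thesis by (simp add: 1)
next
 case (2 i j)
 let ?f = "single [i, j] 1 - single [j, i] (q i j)" and ?g = "grp D i + grp D j"
 note ij = 2(2-4)
 have k2: "keys ?f \<subseteq> {[i, j], [j, i]}" by (rule subset_trans[OF keys_diff]) (auto split: if_splits)
 have k: "keys ?f \<subseteq> lists I" using k2 ij by auto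
 have nz: "q i i ~= 0" "q j j ~= 0" "q i j ~= 0" "q j i ~= 0"
  using ij chr_nz by (auto simp: qq_def)
 have qi: "inverse (q j i) = q i j"
  using not_sim[OF ij] inverse_unique[of "q j i" "q i j"] by (simp add: mult.commute)
 have cancel: "q i j * (c * (inverse (q i j) * d)) = c * d" for c d using nz(3) by simp
 \<comment> \<open>The antipode maps \<open>lr i j\<close> to \<open>- \<kappa>\<close> times
   \<open>lr i j\<close> times the inverse of the group element.\<close>
 define \<kappa> where "\<kappa> = inverse (q i i * q j j)"
 have n: "fb [] a :[F]" "p (fb [] a) :[U]" for a by (rule fbF p_closed[OF fbF]; simp)+
 have l: "lin_map F U (%x. p (SF x))" by (intro lin_p lin_SF' lin_map_id)
 have SFg: "SF (fb [] a) = fb [] (- a)" for a using n(1)[of "- a"] by (simp add: SF_fb rc_def del: F_simps)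
 have r: "rho q [k, l] = single [l, k] (inverse (q k k * q l k) * inverse (q l l))" for k l
  by (simp add: mult_ac inverse_mult_distrib)
 have "lx (rho q) ?f = rho q [i, j] - scale (q i j) (rho q [j, i])" by (simp del: rho.simps)
 also have "... = single [j, i] (\<kappa> * q i j) - single [i, j] \<kappa>"
  unfolding r using nz qi by (simp add: \<kappa>_def mult_ac inverse_mult_distrib cancel)
 also have "... = scale (- \<kappa>) ?f" by (simp add: single_uminus mult.commute)
 finally have "lx (rho q) ?f = scale (- \<kappa>) ?f" .
 moreover have "gr D w = ?g" if "w : keys ?f" for w
 proof -
  have "w = [i, j] \<or> w = [j, i]" using subsetD[OF k2 that] by simp
  then show ?thesis by (auto simp: add.commute)
 qed
 ultimately have "SF (lr i j) = fbf (scale (- \<kappa>) ?f) (- ?g)"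
  unfolding lr_def using SF_fbf[OF k, of ?g] by metis
 also have "... = (- \<kappa>) *:[F] (lr i j *[F] fb [] (- ?g))"
  unfolding lr_def fbf_g[OF k] using fbf_smult[OF k, of "- \<kappa>" "- ?g"] by simp
 finally have "p (SF (lr i j)) = (- \<kappa>) *:[U] (p (lr i j) *[U] p (fb [] (- ?g)))"
  using lr_closed[OF ij(1,2)] n(1) by (simp add: U_simps kmult_closed del: F_simps)
 also have "p (lr i j) *[U] p (fb [] (- ?g)) = lam i j *:[U] (p (fb [] (- ?g)) \<ominus>\<^bsub>U\<^esub> p (fb [] 0))"
 proof -
  interpret u: ring U by (rule kalgebraD(2)[OF kalgebra_U])
  have "fb [] a *[F] fb [] b = fb [] (a + b)" for a b using n(1)[of "a + b"] by (simp add: fb_mult del: F_simps)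
  then have "p (fb [] a) *[U] p (fb [] b) = p (fb [] (a + b))" for a b using n(1) by (simp add: U_simps del: F_simps)
  then show ?thesis unfolding p_lr[OF ij]
   using n(2) kalgebraD(3)[OF kalgebra_U] u.minus_closed by (simp add: u.minus_eq u.l_distr u.l_minus)
 qed
 also have "(- \<kappa>) *:[U] (lam i j *:[U] (p (fb [] (- ?g)) \<ominus>\<^bsub>U\<^esub> p (fb [] 0))) = lam i j *:[U] (p (fb [] 0) \<ominus>\<^bsub>U\<^esub> p (fb [] (- ?g)))"
 proof (cases "lam i j = 0")
  case True
  then show ?thesis using n(2) by (simp add: vs_minus_closed)
 next
  case False
  \<comment> \<open>A nonzero parameter forces the two characters to be inverse to each other.
    Evaluated at both group elements and combined with \<open>q i j * q j i = 1\<close>, this gives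
    \<open>\<kappa> = 1\<close>, the value that the linking relation requires.\<close>
  then have "linkable D i j" using lp ij unfolding linking_parameter_def by blast
  then have c: "chr D i a * chr D j a = 1" for a by (simp add: linkable_def)
  have "q i i * q i j = 1" "q j i * q j j = 1" using c by (simp_all add: qq_def)
  then have "(q i i * q j j) * (q i j * q j i) = 1" by (simp add: mult_ac)
  then have "\<kappa> = 1" using not_sim[OF ij] by (simp add: \<kappa>_def)
  then show ?thesis using n(2) by (simp add: vs_minus_eq vs_smult_r_distr vs_smult_smult vs_comm)
 qed
 finally show ?thesis unfolding 2(1) by (intro rel_map[OF l vspace_U ij(1,2)]) (simp add: SFg)
qed

text \<open>\<open>SF\<close> reverses products, so the kernel of \<open>p\<close> after
  \<open>SF\<close> is still a two-sided ideal, and it contains the generators.\<close>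

lemma p_SF_J0:
 assumes "x : J0" shows "p (SF x) = \<zero>[U]"
proof -
 interpret u: ring U by (rule kalgebraD(2)[OF kalgebra_U])
 let ?K = "{x : carrier F. p (SF x) = \<zero>[U]}"
 have l: "lin_map F U (%x. p (SF x))" by (intro lin_p lin_SF' lin_map_id)
 have m: "p (SF (x *[F] y)) = p (SF y) *[U] p (SF x)" if "x :[F]" "y :[F]" for x y
  using that by (simp add: SF_mult U_simps SF_closed del: F_simps)
 have pc: "p (SF x) :[U]" if "x :[F]" for x using lin_map_closed[OF l that] .
 have "ideal ?K F"
 proof (rule idealI)
  show "ring F" by (rule kalgebraD(2)[OF kalgebra_F])
  show "subgroup ?K (add_monoid F)"
  proof (rule hF.add.subgroupI)
   show "?K ~= {}" using lin_map_zero[OF l vspace_F vspace_U] vs_zero[OF vspace_F] by blast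
   show "\<ominus>\<^bsub>F\<^esub> a : ?K" if "a : ?K" for a
    using that lin_map_uminus[OF l vspace_F vspace_U, of a] vs_uminus[OF vspace_F, of a] vs_uminus_eq[OF vspace_U vs_zero[OF vspace_U]] by (simp del: F_simps)
   show "a +[F] b : ?K" if "a : ?K" "b : ?K" for a b
    using that lin_map_add[OF l, of a b] vs_add[OF vspace_F, of a b] by (simp del: F_simps)
  qed auto
 qed (use m pc kmult_closed[OF _ _ kalgebra_F] in \<open>auto simp del: F_simps\<close>)
 then have "J0 \<subseteq> ?K" unfolding ideal_rels
  by (rule hF.genideal_minimal) (use rels_F p_SF_rels in blast)
 then show ?thesis using assms by blast
qed

lemma p_rep_eq:
 assumes h: "lin_map F Z h" "vspace Z" "!!x. x : J0 ==> h x = \<zero>[Z]" and x: "x :[F]"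
 shows "h (SOME a. a : p x) = h x"
proof -
 let ?r = "SOME a. a : p x"
 have r: "?r :[F]" "p ?r = p x" using p_rep[OF x] by simp_all
 then have "h (?r \<ominus>\<^bsub>F\<^esub> x) = \<zero>[Z]" using p_eq[OF r(1) x] h(3) by blast
 then have "h ?r \<ominus>\<^bsub>Z\<^esub> h x = \<zero>[Z]" using lin_map_minus[OF h(1) vspace_F h(2) r(1) x] by simp
 then show ?thesis using vs_minus_0_iff[OF h(2) lin_map_closed[OF h(1) r(1)] lin_map_closed[OF h(1) x]] by simp
qed

lemma lin_D2: "lin_map F UU D2" using alg_homD(1)[OF alg_hom_D2] by simp

text \<open>The quotient defines its operations through a chosen representative, and linear maps
  that vanish on the ideal do not depend on the choice.\<close>

lemma U_coalg:
 assumes x: "x :[F]" shows "comult U (p x) = D2 x" "counit U (p x) = counit F x"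
proof -
 define Q where "Q = ring.extend (F Quot J0) (module.fields (%c A. J0 +>\<^bsub>F\<^esub> (c *:[F] (SOME a. a : A))))"
 have U: "U = module.extend Q (bialg.fields
  (%A. tensor_lift (tensor Q Q) (%a b. tns Q Q (p a) (p b)) (comult F (SOME a. a : A))) (%A. counit F (SOME a. a : A)))"
  unfolding U_alg_def bialg_quot_def Let_def Q_def p_def ..
 have t: "tensor Q Q = UU" "tns Q Q = tns U U" by (rule tensor_cong; simp add: U module.defs)+
 have "comult U (p x) = D2 (SOME a. a : p x)" unfolding D2_def pp_def t[symmetric] by (subst U) (simp add: module.defs bialg.defs)
 then show "comult U (p x) = D2 x" using p_rep_eq[OF lin_D2 vspace_tensor D2_J0 x] by simp
 have "counit U (p x) = counit F (SOME a. a : p x)" by (subst U) (simp add: module.defs bialg.defs)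
 then show "counit U (p x) = counit F x" using p_rep_eq[OF lin_counit_F vspace_base_alg _ x] counit_J0 by simp
qed

lemma hopf_U: "hopf_algebra U" and hopf_p: "hopf_hom F U p"
proof -
 have "comult U (p x) = sw F UU (%a b. tns U U (p a) (p b)) x" if "x :[F]" for x
  using U_coalg(1)[OF that] hF.tensor_lift_sw[OF vspace_tensor that, of U U "%a b. tns U U (p a) (p b)"] by (simp add: D2_def pp_def)
 moreover have "p (antipode F x) = \<zero>[U]" if "x :[F]" "p x = \<zero>[U]" for x
  using that p_SF_J0 p_zero antipode_F by metis
 ultimately show "hopf_algebra U" "hopf_hom F U p"
  using hF.hopf_surj[OF vspace_U lin_p0 U_simps(1)[symmetric] alg_homD(2,3)[OF alg_hom_p]] U_coalg(2) by blast+
qed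

text \<open>Compatibility with coproduct and counit is an equality of algebra maps on the free
  object, hence checked on letters and group elements. It passes to \<open>U\<close> since every
  element lifts.\<close>

lemma U_UP:
 assumes B: "hopf_algebra B" and x: "!!i. i : I ==> x i :[B]" and g: "!!a. g a :[B]"
  and g0: "g 0 = \<one>[B]" and gg: "!!a b. g (a + b) = g a *[B] g b"
  and gx: "!!i a. i : I ==> g a *[B] x i = chr D i a *:[B] (x i *[B] g a)"
  and cx: "!!i. i : I ==> comult B (x i) = tns B B (x i) \<one>[B] +[tensor B B] tns B B (g (grp D i)) (x i)"
  and cg: "!!a. comult B (g a) = tns B B (g a) (g a)"
  and ex: "!!i. i : I ==> counit B (x i) = 0" and eg: "!!a. counit B (g a) = 1"
  and nn: "!!J f. J : I // sim D ==> f : NN q ==> keys f \<subseteq> lists J ==> lin_ext B (%w. foldr (%i y. x i *[B] y) w \<one>[B]) f = \<zero>[B]"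
  and lk: "!!i j. i : I ==> j : I ==> (i, j) \<notin> sim D ==>
   x i *[B] x j \<ominus>\<^bsub>B\<^esub> q i j *:[B] (x j *[B] x i) = lam i j *:[B] (\<one>[B] \<ominus>\<^bsub>B\<^esub> g (grp D i + grp D j))"
 shows "\<exists>\<Phi>. hopf_hom U B \<Phi> & (\<forall>i\<in>I. \<Phi> (p (fb [i] 0)) = x i) & (\<forall>a. \<Phi> (p (fb [] a)) = g a)"
proof -
 interpret B: hopf B by unfold_locales (rule B)
 obtain f where f: "alg_hom F B f" and fx: "!!i. i : I ==> f (fb [i] 0) = x i" and fg: "!!a. f (fb [] a) = g a"
  and fw: "!!w. w : lists I ==> f (fb w 0) = foldr (%i y. x i *[B] y) w \<one>[B]"
  using fb_UP[OF B.kU x g g0 gg gx] by blast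
 note fl = alg_homD(1)[OF f]
 have f0: "f y = \<zero>[B]" if "y : J0" for y
 proof (rule alg_hom_Idl[OF kalgebra_F B.kU f rels_F _ that[unfolded ideal_rels]])
  fix y assume "y : rels"
  then show "f y = \<zero>[B]"
  proof (cases rule: rels_cases)
   case (1 h J)
   have "f (fbf h 0) = lin_ext B (%w. f (fb w 0)) h"
    by (rule lin_map_expand[OF lin_map_comp[OF fl lin_fbf[OF lin_map_id]] B.vU 1(5)])
   also have "... = lin_ext B (%w. foldr (%i y. x i *[B] y) w \<one>[B]) h"
    by (rule lin_ext_fun_cong) (use fw subsetD[OF 1(5)] in blast)
   finally show ?thesis using 1 nn by simp
  next
   case (2 i j)
   have c: "fb [i, j] 0 :[F]" "fb [j, i] 0 :[F]" using 2 by simp_all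
   have "f (lr i j) = x i *[B] x j \<ominus>\<^bsub>B\<^esub> q i j *:[B] (x j *[B] x i)"
    unfolding lr_eq[OF 2(2,3)] using lin_map_minus[OF fl vspace_F B.vU c(1) vs_smult[OF vspace_F c(2)]] lin_map_smult[OF fl c(2)]
     fw[of "[i, j]"] fw[of "[j, i]"] x 2 by (simp del: F_simps)
   then show ?thesis unfolding 2(1)
    by (intro rel_map[OF fl B.vU 2(2,3)]) (simp add: fg g0 lk[OF 2(2-4)])
  qed
 qed
 define \<Phi> where "\<Phi> A = f (SOME a. a : A)" for A
 have \<Phi>: "\<Phi> (p y) = f y" if "y :[F]" for y unfolding \<Phi>_def by (rule p_rep_eq[OF fl B.vU f0 that])
 have l\<Phi>: "lin_map U B \<Phi>"
  by (rule lin_map_surj[OF lin_p0 U_simps(1)[symmetric] vspace_F], rule lin_map_cong[OF \<Phi> vspace_F fl])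
 have ah: "alg_hom U B \<Phi>"
 proof (rule alg_homI[OF l\<Phi>])
  show "\<Phi> \<one>[U] = \<one>[B]" using \<Phi>[OF hF.one_closed] alg_homD(3)[OF f] by (simp add: U_simps(4))
  fix u v assume "u :[U]" "v :[U]"
  then obtain y z where "u = p y" "v = p z" "y :[F]" "z :[F]" by (auto simp: U_simps(1) simp del: F_simps)
  then show "\<Phi> (u *[U] v) = \<Phi> u *[B] \<Phi> v"
   by (simp add: U_simps(2) \<Phi> alg_homD(2)[OF f] kmult_closed del: F_simps)
 qed
 let ?BB = "tensor B B"
 let ?ff = "tensor_lift ?BB (%a b. tns B B (f a) (f b))"
 have bf: "bilin F F ?BB (%a b. tns B B (f a) (f b))" by (intro bilinI lin_tns_l lin_tns_r fl lin_map_closed[OF fl])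
 note lff = lin_map_tensor_lift[OF vspace_F vspace_F vspace_tensor bf] and tff = tensor_lift_tns[OF vspace_F vspace_F vspace_tensor bf]
 have b\<Phi>: "bilin U U ?BB (%a b. tns B B (\<Phi> a) (\<Phi> b))" by (intro bilinI lin_tns_l lin_tns_r l\<Phi> lin_map_closed[OF l\<Phi>])
 note l\<Phi>2 = lin_map_tensor_lift[OF vspace_U vspace_U vspace_tensor b\<Phi>] and t\<Phi> = tensor_lift_tns[OF vspace_U vspace_U vspace_tensor b\<Phi>]
 have cf: "comult B (f y) = ?ff (comult F y)" if "y :[F]" for y
 proof (rule fb_gen_ext[OF alg_hom_comp[OF f B.comult_hom] alg_hom_comp[OF comult_F_hom alg_hom_tensor[OF f kalgebra_F B.kU]] kalgebra_tensor_alg[OF B.kU B.kU] _ _ that])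
  show "comult B (f (fb [] a)) = ?ff (comult F (fb [] a))" for a
   using tff[OF fbF fbF, of "[]" "[]" a a] by (simp add: comult_g fg cg)
  fix i assume i: "i : I"
  have c: "fb [i] 0 :[F]" "fb [] a :[F]" for a using i by simp_all
  show "comult B (f (fb [i] 0)) = ?ff (comult F (fb [i] 0))"
   unfolding comult_x[OF i] lin_map_add[OF lff tns_closed[OF c(1) c(2)] tns_closed[OF c(2) c(1)]] tff[OF c(1) c(2)] tff[OF c(2) c(1)]
   by (simp only: fx[OF i] fg cx[OF i] g0)
 qed
 have ef: "counit B (f y) = counit F y" if "y :[F]" for y
  by (rule fb_gen_ext[OF alg_hom_comp[OF f B.counit_hom] counit_F_hom kalgebra_base_alg _ _ that])
   (simp_all add: fx fg ex eg counit_fb)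
 have "comult B (\<Phi> u) = tensor_lift ?BB (%a b. tns B B (\<Phi> a) (\<Phi> b)) (comult U u) & counit B (\<Phi> u) = counit U u" if u: "u :[U]" for u
 proof -
  obtain y where y: "u = p y" "y :[F]" using u by (auto simp: U_simps(1) simp del: F_simps)
  have "?ff t = tensor_lift ?BB (%a b. tns B B (\<Phi> a) (\<Phi> b)) (pp t)" if "t :[FF]" for t
   by (rule tensor_ext[OF vspace_F vspace_F vspace_tensor lff lin_map_comp[OF l\<Phi>2 lin_pp] _ that])
    (simp add: tff pp_tns t\<Phi> \<Phi> p_closed del: F_simps)
  then show ?thesis using y cf ef lin_map_closed[OF lin_comult_F] by (simp add: \<Phi> U_coalg D2_def del: F_simps)
 qed
 then have "hopf_hom U B \<Phi>" unfolding hopf_hom_def using hopf_U B ah by blast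
 moreover have "\<forall>i\<in>I. \<Phi> (p (fb [i] 0)) = x i" "\<forall>a. \<Phi> (p (fb [] a)) = g a" using \<Phi> fx fg by simp_all
 ultimately show ?thesis by blast
qed

end

lemma lin_map_fmod_mono: "A \<subseteq> B ==> lin_map (fmod B) Z f ==> lin_map (fmod A) Z f"
proof -
 assume "A \<subseteq> B"
 then have "lin_map (fmod A) (fmod B) (%x. x)" by (auto simp: lin_map_def)
 then show "lin_map (fmod B) Z f ==> lin_map (fmod A) Z f" using lin_map_comp[of "fmod B" Z f "fmod A" "%x. x"] by simp
qed

lemma equiv_sim: "equiv (Ind D) (sim D)"
proof -
 let ?r = "{(i, j). i : Ind D & j : Ind D & qq D i j * qq D j i ~= 1}"
 have "sim D \<subseteq> Ind D \<times> Ind D" unfolding sim_def by (intro Un_least trancl_subset_Sigma) auto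
 moreover have "refl_on (Ind D) (sim D)" using calculation by (auto simp: refl_on_def sim_def)
 moreover have "sym (sim D)" by (rule symI) (rule sim_sym)
 moreover have "trans (sim D)"
  unfolding sim_def by (rule transI) (auto intro: trancl_trans)
 ultimately show ?thesis by (simp add: equiv_def)
qed

lemma omit_simps[simp]: "Ind (omit D L) = Ind D - L" "chr (omit D L) = chr D" "grp (omit D L) = grp D"
 by (simp_all add: omit_def)

lemma omit_qq[simp]: "qq (omit D L) = qq D" by (intro ext) (simp add: qq_def)

text \<open>A path through the remaining vertices is a path in the whole datum. The converse can
  fail, which is why a class may break up.\<close>

lemma sim_omit: "sim (omit D L) \<subseteq> sim D"
proof -
 let ?r = "%A. {(i, j). i : A & j : A & qq D i j * qq D j i ~= 1}"
 have "?r (Ind D - L) \<subseteq> ?r (Ind D)" by auto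
 then have "(?r (Ind D - L))\<^sup>+ \<subseteq> (?r (Ind D))\<^sup>+" by (meson subsetI trancl_mono)
 moreover have "Id_on (Ind D - L) \<subseteq> Id_on (Ind D)" by auto
 ultimately show ?thesis unfolding sim_def omit_simps omit_qq by (intro Un_mono)
qed

section \<open>Generators and relations in the quotient\<close>

context linked
begin

lemma U_x_p: "U_x D lam i = p (fb [i] 0)" and U_g_p: "U_g D lam a = p (fb [] a)"
 by (simp_all add: U_x_def U_g_def p_def fb_x_def fb_word_def fb_grp_def fbf_def)

lemma gF: "fb [] a :[F]" by simp
lemma xF: "i : I ==> fb [i] a :[F]" by simp

lemma U_closed[simp, mlin]: "i : I ==> U_x D lam i :[U]" "U_g D lam a :[U]"
 unfolding U_x_p U_g_p by (simp_all add: xF gF del: F_simps)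

lemma U_g_mult: "U_g D lam 0 = \<one>[U]" "U_g D lam (a + b) = U_g D lam a *[U] U_g D lam b"
 unfolding U_g_p using gF[of "a + b"] by (simp_all add: U_simps F_one gF fb_mult del: F_simps)

lemma U_gx: "i : I ==> U_g D lam a *[U] U_x D lam i = chr D i a *:[U] (U_x D lam i *[U] U_g D lam a)"
 unfolding U_g_p U_x_p using xF[of i a] xF[of i 0] gF[of a] by (simp add: U_simps fb_mult kmult_closed del: F_simps)

lemma U_comult: "i : I ==> comult U (U_x D lam i) = tns U U (U_x D lam i) \<one>[U] +[UU] tns U U (U_g D lam (grp D i)) (U_x D lam i)"
 "comult U (U_g D lam a) = tns U U (U_g D lam a) (U_g D lam a)"
proof -
 show "comult U (U_g D lam a) = tns U U (U_g D lam a) (U_g D lam a)"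
  unfolding U_g_p U_coalg(1)[OF gF] by (rule D2_g)
 assume i: "i : I"
 show "comult U (U_x D lam i) = tns U U (U_x D lam i) \<one>[U] +[UU] tns U U (U_g D lam (grp D i)) (U_x D lam i)"
  unfolding U_x_p U_coalg(1)[OF xF[OF i]] D2_def comult_x[OF i]
   lin_map_add[OF lin_pp tns_closed[OF xF[OF i] gF] tns_closed[OF gF xF[OF i]]] pp_tns[OF xF[OF i] gF] pp_tns[OF gF xF[OF i]]
  by (simp add: U_g_p U_simps(4) F_one)
qed

lemma U_counit: "i : I ==> counit U (U_x D lam i) = 0" "counit U (U_g D lam a) = 1"
 unfolding U_x_p U_g_p using U_coalg(2)[OF xF, of i 0] U_coalg(2)[OF gF, of a] by (simp_all add: counit_fb)

lemma U_word: "w : lists I ==> foldr (%i y. U_x D lam i *[U] y) w \<one>[U] = p (fb w 0)"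
proof (induction w)
 case (Cons i w)
 then show ?case unfolding U_x_p using fb_Cons[of i w 0] xF[of i 0] fbF[of w 0] by (simp add: U_simps del: F_simps)
qed (simp add: U_simps F_one del: F_simps)

lemma U_foldr: "keys f \<subseteq> lists I ==> lin_ext U (%w. foldr (%i y. U_x D lam i *[U] y) w \<one>[U]) f = p (fbf f 0)"
proof -
 assume f: "keys f \<subseteq> lists I"
 have "p (fbf f 0) = lin_ext U (%w. p (fb w 0)) f" by (rule lin_map_expand[OF lin_p[OF lin_fbf[OF lin_map_id]] vspace_U f])
 also have "... = lin_ext U (%w. foldr (%i y. U_x D lam i *[U] y) w \<one>[U]) f"
  by (rule lin_ext_fun_cong) (use U_word subsetD[OF f] in metis)
 finally show ?thesis ..
qed

lemma p_lr_x:
 assumes "i : I" "j : I"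
 shows "p (lr i j) = U_x D lam i *[U] U_x D lam j \<ominus>\<^bsub>U\<^esub> q i j *:[U] (U_x D lam j *[U] U_x D lam i)"
proof -
 have c: "fb [i, j] 0 :[F]" "fb [j, i] 0 :[F]" using assms by simp_all
 have e: "fb [k, l] 0 = fb [k] 0 *[F] fb [l] 0" if "k : I" "l : I" for k l using fb_Cons[of k "[l]" 0] that by simp
 have "p (lr i j) = p (fb [i, j] 0) \<ominus>\<^bsub>U\<^esub> q i j *:[U] p (fb [j, i] 0)"
  unfolding lr_eq[OF assms] using lin_map_minus[OF lin_p0 vspace_F vspace_U c(1) vs_smult[OF vspace_F c(2)]] lin_map_smult[OF lin_p0 c(2)] by simp
 then show ?thesis unfolding e[OF assms] e[OF assms(2,1)] U_x_p using U_simps(2)[OF xF[OF assms(1)] xF[OF assms(2)]] U_simps(2)[OF xF[OF assms(2)] xF[OF assms(1)]] by simp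
qed

lemma U_link: "i : I ==> j : I ==> (i, j) \<notin> sim D ==>
 U_x D lam i *[U] U_x D lam j \<ominus>\<^bsub>U\<^esub> q i j *:[U] (U_x D lam j *[U] U_x D lam i) = lam i j *:[U] (\<one>[U] \<ominus>\<^bsub>U\<^esub> U_g D lam (grp D i + grp D j))"
 using p_lr[of i j] p_lr_x[of i j] by (simp add: U_g_p U_simps(4) F_one)

lemma U_gen_ext:
 assumes f: "alg_hom U B f" and f': "alg_hom U B f'" and B: "kalgebra B"
  and x: "!!i. i : I ==> f (U_x D lam i) = f' (U_x D lam i)" and g: "!!a. f (U_g D lam a) = f' (U_g D lam a)" and u: "u :[U]"
 shows "f u = f' u"
proof -
 obtain y where y: "u = p y" "y :[F]" using u by (auto simp: U_simps(1) simp del: F_simps)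
 have "f (p y) = f' (p y)"
  by (rule fb_gen_ext[OF alg_hom_comp[OF alg_hom_p f] alg_hom_comp[OF alg_hom_p f'] B _ _ y(2)])
   (use x g in \<open>simp_all add: U_x_p U_g_p\<close>)
 then show ?thesis by (simp add: y)
qed

end

section \<open>Omitting vertices: the projection and its section\<close>

locale omitting = linked D lam for D :: "('i, 'g::ab_group_add, 'k::field) yd_datum" and lam +
 fixes L :: "'i set"
 assumes L: "L \<subseteq> {i : Ind D. not_linked D lam i}"
begin

sublocale O: linked "omit D L" "omit_link D lam"
 using is_yd_datum_omit[OF D] linking_parameter_omit[OF lp] by unfold_locales simp_all

abbreviation "D' \<equiv> omit D L"
abbreviation "lam' \<equiv> omit_link D lam"
abbreviation "U' \<equiv> U_alg D' lam'"

text \<open>An unlinked vertex has zero parameters in its row, and the skew symmetry of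
  \<open>lam\<close> gives the column.\<close>

lemma lam_L: "i : I ==> j : I ==> (i, j) \<notin> sim D ==> i : L \<or> j : L ==> lam i j = 0"
proof -
 assume ij: "i : I" "j : I" "(i, j) \<notin> sim D" "i : L \<or> j : L"
 have "(j, i) \<notin> sim D" using ij(3) sim_sym by metis
 moreover have "lam i j = - qq D i j * lam j i" using lp ij unfolding linking_parameter_def by blast
 ultimately show ?thesis using ij L unfolding not_linked_def by auto
qed

text \<open>Without \<open>L\<close> the class \<open>J\<close> is a union of classes of the smaller
  datum that are orthogonal to each other. Their parameters vanish inside \<open>J\<close> by the
  definition of \<open>omit_link\<close>, so letters of different parts commute up to
  \<open>q\<close> in \<open>U'\<close>, and \<open>NN_union\<close> applies.\<close>

lemma O_NN:
 assumes J: "J : I // sim D" and f: "f : NN q" "keys f \<subseteq> lists (J - L)"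
 shows "O.p (O.fbf f 0) = \<zero>[U']"
proof -
 let ?\<phi> = "%f. O.p (O.fbf f 0)"
 let ?CC = "{C : Ind D' // sim D'. C \<subseteq> J}"
 have l: "lin_map (fmod (lists (I - L))) U' ?\<phi>" using O.lin_p[OF O.lin_fbf[OF lin_map_id]] by simp
 have J2: "(i, j) : sim D" if "i : J" "j : J" for i j using quotient_eq_iff[OF equiv_sim J J that] by simp
 have Ccl: "C \<subseteq> I - L" if "C : ?CC" for C using O.class_sub[of C] that by simp
 \<comment> \<open>Classes are added one at a time, and \<open>NN_union\<close> reduces the radical
   of the enlarged alphabet to its two parts.\<close>
 have main: "?\<phi> f = \<zero>[U']" if "finite C" "C \<subseteq> ?CC" "f : NN q" "keys f \<subseteq> lists (\<Union> C)" for C f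
  using that
 proof (induction C arbitrary: f)
  case empty
  have "pr q [] f = 0" using empty.prems(2) by (simp only: NN_def mem_Collect_eq)
  moreover have "lookup f w = 0" if "w ~= []" for w
  proof -
   have "w \<notin> keys f" using empty.prems(3) that by auto
   then show ?thesis by (simp add: in_keys_iff)
  qed
  ultimately have "lookup f w = 0" for w by (cases "w = []") simp_all
  then have "f = 0" by (intro poly_mapping_eqI) simp
  then show ?case using lin_map_zero[OF l vspace_fmod O.vspace_U] by simp
 next
  case (insert Y0 C)
  have CC: "Z : ?CC" if "Z : insert Y0 C" for Z using that insert.prems(1) by (rule subsetD[rotated])
  have UC: "\<Union> C \<subseteq> I - L" "Y0 \<subseteq> I - L"
   by (rule Union_least, rule Ccl, rule CC, simp) (rule Ccl, rule CC, simp)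
  have Xc: "Y0 : Ind D' // sim D'" using insert.prems(1) by simp
  show ?case
  proof (rule NN_union[OF O.kalgebra_U, where q = q and A = "\<Union> C" and B = Y0 and \<phi> = ?\<phi>])
   show "\<Union> C \<inter> Y0 = {}"
   proof -
    have "Y0 \<inter> Z = {}" if "Z : C" for Z
    proof -
     have "Z : Ind D' // sim D'" using CC[of Z] that by simp
     then show ?thesis using quotient_disj[OF equiv_sim[of D'] Xc] that insert.hyps(2) by metis
    qed
    then show ?thesis by blast
   qed
   show "lin_map (fmod (lists (\<Union> C \<union> Y0))) U' ?\<phi>" by (rule lin_map_fmod_mono[OF lists_mono l]) (use UC in simp)
   show "?\<phi> (single (u @ v) 1) = ?\<phi> (single u 1) *[U'] ?\<phi> (single v 1)" if "u : lists (\<Union> C \<union> Y0)" "v : lists (\<Union> C \<union> Y0)" for u v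
   proof -
    have "lists (\<Union> C \<union> Y0) \<subseteq> lists (Ind D')" by (rule lists_mono) (use UC in auto)
    then have uv: "u : lists (Ind D')" "v : lists (Ind D')" using that by blast+
    then have uvc: "u @ v : lists (Ind D')" by (simp only: append_in_lists_conv)
    have "O.fb u 0 *[O.F] O.fb v 0 = O.fb (u @ v) 0"
     unfolding O.fb_mult[OF uv] O.ch_0[OF uv(2)] add_0_right by (rule vs_one[OF O.vspace_F O.fbF[OF uvc]])
    then show ?thesis using O.U_simps(2)[OF O.fbF[OF uv(1)] O.fbF[OF uv(2)]] by metis
   qed
   fix i j assume ij: "i : Y0" "j : \<Union> C"
   have s: "(i, j) : sim D"
   proof -
    obtain Y where "j : Y" "Y : C" using ij by blast
    then have "j : J" using CC[of Y] by auto
    moreover have "i : J" using CC[of Y0] ij(1) by auto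
    ultimately show ?thesis using J2 by simp
   qed
   have i: "i : Ind D'" "j : Ind D'" using ij UC by auto
   have n: "(i, j) \<notin> sim D'"
   proof
    assume a: "(i, j) : sim D'"
    obtain Y where Y: "j : Y" "Y : C" using ij by blast
    then have "Y : Ind D' // sim D'" using CC[of Y] by simp
    then have "Y0 = Y" using quotient_eqI[OF equiv_sim[of D'] Xc _ ij(1) Y(1) a] by blast
    then show False using Y insert.hyps(2) by simp
   qed
   have c: "O.fb [i, j] 0 :[O.F]" "O.fb [j, i] 0 :[O.F]" using i by (simp_all only: O.F_simps O.fb_closed lists.intros)
   \<comment> \<open>\<open>i\<close> and \<open>j\<close> are equivalent in \<open>D\<close>, so
     their parameter in the smaller datum is zero and the linking relation is a plain quantum
     commutator.\<close>
   have "O.p (O.lr i j) = \<zero>[U']" unfolding O.p_lr[OF i n] using s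
    by (simp only: omit_link_def if_True) (intro vs_null O.vspace_U vs_minus_closed O.p_closed O.gF)
   then have "?\<phi> (single [i, j] 1) \<ominus>\<^bsub>U'\<^esub> q i j *:[U'] ?\<phi> (single [j, i] 1) = \<zero>[U']"
    unfolding O.lr_eq[OF i] using lin_map_minus[OF O.lin_p0 O.vspace_F O.vspace_U c(1) vs_smult[OF O.vspace_F c(2)]] lin_map_smult[OF O.lin_p0 c(2)] by simp
   then show "?\<phi> (single [i, j] 1) = q i j *:[U'] ?\<phi> (single [j, i] 1)"
    using vs_minus_0_iff[OF O.vspace_U O.p_closed[OF c(1)] vs_smult[OF O.vspace_U O.p_closed[OF c(2)]]] by simp
  next
   show "?\<phi> f = \<zero>[U']" if "f : NN q" "keys f \<subseteq> lists (\<Union> C)" for f using insert.IH[of f] insert.prems(1) that by simp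
   show "?\<phi> f = \<zero>[U']" if "f : NN q" "keys f \<subseteq> lists Y0" for f using O.p_NJ[OF Xc] that by simp
   show "f : NN q" "keys f \<subseteq> lists (\<Union> C \<union> Y0)" using insert.prems by (simp_all add: Un_commute)
  qed
 qed
 have "finite ?CC" using finite_quotient[of "Ind D'" "sim D'"] O.D equiv_sim[of D'] by (simp add: is_yd_datum_def equiv_def finite_subset)
 moreover have "J - L \<subseteq> \<Union> ?CC"
 proof
  fix i assume i: "i : J - L"
  then have iI: "i : Ind D'" using class_sub[OF J] by auto
  have "sim D' `` {i} \<subseteq> J"
  proof
   fix j assume "j : sim D' `` {i}"
   then have "(i, j) : sim D" using sim_omit[of D L] by auto
   then show "j : J" by (rule in_quotient_imp_closed[OF equiv_sim J, rotated]) (use i in simp)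
  qed
  then have "sim D' `` {i} : ?CC" using quotientI[OF iI, of "sim D'"] by simp
  then show "i : \<Union> ?CC" using equiv_class_self[OF equiv_sim iI] by (rule UnionI)
 qed
 ultimately show ?thesis
  by (intro main[OF _ order_refl f(1) subset_trans[OF f(2) lists_mono]])
qed

text \<open>Words with a letter of \<open>L\<close> go to zero, and the restriction of a radical
  element to the remaining words is radical, so \<open>O_NN\<close> covers the Nichols relations.
  Linking relations that involve \<open>L\<close> have parameter zero.\<close>

lemma Phi_ex: "\<exists>\<Phi>. hopf_hom U U' \<Phi> & (\<forall>i\<in>I - L. \<Phi> (U_x D lam i) = U_x D' lam' i) & (\<forall>i\<in>L. \<Phi> (U_x D lam i) = \<zero>[U']) & (\<forall>a. \<Phi> (U_g D lam a) = U_g D' lam' a)"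
proof -
 let ?x = "%i. if i : L then \<zero>[U'] else U_x D' lam' i" and ?g = "U_g D' lam'"
 interpret u: hopf U' by unfold_locales (rule O.hopf_U)
 have xc: "?x i :[U']" if "i : I" for i using O.U_closed(1)[of i] that by simp
 have gc: "?g a :[U']" for a by (rule O.U_closed)
 have w0: "foldr (%i y. ?x i *[U'] y) w \<one>[U'] = (if set w \<inter> L = {} then foldr (%i y. U_x D' lam' i *[U'] y) w \<one>[U'] else \<zero>[U'])
   & foldr (%i y. ?x i *[U'] y) w \<one>[U'] :[U']" if "w : lists I" for w
  using that by (induction w) (use xc in auto)
 have "\<exists>\<Phi>. hopf_hom U U' \<Phi> & (\<forall>i\<in>I. \<Phi> (p (fb [i] 0)) = ?x i) & (\<forall>a. \<Phi> (p (fb [] a)) = ?g a)"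
 proof (rule U_UP[OF O.hopf_U xc gc])
  show "?g 0 = \<one>[U']" "?g (a + b) = ?g a *[U'] ?g b" for a b by (rule O.U_g_mult)+
  show "comult U' (?g a) = tns U' U' (?g a) (?g a)" "counit U' (?g a) = 1" for a by (rule O.U_comult O.U_counit)+
  show "?g a *[U'] ?x i = chr D i a *:[U'] (?x i *[U'] ?g a)" if "i : I" for i a
   using O.U_gx[of i a] gc that by simp
  show "comult U' (?x i) = tns U' U' (?x i) \<one>[U'] +[tensor U' U'] tns U' U' (?g (grp D i)) (?x i)" if "i : I" for i
   using O.U_comult(1)[of i] O.tns_U0[OF u.one_closed] O.tns_U0[OF gc] that lin_map_zero[OF u.lin_comult0 u.vU vspace_tensor] by simp
  show "counit U' (?x i) = 0" if "i : I" for i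
   using O.U_counit(1)[of i] that lin_map_zero[OF u.lin_counit0 u.vU vspace_base_alg] by simp
  show "?x i *[U'] ?x j \<ominus>\<^bsub>U'\<^esub> q i j *:[U'] (?x j *[U'] ?x i) = lam i j *:[U'] (\<one>[U'] \<ominus>\<^bsub>U'\<^esub> ?g (grp D i + grp D j))"
   if ij: "i : I" "j : I" "(i, j) \<notin> sim D" for i j
  proof (cases "i : L \<or> j : L")
   case True
   then show ?thesis using lam_L[OF ij True] xc[OF ij(1)] xc[OF ij(2)] gc u.minus_closed[OF u.one_closed gc] by (auto simp: u.minus_eq)
  next
   case False
   moreover have "(i, j) \<notin> sim D'" using ij(3) sim_omit by blast
   ultimately show ?thesis using O.U_link[of i j] ij by (simp add: omit_link_def)
  qed
  fix J f assume J: "J : I // sim D" and f: "f : NN q" "keys f \<subseteq> lists J"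
  have JI: "keys f \<subseteq> lists I" using f(2) lists_mono[OF class_sub[OF J]] by blast
  let ?f = "res (I - L) f"
  have k: "keys ?f \<subseteq> lists (I - L)" by (rule keys_res)
  have "keys ?f \<subseteq> lists J" using keys_wt f(2) unfolding res_def by blast
  then have k2: "keys ?f \<subseteq> lists (J - L)" using k by (fastforce simp: in_lists_conv_set)
  have lh: "lin_map (fmod (lists I)) U' (lin_ext U' (%w. foldr (%i y. ?x i *[U'] y) w \<one>[U']))"
   by (rule lin_ext_lin[OF O.vspace_U]) (use w0 in blast)
  have "lists (I - L) \<subseteq> lists I" by (rule lists_mono) blast
  then have lr: "lin_map (fmod (lists I)) (fmod (lists I)) (res (I - L))"
   using lin_map_fmod_sub[OF lin_res[OF lin_map_id], of "lists I" "I - L"] keys_res[of "I - L"] unfolding lin_map_fmod_iff[of _ "lists I"] by blast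
  have "lin_ext U' (%w. foldr (%i y. ?x i *[U'] y) w \<one>[U']) f = lin_ext U' (%w. foldr (%i y. ?x i *[U'] y) w \<one>[U']) ?f"
  proof (rule fmod_ext[OF lh lin_map_comp[OF lh lr] O.vspace_U _ JI])
   fix w assume w: "w : lists I"
   have "w : lists (I - L) \<longleftrightarrow> set w \<inter> L = {}" using w by (auto simp: in_lists_conv_set)
   then show "lin_ext U' (%w. foldr (%i y. ?x i *[U'] y) w \<one>[U']) (single w 1) = lin_ext U' (%w. foldr (%i y. ?x i *[U'] y) w \<one>[U']) (res (I - L) (single w 1))"
    using w0[OF w] by (simp add: res_single)
  qed
  also have "... = lin_ext U' (%w. foldr (%i y. U_x D' lam' i *[U'] y) w \<one>[U']) ?f"
  proof (rule lin_ext_fun_cong)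
   fix w assume "w : keys ?f"
   then have "w : lists (I - L)" by (rule subsetD[OF k])
   then have "w : lists I" "set w \<inter> L = {}" by (auto simp: in_lists_conv_set)
   then show "foldr (%i y. ?x i *[U'] y) w \<one>[U'] = foldr (%i y. U_x D' lam' i *[U'] y) w \<one>[U']" using w0 by simp
  qed
  also have "... = \<zero>[U']" using O.U_foldr[of ?f] k O_NN[OF J NN_res[OF f(1)] k2] by simp
  finally show "lin_ext U' (%w. foldr (%i y. ?x i *[U'] y) w \<one>[U']) f = \<zero>[U']" .
 qed
 then show ?thesis using L unfolding U_x_p U_g_p by (auto simp: subset_iff)
qed

text \<open>Each class of the smaller datum lies in a class of \<open>D\<close>, so its radical is
  killed in \<open>U\<close>. Vertices that are inequivalent only after omission have parameter
  zero, and their quantum commutator is radical in the common class.\<close>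

lemma Psi_ex: "\<exists>\<Psi>. hopf_hom U' U \<Psi> & (\<forall>i\<in>I - L. \<Psi> (U_x D' lam' i) = U_x D lam i) & (\<forall>a. \<Psi> (U_g D' lam' a) = U_g D lam a)"
proof -
 have "\<exists>\<Psi>. hopf_hom U' U \<Psi> & (\<forall>i\<in>Ind D'. \<Psi> (O.p (O.fb [i] 0)) = U_x D lam i) & (\<forall>a. \<Psi> (O.p (O.fb [] a)) = U_g D lam a)"
 proof (rule O.U_UP[OF hopf_U])
  fix i a b
  show "U_g D lam a :[U]" "U_g D lam 0 = \<one>[U]" "U_g D lam (a + b) = U_g D lam a *[U] U_g D lam b"
   "comult U (U_g D lam a) = tns U U (U_g D lam a) (U_g D lam a)" "counit U (U_g D lam a) = 1"
   by (rule U_closed U_g_mult U_comult U_counit)+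
  assume "i : Ind D'"
  then have i: "i : I" by simp
  show "U_x D lam i :[U]" "U_g D lam a *[U] U_x D lam i = chr D' i a *:[U] (U_x D lam i *[U] U_g D lam a)"
   "comult U (U_x D lam i) = tns U U (U_x D lam i) \<one>[U] +[tensor U U] tns U U (U_g D lam (grp D' i)) (U_x D lam i)"
   "counit U (U_x D lam i) = 0"
   using U_closed(1)[OF i] U_gx[OF i, of a] U_comult(1)[OF i] U_counit(1)[OF i] by simp_all
 next
  fix C f assume C: "C : Ind D' // sim D'" and f: "f : NN O.q" "keys f \<subseteq> lists C"
  obtain i where i: "i : Ind D'" "C = sim D' `` {i}" using C by (rule quotientE)
  let ?J = "sim D `` {i}"
  have J: "?J : I // sim D" using i by (intro quotientI) simp
  have "C \<subseteq> ?J" unfolding i(2) using sim_omit by blast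
  then have k: "keys f \<subseteq> lists ?J" using f(2) lists_mono by blast
  then have "keys f \<subseteq> lists I" using lists_mono[OF class_sub[OF J]] by blast
  then show "lin_ext U (%w. foldr (%i y. U_x D lam i *[U] y) w \<one>[U]) f = \<zero>[U]"
   using U_foldr p_NJ[OF J _ k] f(1) by simp
 next
  fix i j assume ij: "i : Ind D'" "j : Ind D'" "(i, j) \<notin> sim D'"
  have I: "i : I" "j : I" using ij by simp_all
  show "U_x D lam i *[U] U_x D lam j \<ominus>\<^bsub>U\<^esub> O.q i j *:[U] (U_x D lam j *[U] U_x D lam i) = lam' i j *:[U] (\<one>[U] \<ominus>\<^bsub>U\<^esub> U_g D lam (grp D' i + grp D' j))"
  proof (cases "(i, j) : sim D")
   case False
   then show ?thesis using U_link[OF I False] by (simp add: omit_link_def)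
  next
   case True
   let ?J = "sim D `` {i}"
   have J: "?J : I // sim D" using I by (intro quotientI)
   have iJ: "i : ?J" "j : ?J" using True equiv_class_self[OF equiv_sim I(1)] by auto
   have "keys (single [i, j] 1 - single [j, i] (q i j)) \<subseteq> lists ?J"
    by (rule subset_trans[OF keys_diff]) (use iJ in \<open>auto split: if_splits\<close>)
   moreover have "single [i, j] 1 - single [j, i] (q i j) : NN q"
    using O.not_sim[OF ij] by (intro NN_commutator) simp_all
   ultimately have "p (lr i j) = \<zero>[U]" unfolding lr_def by (intro p_NJ[OF J])
   moreover have "\<one>[U] \<ominus>\<^bsub>U\<^esub> U_g D lam a :[U]" for a
    by (intro vs_minus_closed vspace_U U_closed kone_closed kalgebra_U)
   ultimately show ?thesis using p_lr_x[OF I] True by (simp add: omit_link_def)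
  qed
 qed
 then show ?thesis unfolding O.U_x_p O.U_g_p by simp
qed

end

section \<open>Generators of the coinvariants\<close>

lemma lin_span_smult:
 assumes Z: "vspace Z" and M: "M \<subseteq> carrier Z" and x: "x : lin_span Z M"
 shows "c *:[Z] x : lin_span Z M"
proof -
 obtain f where f: "x = lin_ext Z (%x. x) f" "keys f \<subseteq> M" using x unfolding lin_span_def by auto
 have "(%x. x) : keys f \<rightarrow> carrier Z" using f M by auto
 then have "c *:[Z] x = lin_ext Z (%x. x) (scale c f)" using f lin_ext_scale[OF Z] by metis
 moreover have "keys (scale c f) \<subseteq> M" using f(2) keys_scale_subset by (rule subset_trans[rotated])
 ultimately show ?thesis unfolding lin_span_def by blast
qed

lemma lin_ext_mem:
 assumes Z: "vspace Z" and b: "!!x. x : keys f ==> b x : B" and B: "B \<subseteq> carrier Z" "\<zero>[Z] : B"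
  "!!y z. y : B ==> z : B ==> y +[Z] z : B" "!!c y. y : B ==> c *:[Z] y : B"
 shows "lin_ext Z b f : B"
proof -
 have "lin_ext Z b g : B" if "keys g \<subseteq> keys f" for g
  using that
 proof (induction g rule: poly_mapping_lin_induct)
  case (single x c g)
  have bx: "b x :[Z]" using single.hyps(2) b B(1) by blast
  have "b : keys (single x c) \<union> keys g \<rightarrow> carrier Z" using single.hyps b B(1) by (auto split: if_splits)
  then have "lin_ext Z b (single x c + g) = c *:[Z] b x +[Z] lin_ext Z b g"
   using lin_ext_add[OF Z] lin_ext_single[where b = b, OF Z bx] by metis
  then show ?case using B(3)[OF B(4)[OF b[OF single.hyps(2)]] single.IH] by simp
 qed (use B Z in simp)
 then show ?thesis by simp
qed

context datum
begin

lemma fb_span: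
 assumes B: "B \<subseteq> carrier F" "\<zero>[F] : B" "!!y z. y : B ==> z : B ==> y +[F] z : B" "!!c y. y : B ==> c *:[F] y : B"
  and b: "!!w a. w : lists I ==> fb w a : B" and y: "y :[F]"
 shows "y : B"
proof -
 have t: "tns V G r h : B" if r: "r :[V]" for r h
 proof -
  have "tns V G (single w 1) h : B" if "w : lists I" for w
  proof -
   have c: "single w 1 :[V]" using that by auto
   show ?thesis
    by (subst lin_map_expand[OF lin_tns_VG(2)[OF lin_map_id c] vspace_F, of h], simp, rule lin_ext_mem[OF vspace_F _ B])
     (use b[OF that] in \<open>simp add: fbf_def\<close>)
  qed
  moreover have "keys r \<subseteq> lists I" using r by simp
  ultimately show ?thesis
   by (subst lin_map_expand[OF lin_tns_VG(1)[OF lin_map_id] vspace_F, where h = r], simp, simp) (rule lin_ext_mem[OF vspace_F _ B], blast)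
 qed
 have "y :[T]" using y by simp
 then show ?thesis
 proof (induction rule: tensor_induct)
  case zero
  show ?case using B(2) by simp
 next
  case (tns v w c t')
  then show ?case using B(3)[OF B(4)[OF t]] by simp
 qed
qed

end

section \<open>The adjoint action on the generating set\<close>

context omitting
begin

definition "SS = {ad U (U_mon D lam is) (U_x D lam h) | is h. h : L & set is \<subseteq> Ind D' & (\<forall>i\<in>set is. (i, h) : sim D)}"

sublocale hU: hopf U by unfold_locales (rule hopf_U)

lemma sw_g: "vspace Z ==> bilin U U Z B ==> sw U Z B (U_g D lam a) = B (U_g D lam a) (U_g D lam a)"
 using hU.tensor_lift_sw[of Z "U_g D lam a" B] tensor_lift_tns[OF vspace_U vspace_U, of Z B] by (simp add: U_comult)

lemma sw_x: "vspace Z ==> bilin U U Z B ==> i : I ==> sw U Z B (U_x D lam i) = B (U_x D lam i) \<one>[U] +[Z] B (U_g D lam (grp D i)) (U_x D lam i)"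
proof -
 assume Z: "vspace Z" and B: "bilin U U Z B" and i: "i : I"
 note l = lin_map_tensor_lift[OF vspace_U vspace_U Z B] and t = tensor_lift_tns[OF vspace_U vspace_U Z B]
 have "sw U Z B (U_x D lam i) = tensor_lift Z B (comult U (U_x D lam i))"
  using hU.tensor_lift_sw[OF Z U_closed(1)[OF i]] by simp
 then show ?thesis unfolding U_comult(1)[OF i]
   lin_map_add[OF l tns_closed[OF U_closed(1)[OF i] hU.one_closed] tns_closed[OF U_closed(2) U_closed(1)[OF i]]]
   t[OF U_closed(1)[OF i] hU.one_closed] t[OF U_closed(2) U_closed(1)[OF i]] .
qed

lemma ad_one[simp]: "y :[U] ==> ad U \<one>[U] y = y"
proof -
 assume y: "y :[U]"
 have "bilin U U U (%a b. a *[U] y *[U] antipode U b)" using y by - (assumption | rule mlin)+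
 then show ?thesis using hU.ad_sw[of "\<one>[U]" y] hU.sw_one[OF vspace_U] y by simp
qed

lemma ad_unit: "x :[U] ==> ad U x \<one>[U] = counit U x *:[U] \<one>[U]"
 by (simp add: hU.ad_sw hU.sw_S_r cong: sw_cong)

lemma ad_g_mult: "y :[U] ==> z :[U] ==> ad U (U_g D lam a) (y *[U] z) = ad U (U_g D lam a) y *[U] ad U (U_g D lam a) z"
proof -
 assume yz: "y :[U]" "z :[U]"
 have "bilin U U U (%a b. ad U a y *[U] ad U b z)" using yz by - (assumption | rule mlin)+
 then show ?thesis unfolding hU.ad_mult_right[OF U_closed(2) yz] by (rule sw_g[OF vspace_U])
qed

text \<open>The two terms of the coproduct of a letter make its adjoint action a skew
  derivation.\<close>

lemma ad_x_mult: "i : I ==> y :[U] ==> z :[U] ==> ad U (U_x D lam i) (y *[U] z)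
 = ad U (U_x D lam i) y *[U] z +[U] ad U (U_g D lam (grp D i)) y *[U] ad U (U_x D lam i) z"
proof -
 assume i: "i : I" and yz: "y :[U]" "z :[U]"
 have "bilin U U U (%a b. ad U a y *[U] ad U b z)" using yz by - (assumption | rule mlin)+
 then show ?thesis unfolding hU.ad_mult_right[OF U_closed(1)[OF i] yz] using sw_x[OF vspace_U _ i] yz by simp
qed

lemma ad_g_x: "h : I ==> ad U (U_g D lam a) (U_x D lam h) = chr D h a *:[U] U_x D lam h"
proof -
 assume h: "h : I"
 let ?g = "U_g D lam a" and ?x = "U_x D lam h" and ?S = "antipode U (U_g D lam a)"
 have c: "?g :[U]" "?x :[U]" "?S :[U]" using h by simp_all
 have b: "bilin U U U (%a b. a *[U] antipode U b)" by (assumption | rule mlin)+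
 have gS: "?g *[U] ?S = \<one>[U]" using hU.sw_S_r[OF c(1)] sw_g[OF vspace_U b, of a] by (simp add: U_counit)
 have "bilin U U U (%a b. a *[U] ?x *[U] antipode U b)" using c by - (assumption | rule mlin)+
 then have "ad U ?g ?x = ?g *[U] ?x *[U] ?S" unfolding hU.ad_sw[OF c(1)] by (rule sw_g[OF vspace_U])
 also have "... = chr D h a *:[U] (?x *[U] (?g *[U] ?S))" using c U_gx[OF h, of a] by (simp add: hU.m_assoc)
 finally show ?thesis using c by (simp add: gS)
qed

text \<open>The antipode axiom for a letter gives \<open>g S(x_i) = - x_i\<close>. This turns the
  adjoint action on another letter into the quantum commutator, the left side of the linking
  relation.\<close>

lemma ad_x_x: "i : I ==> h : I ==> ad U (U_x D lam i) (U_x D lam h)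
 = U_x D lam i *[U] U_x D lam h \<ominus>\<^bsub>U\<^esub> q i h *:[U] (U_x D lam h *[U] U_x D lam i)"
proof -
 assume i: "i : I" and h: "h : I"
 let ?g = "U_g D lam (grp D i)" and ?x = "U_x D lam h" and ?y = "U_x D lam i" and ?S = "antipode U (U_x D lam i)"
 have c: "?g :[U]" "?x :[U]" "?y :[U]" "?S :[U]" using h i by simp_all
 have b: "bilin U U U (%a b. a *[U] antipode U b)" by (assumption | rule mlin)+
 have "?y +[U] ?g *[U] ?S = \<zero>[U]" using hU.sw_S_r[OF c(3)] sw_x[OF vspace_U b i] i c by (simp add: U_counit)
 then have gS: "?g *[U] ?S = \<ominus>\<^bsub>U\<^esub> ?y" using c hU.minus_unique[of "?g *[U] ?S" ?y ] hU.a_comm hU.minus_equality by (metis hU.m_closed)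
 have "bilin U U U (%a b. a *[U] ?x *[U] antipode U b)" using c by - (assumption | rule mlin)+
 then have "ad U ?y ?x = ?y *[U] ?x *[U] antipode U \<one>[U] +[U] ?g *[U] ?x *[U] ?S"
  unfolding hU.ad_sw[OF c(3)] by (rule sw_x[OF vspace_U _ i])
 also have "?g *[U] ?x *[U] ?S = q i h *:[U] (?x *[U] (?g *[U] ?S))" using c U_gx[OF h] by (simp add: hU.m_assoc qq_def)
 finally show ?thesis using c by (simp add: gS hU.r_minus vs_minus_eq vs_uminus_eq vs_smult_smult)
qed

lemma mon_Cons: "i : I ==> set is \<subseteq> I ==> U_mon D lam (i # is) = U_x D lam i *[U] U_mon D lam is"
 by (simp add: U_mon_def)

lemma mon_closed: "set is \<subseteq> I ==> U_mon D lam is :[U]"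
 by (induction "is") (simp_all add: U_mon_def)

lemma SS_U: "SS \<subseteq> carrier U"
proof
 fix y assume "y : SS"
 then obtain w h where y: "y = ad U (U_mon D lam w) (U_x D lam h)" "h : L" "set w \<subseteq> Ind D'" unfolding SS_def by blast
 then have "h : I" "set w \<subseteq> I" using L by auto
 then show "y :[U]" unfolding y(1) by (intro hU.ad_closed mon_closed U_closed)
qed

lemma ad_g_mon: "h : I ==> set is \<subseteq> I ==> ad U (U_g D lam a) (ad U (U_mon D lam is) (U_x D lam h))
 = (ch D is a * chr D h a) *:[U] ad U (U_mon D lam is) (U_x D lam h)"
proof (induction "is")
 case Nil
 then show ?case using ad_g_x[of h a] by (simp add: U_mon_def)
next
 case (Cons i "is")
 then have i: "i : I" "set is \<subseteq> I" by auto
 let ?z = "ad U (U_mon D lam is) (U_x D lam h)" and ?g = "U_g D lam a" and ?x = "U_x D lam i"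
 have c: "?z :[U]" "?g :[U]" "?x :[U]" "U_mon D lam is :[U]" "U_x D lam h :[U]"
  using i Cons.prems mon_closed by simp_all
 have e: "ad U (U_mon D lam (i # is)) (U_x D lam h) = ad U ?x ?z" unfolding mon_Cons[OF i] by (rule hU.ad_mult_left[OF c(3,4,5)])
 have "ad U ?g (ad U ?x ?z) = ad U (chr D i a *:[U] (?x *[U] ?g)) ?z" using hU.ad_mult_left[OF c(2,3,1)] U_gx[OF i(1), of a] by simp
 also have "... = chr D i a *:[U] ad U ?x (ad U ?g ?z)"
  using lin_map_smult[OF hU.lin_ad_l[OF lin_map_id c(1)] hU.m_closed[OF c(3,2)]] hU.ad_mult_left[OF c(3,2,1)] by simp
 also have "... = chr D i a *:[U] ((ch D is a * chr D h a) *:[U] ad U ?x ?z)"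
  using Cons.IH[OF Cons.prems(1) i(2)] lin_map_smult[OF hU.lin_ad_r[OF lin_map_id c(3)] c(1)] by simp
 finally show ?case unfolding e using c by (simp add: vs_smult_smult mult.assoc)
qed

text \<open>For a letter \<open>i\<close> that is not equivalent to \<open>h\<close>, the linking relations move \<open>x\<^sub>i\<close> to the right,
 where it acts trivially on \<open>x\<^sub>h\<close>, up to terms in the span of shorter elements.\<close>

lemma ad_x_SS:
 assumes i: "i : Ind D'" and h: "h : L" and "is": "set is \<subseteq> Ind D'" "\<forall>j\<in>set is. (j, h) : sim D"
 shows "ad U (U_x D lam i) (ad U (U_mon D lam is) (U_x D lam h)) : lin_span U SS"
proof (cases "(i, h) : sim D")
 case True
 have I: "i : I" "h : I" "set is \<subseteq> I" using i h L "is" by auto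
 have "ad U (U_x D lam i) (ad U (U_mon D lam is) (U_x D lam h)) = ad U (U_mon D lam (i # is)) (U_x D lam h)"
  unfolding mon_Cons[OF I(1,3)] using hU.ad_mult_left[of "U_x D lam i" "U_mon D lam is" "U_x D lam h"] I mon_closed by simp
 moreover have "set (i # is) \<subseteq> Ind D' & (\<forall>j\<in>set (i # is). (j, h) : sim D)" using i "is" True by simp
 ultimately have "ad U (U_x D lam i) (ad U (U_mon D lam is) (U_x D lam h)) : SS" unfolding SS_def using h by blast
 then show ?thesis by (rule lin_span_sub(3)[OF vspace_U SS_U])
next
 case False
 \<comment> \<open>With \<open>h\<close> fixed, a letter of \<open>D'\<close> equivalent to
   \<open>h\<close> maps these elements to each other, which the induction over the word
   needs.\<close>
 define M where "M = {ad U (U_mon D lam is) (U_x D lam h) | is. set is \<subseteq> Ind D' & (\<forall>j\<in>set is. (j, h) : sim D)}"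
 have M: "M \<subseteq> SS" unfolding M_def SS_def using h by blast
 note MU = subset_trans[OF M SS_U]
 note sp = lin_span_sub[OF vspace_U MU] and sm = lin_span_smult[OF vspace_U MU]
 have hI: "h : I" "i : I" using h i L by auto
 have "ad U (U_x D lam i) (ad U (U_mon D lam is) (U_x D lam h)) : lin_span U M"
  using "is"
 proof (induction "is")
  case Nil
  \<comment> \<open>\<open>h\<close> is not linked, so the linking relation makes this quantum
    commutator vanish.\<close>
  have "ad U (U_x D lam i) (U_x D lam h) = \<zero>[U]"
   unfolding ad_x_x[OF hI(2,1)] U_link[OF hI(2,1) False] using lam_L[OF hI(2,1) False] h hU.minus_closed[OF hU.one_closed U_closed(2)] by simp
  then show ?case using sp(1) hI by (simp add: U_mon_def)
 next
  case (Cons j "is")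
  let ?z = "ad U (U_mon D lam is) (U_x D lam h)" and ?g = "U_g D lam (grp D i + grp D j)"
  have j: "j : I" "set is \<subseteq> I" "(j, h) : sim D" "j : Ind D'" using Cons.prems by auto
  \<comment> \<open>\<open>j\<close> is equivalent to \<open>h\<close> and \<open>i\<close> is not,
    so \<open>x_i\<close> and \<open>x_j\<close> satisfy a linking relation. The group element on
    its right side acts on \<open>?z\<close> by a scalar.\<close>
  have nij: "(i, j) \<notin> sim D"
   using False j(3) equiv_sim[of D] by (meson equivE transE)
  have zM: "?z : M" unfolding M_def using Cons.prems by auto
  have c: "?z :[U]" "?g :[U]" "U_x D lam i :[U]" "U_x D lam j :[U]" "U_mon D lam is :[U]" "U_x D lam h :[U]"
   using zM MU hI j mon_closed by auto
  let ?l = "lam i j *:[U] (\<one>[U] \<ominus>\<^bsub>U\<^esub> ?g)"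
  have lc: "?l :[U]" "\<one>[U] \<ominus>\<^bsub>U\<^esub> ?g :[U]" using c by (simp_all add: hU.minus_closed)
  note la = hU.lin_ad_l[OF lin_map_id c(1)]
  have "U_x D lam i *[U] U_x D lam j = q i j *:[U] (U_x D lam j *[U] U_x D lam i) +[U] ?l"
   unfolding U_link[OF hI(2) j(1) nij, symmetric] using c by (simp add: hU.minus_eq hU.a_lcomm hU.r_neg hU.a_assoc)
  then have "ad U (U_x D lam i) (ad U (U_x D lam j) ?z) = q i j *:[U] ad U (U_x D lam j) (ad U (U_x D lam i) ?z) +[U] lam i j *:[U] (?z \<ominus>\<^bsub>U\<^esub> ad U ?g ?z)"
   using hU.ad_mult_left[OF c(3,4,1)] hU.ad_mult_left[OF c(4,3,1)] lin_map_add[OF la vs_smult[OF vspace_U hU.m_closed[OF c(4,3)]] lc(1)]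
    lin_map_smult[OF la hU.m_closed[OF c(4,3)]] lin_map_smult[OF la lc(2)] lin_map_minus[OF la vspace_U vspace_U hU.one_closed c(2)] c(1) by simp
  also have "... : lin_span U M"
  proof (intro sp(2) sm)
   show "ad U (U_x D lam j) (ad U (U_x D lam i) ?z) : lin_span U M"
   proof (rule lin_span_image[OF hU.lin_ad_r[OF lin_map_id c(4)] vspace_U vspace_U MU])
    show "ad U (U_x D lam i) ?z : lin_span U M" using Cons by simp
    fix y assume "y : M"
    then obtain js where js: "y = ad U (U_mon D lam js) (U_x D lam h)" "set js \<subseteq> Ind D'" "\<forall>j\<in>set js. (j, h) : sim D" unfolding M_def by blast
    then have jI: "set js \<subseteq> I" by auto
    have "ad U (U_x D lam j) y = ad U (U_mon D lam (j # js)) (U_x D lam h)"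
     unfolding mon_Cons[OF j(1) jI] js(1) using hU.ad_mult_left[OF c(4) mon_closed[OF jI] c(6)] by simp
    moreover have "set (j # js) \<subseteq> Ind D'" "\<forall>k\<in>set (j # js). (k, h) : sim D" using j js by auto
    ultimately have "ad U (U_x D lam j) y : M" unfolding M_def by blast
    then show "ad U (U_x D lam j) y : lin_span U M" by (rule sp(3))
   qed (use sp sm in blast)+
   show "?z \<ominus>\<^bsub>U\<^esub> ad U ?g ?z : lin_span U M"
    unfolding ad_g_mon[OF hI(1) j(2)] using sp(2)[OF sp(3)[OF zM] sm[OF sm[OF sp(3)[OF zM]]]] c
    by (simp add: vs_minus_eq)
  qed
  also have "ad U (U_x D lam j) ?z = ad U (U_mon D lam (j # is)) (U_x D lam h)"
   unfolding mon_Cons[OF j(1,2)] using hU.ad_mult_left[OF c(4,5,6)] by simp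
  finally show ?case .
 qed
 then obtain f where f: "ad U (U_x D lam i) (ad U (U_mon D lam is) (U_x D lam h)) = lin_ext U (%x. x) f" "keys f \<subseteq> M"
  unfolding lin_span_def by blast
 then show ?thesis unfolding lin_span_def using M by blast
qed

text \<open>Every element of \<open>K\<close> is \<open>rh\<close> of a combination of words times
  group elements. Reading a word from the left, a letter of \<open>L\<close> is coinvariant and
  leaves \<open>rh\<close> as a factor, and any other letter acts by \<open>ad\<close>.\<close>

lemma coinv_generated:
 assumes \<Phi>: "hopf_hom U U' \<Phi>" and \<Psi>: "hopf_hom U' U \<Psi>" and \<Phi>\<Psi>: "!!u. u :[U'] ==> \<Phi> (\<Psi> u) = u"
  and \<Phi>L: "!!h. h : L ==> \<Phi> (U_x D lam h) = \<zero>[U']"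
  and \<Psi>x: "!!i. i : Ind D' ==> \<Psi> (U_x D' lam' i) = U_x D lam i" and \<Psi>g: "!!a. \<Psi> (U_g D' lam' a) = U_g D lam a"
 shows "alg_generate U SS = carrier (coinv_hopf U U' \<Phi> \<Psi>)"
proof -
 interpret P: hopf_proj U U' \<Phi> \<Psi>
  using hopf_U O.hopf_U \<Phi> \<Psi> \<Phi>\<Psi> by unfold_locales
 define M where "M = alg_generate U SS"
 have sub: "M \<subseteq> B" if "subring B U" "!!c x. x : B ==> c *:[U] x : B" "SS \<subseteq> B" for B
  unfolding M_def alg_generate_def by (rule Inter_lower) (use that in simp)
 have MI: "y : M" if "!!B. subring B U ==> (!!c x. x : B ==> c *:[U] x : B) ==> SS \<subseteq> B ==> y : B" for y
  unfolding M_def alg_generate_def by (rule InterI) (use that in simp)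
 have M: "SS \<subseteq> M" "\<one>[U] : M" "\<zero>[U] : M" "!!x y. x : M ==> y : M ==> x *[U] y : M" "!!x y. x : M ==> y : M ==> x +[U] y : M"
  "!!c x. x : M ==> c *:[U] x : M"
 proof -
  show "SS \<subseteq> M"
  proof
   fix y assume "y : SS"
   then show "y : M" by (intro MI) (rule subsetD)
  qed
  show "\<one>[U] : M" by (rule MI) (rule subringE(3))
  show "\<zero>[U] : M" by (rule MI) (rule subringE(2))
  show "x *[U] y : M" if "x : M" "y : M" for x y
  proof (rule MI)
   fix B assume B: "subring B U" "!!c x. x : B ==> c *:[U] x : B" "SS \<subseteq> B"
   have "M \<subseteq> B" by (rule sub) (fact B)+
   then show "x *[U] y : B" by (intro subringE(6)[OF B(1)]) (use that in \<open>simp_all add: subset_iff\<close>)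
  qed
  show "x +[U] y : M" if "x : M" "y : M" for x y
  proof (rule MI)
   fix B assume B: "subring B U" "!!c x. x : B ==> c *:[U] x : B" "SS \<subseteq> B"
   have "M \<subseteq> B" by (rule sub) (fact B)+
   then show "x +[U] y : B" by (intro subringE(7)[OF B(1)]) (use that in \<open>simp_all add: subset_iff\<close>)
  qed
  show "c *:[U] x : M" if "x : M" for c x
  proof (rule MI)
   fix B assume B: "subring B U" "!!c x. x : B ==> c *:[U] x : B" "SS \<subseteq> B"
   have "M \<subseteq> B" by (rule sub) (fact B)+
   then show "c *:[U] x : B" using that by (intro B(2)) (rule subsetD)
  qed
 qed
 have subI: "subring B U" if "B \<subseteq> carrier U" "\<one>[U] : B" "!!c x. x : B ==> c *:[U] x : B"
  "!!x y. x : B ==> y : B ==> x *[U] y : B" "!!x y. x : B ==> y : B ==> x +[U] y : B" for B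
 proof (rule hU.subringI[OF that(1,2)])
  fix x assume "x : B"
  then show "\<ominus>\<^bsub>U\<^esub> x : B" using that(3)[of x "- 1"] vs_uminus_eq[OF vspace_U subsetD[OF that(1)]] by simp
 qed (rule that; assumption)+
 have MU: "M \<subseteq> carrier U"
  by (rule sub[OF subI]) (simp_all add: SS_U vs_smult[OF vspace_U])
 have lrh: "lin_map U U P.rh" by (rule P.lin_rh[OF lin_map_id])
 have lad: "lin_map U U (%y. ad U x y)" if "x :[U]" for x by (rule hU.lin_ad_r[OF lin_map_id that])
 \<comment> \<open>It suffices that the generators are coinvariant: \<open>x_h\<close> is, because
   \<open>\<Phi>\<close> kills it, and \<open>ad\<close> through \<open>\<Psi>\<close> preserves
   \<open>K\<close> by \<open>rh_ad\<close>.\<close>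
 have MK: "M \<subseteq> carrier P.K"
 proof (rule sub[OF subI])
  show "carrier P.K \<subseteq> carrier U" using P.K_sub by blast
  show "\<one>[U] :[P.K]" by (rule P.one_K)
  show sK: "c *:[U] x :[P.K]" if "x :[P.K]" for c x
   using vs_smult[OF kalgebraD(1), of P.K x c] P.braided_hopf_K that unfolding braided_hopf_algebra_def by (simp add: P.K_simps)
  show "c *:[U] x :[P.K]" if "x :[P.K]" for c x by (rule sK[OF that])
  show "x *[U] y :[P.K]" if "x :[P.K]" "y :[P.K]" for x y using P.K_mult_closed[OF that] .
  show "x +[U] y :[P.K]" if "x :[P.K]" "y :[P.K]" for x y
   using vs_add[OF kalgebraD(1), of P.K x y] P.braided_hopf_K that unfolding braided_hopf_algebra_def by (simp add: P.K_simps)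
  show "SS \<subseteq> carrier P.K"
  proof
   fix y assume "y : SS"
   then obtain w h where y: "y = ad U (U_mon D lam w) (U_x D lam h)" "h : L" "set w \<subseteq> Ind D'" unfolding SS_def by blast
   have h: "h : I" using y L by auto
   have "tensor_lift (tensor U U') (%a b. tns U U' a (\<Phi> b)) (comult U (U_x D lam h)) = tns U U' (U_x D lam h) \<one>[U']"
   proof -
    have ah: "alg_hom U U' \<Phi>" using \<Phi> unfolding hopf_hom_def by blast
    have f: "lin_map U U' \<Phi>" "\<Phi> \<one>[U] = \<one>[U']" by (rule alg_homD[OF ah])+
    have b: "bilin U U (tensor U U') (%a b. tns U U' a (\<Phi> b))" by (intro bilinI lin_tns_l lin_tns_r lin_map_id f(1) lin_map_closed[OF f(1)])
    have z: "tns U U' z \<zero>[U'] = \<zero>[tensor U U']" if "z :[U]" for z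
     by (rule lin_map_zero[OF lin_tns_r[OF lin_map_id that] O.vspace_U vspace_tensor])
    have u1: "\<one>[U'] :[U']" by (rule kone_closed[OF O.kalgebra_U])
    show ?thesis
     unfolding hU.tensor_lift_sw[OF vspace_tensor U_closed(1)[OF h]] sw_x[OF vspace_tensor b h] f(2) \<Phi>L[OF y(2)] z[OF U_closed(2)]
     by (rule vs_r_zero[OF vspace_tensor tns_closed[OF U_closed(1)[OF h] u1]])
   qed
   then have xK: "U_x D lam h :[P.K]" using U_closed(1)[OF h]
    by (simp add: coinv_hopf_def Let_def yd.defs bhopf.defs module.defs coinv_def)
   have "\<Psi> (U_mon D' lam' w) = U_mon D lam w & U_mon D' lam' w :[U']" using y(3)
   proof (induction w)
    case Nil
    have ah: "alg_hom U' U \<Psi>" using \<Psi> unfolding hopf_hom_def by blast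
    show ?case using alg_homD(3)[OF ah] kone_closed[OF O.kalgebra_U] by (simp add: U_mon_def)
   next
    case (Cons i w)
    have ah: "alg_hom U' U \<Psi>" using \<Psi> unfolding hopf_hom_def by blast
    have iw: "i : Ind D'" "set w \<subseteq> Ind D'" using Cons.prems by auto
    note IH = conjunct1[OF Cons.IH[OF iw(2)]] conjunct2[OF Cons.IH[OF iw(2)]]
    have xi: "U_x D' lam' i :[U']" by (rule O.U_closed(1)[OF iw(1)])
    have e: "U_mon D' lam' (i # w) = U_x D' lam' i *[U'] U_mon D' lam' w" "U_mon D lam (i # w) = U_x D lam i *[U] U_mon D lam w"
     by (simp_all only: U_mon_def foldr.simps o_apply)
    show ?case unfolding e alg_homD(2)[OF ah xi IH(2)] \<Psi>x[OF iw(1)] IH(1)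
     by (rule conjI[OF refl kmult_closed[OF xi IH(2) O.kalgebra_U]])
   qed
   then have mw: "U_mon D lam w = \<Psi> (U_mon D' lam' w)" "U_mon D' lam' w :[U']" by (simp_all only:)
   have adK: "ad U (\<Psi> u) (U_x D lam h) :[P.K]" if "u :[U']" for u
  proof -
   have ux: "U_x D lam h :[U]" "P.rh (U_x D lam h) = U_x D lam h" by (rule P.K_sub[OF xK], rule P.rh_K[OF xK])
   have "ad U (\<Psi> u) (U_x D lam h) = P.rh (\<Psi> u *[U] U_x D lam h)" using P.rh_ad[OF that ux(1)] ux(2) by metis
   moreover have ah: "alg_hom U' U \<Psi>" using \<Psi> unfolding hopf_hom_def by blast
   have "\<Psi> u *[U] U_x D lam h :[U]" by (rule hU.m_closed[OF lin_map_closed[OF alg_homD(1)[OF ah] that] ux(1)])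
   ultimately show ?thesis using P.rh_in_K by metis
  qed
   show "y :[P.K]" unfolding y(1) mw(1) by (rule adK[OF mw(2)])
  qed
 qed
 have spM: "lin_span U SS \<subseteq> M"
 proof
  fix y assume "y : lin_span U SS"
  then obtain f where f: "y = lin_ext U (%x. x) f" "keys f \<subseteq> SS" unfolding lin_span_def by blast
  have kM: "x : M" if "x : keys f" for x by (rule subsetD[OF M(1) subsetD[OF f(2) that]])
  show "y : M" unfolding f(1) by (rule lin_ext_mem[OF vspace_U _ MU M(3,5,6)]) (auto intro: kM)
 qed
 \<comment> \<open>The part of \<open>M\<close> that letters and group elements keep inside
   \<open>M\<close> is a subalgebra by the skew Leibniz rule. It contains the generators by
   \<open>ad_x_SS\<close>, so it is all of \<open>M\<close>.\<close>
 let ?N = "{y : M. (\<forall>a. ad U (U_g D lam a) y : M) & (\<forall>i\<in>Ind D'. ad U (U_x D lam i) y : M)}"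
 have xU: "U_x D lam i :[U]" if "i : Ind D'" for i using that by simp
 have N: "M \<subseteq> ?N"
 proof (rule sub[OF subI])
  show "?N \<subseteq> carrier U" using MU by blast
  show "\<one>[U] : ?N" using M(2) M(6)[OF M(2)] ad_unit xU by simp
  have sN: "c *:[U] x : ?N" if "x : ?N" for c x
  proof -
   have x: "x :[U]" using that MU by auto
   show ?thesis using that M(6) lin_map_smult[OF lad[OF U_closed(2)] x] lin_map_smult[OF lad[OF xU] x] by simp
  qed
  show "c *:[U] x : ?N" if "x : ?N" for c x by (rule sN[OF that])
  show "c *:[U] x : ?N" if "x : ?N" for c x by (rule sN[OF that])
  show "x +[U] y : ?N" if "x : ?N" "y : ?N" for x y
  proof -
   have x: "x :[U]" "y :[U]" using that MU by auto
   show ?thesis using that M(5) lin_map_add[OF lad[OF U_closed(2)] x] lin_map_add[OF lad[OF xU] x] by simp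
  qed
  show "x *[U] y : ?N" if "x : ?N" "y : ?N" for x y
  proof -
   have c: "x :[U]" "y :[U]" using that MU by auto
   show ?thesis using that M(4,5) ad_g_mult[OF c] ad_x_mult[OF _ c] by simp
  qed
  show "SS \<subseteq> ?N"
  proof
   fix y assume ySS: "y : SS"
   then obtain w h where y: "y = ad U (U_mon D lam w) (U_x D lam h)" "h : L" "set w \<subseteq> Ind D'" "\<forall>j\<in>set w. (j, h) : sim D"
    unfolding SS_def by blast
   have I: "h : I" "set w \<subseteq> I" using y L by auto
   have "ad U (U_g D lam a) y : M" for a unfolding y(1) ad_g_mon[OF I] using M(6) M(1) ySS y(1) by blast
   moreover have "ad U (U_x D lam i) y : M" if "i : Ind D'" for i unfolding y(1) using ad_x_SS[OF that y(2-4)] spM by blast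
   ultimately show "y : ?N" using ySS M(1) by blast
  qed
 qed
 let ?B = "{y : carrier F. P.rh (p y) : M}"
 have lp: "lin_map F U (%y. P.rh (p y))" by (rule lin_map_comp[OF lrh lin_p0])
 have wB: "fb w a : ?B" if "w : lists I" for w a
  using that
 proof (induction w)
  case Nil
  have gc: "U_g D' lam' a :[U']" by (rule O.U_closed)
  have "P.rh (\<Psi> (U_g D' lam' a) *[U] \<one>[U]) = ad U (U_g D lam a) \<one>[U]"
   using P.rh_ad[OF gc hU.one_closed] by (simp add: \<Psi>g P.rh_one)
  then have "P.rh (p (fb [] a)) = counit U (U_g D lam a) *:[U] \<one>[U]" using ad_unit[OF U_closed(2)] by (simp add: \<Psi>g flip: U_g_p)
  then show ?case using M(2,6) by simp
 next
  case (Cons i w)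
  then have i: "i : I" and w: "w : lists I" and IH: "P.rh (p (fb w a)) : M" by auto
  have pw: "p (fb w a) :[U]" by (rule p_closed[OF fbF[OF w]])
  have e: "p (fb (i # w) a) = U_x D lam i *[U] p (fb w a)"
   unfolding fb_Cons[OF i w] U_x_p by (rule U_simps(2)[OF xF[OF i] fbF[OF w], symmetric])
  have "P.rh (p (fb (i # w) a)) : M"
  proof (cases "i : L")
   case True
   have "ad U (U_mon D lam []) (U_x D lam i) = U_x D lam i" using i by (simp add: U_mon_def)
   moreover have "ad U (U_mon D lam []) (U_x D lam i) : SS" unfolding SS_def using True by fastforce
   ultimately have xM: "U_x D lam i : M" using M(1) by auto
   then show ?thesis unfolding e using P.rh_K_mult[OF _ pw, of "U_x D lam i"] MK M(4)[OF xM IH] by auto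
  next
   case False
   then have iD: "i : Ind D'" using i by simp
   have "P.rh (\<Psi> (U_x D' lam' i) *[U] p (fb w a)) = ad U (\<Psi> (U_x D' lam' i)) (P.rh (p (fb w a)))"
    by (rule P.rh_ad[OF O.U_closed(1)[OF iD] pw])
   then show ?thesis unfolding e \<Psi>x[OF iD] using N IH iD by auto
  qed
  then show ?case using fbF[of "i # w" a] i w by simp
 qed
 have B: "y : ?B" if "y :[F]" for y
 proof (rule fb_span[OF _ _ _ _ wB that])
  show "?B \<subseteq> carrier F" by blast
  show "\<zero>[F] : ?B" using lin_map_zero[OF lp vspace_F vspace_U] M(3) vs_zero[OF vspace_F] by simp
  show "y +[F] z : ?B" if "y : ?B" "z : ?B" for y z using that lin_map_add[OF lp, of y z] M(5) vs_add[OF vspace_F, of y z] by simp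
  show "c *:[F] y : ?B" if "y : ?B" for c y using that lin_map_smult[OF lp, of y c] M(6) vs_smult[OF vspace_F, of y c] by simp
 qed
 have "carrier P.K \<subseteq> M"
 proof
  fix x assume "x :[P.K]"
  then have x: "x :[U]" "P.rh x = x" by (rule P.K_sub, rule P.rh_K)
  then obtain y where y: "x = p y" "y :[F]" by (auto simp: U_simps(1) simp del: F_simps)
  have "P.rh (p y) : M" by (rule conjunct2[OF CollectD[OF B[OF y(2)]]])
  then show "x : M" using x(2) y(1) by metis
 qed
 then show ?thesis using MK unfolding M_def by blast
qed

lemma hopf_splitting:
 "\<exists>\<Phi> \<Psi>.
  hopf_hom U U' \<Phi> & hopf_hom U' U \<Psi> &
  (\<forall>i\<in>Ind D'. \<Phi> (U_x D lam i) = U_x D' lam' i) &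
  (\<forall>h\<in>L. \<Phi> (U_x D lam h) = \<zero>[U']) &
  (\<forall>a. \<Phi> (U_g D lam a) = U_g D' lam' a) &
  (\<forall>i\<in>Ind D'. \<Psi> (U_x D' lam' i) = U_x D lam i) &
  (\<forall>a. \<Psi> (U_g D' lam' a) = U_g D lam a) &
  (\<forall>u\<in>carrier U'. \<Phi> (\<Psi> u) = u) &
  (let K = coinv_hopf U U' \<Phi> \<Psi> in
   braided_hopf_algebra U' K &
   hopf_iso (boson K U') U (tensor_lift U (%r u. r *[U] \<Psi> u)) &
   alg_generate U SS = carrier K)"
proof -
 obtain \<Phi> where \<Phi>: "hopf_hom U U' \<Phi>" "!!i. i : I - L ==> \<Phi> (U_x D lam i) = U_x D' lam' i" "!!i. i : L ==> \<Phi> (U_x D lam i) = \<zero>[U']"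
  "!!a. \<Phi> (U_g D lam a) = U_g D' lam' a" using Phi_ex by metis
 obtain \<Psi> where \<Psi>: "hopf_hom U' U \<Psi>" "!!i. i : I - L ==> \<Psi> (U_x D' lam' i) = U_x D lam i" "!!a. \<Psi> (U_g D' lam' a) = U_g D lam a"
  using Psi_ex by metis
 have ID: "Ind D' = I - L" by simp
 have ah: "alg_hom U U' \<Phi>" "alg_hom U' U \<Psi>" using \<Phi>(1) \<Psi>(1) unfolding hopf_hom_def by blast+
 have id: "alg_hom U' U' (%u. u)" by (rule alg_homI[OF lin_map_id]) (rule refl)+
 \<comment> \<open>Both sides are algebra maps on \<open>U'\<close>, so agreement on letters and
   group elements suffices.\<close>
 have \<Phi>\<Psi>: "\<Phi> (\<Psi> u) = u" if "u :[U']" for u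
 proof (rule O.U_gen_ext[OF alg_hom_comp[OF ah(2,1)] id O.kalgebra_U _ _ that])
  show "\<Phi> (\<Psi> (U_x D' lam' i)) = U_x D' lam' i" if "i : Ind D'" for i using that \<Phi>(2) \<Psi>(2) unfolding ID by metis
  show "\<Phi> (\<Psi> (U_g D' lam' a)) = U_g D' lam' a" for a using \<Phi>(4) \<Psi>(3) by metis
 qed
 interpret P: hopf_proj U U' \<Phi> \<Psi>
  using hopf_U O.hopf_U \<Phi>(1) \<Psi>(1) \<Phi>\<Psi> by unfold_locales
 have g: "alg_generate U SS = carrier (coinv_hopf U U' \<Phi> \<Psi>)"
  by (rule coinv_generated[OF \<Phi>(1) \<Psi>(1) \<Phi>\<Psi> \<Phi>(3)]) (use \<Psi>(2,3) ID in metis)+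
 show ?thesis
  unfolding Let_def
  by (intro exI[of _ \<Phi>] exI[of _ \<Psi>] conjI ballI allI \<Phi>(1,3,4) \<Psi>(1,3) \<Phi>\<Psi> g P.braided_hopf_K P.boson_iso)
   (use \<Phi>(2) \<Psi>(2) ID in metis)+
qed

end

theorem theorem2p1:
  fixes D :: "(nat, 'g::ab_group_add, 'k::{alg_closed_field, field_char_0}) yd_datum"
    and lam :: "nat \<Rightarrow> nat \<Rightarrow> 'k" and \<theta> :: nat and L :: "nat set"
  defines "D' \<equiv> omit D L" and "lam' \<equiv> omit_link D lam"
  defines "U \<equiv> U_alg D lam" and "U' \<equiv> U_alg D' lam'"
  assumes "is_yd_datum D" and "Ind D = {1..\<theta>}" and "linking_parameter D lam"
    and "L \<subseteq> {i \<in> Ind D. not_linked D lam i}"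
  shows "\<exists>\<Phi> \<Psi>.
    hopf_hom U U' \<Phi> \<and> hopf_hom U' U \<Psi> \<and>
    (\<forall>i\<in>Ind D'. \<Phi> (U_x D lam i) = U_x D' lam' i) \<and>
    (\<forall>h\<in>L. \<Phi> (U_x D lam h) = \<zero>\<^bsub>U'\<^esub>) \<and>
    (\<forall>a. \<Phi> (U_g D lam a) = U_g D' lam' a) \<and>
    (\<forall>i\<in>Ind D'. \<Psi> (U_x D' lam' i) = U_x D lam i) \<and>
    (\<forall>a. \<Psi> (U_g D' lam' a) = U_g D lam a) \<and>
    (\<forall>u\<in>carrier U'. \<Phi> (\<Psi> u) = u) \<and>
    (let K = coinv_hopf U U' \<Phi> \<Psi> in
      braided_hopf_algebra U' K \<and>
      hopf_iso (boson K U') U (tensor_lift U (\<lambda>r u. r \<otimes>\<^bsub>U\<^esub> \<Psi> u)) \<and>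
      alg_generate U {ad U (U_mon D lam is) (U_x D lam h) | is h.
          h \<in> L \<and> set is \<subseteq> Ind D' \<and> (\<forall>i\<in>set is. (i, h) \<in> sim D)} = carrier K)"
proof -
  interpret omitting D lam L using assms(5,7,8) by unfold_locales (auto simp: is_yd_datum_def)
  show ?thesis
    unfolding D'_def lam'_def U_def U'_def using hopf_splitting unfolding SS_def .
qed

end
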